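(* Let $\mathbb{F}$ be an algebraically closed field, $\mathrm{char}\,\mathbb{F}\neq 2$. Let $G$ be an abelian group. Let $R=\mathcal{M}(G,T,\beta,\kappa,\gamma)$. Assume that $R$ admits an anti-automorphism $\varphi$ that is compatible with the grading and satisfies $\varphi^2|_{R_e}=\mathrm{id}$. Write (after reordering components according to the action of $\varphi$ on the block idempotents, as explained in the context) $$\kappa=(q_1,\ldots,q_\ell,2q_{\ell+1},\ldots,2q_m,q_{m+1},q_{m+1},\ldots,q_k,q_k),$$ $$\gamma=(g_1,\ldots,g_\ell,g_{\ell+1},\ldots,g_m,g_{m+1}',g_{m+1}'',\ldots,g_k',g_k'').$$ Then $T$ is an elementary $2$-group and $$g_1^2\equiv\cdots\equiv g_m^2\equiv g_{m+1}'g_{m+1}''\equiv\cdots\equiv g_k'g_k''\pmod{T}.$$ Moreover, up to an isomorphism of the pair $(R,\varphi)$ (that is, after replacing $(R,\varphi)$ by an isomorphic pair in which the graded algebra is again of the form $\mathcal{M}(G,T,\beta,\kappa,\gamma)$ with $\kappa=(q_1,\ldots,q_\ell,2q_{\ell+1},\ldots,2q_m,q_{m+1},q_{m+1},\ldots,q_k,q_k)$ and $\gamma=(g_1,\ldots,g_m,g_{m+1}',g_{m+1}'',\ldots,g_k',g_k'')$ ordered according to the action of the anti-automorphism on the block idempotents), $\gamma$ satisfies $$g_1^2t_1=\cdots=g_m^2t_m=g_{m+1}'g_{m+1}''=\cdots=g_k'g_k''$$ for some $t_1,\ldots,t_m\in T$, and $\varphi$ is given by $\varphi(X)=\Phi^{-1}({}^tX)\Phi$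 for all $X\in R$, where the matrix $\Phi$ has the block-diagonal form $$\Phi=\sum_{i=1}^\ell I_{q_i}\otimes X_{t_i}\oplus\sum_{i=\ell+1}^mS_i\otimes X_{t_i}\oplus\sum_{i=m+1}^k\begin{pmatrix}0&I_{q_i}\\\mu_iI_{q_i}&0\end{pmatrix}\otimes I,$$ where, for $i=\ell+1,\ldots,m$, each $S_i$ is either $I_{2q_i}$ or $\begin{pmatrix}0&I_{q_i}\\-I_{q_i}&0\end{pmatrix}$, and $\mu_{m+1},\ldots,\mu_k$ are nonzero scalars in $\mathbb{F}$.
   Context: **Gradings, compatibility.** A $G$-grading on an algebra $U$ is a decomposition $U=\bigoplus_{g\in G}U_g$ into subspaces with $U_gU_h\subset U_{gh}$. An anti-automorphism $\varphi$ of a $G$-graded algebra $U$ is compatible with the grading if $\varphi(U_g)=U_g$ for all $g\in G$. Pairs $(U_1,\varphi_1)$, $(U_2,\varphi_2)$ of $G$-graded algebras with compatible anti-automorphisms are isomorphic if there is an isomorphism of graded algebras (degree-preserving algebra isomorphism) $\psi:U_1\to U_2$ with $\varphi_1=\psi^{-1}\varphi_2\psi$. **Bicharacters and standard realizations.** An alternating bicharacter $\beta:T\times T\to\mathbb{F}^\times$ on an abelian group $T$ is a map multiplicative in each variable with $\beta(t,t)=1$ for all $t$; it is nondegenerate if $\beta(u,t)=1$ for all $u\in T$ implies $t=e$. For finite $T$ and nondegenerate $\beta$ there is a decomposition $T=H_1'\times H_1''\times\cdots\times H_r'\times H_r''$ with $H_i'=\langle a_i\rangle$, $H_i''=\langle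 b_i\rangle$ cyclic of the same order $\ell_i$, such that $\varepsilon_i:=\beta(a_i,b_i)$ is a primitive $\ell_i$-th root of unity and all other values of $\beta$ on pairs of generators from different pairs are $1$. Let $X_i=\mathrm{diag}(\varepsilon_i^{\ell_i-1},\ldots,\varepsilon_i,1)\in M_{\ell_i}(\mathbb{F})$ and let $Y_i\in M_{\ell_i}(\mathbb{F})$ have entries $1$ at positions $(j,j+1)$, $1\le j<\ell_i$, and $(\ell_i,1)$, and $0$ elsewhere. Grade $M_{\ell_i}(\mathbb{F})$ by $\deg X_i=a_i$, $\deg Y_i=b_i$. Then $D=M_{\ell_1}(\mathbb{F})\otimes\cdots\otimes M_{\ell_r}(\mathbb{F})$ with the tensor product grading is a standard realization of the division graded algebra with support $T$ and bicharacter $\beta$; each $D_t$ is one-dimensional, spanned by $X_t:=X_{a_1}^{i_1}X_{b_1}^{j_1}\cdots X_{a_r}^{i_r}X_{b_r}^{j_r}$ for $t=a_1^{i_1}b_1^{j_1}\cdots a_r^{i_r}b_r^{j_r}$, where $X_{a_i}$ (resp. $X_{b_i}$) is $X_i$ (resp. $Y_i$) in the $i$-th tensor factor and $I$ elsewhere. **The graded algebra $\mathcal{M}(G,T,\beta,\kappa,\gamma)$.** Let $T\subset G$ be a finite subgroup with nondegenerate alternating bicharacter $\beta$ and a fixed standard realization $D$, $\kappa=(k_1,\ldots,k_s)$ positive integers, $|\kappa|=k_1+\cdots+k_s$, $\gamma=(g_1,\ldots,g_s)$ with $g_i\in G$, $g_i^{-1}g_j\notin T$ for $i\neq j$. Let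 $C=M_{|\kappa|}(\mathbb{F})$ with diagonal block idempotents $e_1,\ldots,e_s$ given by $\kappa$. Then $\mathcal{M}(G,T,\beta,\kappa,\gamma)$ is the matrix algebra $C\otimes D$ graded by letting $U\otimes d$ have degree $g_i^{-1}tg_j$ for $U\in e_iCe_j$, $d\in D_t$. ${}^tX$ denotes the matrix transpose on $C\otimes D$, a tensor product of matrix algebras. **Form of $\kappa,\gamma$ relative to $\varphi$.** The identity component is $R_e=\bigoplus_i(e_iCe_i)\otimes I$, so $\varphi$ permutes the idempotents $e_1,\ldots,e_s$, and since $\varphi^2|_{R_e}=\mathrm{id}$ each is either fixed or swapped with another. Components are reordered so that: the $\varphi$-invariant idempotents are $e_1,\ldots,e_m$, with $e_1,\ldots,e_\ell$ of odd rank in $C$ (block sizes $q_1,\ldots,q_\ell$) and $e_{\ell+1},\ldots,e_m$ of even rank in $C$ (block sizes $2q_{\ell+1},\ldots,2q_m$); the remaining ones are denoted $e_{m+1}',e_{m+1}'',\ldots,e_k',e_k''$, with $\varphi$ swapping $e_i'$ and $e_i''$ (both of block size $q_i$). The components of $\gamma$ are named correspondingly. The $2\times2$ block matrices in $\Phi$ for $i>m$ are written relative to $e_i',e_i''$. *)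

theory Defs
  imports
    "Jordan_Normal_Form.Matrix"
    "HOL-Algebra.Multiplicative_Group"
    "HOL-Combinatorics.Permutations"
    "HOL-Computational_Algebra.Polynomial"
begin

section \<open>Tensor products of matrices\<close>

text \<open>
  A tensor product of matrix algebras is realized as a matrix algebra through the Kronecker
  product; the transpose of the tensor product is then the ordinary transpose.
\<close>

definition kron :: "'a::semiring_1 mat \<Rightarrow> 'a mat \<Rightarrow> 'a mat" where
  "kron A B = mat (dim_row A * dim_row B) (dim_col A * dim_col B)
     (\<lambda>(i, j). A $$ (i div dim_row B, j div dim_col B) * B $$ (i mod dim_row B, j mod dim_col B))"

definition kron_list :: "'a::semiring_1 mat list \<Rightarrow> 'a mat" where
  "kron_list As = foldr kron As (1\<^sub>m 1)"

definition mat_prod_list :: "nat \<Rightarrow> 'a::semiring_1 mat list \<Rightarrow> 'a mat" where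
  "mat_prod_list n As = foldr (*) As (1\<^sub>m n)"

inductive_set mat_span :: "nat \<Rightarrow> 'a::semiring_1 mat set \<Rightarrow> 'a mat set"
  for n :: nat and S :: "'a mat set" where
  zero: "0\<^sub>m n n \<in> mat_span n S"
| add: "A \<in> S \<Longrightarrow> B \<in> mat_span n S \<Longrightarrow> c \<cdot>\<^sub>m A + B \<in> mat_span n S"


section \<open>Graded matrix algebras and compatible anti-automorphisms\<close>

text \<open>
  Below, a grading of the algebra of \<open>n\<close>-by-\<open>n\<close> matrices by \<open>G\<close> is given by its homogeneous
  components, \<open>U g\<close> being the component of degree \<open>g\<close>. Maps matter only on \<open>carrier_mat n n\<close>.
\<close>

definition mat_linear :: "nat \<Rightarrow> ('a::semiring_1 mat \<Rightarrow> 'a mat) \<Rightarrow> bool" where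
  "mat_linear n \<psi> \<longleftrightarrow>
     (\<forall>X\<in>carrier_mat n n. \<forall>Y\<in>carrier_mat n n. \<psi> (X + Y) = \<psi> X + \<psi> Y) \<and>
     (\<forall>c. \<forall>X\<in>carrier_mat n n. \<psi> (c \<cdot>\<^sub>m X) = c \<cdot>\<^sub>m \<psi> X)"

definition mat_alg_iso :: "nat \<Rightarrow> nat \<Rightarrow> ('a::semiring_1 mat \<Rightarrow> 'a mat) \<Rightarrow> bool" where
  "mat_alg_iso n1 n2 \<psi> \<longleftrightarrow>
     bij_betw \<psi> (carrier_mat n1 n1) (carrier_mat n2 n2) \<and> mat_linear n1 \<psi> \<and>
     (\<forall>X\<in>carrier_mat n1 n1. \<forall>Y\<in>carrier_mat n1 n1. \<psi> (X * Y) = \<psi> X * \<psi> Y)"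

definition mat_alg_antiaut :: "nat \<Rightarrow> ('a::semiring_1 mat \<Rightarrow> 'a mat) \<Rightarrow> bool" where
  "mat_alg_antiaut n \<phi> \<longleftrightarrow>
     bij_betw \<phi> (carrier_mat n n) (carrier_mat n n) \<and> mat_linear n \<phi> \<and>
     (\<forall>X\<in>carrier_mat n n. \<forall>Y\<in>carrier_mat n n. \<phi> (X * Y) = \<phi> Y * \<phi> X)"

definition compatible_with_grading ::
    "('g, 'b) monoid_scheme \<Rightarrow> ('g \<Rightarrow> 'a mat set) \<Rightarrow> ('a mat \<Rightarrow> 'a mat) \<Rightarrow> bool" where
  "compatible_with_grading G U \<phi> \<longleftrightarrow> (\<forall>g\<in>carrier G. \<phi> ` U g = U g)"

definition isomorphic_pairs ::
    "('g, 'b) monoid_scheme \<Rightarrow> nat \<Rightarrow> ('g \<Rightarrow> 'a::semiring_1 mat set) \<Rightarrow> ('a mat \<Rightarrow> 'a mat)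
       \<Rightarrow> nat \<Rightarrow> ('g \<Rightarrow> 'a mat set) \<Rightarrow> ('a mat \<Rightarrow> 'a mat) \<Rightarrow> bool" where
  "isomorphic_pairs G n1 U1 \<phi>1 n2 U2 \<phi>2 \<longleftrightarrow>
     (\<exists>\<psi>. mat_alg_iso n1 n2 \<psi> \<and> (\<forall>g\<in>carrier G. \<psi> ` U1 g = U2 g) \<and>
        (\<forall>X\<in>carrier_mat n1 n1. \<phi>1 X = the_inv_into (carrier_mat n1 n1) \<psi> (\<phi>2 (\<psi> X))))"


section \<open>Bicharacters and standard realizations\<close>

definition alternating_bicharacter ::
    "('g, 'b) monoid_scheme \<Rightarrow> 'g set \<Rightarrow> ('g \<Rightarrow> 'g \<Rightarrow> 'a::field) \<Rightarrow> bool" where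
  "alternating_bicharacter G T \<beta> \<longleftrightarrow>
     (\<forall>u\<in>T. \<forall>v\<in>T. \<beta> u v \<noteq> 0) \<and>
     (\<forall>u\<in>T. \<forall>v\<in>T. \<forall>w\<in>T. \<beta> (u \<otimes>\<^bsub>G\<^esub> v) w = \<beta> u w * \<beta> v w) \<and>
     (\<forall>u\<in>T. \<forall>v\<in>T. \<forall>w\<in>T. \<beta> u (v \<otimes>\<^bsub>G\<^esub> w) = \<beta> u v * \<beta> u w) \<and>
     (\<forall>t\<in>T. \<beta> t t = 1)"

definition nondegenerate ::
    "('g, 'b) monoid_scheme \<Rightarrow> 'g set \<Rightarrow> ('g \<Rightarrow> 'g \<Rightarrow> 'a::field) \<Rightarrow> bool" where
  "nondegenerate G T \<beta> \<longleftrightarrow> (\<forall>t\<in>T. (\<forall>u\<in>T. \<beta> u t = 1) \<longrightarrow> t = \<one>\<^bsub>G\<^esub>)"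

definition primitive_root_of_unity :: "nat \<Rightarrow> 'a::field \<Rightarrow> bool" where
  "primitive_root_of_unity n z \<longleftrightarrow> n > 0 \<and> z ^ n = 1 \<and> (\<forall>k. 0 < k \<and> k < n \<longrightarrow> z ^ k \<noteq> 1)"

text \<open>
  The generators of the cyclic factors of \<open>T\<close> are kept in a list \<open>ab\<close> of pairs
  \<open>(a\<^sub>i, b\<^sub>i)\<close>, with indices starting from \<open>0\<close>.
\<close>

definition gen_ord :: "('g, 'b) monoid_scheme \<Rightarrow> ('g \<times> 'g) list \<Rightarrow> nat \<Rightarrow> nat" where
  "gen_ord G ab i = group.ord G (fst (ab ! i))"

definition exponents :: "('g, 'b) monoid_scheme \<Rightarrow> ('g \<times> 'g) list \<Rightarrow> (nat \<Rightarrow> nat \<times> nat) set" where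
  "exponents G ab = (\<Pi>\<^sub>E i\<in>{..<length ab}. {..<gen_ord G ab i} \<times> {..<gen_ord G ab i})"

definition elem_of_exponents ::
    "('g, 'b) monoid_scheme \<Rightarrow> ('g \<times> 'g) list \<Rightarrow> (nat \<Rightarrow> nat \<times> nat) \<Rightarrow> 'g" where
  "elem_of_exponents G ab x =
     finprod G (\<lambda>i. (fst (ab ! i) [^]\<^bsub>G\<^esub> fst (x i)) \<otimes>\<^bsub>G\<^esub> (snd (ab ! i) [^]\<^bsub>G\<^esub> snd (x i)))
       {..<length ab}"

text \<open>
  The bijectivity condition says that \<open>T\<close> is the internal direct product of the cyclic groups
  generated by the \<open>a\<^sub>i\<close> and the \<open>b\<^sub>i\<close>.
\<close>

definition standard_decomposition ::
    "('g, 'b) monoid_scheme \<Rightarrow> 'g set \<Rightarrow> ('g \<Rightarrow> 'g \<Rightarrow> 'a::field) \<Rightarrow> ('g \<times> 'g) list \<Rightarrow> bool" where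
  "standard_decomposition G T \<beta> ab \<longleftrightarrow>
     (\<forall>(a, b)\<in>set ab. a \<in> T \<and> b \<in> T \<and> group.ord G a = group.ord G b \<and>
        primitive_root_of_unity (group.ord G a) (\<beta> a b)) \<and>
     bij_betw (elem_of_exponents G ab) (exponents G ab) T \<and>
     (\<forall>i<length ab. \<forall>j<length ab. i \<noteq> j \<longrightarrow>
        (\<forall>x\<in>{fst (ab ! i), snd (ab ! i)}. \<forall>y\<in>{fst (ab ! j), snd (ab ! j)}. \<beta> x y = 1))"

definition clockX :: "nat \<Rightarrow> 'a::semiring_1 \<Rightarrow> 'a mat" where
  "clockX l \<epsilon> = mat_diag l (\<lambda>j. \<epsilon> ^ (l - 1 - j))"

definition shiftY :: "nat \<Rightarrow> 'a::semiring_1 mat" where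
  "shiftY l = mat l l (\<lambda>(i, j). if j = i + 1 \<or> (i = l - 1 \<and> j = 0) then 1 else 0)"

definition D_dim :: "('g, 'b) monoid_scheme \<Rightarrow> ('g \<times> 'g) list \<Rightarrow> nat" where
  "D_dim G ab = (\<Prod>i<length ab. gen_ord G ab i)"

definition in_factor ::
    "('g, 'b) monoid_scheme \<Rightarrow> ('g \<times> 'g) list \<Rightarrow> nat \<Rightarrow> 'a::semiring_1 mat \<Rightarrow> 'a mat" where
  "in_factor G ab i A =
     kron_list (map (\<lambda>j. if j = i then A else 1\<^sub>m (gen_ord G ab j)) [0..<length ab])"

definition X_mat ::
    "('g, 'b) monoid_scheme \<Rightarrow> ('g \<Rightarrow> 'g \<Rightarrow> 'a::field) \<Rightarrow> ('g \<times> 'g) list \<Rightarrow> 'g \<Rightarrow> 'a mat" where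
  "X_mat G \<beta> ab t =
     (let x = the_inv_into (exponents G ab) (elem_of_exponents G ab) t;
          l = gen_ord G ab
      in mat_prod_list (D_dim G ab)
           (map (\<lambda>i. (in_factor G ab i (clockX (l i) (\<beta> (fst (ab ! i)) (snd (ab ! i)))) ^\<^sub>m fst (x i)) *
                     (in_factor G ab i (shiftY (l i)) ^\<^sub>m snd (x i)))
              [0..<length ab]))"

definition D_comp ::
    "('g, 'b) monoid_scheme \<Rightarrow> ('g \<Rightarrow> 'g \<Rightarrow> 'a::field) \<Rightarrow> ('g \<times> 'g) list \<Rightarrow> 'g \<Rightarrow> 'a mat set" where
  "D_comp G \<beta> ab t = {c \<cdot>\<^sub>m X_mat G \<beta> ab t |c. True}"


section \<open>The graded algebra determined by \<open>G, T, \<beta>, \<kappa>, \<gamma>\<close>\<close>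

text \<open>
  The lists \<open>\<kappa>\<close> and \<open>\<gamma>\<close> are indexed from \<open>0\<close>. They are required to be nonempty: otherwise
  the algebra would be zero.
\<close>

definition graded_matrix_data ::
    "('g, 'b) monoid_scheme \<Rightarrow> 'g set \<Rightarrow> ('g \<Rightarrow> 'g \<Rightarrow> 'a::field) \<Rightarrow> ('g \<times> 'g) list
       \<Rightarrow> nat list \<Rightarrow> 'g list \<Rightarrow> bool" where
  "graded_matrix_data G T \<beta> ab \<kappa> \<gamma> \<longleftrightarrow>
     subgroup T G \<and> finite T \<and>
     alternating_bicharacter G T \<beta> \<and> nondegenerate G T \<beta> \<and> standard_decomposition G T \<beta> ab \<and>
     \<kappa> \<noteq> [] \<and> (\<forall>k\<in>set \<kappa>. k > 0) \<and>
     length \<gamma> = length \<kappa> \<and> set \<gamma> \<subseteq> carrier G \<and>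
     (\<forall>i<length \<gamma>. \<forall>j<length \<gamma>. i \<noteq> j \<longrightarrow> inv\<^bsub>G\<^esub> (\<gamma> ! i) \<otimes>\<^bsub>G\<^esub> (\<gamma> ! j) \<notin> T)"

definition block_idem :: "nat list \<Rightarrow> nat \<Rightarrow> 'a::semiring_1 mat" where
  "block_idem \<kappa> i =
     diag_block_mat (map (\<lambda>j. if j = i then 1\<^sub>m (\<kappa> ! j) else 0\<^sub>m (\<kappa> ! j) (\<kappa> ! j)) [0..<length \<kappa>])"

definition R_dim :: "('g, 'b) monoid_scheme \<Rightarrow> ('g \<times> 'g) list \<Rightarrow> nat list \<Rightarrow> nat" where
  "R_dim G ab \<kappa> = sum_list \<kappa> * D_dim G ab"

definition R_comp ::
    "('g, 'b) monoid_scheme \<Rightarrow> 'g set \<Rightarrow> ('g \<Rightarrow> 'g \<Rightarrow> 'a::field) \<Rightarrow> ('g \<times> 'g) list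
       \<Rightarrow> nat list \<Rightarrow> 'g list \<Rightarrow> 'g \<Rightarrow> 'a mat set" where
  "R_comp G T \<beta> ab \<kappa> \<gamma> g = mat_span (R_dim G ab \<kappa>)
     {kron (block_idem \<kappa> i * A * block_idem \<kappa> j) d |A d i j t.
        i < length \<kappa> \<and> j < length \<kappa> \<and> t \<in> T \<and>
        A \<in> carrier_mat (sum_list \<kappa>) (sum_list \<kappa>) \<and> d \<in> D_comp G \<beta> ab t \<and>
        g = inv\<^bsub>G\<^esub> (\<gamma> ! i) \<otimes>\<^bsub>G\<^esub> t \<otimes>\<^bsub>G\<^esub> (\<gamma> ! j)}"

definition R_idem :: "('g, 'b) monoid_scheme \<Rightarrow> ('g \<times> 'g) list \<Rightarrow> nat list \<Rightarrow> nat \<Rightarrow> 'a::semiring_1 mat" where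
  "R_idem G ab \<kappa> i = kron (block_idem \<kappa> i) (1\<^sub>m (D_dim G ab))"

definition graded_antiaut ::
    "('g, 'b) monoid_scheme \<Rightarrow> 'g set \<Rightarrow> ('g \<Rightarrow> 'g \<Rightarrow> 'a::field) \<Rightarrow> ('g \<times> 'g) list
       \<Rightarrow> nat list \<Rightarrow> 'g list \<Rightarrow> ('a mat \<Rightarrow> 'a mat) \<Rightarrow> bool" where
  "graded_antiaut G T \<beta> ab \<kappa> \<gamma> \<phi> \<longleftrightarrow>
     mat_alg_antiaut (R_dim G ab \<kappa>) \<phi> \<and> compatible_with_grading G (R_comp G T \<beta> ab \<kappa> \<gamma>) \<phi>"


section \<open>Ordering of the components according to the anti-automorphism\<close>

text \<open>
  The families \<open>q, g, g', g''\<close> are indexed from \<open>1\<close>, and only the indices up to \<open>k\<close> are used.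
\<close>

definition kappa_form :: "nat \<Rightarrow> nat \<Rightarrow> nat \<Rightarrow> (nat \<Rightarrow> nat) \<Rightarrow> nat list" where
  "kappa_form l m k q =
     map q [1..<l+1] @ map (\<lambda>i. 2 * q i) [l+1..<m+1] @ concat (map (\<lambda>i. [q i, q i]) [m+1..<k+1])"

definition gamma_form :: "nat \<Rightarrow> nat \<Rightarrow> (nat \<Rightarrow> 'g) \<Rightarrow> (nat \<Rightarrow> 'g) \<Rightarrow> (nat \<Rightarrow> 'g) \<Rightarrow> 'g list" where
  "gamma_form m k g g' g'' = map g [1..<m+1] @ concat (map (\<lambda>i. [g' i, g'' i]) [m+1..<k+1])"

text \<open>
  The permutation \<open>\<pi>\<close> is the reordering of the components: the idempotent listed in position
  \<open>p\<close> after reordering is the original one in position \<open>\<pi> p\<close>. For \<open>i > m\<close>, the positions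
  of \<open>e\<^sub>i'\<close> and \<open>e\<^sub>i''\<close> are \<open>m + 2 * (i - m - 1)\<close> and the next one.
\<close>

definition ordered_by_antiaut ::
    "('g, 'b) monoid_scheme \<Rightarrow> ('g \<times> 'g) list \<Rightarrow> nat list \<Rightarrow> 'g list \<Rightarrow> ('a::semiring_1 mat \<Rightarrow> 'a mat)
       \<Rightarrow> (nat \<Rightarrow> nat) \<Rightarrow> nat \<Rightarrow> nat \<Rightarrow> nat \<Rightarrow> (nat \<Rightarrow> nat)
       \<Rightarrow> (nat \<Rightarrow> 'g) \<Rightarrow> (nat \<Rightarrow> 'g) \<Rightarrow> (nat \<Rightarrow> 'g) \<Rightarrow> bool" where
  "ordered_by_antiaut G ab \<kappa> \<gamma> \<phi> \<pi> l m k q g g' g'' \<longleftrightarrow>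
     l \<le> m \<and> m \<le> k \<and>
     \<pi> permutes {..<length \<kappa>} \<and>
     permute_list \<pi> \<kappa> = kappa_form l m k q \<and>
     permute_list \<pi> \<gamma> = gamma_form m k g g' g'' \<and>
     (\<forall>i\<in>{1..l}. odd (q i)) \<and>
     (let e = (\<lambda>p. R_idem G ab \<kappa> (\<pi> p)) in
        (\<forall>i\<in>{1..m}. \<phi> (e (i - 1)) = e (i - 1)) \<and>
        (\<forall>i\<in>{m+1..k}. let p = m + 2 * (i - m - 1) in
           \<phi> (e p) = e (p + 1) \<and> \<phi> (e (p + 1)) = e p))"


section \<open>The matrix of the normal form\<close>

definition symplectic_mat :: "nat \<Rightarrow> 'a::ring_1 mat" where
  "symplectic_mat q = four_block_mat (0\<^sub>m q q) (1\<^sub>m q) (- 1\<^sub>m q) (0\<^sub>m q q)"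

definition Phi_mat ::
    "('g, 'b) monoid_scheme \<Rightarrow> ('g \<Rightarrow> 'g \<Rightarrow> 'a::field) \<Rightarrow> ('g \<times> 'g) list
       \<Rightarrow> nat \<Rightarrow> nat \<Rightarrow> nat \<Rightarrow> (nat \<Rightarrow> nat) \<Rightarrow> (nat \<Rightarrow> 'g) \<Rightarrow> (nat \<Rightarrow> 'a mat) \<Rightarrow> (nat \<Rightarrow> 'a) \<Rightarrow> 'a mat" where
  "Phi_mat G \<beta> ab l m k q t S \<mu> = diag_block_mat
     (map (\<lambda>i. kron (1\<^sub>m (q i)) (X_mat G \<beta> ab (t i))) [1..<l+1] @
      map (\<lambda>i. kron (S i) (X_mat G \<beta> ab (t i))) [l+1..<m+1] @
      map (\<lambda>i. kron (four_block_mat (0\<^sub>m (q i) (q i)) (1\<^sub>m (q i)) (\<mu> i \<cdot>\<^sub>m 1\<^sub>m (q i)) (0\<^sub>m (q i) (q i)))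
                 (1\<^sub>m (D_dim G ab))) [m+1..<k+1])"

end

theory Submission
  imports Defs "Jordan_Normal_Form.Determinant"
begin

text \<open>The automorphism \<open>Y \<mapsto> \<phi> (Y\<^sup>T)\<close> of the full matrix algebra is inner, so
  \<open>\<phi> Y = P\<^sup>-\<^sup>1 Y\<^sup>T P\<close>. It permutes the block idempotents \<open>e\<^sub>i\<close> by an involution \<open>\<tau>\<close> and maps
  \<open>e\<^sub>i \<otimes> X\<^sub>t\<close> to a scalar multiple of \<open>e\<^sub>\<tau>\<^sub>i \<otimes> X\<^sub>t\<close>; for these scalars \<open>c t\<close>, reversal of products gives
  \<open>c (st) X\<^sub>s X\<^sub>t = c s c t X\<^sub>t X\<^sub>s\<close>, so \<open>\<beta>\<close> is symmetric, \<open>\<beta>\<^sup>2 = 1\<close>, and \<open>T\<close> is an elementary 2-group. Then every \<open>X\<^sub>t\<close> is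
  symmetric or skew, the slices of the blocks of \<open>P\<close> are eigenmatrices for conjugation by all \<open>X\<^sub>u\<close>, and
  so the \<open>i\<close>-th row of blocks of \<open>P\<close> is \<open>Q\<^sub>i \<otimes> X\<^sub>t\<close> with \<open>t = t\<^sub>i\<close>. Comparing the degrees of
  \<open>e\<^sub>i C e\<^sub>j\<close> and of its image shows that \<open>g\<^sub>i g\<^sub>\<tau>\<^sub>i t\<^sub>i\<close> does not depend on \<open>i\<close>. Since \<open>\<phi>\<^sup>2\<close> is the identity on
  \<open>R\<^sub>e\<close>, the \<open>Q\<^sub>i\<close> are symmetric or skew (or paired off up to a scalar), so congruence reduces them to
  standard form; the factors \<open>X\<^sub>t\<close> of the paired blocks are removed by conjugation, which replaces one
  degree of each pair by its \<open>t\<close>-translate.\<close>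

section \<open>Kronecker products\<close>

text \<open>The conjugating matrix \<open>P\<close> is in general no Kronecker product, because the
  element \<open>t\<close> changes from one row of blocks to the next. Hence the use of matrices
  whose right tensor factor may depend on the row: products and transposes keep this shape as long
  as the right factors that meet on the support of the left factor agree, and the block support of
  \<open>P\<close> guarantees that. Conjugating the algebra by the inverse of \<open>W\<close>
  replaces \<open>P\<close> by \<open>W^T P W\<close>, so the problem becomes one about bilinear
  forms up to congruence. On a pair of swapped blocks the two blocks of \<open>Q\<close> are
  transposes of each other up to a scalar; the inverse of one of them, used as a coordinate change
  on the second member alone, normalizes both, and the leftover scalar goes into
  \<open>\<mu>\<close>. The factor \<open>X t\<close> is also corrected on the second member, so
  only its degree moves. Characteristic different from 2 makes the order of \<open>T\<close>
  invertible, so that sums of characters over \<open>T\<close> can be exploited, and it separates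
  symmetric from skew forms. Square roots are extracted only to turn symmetric forms into identity
  matrices.\<close>

lemma index_mult_mat_sum:
  assumes "A \<in> carrier_mat n m" "B \<in> carrier_mat m p" "i < n" "j < p"
  shows "(A * B) $$ (i, j) = (\<Sum>k<m. A $$ (i, k) * B $$ (k, j))"
  using assms by (auto simp: scalar_prod_def lessThan_atLeast0 intro!: sum.cong)

lemma nonzero_mat_entry:
  assumes "M \<in> carrier_mat n m" "M \<noteq> 0\<^sub>m n m"
  obtains i j where "i < n" "j < m" "M $$ (i, j) \<noteq> 0"
proof (rule ccontr)
  assume "\<not> thesis"
  then have "\<And>i j. i < n \<Longrightarrow> j < m \<Longrightarrow> M $$ (i, j) = 0" using that by blast
  then have "M = 0\<^sub>m n m" using assms(1) by (intro eq_matI) auto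
  then show False using assms(2) by blast
qed

lemma sum_lessThan_mult:
  fixes f :: "nat \<Rightarrow> 'a::comm_monoid_add"
  shows "(\<Sum>k<b * q. f k) = (\<Sum>i<b. \<Sum>j<q. f (i * q + j))"
proof -
  have "(\<Sum>j<q. f (i * q + j)) = sum f {i * q..<i * q + q}" for i
    by (rule sum.reindex_bij_witness[of _ "\<lambda>k. k - i * q" "\<lambda>j. i * q + j"]) auto
  then show ?thesis by (simp add: sum.nat_group)
qed

lemma mult_add_less_mult:
  fixes a u N d :: nat
  assumes "a < N" "u < d"
  shows "a * d + u < N * d"
proof -
  have "a * d + u < Suc a * d" using assms by simp
  also have "\<dots> \<le> N * d" using assms by (intro mult_le_mono1) simp
  finally show ?thesis .
qed

lemma div_mod_less:
  fixes i N d :: nat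
  assumes "i < N * d"
  shows "i div d < N" "i mod d < d" "0 < d"
proof -
  show "0 < d" using assms by (cases d) auto
  then show "i mod d < d" by simp
  show "i div d < N" using assms by (simp add: less_mult_imp_div_less)
qed

text \<open>Block \<open>(a, b)\<close> is \<open>Q $$ (a, b)\<close> times \<open>F a\<close>: a
  Kronecker product whose right factor may vary with the row of blocks. It equals the block diagonal
  matrix of the \<open>F a\<close> times \<open>kron Q 1\<close>.\<close>

definition row_kron :: "nat \<Rightarrow> nat \<Rightarrow> 'a::comm_semiring_1 mat \<Rightarrow> (nat \<Rightarrow> 'a mat) \<Rightarrow> 'a mat" where
  "row_kron N d Q F =
     mat (N * d) (N * d) (\<lambda>(i, j). Q $$ (i div d, j div d) * F (i div d) $$ (i mod d, j mod d))"

lemma row_kron_carrier [simp]: "row_kron N d Q F \<in> carrier_mat (N * d) (N * d)"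
  and row_kron_dim [simp]: "dim_row (row_kron N d Q F) = N * d" "dim_col (row_kron N d Q F) = N * d"
  by (simp_all add: row_kron_def)

lemma row_kron_index:
  assumes "a < N" "b < N" "u < d" "v < d"
  shows "row_kron N d Q F $$ (a * d + u, b * d + v) = Q $$ (a, b) * F a $$ (u, v)"
  using assms by (simp add: row_kron_def mult_add_less_mult)

lemma kron_conv_row_kron:
  assumes "A \<in> carrier_mat N N" "B \<in> carrier_mat d d"
  shows "kron A B = row_kron N d A (\<lambda>_. B)"
  using assms by (auto simp: kron_def row_kron_def)

lemma eq_mat_blockwise:
  assumes "A \<in> carrier_mat (N * d) (N * d)" "B \<in> carrier_mat (N * d) (N * d)"
    and "\<And>a b u v. a < N \<Longrightarrow> b < N \<Longrightarrow> u < d \<Longrightarrow> v < d \<Longrightarrow>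
      A $$ (a * d + u, b * d + v) = B $$ (a * d + u, b * d + v)"
  shows "A = B"
proof (rule eq_matI)
  fix i j assume "i < dim_row B" "j < dim_col B"
  then have *: "i < N * d" "j < N * d" using assms by auto
  have "A $$ (i div d * d + i mod d, j div d * d + j mod d) =
        B $$ (i div d * d + i mod d, j div d * d + j mod d)"
    using div_mod_less[OF *(1)] div_mod_less[OF *(2)] by (intro assms) auto
  then show "A $$ (i, j) = B $$ (i, j)" by simp
qed (use assms in auto)

text \<open>Entries are compared as products, so the right factor may be exchanged freely wherever
  the left factor vanishes.\<close>

lemma row_kron_cong:
  assumes "\<And>a b u v. a < N \<Longrightarrow> b < N \<Longrightarrow> u < d \<Longrightarrow> v < d \<Longrightarrow>
      Q $$ (a, b) * F a $$ (u, v) = Q' $$ (a, b) * F' a $$ (u, v)"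
  shows "row_kron N d Q F = row_kron N d Q' F'"
  by (rule eq_mat_blockwise) (auto simp: row_kron_index assms)

text \<open>In the sum over the middle index \<open>c\<close>, the factors \<open>F a\<close> and
  \<open>F' c\<close> meet only where \<open>Q $$ (a, c)\<close> is nonzero. If \<open>F' c\<close>
  equals a matrix \<open>H a\<close> independent of \<open>c\<close> there, the two sums
  separate.\<close>

lemma row_kron_mult:
  assumes Q: "Q \<in> carrier_mat N N" "Q' \<in> carrier_mat N N"
    and F: "\<And>a. a < N \<Longrightarrow> F a \<in> carrier_mat d d" "\<And>a. a < N \<Longrightarrow> F' a \<in> carrier_mat d d"
    and H: "\<And>a c. a < N \<Longrightarrow> c < N \<Longrightarrow> Q $$ (a, c) \<noteq> 0 \<Longrightarrow> F' c = H a"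
      "\<And>a. a < N \<Longrightarrow> H a \<in> carrier_mat d d"
  shows "row_kron N d Q F * row_kron N d Q' F' = row_kron N d (Q * Q') (\<lambda>a. F a * H a)"
proof (rule eq_mat_blockwise)
  fix a b u v assume ab: "a < N" "b < N" "u < d" "v < d"
  have "(row_kron N d Q F * row_kron N d Q' F') $$ (a * d + u, b * d + v) =
     (\<Sum>c<N. \<Sum>w<d. Q $$ (a, c) * F a $$ (u, w) * (Q' $$ (c, b) * F' c $$ (w, v)))"
    using ab by (subst index_mult_mat_sum[where m = "N * d"])
      (auto simp: mult_add_less_mult sum_lessThan_mult row_kron_index intro!: sum.cong)
  also have "\<dots> = (\<Sum>c<N. (Q $$ (a, c) * Q' $$ (c, b)) * (\<Sum>w<d. F a $$ (u, w) * H a $$ (w, v)))"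
  proof (rule sum.cong[OF refl])
    fix c assume c: "c \<in> {..<N}"
    show "(\<Sum>w<d. Q $$ (a, c) * F a $$ (u, w) * (Q' $$ (c, b) * F' c $$ (w, v))) =
      (Q $$ (a, c) * Q' $$ (c, b)) * (\<Sum>w<d. F a $$ (u, w) * H a $$ (w, v))"
    proof (cases "Q $$ (a, c) = 0")
      case False
      then have "F' c = H a" using H ab c by auto
      then show ?thesis by (simp add: sum_distrib_left mult_ac)
    qed simp
  qed
  also have "\<dots> = (Q * Q') $$ (a, b) * (F a * H a) $$ (u, v)"
    unfolding index_mult_mat_sum[OF Q ab(1,2)] index_mult_mat_sum[OF F(1)[OF ab(1)] H(2)[OF ab(1)] ab(3,4)]
    by (simp add: sum_distrib_right)
  finally show "(row_kron N d Q F * row_kron N d Q' F') $$ (a * d + u, b * d + v) =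
     row_kron N d (Q * Q') (\<lambda>a. F a * H a) $$ (a * d + u, b * d + v)"
    using ab by (simp add: row_kron_index)
qed (use Q in \<open>auto intro!: mult_carrier_mat[of _ _ "N * d"]\<close>)

text \<open>Transposing turns dependence on the row into dependence on the column; on the support of
  \<open>Q\<close> the matrix \<open>H\<close> expresses it through the row again.\<close>

lemma row_kron_transpose:
  assumes Q: "Q \<in> carrier_mat N N"
    and F: "\<And>a. a < N \<Longrightarrow> F a \<in> carrier_mat d d"
    and H: "\<And>a b. a < N \<Longrightarrow> b < N \<Longrightarrow> Q $$ (b, a) \<noteq> 0 \<Longrightarrow> transpose_mat (F b) = H a"
  shows "transpose_mat (row_kron N d Q F) = row_kron N d (transpose_mat Q) H"
proof (rule eq_mat_blockwise)
  fix a b u v assume ab: "a < N" "b < N" "u < d" "v < d"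
  have "Q $$ (b, a) * F b $$ (v, u) = Q $$ (b, a) * H a $$ (u, v)"
    using H[OF ab(1,2)] F[OF ab(2)] ab by (cases "Q $$ (b, a) = 0") (auto simp flip: H[OF ab(1,2)])
  then show "transpose_mat (row_kron N d Q F) $$ (a * d + u, b * d + v) =
     row_kron N d (transpose_mat Q) H $$ (a * d + u, b * d + v)"
    using ab Q by (simp add: row_kron_index mult_add_less_mult)
qed auto

lemma kron_carrier [simp]:
  fixes A :: "'a::comm_semiring_1 mat"
  assumes "A \<in> carrier_mat N N" "B \<in> carrier_mat d d"
  shows "kron A B \<in> carrier_mat (N * d) (N * d)"
  using assms by (simp add: kron_conv_row_kron)

lemma kron_index:
  fixes A :: "'a::comm_semiring_1 mat"
  assumes "A \<in> carrier_mat N N" "B \<in> carrier_mat d d" "a < N" "b < N" "u < d" "v < d"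
  shows "kron A B $$ (a * d + u, b * d + v) = A $$ (a, b) * B $$ (u, v)"
  using assms by (simp add: kron_conv_row_kron row_kron_index)

lemma kron_mult:
  fixes A :: "'a::comm_semiring_1 mat"
  assumes "A \<in> carrier_mat N N" "C \<in> carrier_mat N N" "B \<in> carrier_mat d d" "E \<in> carrier_mat d d"
  shows "kron A B * kron C E = kron (A * C) (B * E)"
proof -
  have "kron A B * kron C E = row_kron N d (A * C) (\<lambda>_. B * E)"
    using assms unfolding kron_conv_row_kron[OF assms(1,3)] kron_conv_row_kron[OF assms(2,4)]
    by (intro row_kron_mult) auto
  then show ?thesis using assms by (subst kron_conv_row_kron[of _ N _ d]) auto
qed

lemma kron_transpose:
  fixes A :: "'a::comm_semiring_1 mat"
  assumes "A \<in> carrier_mat N N" "B \<in> carrier_mat d d"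
  shows "transpose_mat (kron A B) = kron (transpose_mat A) (transpose_mat B)"
proof -
  have "transpose_mat (kron A B) = row_kron N d (transpose_mat A) (\<lambda>_. transpose_mat B)"
    using assms unfolding kron_conv_row_kron[OF assms] by (intro row_kron_transpose) auto
  then show ?thesis using assms by (subst kron_conv_row_kron[of _ N _ d]) auto
qed

lemma kron_one: "kron (1\<^sub>m N) (1\<^sub>m d) = (1\<^sub>m (N * d) :: 'a::comm_semiring_1 mat)"
proof (rule eq_mat_blockwise)
  fix a b u v assume ab: "a < N" "b < N" "u < d" "v < d"
  have "a * d + u = b * d + v \<longleftrightarrow> a = b \<and> u = v"
  proof
    assume "a * d + u = b * d + v"
    then have "(a * d + u) div d = (b * d + v) div d" "(a * d + u) mod d = (b * d + v) mod d" by auto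
    then show "a = b \<and> u = v" using ab by simp
  qed auto
  then show "kron (1\<^sub>m N) (1\<^sub>m d) $$ (a * d + u, b * d + v) =
     (1\<^sub>m (N * d) :: 'a mat) $$ (a * d + u, b * d + v)"
    using ab by (auto simp: kron_index[of _ N _ d] mult_add_less_mult)
qed auto

lemma kron_add_left:
  fixes A :: "'a::comm_semiring_1 mat"
  assumes "A \<in> carrier_mat N N" "A' \<in> carrier_mat N N" "B \<in> carrier_mat d d"
  shows "kron (A + A') B = kron A B + kron A' B"
  by (rule eq_mat_blockwise)
    (use assms in \<open>auto simp: kron_index[of _ N _ d] mult_add_less_mult distrib_right carrier_matD[OF kron_carrier[of _ N _ d]]\<close>)

lemma kron_smult:
  fixes A :: "'a::comm_semiring_1 mat"
  assumes "A \<in> carrier_mat N N" "B \<in> carrier_mat d d"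
  shows "kron (c \<cdot>\<^sub>m A) B = c \<cdot>\<^sub>m kron A B" "kron A (c \<cdot>\<^sub>m B) = c \<cdot>\<^sub>m kron A B"
proof -
  have *: "kron A B \<in> carrier_mat (N * d) (N * d)" using assms by simp
  note * = * carrier_matD[OF *]
  show "kron (c \<cdot>\<^sub>m A) B = c \<cdot>\<^sub>m kron A B"
    by (rule eq_mat_blockwise[of _ N d])
      (use assms * in \<open>auto simp: kron_index[of _ N _ d] mult_add_less_mult mult_ac\<close>)
  show "kron A (c \<cdot>\<^sub>m B) = c \<cdot>\<^sub>m kron A B"
    by (rule eq_mat_blockwise[of _ N d])
      (use assms * in \<open>auto simp: kron_index[of _ N _ d] mult_add_less_mult mult_ac\<close>)
qed

lemma kron_zero_left:
  fixes B :: "'a::comm_semiring_1 mat"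
  assumes "B \<in> carrier_mat d d"
  shows "kron (0\<^sub>m N N) B = 0\<^sub>m (N * d) (N * d)"
  by (rule eq_mat_blockwise) (use assms in \<open>auto simp: kron_index[of _ N _ d] mult_add_less_mult\<close>)

lemma kron_left_cancel:
  fixes A :: "'a::field mat"
  assumes "A \<in> carrier_mat N N" "A' \<in> carrier_mat N N" "B \<in> carrier_mat d d"
    and "B \<noteq> 0\<^sub>m d d" "kron A B = kron A' B"
  shows "A = A'"
proof -
  obtain u v where uv: "u < d" "v < d" "B $$ (u, v) \<noteq> 0"
    using nonzero_mat_entry[OF assms(3,4)] by blast
  show ?thesis
  proof (rule eq_matI)
    fix i j assume "i < dim_row A'" "j < dim_col A'"
    then have "A $$ (i, j) * B $$ (u, v) = A' $$ (i, j) * B $$ (u, v)"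
      using assms uv by (simp flip: kron_index)
    then show "A $$ (i, j) = A' $$ (i, j)" using uv by simp
  qed (use assms in auto)
qed

section \<open>Tensor products of several matrices\<close>

definition tensor :: "nat \<Rightarrow> (nat \<Rightarrow> 'a::comm_semiring_1 mat) \<Rightarrow> 'a mat" where
  "tensor r A = kron_list (map A [0..<r])"

lemma tensor_0: "tensor 0 A = 1\<^sub>m 1"
  by (simp add: tensor_def kron_list_def)

lemma tensor_Suc: "tensor (Suc r) A = kron (A 0) (tensor r (\<lambda>i. A (Suc i)))"
proof -
  have "map A [0..<Suc r] = A 0 # map (\<lambda>i. A (Suc i)) [0..<r]"
    by (simp add: upt_conv_Cons map_Suc_upt[symmetric] del: upt_Suc)
  then show ?thesis by (simp add: tensor_def kron_list_def)
qed

lemma tensor_cong: "(\<And>i. i < r \<Longrightarrow> A i = B i) \<Longrightarrow> tensor r A = tensor r B"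
  unfolding tensor_def by (intro arg_cong[of _ _ kron_list] map_cong) auto

lemma tensor_carrier:
  "(\<And>i. i < r \<Longrightarrow> A i \<in> carrier_mat (l i) (l i)) \<Longrightarrow>
    tensor r A \<in> carrier_mat (\<Prod>i<r. l i) (\<Prod>i<r. l i)"
proof (induction r arbitrary: A l)
  case 0 then show ?case by (simp add: tensor_0)
next
  case (Suc r)
  have "tensor r (\<lambda>i. A (Suc i)) \<in> carrier_mat (\<Prod>i<r. l (Suc i)) (\<Prod>i<r. l (Suc i))"
    using Suc.prems by (intro Suc.IH) auto
  then show ?case using Suc.prems[of 0]
    by (simp add: tensor_Suc prod.lessThan_Suc_shift del: prod.lessThan_Suc)
qed

lemma tensor_mult:
  "(\<And>i. i < r \<Longrightarrow> A i \<in> carrier_mat (l i) (l i)) \<Longrightarrow> (\<And>i. i < r \<Longrightarrow> B i \<in> carrier_mat (l i) (l i)) \<Longrightarrow>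
    tensor r A * tensor r B = tensor r (\<lambda>i. A i * B i)"
proof (induction r arbitrary: A B l)
  case 0 then show ?case by (simp add: tensor_0)
next
  case (Suc r)
  have "tensor r (\<lambda>i. A (Suc i)) \<in> carrier_mat (\<Prod>i<r. l (Suc i)) (\<Prod>i<r. l (Suc i))"
    "tensor r (\<lambda>i. B (Suc i)) \<in> carrier_mat (\<Prod>i<r. l (Suc i)) (\<Prod>i<r. l (Suc i))"
    using Suc.prems by (auto intro!: tensor_carrier)
  moreover have "tensor r (\<lambda>i. A (Suc i)) * tensor r (\<lambda>i. B (Suc i)) = tensor r (\<lambda>i. A (Suc i) * B (Suc i))"
    using Suc.prems by (intro Suc.IH[where l = "\<lambda>i. l (Suc i)"]) auto
  ultimately show ?case using Suc.prems(1)[of 0] Suc.prems(2)[of 0]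
    by (simp add: tensor_Suc kron_mult)
qed

lemma tensor_one: "tensor r (\<lambda>i. 1\<^sub>m (l i)) = 1\<^sub>m (\<Prod>i<r. l i)"
proof (induction r arbitrary: l)
  case (Suc r)
  show ?case by (simp add: tensor_Suc Suc prod.lessThan_Suc_shift kron_one del: prod.lessThan_Suc)
qed (simp add: tensor_0)

lemma tensor_transpose:
  "(\<And>i. i < r \<Longrightarrow> A i \<in> carrier_mat (l i) (l i)) \<Longrightarrow>
    transpose_mat (tensor r A) = tensor r (\<lambda>i. transpose_mat (A i))"
proof (induction r arbitrary: A l)
  case (Suc r)
  have "tensor r (\<lambda>i. A (Suc i)) \<in> carrier_mat (\<Prod>i<r. l (Suc i)) (\<Prod>i<r. l (Suc i))"
    using Suc.prems by (auto intro!: tensor_carrier)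
  moreover have "transpose_mat (tensor r (\<lambda>i. A (Suc i))) = tensor r (\<lambda>i. transpose_mat (A (Suc i)))"
    using Suc.prems by (intro Suc.IH[where l = "\<lambda>i. l (Suc i)"]) auto
  ultimately show ?case using Suc.prems[of 0]
    by (simp add: tensor_Suc kron_transpose)
qed (simp add: tensor_0)

lemma smult_smult_mat: "a \<cdot>\<^sub>m (b \<cdot>\<^sub>m A) = (a * b) \<cdot>\<^sub>m (A :: 'a::semigroup_mult mat)"
  by (rule eq_matI) (auto simp: mult.assoc)

lemma tensor_smult:
  "(\<And>i. i < r \<Longrightarrow> A i \<in> carrier_mat (l i) (l i)) \<Longrightarrow>
    tensor r (\<lambda>i. c i \<cdot>\<^sub>m A i) = (\<Prod>i<r. c i) \<cdot>\<^sub>m tensor r A"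
proof (induction r arbitrary: A l c)
  case 0 show ?case by (auto simp: tensor_0)
next
  case (Suc r)
  have "tensor r (\<lambda>i. A (Suc i)) \<in> carrier_mat (\<Prod>i<r. l (Suc i)) (\<Prod>i<r. l (Suc i))"
    using Suc.prems by (auto intro!: tensor_carrier)
  moreover have "tensor r (\<lambda>i. c (Suc i) \<cdot>\<^sub>m A (Suc i)) = (\<Prod>i<r. c (Suc i)) \<cdot>\<^sub>m tensor r (\<lambda>i. A (Suc i))"
    using Suc.prems by (intro Suc.IH[where l = "\<lambda>i. l (Suc i)"]) auto
  ultimately show ?case using Suc.prems[of 0]
    by (simp add: tensor_Suc kron_smult[of _ "l 0" _ "\<Prod>i<r. l (Suc i)"] prod.lessThan_Suc_shift
        smult_smult_mat mult.commute del: prod.lessThan_Suc)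
qed

definition factor_at :: "nat \<Rightarrow> (nat \<Rightarrow> nat) \<Rightarrow> nat \<Rightarrow> 'a::comm_semiring_1 mat \<Rightarrow> 'a mat" where
  "factor_at r l i A = tensor r (\<lambda>j. if j = i then A else 1\<^sub>m (l j))"

lemma factor_at_pow:
  assumes "A \<in> carrier_mat (l i) (l i)"
  shows "factor_at r l i A ^\<^sub>m k = factor_at r l i (A ^\<^sub>m k)"
proof (induction k)
  case 0
  have "factor_at r l i (A ^\<^sub>m 0) = tensor r (\<lambda>j. 1\<^sub>m (l j))"
    unfolding factor_at_def using assms by (intro tensor_cong) auto
  moreover have "dim_row (factor_at r l i A) = (\<Prod>i<r. l i)"
    unfolding factor_at_def by (rule carrier_matD(1)[OF tensor_carrier]) (use assms in auto)
  ultimately show ?case by (simp add: tensor_one)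
next
  case (Suc k)
  have "factor_at r l i (A ^\<^sub>m k) * factor_at r l i A = factor_at r l i (A ^\<^sub>m k * A)"
    unfolding factor_at_def using assms
    by (subst tensor_mult[where l = l]) (auto intro!: tensor_cong)
  then show ?case using Suc by simp
qed

lemma mat_prod_list_factor_at:
  assumes A: "\<And>i. i < r \<Longrightarrow> A i \<in> carrier_mat (l i) (l i)"
  shows "mat_prod_list (\<Prod>i<r. l i) (map (\<lambda>i. factor_at r l i (A i)) [0..<r]) = tensor r A"
proof -
  \<comment> \<open>Generalized to any list of distinct coordinates, so that the induction can leave
    the identity in the coordinates not yet reached.\<close>
  have "mat_prod_list (\<Prod>i<r. l i) (map (\<lambda>i. factor_at r l i (A i)) xs) =
      tensor r (\<lambda>j. if j \<in> set xs then A j else 1\<^sub>m (l j))"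
    if "distinct xs" "set xs \<subseteq> {..<r}" for xs
    using that
  proof (induction xs)
    case Nil
    show ?case by (simp add: mat_prod_list_def tensor_one)
  next
    case (Cons x xs)
    have "mat_prod_list (\<Prod>i<r. l i) (map (\<lambda>i. factor_at r l i (A i)) (x # xs)) =
       factor_at r l x (A x) * tensor r (\<lambda>j. if j \<in> set xs then A j else 1\<^sub>m (l j))"
      using Cons by (simp add: mat_prod_list_def)
    also have "\<dots> = tensor r (\<lambda>j. if j \<in> set (x # xs) then A j else 1\<^sub>m (l j))"
      unfolding factor_at_def using A Cons.prems right_mult_one_mat[OF A] left_mult_one_mat[OF A]
      by (subst tensor_mult[where l = l]) (auto intro!: tensor_cong)
    finally show ?case .
  qed
  from this[of "[0..<r]"]
  have "mat_prod_list (\<Prod>i<r. l i) (map (\<lambda>i. factor_at r l i (A i)) [0..<r]) =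
      tensor r (\<lambda>j. if j < r then A j else 1\<^sub>m (l j))"
    by (simp add: lessThan_atLeast0)
  also have "\<dots> = tensor r A" by (intro tensor_cong) auto
  finally show ?thesis .
qed

text \<open>A matrix commuting with the left factor has scalar entries in the left tensor coordinate, so
  it is of the form \<open>kron 1 Z'\<close>, and \<open>Z'\<close> again satisfies the hypotheses.\<close>

lemma tensor_centralizer:
  fixes Z :: "'a::field mat"
  shows "Z \<in> carrier_mat (\<Prod>i<r. l i) (\<Prod>i<r. l i) \<Longrightarrow>
    (\<And>i. i < r \<Longrightarrow> 0 < l i) \<Longrightarrow>
    (\<And>i. i < r \<Longrightarrow> C i \<in> carrier_mat (l i) (l i)) \<Longrightarrow> (\<And>i. i < r \<Longrightarrow> S i \<in> carrier_mat (l i) (l i)) \<Longrightarrow>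
    (\<And>i Y. i < r \<Longrightarrow> Y \<in> carrier_mat (l i) (l i) \<Longrightarrow> Y * C i = C i * Y \<Longrightarrow> Y * S i = S i * Y \<Longrightarrow>
      \<exists>c. Y = c \<cdot>\<^sub>m 1\<^sub>m (l i)) \<Longrightarrow>
    (\<And>i. i < r \<Longrightarrow> Z * factor_at r l i (C i) = factor_at r l i (C i) * Z) \<Longrightarrow>
    (\<And>i. i < r \<Longrightarrow> Z * factor_at r l i (S i) = factor_at r l i (S i) * Z) \<Longrightarrow>
    \<exists>c. Z = c \<cdot>\<^sub>m 1\<^sub>m (\<Prod>i<r. l i)"
proof (induction r arbitrary: Z l C S)
  case 0
  then have "Z = Z $$ (0, 0) \<cdot>\<^sub>m 1\<^sub>m 1" by (intro eq_matI) auto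
  then show ?case by auto
next
  case (Suc r)
  define L where "L = l 0"
  define l' where "l' i = l (Suc i)" for i
  define M where "M = (\<Prod>i<r. l' i)"
  have LM: "(\<Prod>i<Suc r. l i) = L * M"
    by (simp add: L_def M_def l'_def prod.lessThan_Suc_shift del: prod.lessThan_Suc)
  have Z: "Z \<in> carrier_mat (L * M) (L * M)" using Suc.prems(1) LM by simp
  have L0: "0 < L" using Suc.prems(2)[of 0] by (simp add: L_def)
  have f0: "factor_at (Suc r) l 0 A = kron A (1\<^sub>m M)" for A :: "'a mat"
    unfolding factor_at_def tensor_Suc by (simp add: M_def l'_def tensor_one)
  have fS: "factor_at (Suc r) l (Suc i) A = kron (1\<^sub>m L) (factor_at r l' i A)" for A :: "'a mat" and i
    unfolding factor_at_def tensor_Suc by (simp add: L_def l'_def cong: if_cong)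
  \<comment> \<open>For fixed inner coordinates \<open>u\<close>, \<open>v\<close> the entries of
    \<open>Z\<close> form an \<open>L\<close>-by-\<open>L\<close> matrix commuting with
    \<open>C 0\<close> and \<open>S 0\<close>, hence a scalar one.\<close>
  have comm0: "\<exists>c. mat L L (\<lambda>(a, b). Z $$ (a * M + u, b * M + v)) = c \<cdot>\<^sub>m 1\<^sub>m L" if uv: "u < M" "v < M" for u v
  proof -
    let ?Y = "mat L L (\<lambda>(a, b). Z $$ (a * M + u, b * M + v))"
    have *: "?Y * A = A * ?Y" if A: "A \<in> carrier_mat L L" and comm: "Z * kron A (1\<^sub>m M) = kron A (1\<^sub>m M) * Z" for A
    proof (rule eq_matI)
      fix a b assume "a < dim_row (A * ?Y)" "b < dim_col (A * ?Y)"
      then have ab: "a < L" "b < L" using A by auto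
      have "(?Y * A) $$ (a, b) = (\<Sum>c<L. \<Sum>w<M. Z $$ (a * M + u, c * M + w) * (A $$ (c, b) * 1\<^sub>m M $$ (w, v)))"
        using A ab uv by (subst index_mult_mat_sum[where m = L])
          (auto intro!: sum.cong simp: if_distrib sum.delta cong: if_cong)
      also have "\<dots> = (Z * kron A (1\<^sub>m M)) $$ (a * M + u, b * M + v)"
        using A ab uv
        by (subst index_mult_mat_sum[OF Z kron_carrier[OF A one_carrier_mat]])
          (auto simp: sum_lessThan_mult mult_add_less_mult kron_index[of _ L _ M] intro!: sum.cong)
      also have "\<dots> = (kron A (1\<^sub>m M) * Z) $$ (a * M + u, b * M + v)" by (simp add: comm)
      also have "\<dots> = (\<Sum>c<L. \<Sum>w<M. (A $$ (a, c) * 1\<^sub>m M $$ (u, w)) * Z $$ (c * M + w, b * M + v))"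
        using A ab uv
        by (subst index_mult_mat_sum[OF kron_carrier[OF A one_carrier_mat] Z])
          (auto simp: sum_lessThan_mult mult_add_less_mult kron_index[of _ L _ M] intro!: sum.cong)
      also have "\<dots> = (A * ?Y) $$ (a, b)"
        using A ab uv by (subst index_mult_mat_sum[where m = L])
          (auto intro!: sum.cong simp: if_distrib if_distribR sum.delta cong: if_cong)
      finally show "(?Y * A) $$ (a, b) = (A * ?Y) $$ (a, b)" .
    qed (use A in auto)
    show ?thesis
      using Suc.prems(3-7)[of 0] *[of "C 0"] *[of "S 0"] Suc.prems(5)[of 0 ?Y] by (simp add: f0 L_def)
  qed
  \<comment> \<open>The scalars found for the pairs \<open>(u, v)\<close> are read off at
    \<open>a = b = 0\<close>, which exists because \<open>0 < L\<close>; they are the entries of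
    \<open>Z'\<close>.\<close>
  define Z' where "Z' = mat M M (\<lambda>(u, v). Z $$ (u, v))"
  have Z': "Z' \<in> carrier_mat M M" by (simp add: Z'_def)
  have ZZ': "Z = kron (1\<^sub>m L) Z'"
  proof (rule eq_mat_blockwise[OF Z])
    fix a b u v assume ab: "a < L" "b < L" "u < M" "v < M"
    obtain c where c: "mat L L (\<lambda>(a, b). Z $$ (a * M + u, b * M + v)) = c \<cdot>\<^sub>m 1\<^sub>m L"
      using comm0 ab by blast
    have "Z $$ (a * M + u, b * M + v) = (if a = b then c else 0)"
      using arg_cong[OF c, of "\<lambda>A. A $$ (a, b)"] ab by simp
    moreover have "Z $$ (u, v) = c"
      using arg_cong[OF c, of "\<lambda>A. A $$ (0, 0)"] L0 by simp
    ultimately show "Z $$ (a * M + u, b * M + v) = kron (1\<^sub>m L) Z' $$ (a * M + u, b * M + v)"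
      using ab Z' by (simp add: kron_index[of _ L _ M]) (simp add: Z'_def)
  qed (use Z' in auto)
  \<comment> \<open>Since \<open>Z\<close> is \<open>kron 1 Z'\<close>, commuting with
    \<open>kron 1 A\<close> means that \<open>Z'\<close> commutes with \<open>A\<close>, by
    comparison of the block \<open>(0, 0)\<close>.\<close>
  have down: "Z' * A = A * Z'"
    if A: "A \<in> carrier_mat M M" and "Z * kron (1\<^sub>m L) A = kron (1\<^sub>m L) A * Z" for A
  proof -
    have eq: "kron (1\<^sub>m L) (Z' * A) = kron (1\<^sub>m L) (A * Z')"
      using that Z' by (simp add: ZZ' kron_mult[of _ L _ _ M])
    show ?thesis
    proof (rule eq_matI)
      fix u v assume "u < dim_row (A * Z')" "v < dim_col (A * Z')"
      then have uv: "u < M" "v < M" using A Z' by auto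
      have "(1\<^sub>m L :: 'a mat) $$ (0, 0) * (Z' * A) $$ (u, v) = 1\<^sub>m L $$ (0, 0) * (A * Z') $$ (u, v)"
        using A Z' uv L0
        by (subst (1 2) kron_index[symmetric, where N = L and d = M]) (auto simp: eq)
      then show "(Z' * A) $$ (u, v) = (A * Z') $$ (u, v)" using L0 by simp
    qed (use A Z' in auto)
  qed
  have fc: "factor_at r l' i A \<in> carrier_mat M M" if "A \<in> carrier_mat (l' i) (l' i)" for i and A :: "'a mat"
    unfolding factor_at_def M_def using that by (intro tensor_carrier) auto
  have "\<exists>c. Z' = c \<cdot>\<^sub>m 1\<^sub>m (\<Prod>i<r. l' i)"
  proof (rule Suc.IH[where C = "\<lambda>i. C (Suc i)" and S = "\<lambda>i. S (Suc i)"])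
    show "Z' \<in> carrier_mat (\<Prod>i<r. l' i) (\<Prod>i<r. l' i)" using Z' by (simp add: M_def)
    show "Z' * factor_at r l' i (C (Suc i)) = factor_at r l' i (C (Suc i)) * Z'" if "i < r" for i
      using that Suc.prems(3,6)[of "Suc i"] by (intro down fc) (auto simp: fS l'_def)
    show "Z' * factor_at r l' i (S (Suc i)) = factor_at r l' i (S (Suc i)) * Z'" if "i < r" for i
      using that Suc.prems(4,7)[of "Suc i"] by (intro down fc) (auto simp: fS l'_def)
  qed (use Suc.prems(2-5) in \<open>auto simp: l'_def\<close>)
  then obtain c where "Z' = c \<cdot>\<^sub>m 1\<^sub>m M" by (auto simp: M_def)
  then have "Z = c \<cdot>\<^sub>m 1\<^sub>m (L * M)" by (simp add: ZZ' kron_smult[of _ L _ M] kron_one)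
  then show ?case unfolding LM by blast
qed

section \<open>Clock and shift matrices\<close>

text \<open>The monomial matrix \<open>X^i Y^j\<close> in closed form, where
  \<open>x = (i, j)\<close> is the pair of exponents of clock and shift. The exponents are not
  reduced modulo \<open>l\<close>, so they can simply be added.\<close>

definition clock_shift :: "nat \<Rightarrow> 'a::field \<Rightarrow> nat \<times> nat \<Rightarrow> 'a mat" where
  "clock_shift l \<epsilon> x =
     mat l l (\<lambda>(i, j). if j = (i + snd x) mod l then \<epsilon> ^ ((l - 1 - i) * fst x) else 0)"

lemma one_smult_mat [simp]: "(1 :: 'a::monoid_mult) \<cdot>\<^sub>m A = A"
  by (rule eq_matI) auto

lemma clock_shift_carrier [simp]: "clock_shift l \<epsilon> x \<in> carrier_mat l l"
  by (simp add: clock_shift_def)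

lemma clockX_carrier [simp]: "clockX l \<epsilon> \<in> carrier_mat l l"
  by (simp add: clockX_def)

lemma shiftY_carrier [simp]: "shiftY l \<in> carrier_mat l l"
  by (simp add: shiftY_def)

lemma clockX_pow: "clockX l \<epsilon> ^\<^sub>m k = mat_diag l (\<lambda>i. \<epsilon> ^ ((l - 1 - i) * k))" for \<epsilon> :: "'a::field"
proof (induction k)
  case 0 show ?case by (auto simp: clockX_def mat_diag_def)
next
  case (Suc k)
  then show ?case by (simp add: clockX_def mat_diag_diag power_add mult.commute)
qed

lemma shiftY_index:
  assumes "i < l" "j < l"
  shows "shiftY l $$ (i, j) = (if j = (i + 1) mod l then 1 else 0)"
proof (cases "i + 1 = l")
  case True then show ?thesis using assms by (auto simp: shiftY_def)
next
  case False
  then have "i + 1 < l" using assms by simp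
  then show ?thesis using assms by (auto simp: shiftY_def)
qed

lemma shiftY_pow:
  assumes "0 < l"
  shows "shiftY l ^\<^sub>m k = (mat l l (\<lambda>(i, j). if j = (i + k) mod l then 1 else 0) :: 'a::field mat)"
proof (induction k)
  case 0 show ?case by (rule eq_matI) (auto simp: shiftY_def)
next
  case (Suc k)
  let ?P = "mat l l (\<lambda>(i, j). if j = (i + k) mod l then 1 else 0) :: 'a mat"
  have "?P * shiftY l = mat l l (\<lambda>(i, j). if j = (i + Suc k) mod l then 1 else 0)"
  proof (rule eq_matI)
    fix i j assume "i < dim_row (mat l l (\<lambda>(i, j). if j = (i + Suc k) mod l then 1 else 0 :: 'a))"
      "j < dim_col (mat l l (\<lambda>(i, j). if j = (i + Suc k) mod l then 1 else 0 :: 'a))"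
    then have ij: "i < l" "j < l" by auto
    have "(?P * shiftY l) $$ (i, j) = (\<Sum>c<l. ?P $$ (i, c) * shiftY l $$ (c, j))"
      using ij by (intro index_mult_mat_sum) auto
    also have "\<dots> = (\<Sum>c<l. if c = (i + k) mod l then shiftY l $$ (c, j) else 0)"
      using ij by (intro sum.cong) auto
    also have "\<dots> = shiftY l $$ ((i + k) mod l, j)" using assms by (simp add: sum.delta)
    also have "\<dots> = (if j = (i + Suc k) mod l then 1 else 0)"
      using ij assms by (simp add: shiftY_index mod_simps)
    finally show "(?P * shiftY l) $$ (i, j) = mat l l (\<lambda>(i, j). if j = (i + Suc k) mod l then 1 else 0) $$ (i, j)"
      using ij by simp
  qed (auto simp: shiftY_def)
  then show ?case using Suc by simp
qed

lemma clock_shift_conv: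
  assumes "0 < l"
  shows "clockX l \<epsilon> ^\<^sub>m x * shiftY l ^\<^sub>m y = clock_shift l \<epsilon> (x, y)"
  unfolding clockX_pow shiftY_pow[OF assms] clock_shift_def
  by (subst mat_diag_mult_left[of _ l l]) auto

text \<open>Moving a shift past a clock costs a power of the inverse of \<open>\<epsilon>\<close>;
  placing the compensating power on the left avoids inverses.\<close>

lemma clock_shift_mult:
  assumes l: "0 < l" and \<epsilon>: "\<epsilon> ^ l = 1"
  shows "\<epsilon> ^ (snd x * fst y) \<cdot>\<^sub>m (clock_shift l \<epsilon> x * clock_shift l \<epsilon> y) =
    clock_shift l \<epsilon> (fst x + fst y, snd x + snd y)"
proof (rule eq_matI)
  fix i j assume "i < dim_row (clock_shift l \<epsilon> (fst x + fst y, snd x + snd y))"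
    "j < dim_col (clock_shift l \<epsilon> (fst x + fst y, snd x + snd y))"
  then have ij: "i < l" "j < l" by (auto simp: clock_shift_def)
  define k where "k = (i + snd x) mod l"
  have k: "k < l" using l by (simp add: k_def)
  have "clock_shift l \<epsilon> x $$ (i, c) = (if c = k then \<epsilon> ^ ((l - 1 - i) * fst x) else 0)" if "c < l" for c
    using that ij by (simp add: clock_shift_def k_def)
  then have "(clock_shift l \<epsilon> x * clock_shift l \<epsilon> y) $$ (i, j) =
     (\<Sum>c<l. if c = k then \<epsilon> ^ ((l - 1 - i) * fst x) * clock_shift l \<epsilon> y $$ (c, j) else 0)"
    unfolding index_mult_mat_sum[OF clock_shift_carrier clock_shift_carrier ij]
    by (intro sum.cong) auto
  also have "\<dots> = \<epsilon> ^ ((l - 1 - i) * fst x) * clock_shift l \<epsilon> y $$ (k, j)"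
    using k by (simp add: sum.delta)
  finally have 1: "(clock_shift l \<epsilon> x * clock_shift l \<epsilon> y) $$ (i, j) =
     \<epsilon> ^ ((l - 1 - i) * fst x) * clock_shift l \<epsilon> y $$ (k, j)" .
  have kj: "(k + snd y) mod l = (i + (snd x + snd y)) mod l"
    by (simp add: k_def mod_simps add.assoc)
  \<comment> \<open>Wrapping around adds a multiple of \<open>l\<close> to the exponent, which
    \<open>\<epsilon> ^ l = 1\<close> does not see. The multiple is added on the other side because
    subtraction of naturals truncates.\<close>
  have "i + snd x = l * ((i + snd x) div l) + k" by (simp add: k_def)
  then have "snd x + (l - 1 - k) = (l - 1 - i) + l * ((i + snd x) div l)"
    using k ij by linarith
  then have "\<epsilon> ^ (snd x + (l - 1 - k)) = \<epsilon> ^ (l - 1 - i)"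
    by (simp add: power_add power_mult \<epsilon>)
  then have "(\<epsilon> ^ (snd x + (l - 1 - k))) ^ fst y = (\<epsilon> ^ (l - 1 - i)) ^ fst y" by simp
  then have 2: "\<epsilon> ^ (snd x * fst y) * \<epsilon> ^ ((l - 1 - k) * fst y) = \<epsilon> ^ ((l - 1 - i) * fst y)"
    by (simp add: power_mult power_add power_mult_distrib)
  have "dim_row (clock_shift l \<epsilon> x) = l" "dim_col (clock_shift l \<epsilon> y) = l" by (auto simp: clock_shift_def)
  then have "(\<epsilon> ^ (snd x * fst y) \<cdot>\<^sub>m (clock_shift l \<epsilon> x * clock_shift l \<epsilon> y)) $$ (i, j) =
     \<epsilon> ^ ((l - 1 - i) * fst x) * (\<epsilon> ^ (snd x * fst y) * clock_shift l \<epsilon> y $$ (k, j))"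
    using ij 1 by (simp del: index_mult_mat(1) add: index_mult_mat(2,3))
  also have "\<dots> = clock_shift l \<epsilon> (fst x + fst y, snd x + snd y) $$ (i, j)"
    using ij k 2 by (simp add: clock_shift_def kj distrib_left power_add)
  finally show "(\<epsilon> ^ (snd x * fst y) \<cdot>\<^sub>m (clock_shift l \<epsilon> x * clock_shift l \<epsilon> y)) $$ (i, j) =
     clock_shift l \<epsilon> (fst x + fst y, snd x + snd y) $$ (i, j)" .
qed (auto simp: clock_shift_def)

lemma power_mod_period:
  fixes \<epsilon> :: "'a::monoid_mult"
  assumes "\<epsilon> ^ l = 1"
  shows "\<epsilon> ^ (n mod l) = \<epsilon> ^ n"
proof -
  have "\<epsilon> ^ n = \<epsilon> ^ (l * (n div l) + n mod l)" by simp
  also have "\<dots> = \<epsilon> ^ (n mod l)" unfolding power_add power_mult assms by simp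
  finally show ?thesis by simp
qed

lemma clock_shift_mod:
  assumes "\<epsilon> ^ l = 1"
  shows "clock_shift l \<epsilon> (fst x mod l, snd x mod l) = clock_shift l \<epsilon> x"
proof -
  have "(\<epsilon> ^ c) ^ (fst x mod l) = (\<epsilon> ^ c) ^ fst x" for c
    by (intro power_mod_period) (metis assms power_commuting_commutes power_mult mult.commute power_one)
  then show ?thesis unfolding clock_shift_def
    by (intro cong_mat refl) (auto simp: mod_simps power_mult)
qed

lemma clock_shift_zero: "clock_shift l \<epsilon> (0, 0) = 1\<^sub>m l"
  by (rule eq_matI) (auto simp: clock_shift_def)

text \<open>For \<open>l \<le> 2\<close> clock and shift are symmetric, so the transpose of
  \<open>X^i Y^j\<close> is \<open>Y^j X^i\<close>, which differs from it by a power of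
  \<open>\<epsilon>\<close>, a sign.\<close>

lemma clock_shift_transpose:
  assumes "l = 1 \<or> l = 2" "\<epsilon> ^ l = 1"
  shows "transpose_mat (clock_shift l \<epsilon> x) =
    (if odd (snd x) then \<epsilon> ^ fst x else 1) \<cdot>\<^sub>m clock_shift l \<epsilon> x"
proof -
  have *: "\<epsilon> * \<epsilon> = 1 \<Longrightarrow> \<epsilon> ^ fst x * \<epsilon> ^ fst x = 1"
    by (metis power_mult_distrib power_one)
  show ?thesis
    using assms
  proof (elim disjE)
    assume "l = 2"
    have \<epsilon>2: "\<epsilon> ^ fst x * \<epsilon> ^ fst x = 1" using * assms(2) \<open>l = 2\<close> by (simp add: power2_eq_square)
    have even: "(i + snd x) mod 2 = i" if "i < 2" "even (snd x)" for i
      using that by (auto elim!: evenE)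
    have odd: "(i + snd x) mod 2 = 1 - i" if "i < 2" "odd (snd x)" for i
      using that by (auto elim!: oddE simp: less_2_cases_iff mod_Suc)
    show ?thesis
    proof (rule eq_matI)
      fix i j assume "i < dim_row ((if odd (snd x) then \<epsilon> ^ fst x else 1) \<cdot>\<^sub>m clock_shift l \<epsilon> x)"
        "j < dim_col ((if odd (snd x) then \<epsilon> ^ fst x else 1) \<cdot>\<^sub>m clock_shift l \<epsilon> x)"
      then have ij: "i < 2" "j < 2" by (simp_all add: clock_shift_def \<open>l = 2\<close>)
      show "transpose_mat (clock_shift l \<epsilon> x) $$ (i, j) =
        ((if odd (snd x) then \<epsilon> ^ fst x else 1) \<cdot>\<^sub>m clock_shift l \<epsilon> x) $$ (i, j)"
      proof (cases "even (snd x)")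
        case True
        then show ?thesis using ij by (simp add: clock_shift_def \<open>l = 2\<close> even)
      next
        case False
        have "i = 0 \<or> i = 1" "j = 0 \<or> j = 1" using ij by auto
        then show ?thesis using False \<epsilon>2 odd[of 0] odd[of 1]
          by (elim disjE) (simp_all add: clock_shift_def \<open>l = 2\<close>)
      qed
    qed (simp_all add: clock_shift_def)
  next
    assume "l = 1"
    then show ?thesis using assms(2) by (intro eq_matI) (auto simp: clock_shift_def)
  qed
qed

text \<open>Commuting with the clock makes \<open>Y\<close> diagonal, since the clock has distinct
  diagonal entries; commuting with the shift makes neighbouring diagonal entries of \<open>Y\<close>
  equal.\<close>

lemma clock_shift_centralizer:
  assumes Y: "Y \<in> carrier_mat l l" and l: "primitive_root_of_unity l \<epsilon>"
    and C: "Y * clockX l \<epsilon> = clockX l \<epsilon> * Y" and S: "Y * shiftY l = shiftY l * Y"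
  shows "\<exists>c. Y = c \<cdot>\<^sub>m 1\<^sub>m l"
proof -
  have l0: "0 < l" "\<epsilon> ^ l = 1" using l by (auto simp: primitive_root_of_unity_def)
  then have \<epsilon>0: "\<epsilon> \<noteq> 0" by (auto simp: power_0_left)
  have inj: "\<epsilon> ^ i \<noteq> \<epsilon> ^ j" if "i < j" "j < l" for i j
  proof
    assume "\<epsilon> ^ i = \<epsilon> ^ j"
    also have "\<dots> = \<epsilon> ^ i * \<epsilon> ^ (j - i)" using that by (simp flip: power_add)
    finally have "\<epsilon> ^ (j - i) = 1" using \<epsilon>0 by simp
    then show False using l that unfolding primitive_root_of_unity_def
      by (metis diff_le_self le_less_trans zero_less_diff)
  qed
  have diag: "Y $$ (i, j) = 0" if "i < l" "j < l" "i \<noteq> j" for i j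
  proof -
    have "Y $$ (i, j) * \<epsilon> ^ (l - 1 - j) = \<epsilon> ^ (l - 1 - i) * Y $$ (i, j)"
      using arg_cong[OF C, of "\<lambda>A. A $$ (i, j)"] that Y
      unfolding clockX_def mat_diag_mult_left[OF Y] mat_diag_mult_right[OF Y] by simp
    moreover have "\<epsilon> ^ (l - 1 - j) \<noteq> \<epsilon> ^ (l - 1 - i)"
    proof (cases "i < j")
      case True
      then show ?thesis using inj[of "l - 1 - j" "l - 1 - i"] that by fastforce
    next
      case False
      then show ?thesis using inj[of "l - 1 - i" "l - 1 - j"] that by fastforce
    qed
    ultimately show ?thesis by auto
  qed
  have step: "Y $$ (i, i) = Y $$ (Suc i, Suc i)" if "Suc i < l" for i
  proof -
    have "(Y * shiftY l) $$ (i, Suc i) = (\<Sum>k<l. if k = i then Y $$ (i, i) else 0)"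
      using that by (subst index_mult_mat_sum[OF Y shiftY_carrier]) (auto simp: diag shiftY_def simp del: sum.delta sum.delta' intro!: sum.cong)
    moreover have "(shiftY l * Y) $$ (i, Suc i) = (\<Sum>k<l. if k = Suc i then Y $$ (Suc i, Suc i) else 0)"
      using that by (subst index_mult_mat_sum[OF shiftY_carrier Y]) (auto simp: diag shiftY_def simp del: sum.delta sum.delta' intro!: sum.cong)
    ultimately show ?thesis using S that by (simp add: sum.delta)
  qed
  define c where "c = Y $$ (0, 0)"
  have "Y $$ (i, i) = c" if "i < l" for i
    using that by (induction i) (auto simp: step c_def)
  then have "Y = c \<cdot>\<^sub>m 1\<^sub>m l"
    using Y by (intro eq_matI) (auto simp: diag)
  then show ?thesis by blast
qed

section \<open>The division graded algebra\<close>

locale division_data = comm_group G for G :: "('g, 'b) monoid_scheme" (structure) +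
  fixes T :: "'g set" and \<beta> :: "'g \<Rightarrow> 'g \<Rightarrow> 'a::field" and ab :: "('g \<times> 'g) list"
  assumes subgroup_T: "subgroup T G" and finite_T: "finite T"
    and bicharacter: "alternating_bicharacter G T \<beta>"
    and nondeg: "nondegenerate G T \<beta>"
    and decomposition: "standard_decomposition G T \<beta> ab"
begin

abbreviation "r \<equiv> length ab"
abbreviation "ll \<equiv> gen_ord G ab"
abbreviation "d \<equiv> D_dim G ab"
abbreviation "X \<equiv> X_mat G \<beta> ab"
abbreviation "eps i \<equiv> \<beta> (fst (ab ! i)) (snd (ab ! i))"
abbreviation "elt \<equiv> elem_of_exponents G ab"

lemma T_closed [simp]: "s \<in> T \<Longrightarrow> t \<in> T \<Longrightarrow> s \<otimes> t \<in> T" "\<one> \<in> T" "t \<in> T \<Longrightarrow> inv t \<in> T"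
  "t \<in> T \<Longrightarrow> t \<in> carrier G"
  using subgroup_T by (auto simp: subgroup.m_closed subgroup.one_closed subgroup.m_inv_closed subgroup.mem_carrier)

lemma beta_nonzero: "s \<in> T \<Longrightarrow> t \<in> T \<Longrightarrow> \<beta> s t \<noteq> 0"
  and beta_mult_left: "s \<in> T \<Longrightarrow> t \<in> T \<Longrightarrow> w \<in> T \<Longrightarrow> \<beta> (s \<otimes> t) w = \<beta> s w * \<beta> t w"
  and beta_mult_right: "s \<in> T \<Longrightarrow> t \<in> T \<Longrightarrow> w \<in> T \<Longrightarrow> \<beta> w (s \<otimes> t) = \<beta> w s * \<beta> w t"
  and beta_self: "t \<in> T \<Longrightarrow> \<beta> t t = 1"
  using bicharacter by (auto simp: alternating_bicharacter_def)

lemma gens: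
  assumes "i < r"
  shows "fst (ab ! i) \<in> T" "snd (ab ! i) \<in> T"
    "primitive_root_of_unity (ll i) (eps i)" "0 < ll i" "eps i ^ ll i = 1"
    and gen_ords: "ord (fst (ab ! i)) = ll i" "ord (snd (ab ! i)) = ll i"
proof -
  obtain a b where ab_i: "ab ! i = (a, b)" by (cases "ab ! i")
  then have "(a, b) \<in> set ab" using assms by (metis nth_mem)
  then have "a \<in> T \<and> b \<in> T \<and> ord a = ord b \<and> primitive_root_of_unity (ord a) (\<beta> a b)"
    using decomposition unfolding standard_decomposition_def by auto
  then show "fst (ab ! i) \<in> T" "snd (ab ! i) \<in> T" "primitive_root_of_unity (ll i) (eps i)"
    "ord (fst (ab ! i)) = ll i" "ord (snd (ab ! i)) = ll i" "0 < ll i" "eps i ^ ll i = 1"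
    by (auto simp: ab_i gen_ord_def primitive_root_of_unity_def)
qed

lemma d_pos: "0 < d"
  using gens by (auto simp: D_dim_def intro!: prod_pos)

lemma in_factor_conv: "in_factor G ab i A = factor_at r ll i A"
  by (simp add: in_factor_def factor_at_def tensor_def)

text \<open>The product of generator matrices for arbitrary exponents. Unlike \<open>X_mat\<close>
  it does not go through reduced exponents, so exponents can be added.\<close>

definition word :: "(nat \<Rightarrow> nat \<times> nat) \<Rightarrow> 'a mat" where
  "word x = tensor r (\<lambda>i. clock_shift (ll i) (eps i) (x i))"

lemma word_carrier [simp]: "word x \<in> carrier_mat d d"
  unfolding word_def D_dim_def by (rule tensor_carrier) auto

lemma X_conv_word: "X t = word (the_inv_into (exponents G ab) elt t)"
proof -
  define x where "x = the_inv_into (exponents G ab) elt t"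
  have "X t = mat_prod_list (\<Prod>i<r. ll i)
      (map (\<lambda>i. factor_at r ll i (clock_shift (ll i) (eps i) (x i))) [0..<r])"
    unfolding X_mat_def Let_def x_def[symmetric] D_dim_def
  proof (rule arg_cong[where f = "mat_prod_list _"], rule map_cong[OF refl])
    fix i assume "i \<in> set [0..<r]"
    then have l: "0 < ll i" using gens by simp
    show "in_factor G ab i (clockX (ll i) (eps i)) ^\<^sub>m fst (x i) * in_factor G ab i (shiftY (ll i)) ^\<^sub>m snd (x i)
        = factor_at r ll i (clock_shift (ll i) (eps i) (x i))"
      unfolding in_factor_conv factor_at_pow[where l = ll and i = i, OF clockX_carrier]
        factor_at_pow[where l = ll and i = i, OF shiftY_carrier]
      unfolding factor_at_def
      by (subst tensor_mult[where l = ll]) (auto intro!: tensor_cong simp: clock_shift_conv[OF l])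
  qed
  also have "\<dots> = word x" unfolding word_def by (rule mat_prod_list_factor_at) auto
  finally show ?thesis by (simp add: x_def)
qed

lemma elem_bij: "bij_betw elt (exponents G ab) T"
  using decomposition by (simp add: standard_decomposition_def)

lemma pow_closed: "t \<in> T \<Longrightarrow> t [^] (n::nat) \<in> T"
  by (induction n) auto

lemma gen_word_closed: "i < r \<Longrightarrow> fst (ab ! i) [^] (m::nat) \<otimes> snd (ab ! i) [^] (n::nat) \<in> T"
  using gens by (simp add: pow_closed)

lemma elem_add: "elt x \<otimes> elt y = elt (\<lambda>i. (fst (x i) + fst (y i), snd (x i) + snd (y i)))"
proof -
  have "elt x \<otimes> elt y =
    (\<Otimes>i\<in>{..<r}. (fst (ab ! i) [^] fst (x i) \<otimes> snd (ab ! i) [^] snd (x i)) \<otimes>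
      (fst (ab ! i) [^] fst (y i) \<otimes> snd (ab ! i) [^] snd (y i)))"
    unfolding elem_of_exponents_def
    using gens by (intro finprod_multf[symmetric]) (auto simp: gen_word_closed)
  also have "\<dots> = elt (\<lambda>i. (fst (x i) + fst (y i), snd (x i) + snd (y i)))"
    unfolding elem_of_exponents_def
    by (intro finprod_cong) (auto simp: nat_pow_mult[symmetric] gens m_ac simp_implies_def)
  finally show ?thesis .
qed

lemma pow_ord_mod: "a \<in> carrier G \<Longrightarrow> a [^] (n mod ord a) = a [^] (n::nat)"
proof -
  assume a: "a \<in> carrier G"
  have "a [^] n = a [^] (ord a * (n div ord a) + n mod ord a)" by simp
  also have "\<dots> = a [^] (ord a * (n div ord a)) \<otimes> a [^] (n mod ord a)"
    using a by (simp only: nat_pow_mult)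
  also have "a [^] (ord a * (n div ord a)) = \<one>" using a by (simp add: nat_pow_pow[symmetric])
  finally show ?thesis using a by simp
qed

text \<open>Reducing the exponents modulo the orders changes neither the group element nor the
  matrix, so the inverse map hidden in \<open>X_mat\<close> can be forgotten from here on.\<close>

lemma X_elem: "X (elt x) = word x"
proof -
  \<comment> \<open>Restricted to \<open>{..<r}\<close> because \<open>exponents\<close> consists of
    extensional functions.\<close>
  define y where "y = (\<lambda>i\<in>{..<r}. (fst (x i) mod ll i, snd (x i) mod ll i))"
  have y: "y \<in> exponents G ab" using gens by (auto simp: y_def exponents_def PiE_iff)
  have "elt y = elt x"
    unfolding elem_of_exponents_def
  proof (rule finprod_cong)
    show "i \<in> {..<r} =simp=> fst (ab ! i) [^] fst (y i) \<otimes> snd (ab ! i) [^] snd (y i) =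
      fst (ab ! i) [^] fst (x i) \<otimes> snd (ab ! i) [^] snd (x i)" for i
      using gens(1,2)[of i] gen_ords[of i] pow_ord_mod[of "fst (ab ! i)"] pow_ord_mod[of "snd (ab ! i)"]
      by (auto simp: simp_implies_def y_def)
  qed (auto simp: gens gen_word_closed)
  then have "the_inv_into (exponents G ab) elt (elt x) = y"
    using the_inv_into_f_f[OF bij_betw_imp_inj_on[OF elem_bij] y] by simp
  then have "X (elt x) = word y" by (simp add: X_conv_word)
  also have "\<dots> = word x"
    unfolding word_def using gens by (intro tensor_cong) (auto simp: y_def clock_shift_mod)
  finally show ?thesis .
qed

lemma ex_elem: "t \<in> T \<Longrightarrow> \<exists>x. t = elt x"
  using elem_bij by (auto simp: bij_betw_def)

lemma X_carrier [simp]: "X t \<in> carrier_mat d d"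
  by (simp add: X_conv_word)

lemma X_dim [simp]: "dim_row (X t) = d" "dim_col (X t) = d"
  using carrier_matD[OF X_carrier] by blast+

lemma X_one: "X \<one> = 1\<^sub>m d"
proof -
  have "elt (\<lambda>_. (0, 0)) = \<one>" by (simp add: elem_of_exponents_def)
  then have "X \<one> = word (\<lambda>_. (0, 0))" using X_elem[of "\<lambda>_. (0, 0)"] by simp
  then show ?thesis by (simp add: word_def clock_shift_zero tensor_one D_dim_def)
qed

lemma eps_nonzero: "i < r \<Longrightarrow> eps i \<noteq> 0"
  using gens by (intro beta_nonzero) auto

lemma word_mult:
  "(\<Prod>i<r. eps i ^ (snd (x i) * fst (y i))) \<cdot>\<^sub>m (word x * word y) =
     word (\<lambda>i. (fst (x i) + fst (y i), snd (x i) + snd (y i)))"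
proof -
  let ?CS = "\<lambda>i. clock_shift (ll i) (eps i)"
  have "word x * word y = tensor r (\<lambda>i. ?CS i (x i) * ?CS i (y i))"
    unfolding word_def by (rule tensor_mult[where l = ll]) auto
  moreover have "tensor r (\<lambda>i. eps i ^ (snd (x i) * fst (y i)) \<cdot>\<^sub>m (?CS i (x i) * ?CS i (y i))) =
     (\<Prod>i<r. eps i ^ (snd (x i) * fst (y i))) \<cdot>\<^sub>m tensor r (\<lambda>i. ?CS i (x i) * ?CS i (y i))"
    by (rule tensor_smult[where l = ll]) (rule mult_carrier_mat[OF clock_shift_carrier clock_shift_carrier])
  ultimately show ?thesis
    by (simp add: word_def clock_shift_mult gens cong: tensor_cong)
qed

lemma X_mult:
  assumes "s \<in> T" "t \<in> T"
  shows "\<exists>c. c \<noteq> 0 \<and> X s * X t = c \<cdot>\<^sub>m X (s \<otimes> t)"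
proof -
  obtain x y where st: "s = elt x" "t = elt y" using assms ex_elem by blast
  define e where "e = (\<Prod>i<r. eps i ^ (snd (x i) * fst (y i)))"
  have e: "e \<noteq> 0" using eps_nonzero by (auto simp: e_def)
  have "e \<cdot>\<^sub>m (X s * X t) = X (s \<otimes> t)"
    unfolding st X_elem elem_add e_def by (rule word_mult)
  then have "X s * X t = inverse e \<cdot>\<^sub>m X (s \<otimes> t)"
    using e by (simp add: smult_smult_mat flip: \<open>e \<cdot>\<^sub>m (X s * X t) = X (s \<otimes> t)\<close>)
  then show ?thesis using e by (intro exI[of _ "inverse e"]) simp
qed

section \<open>Characters of \<open>T\<close>, evaluated on products of the generators\<close>

context
  fixes h :: "'g \<Rightarrow> 'a"
  assumes h: "\<And>s t. s \<in> T \<Longrightarrow> t \<in> T \<Longrightarrow> h (s \<otimes> t) = h s * h t" "\<And>t. t \<in> T \<Longrightarrow> h t \<noteq> 0"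
begin

lemma character_one: "h \<one> = 1"
  using h(1)[of \<one> \<one>] h(2)[of \<one>] by simp

lemma character_pow: "t \<in> T \<Longrightarrow> h (t [^] (n::nat)) = h t ^ n"
  by (induction n) (auto simp: character_one h pow_closed)

lemma character_finprod:
  "finite I \<Longrightarrow> (\<And>i. i \<in> I \<Longrightarrow> f i \<in> T) \<Longrightarrow> finprod G f I \<in> T \<and> h (finprod G f I) = (\<Prod>i\<in>I. h (f i))"
  by (induction I rule: finite_induct) (auto simp: character_one h Pi_iff)

lemma character_elem:
  "h (elt x) = (\<Prod>i<r. h (fst (ab ! i)) ^ fst (x i) * h (snd (ab ! i)) ^ snd (x i))"
proof -
  have "h (elt x) = (\<Prod>i<r. h (fst (ab ! i) [^] fst (x i) \<otimes> snd (ab ! i) [^] snd (x i)))"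
    unfolding elem_of_exponents_def
    by (rule conjunct2[OF character_finprod]) (auto simp: gen_word_closed)
  also have "\<dots> = (\<Prod>i<r. h (fst (ab ! i)) ^ fst (x i) * h (snd (ab ! i)) ^ snd (x i))"
    by (intro prod.cong) (auto simp: h gens pow_closed character_pow)
  finally show ?thesis .
qed

end

text \<open>The trivial character serves only to obtain the closure half of
  \<open>character_finprod\<close>.\<close>

lemma elem_closed: "elt x \<in> T"
  using character_finprod[of "\<lambda>_. 1" "{..<r}"] by (simp add: elem_of_exponents_def gen_word_closed)

text \<open>Polarization of \<open>\<beta> u u = 1\<close> at
  \<open>u = s \<otimes> t\<close>.\<close>

lemma beta_swap: "s \<in> T \<Longrightarrow> t \<in> T \<Longrightarrow> \<beta> s t * \<beta> t s = 1"
proof -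
  assume st: "s \<in> T" "t \<in> T"
  then have "\<beta> (s \<otimes> t) (s \<otimes> t) = \<beta> s (s \<otimes> t) * \<beta> t (s \<otimes> t)" by (intro beta_mult_left) auto
  also have "\<dots> = \<beta> s t * \<beta> t s" using st by (simp add: beta_mult_right beta_self)
  finally show ?thesis using st by (simp add: beta_self)
qed

lemma beta_one_right: "t \<in> T \<Longrightarrow> \<beta> t \<one> = 1"
  by (rule character_one[of "\<beta> t"]) (auto simp: beta_mult_right beta_nonzero)

text \<open>Only the pairs \<open>(a\<^sub>i, b\<^sub>i)\<close> contribute, and
  \<open>\<beta>\<close> of such a pair in reverse order is the inverse of \<open>eps i\<close>. The
  inverse powers are moved to the left, where they form the product that occurs in
  \<open>word_mult\<close>.\<close>

lemma beta_elem:
  "\<beta> (elt x) (elt y) * (\<Prod>i<r. eps i ^ (snd (x i) * fst (y i))) =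
     (\<Prod>i<r. eps i ^ (fst (x i) * snd (y i)))"
proof -
  have right: "\<beta> t (elt y) = (\<Prod>i<r. \<beta> t (fst (ab ! i)) ^ fst (y i) * \<beta> t (snd (ab ! i)) ^ snd (y i))"
    if "t \<in> T" for t
    using that by (intro character_elem) (auto simp: beta_mult_right beta_nonzero)
  have a: "\<beta> (fst (ab ! i)) (elt y) = eps i ^ snd (y i)" if i: "i < r" for i
  proof -
    have "\<beta> (fst (ab ! i)) (elt y) = (\<Prod>j<r. if j = i then eps i ^ snd (y i) else 1)"
      unfolding right[OF gens(1)[OF i]]
    proof (intro prod.cong refl)
      fix j assume "j \<in> {..<r}"
      then show "\<beta> (fst (ab ! i)) (fst (ab ! j)) ^ fst (y j) * \<beta> (fst (ab ! i)) (snd (ab ! j)) ^ snd (y j) =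
         (if j = i then eps i ^ snd (y i) else 1)"
        using decomposition i by (auto simp: standard_decomposition_def beta_self gens)
    qed
    then show ?thesis using i by simp
  qed
  have b: "\<beta> (snd (ab ! i)) (elt y) = inverse (eps i) ^ fst (y i)" if i: "i < r" for i
  proof -
    have inv: "\<beta> (snd (ab ! i)) (fst (ab ! i)) = inverse (eps i)"
      using beta_swap[OF gens(1,2)[OF i]] by (metis inverse_unique)
    have "\<beta> (snd (ab ! i)) (elt y) = (\<Prod>j<r. if j = i then inverse (eps i) ^ fst (y i) else 1)"
      unfolding right[OF gens(2)[OF i]]
    proof (intro prod.cong refl)
      fix j assume "j \<in> {..<r}"
      then show "\<beta> (snd (ab ! i)) (fst (ab ! j)) ^ fst (y j) * \<beta> (snd (ab ! i)) (snd (ab ! j)) ^ snd (y j) =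
         (if j = i then inverse (eps i) ^ fst (y i) else 1)"
        using decomposition i by (auto simp: standard_decomposition_def beta_self gens inv)
    qed
    then show ?thesis using i by simp
  qed
  have "\<beta> (elt x) (elt y) =
     (\<Prod>i<r. \<beta> (fst (ab ! i)) (elt y) ^ fst (x i) * \<beta> (snd (ab ! i)) (elt y) ^ snd (x i))"
    by (rule character_elem[of "\<lambda>s. \<beta> s (elt y)"]) (auto simp: beta_mult_left beta_nonzero elem_closed)
  also have "\<dots> = (\<Prod>i<r. eps i ^ (fst (x i) * snd (y i)) * inverse (eps i ^ (snd (x i) * fst (y i))))"
    by (intro prod.cong) (auto simp: a b power_mult[symmetric] mult.commute power_inverse)
  finally show ?thesis using eps_nonzero by (auto simp: prod.distrib[symmetric] intro!: prod.cong)
qed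

text \<open>By \<open>word_mult\<close> both orders of the product are multiples of the same word;
  the quotient of the two scalars is \<open>\<beta> s t\<close> by \<open>beta_elem\<close>.\<close>

lemma X_comm:
  assumes "s \<in> T" "t \<in> T"
  shows "X s * X t = \<beta> s t \<cdot>\<^sub>m (X t * X s)"
proof -
  obtain x y where st: "s = elt x" "t = elt y" using assms ex_elem by blast
  define e where "e x y = (\<Prod>i<r. eps i ^ (snd (x i) * fst (y i)))" for x y :: "nat \<Rightarrow> nat \<times> nat"
  have e: "e x y \<noteq> 0" for x y using eps_nonzero by (auto simp: e_def)
  have "e x y \<cdot>\<^sub>m (X s * X t) = e y x \<cdot>\<^sub>m (X t * X s)"
    unfolding st X_elem e_def word_mult by (simp add: add.commute)
  also have "e y x = \<beta> s t * e x y"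
    using beta_elem[of x y] by (simp add: st e_def mult.commute)
  finally have "inverse (e x y) \<cdot>\<^sub>m (e x y \<cdot>\<^sub>m (X s * X t)) = inverse (e x y) \<cdot>\<^sub>m ((\<beta> s t * e x y) \<cdot>\<^sub>m (X t * X s))"
    by simp
  moreover have "inverse (e x y) * (\<beta> s t * e x y) = \<beta> s t" using e by (simp add: field_simps)
  ultimately show ?thesis using e by (simp add: smult_smult_mat)
qed

lemma X_inverse:
  assumes "t \<in> T"
  shows "\<exists>Y\<in>carrier_mat d d. X t * Y = 1\<^sub>m d \<and> Y * X t = 1\<^sub>m d"
proof -
  obtain c where c: "c \<noteq> 0" "X t * X (inv t) = c \<cdot>\<^sub>m X (t \<otimes> inv t)"
    using X_mult[of t "inv t"] assms by auto
  then have "X t * (inverse c \<cdot>\<^sub>m X (inv t)) = 1\<^sub>m d"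
    using assms by (simp add: mult_smult_distrib[of _ d d _ d] X_one smult_smult_mat)
  then show ?thesis using mat_mult_left_right_inverse[of "X t" d] by (metis X_carrier smult_carrier_mat)
qed

lemma one_mat_neq_zero: "1\<^sub>m d \<noteq> (0\<^sub>m d d :: 'a mat)"
proof
  assume *: "1\<^sub>m d = (0\<^sub>m d d :: 'a mat)"
  have "1\<^sub>m d $$ (0, 0) = (0\<^sub>m d d :: 'a mat) $$ (0, 0)" by (simp only: *)
  then show False using d_pos by simp
qed

lemma X_nonzero: "t \<in> T \<Longrightarrow> X t \<noteq> 0\<^sub>m d d"
  using X_inverse[of t] one_mat_neq_zero by (metis left_mult_zero_mat)

text \<open>Proportional matrices have the same commutation factors with every \<open>X u\<close>,
  and these determine the group element by nondegeneracy.\<close>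

lemma X_independent:
  assumes "s \<in> T" "t \<in> T" "X s = c \<cdot>\<^sub>m X t"
  shows "s = t"
proof -
  have "c \<noteq> 0"
  proof
    assume "c = 0"
    then have "X s = 0\<^sub>m d d" using assms X_carrier[of t] by (intro eq_matI) auto
    then show False using X_nonzero assms by blast
  qed
  have "\<beta> u s = \<beta> u t" if u: "u \<in> T" for u
  proof -
    have "\<beta> u s \<cdot>\<^sub>m (X s * X u) = X u * (c \<cdot>\<^sub>m X t)" using X_comm[of u s] u assms by simp
    also have "\<dots> = (c * \<beta> u t) \<cdot>\<^sub>m (X t * X u)"
      using X_comm[of u t] u assms by (simp add: mult_smult_distrib[of _ d d _ d] smult_smult_mat)
    also have "\<dots> = \<beta> u t \<cdot>\<^sub>m (X s * X u)"
      using assms by (simp add: mult_smult_assoc_mat[of _ d d _ d] smult_smult_mat mult.commute)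
    finally have eq: "\<beta> u s \<cdot>\<^sub>m (X s * X u) = \<beta> u t \<cdot>\<^sub>m (X s * X u)" .
    obtain Y where Y: "Y \<in> carrier_mat d d" "X u * Y = 1\<^sub>m d" using X_inverse u by blast
    have "X s * X u \<noteq> 0\<^sub>m d d"
    proof
      assume "X s * X u = 0\<^sub>m d d"
      then have "(X s * X u) * Y = 0\<^sub>m d d" using Y by simp
      then show False using Y X_nonzero assms by (simp add: assoc_mult_mat[of _ d d _ d _ d] del: assoc_mult_mat)
    qed
    then obtain i j where ij: "i < d" "j < d" "(X s * X u) $$ (i, j) \<noteq> 0"
      using nonzero_mat_entry[OF mult_carrier_mat[OF X_carrier X_carrier]] by blast
    have "dim_row (X s * X u) = d" "dim_col (X s * X u) = d"
      using X_carrier[of s] X_carrier[of u] by auto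
    then have "\<beta> u s * (X s * X u) $$ (i, j) = \<beta> u t * (X s * X u) $$ (i, j)"
      using arg_cong[OF eq, of "\<lambda>A. A $$ (i, j)"] ij(1,2) by (simp del: index_mult_mat)
    then show ?thesis using ij by simp
  qed
  then have "\<beta> u (s \<otimes> inv t) = 1" if "u \<in> T" for u
    using that assms beta_mult_right[of t "inv t" u] by (simp add: beta_mult_right beta_one_right)
  then have "s \<otimes> inv t = \<one>" using nondeg assms by (simp add: nondegenerate_def)
  then show ?thesis using assms
    by (metis T_closed(3,4) inv_inv inv_equality)
qed

text \<open>Among the \<open>X t\<close> are the clock and the shift of each tensor factor, taken at
  exponents with a single 1; their joint centralizer is scalar.\<close>

lemma X_centralizer:
  assumes Z: "Z \<in> carrier_mat d d" and comm: "\<And>t. t \<in> T \<Longrightarrow> Z * X t = X t * Z"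
  shows "\<exists>c. Z = c \<cdot>\<^sub>m 1\<^sub>m d"
proof -
  have 1: "factor_at r ll i (clockX (ll i) (eps i)) = X (elt (\<lambda>j. if j = i then (1, 0) else (0, 0)))"
    if "i < r" for i
    unfolding X_elem word_def factor_at_def using gens(4)[OF that]
    by (intro tensor_cong) (auto simp: clock_shift_zero clock_shift_conv[symmetric] shiftY_pow
        right_mult_one_mat[OF clockX_carrier] carrier_matD[OF clockX_carrier] carrier_matD[OF shiftY_carrier])
  have 2: "factor_at r ll i (shiftY (ll i)) = X (elt (\<lambda>j. if j = i then (0, 1) else (0, 0)))"
    if "i < r" for i
    unfolding X_elem word_def factor_at_def using gens(4)[OF that]
    by (intro tensor_cong) (auto simp: clock_shift_zero clock_shift_conv[symmetric]
        left_mult_one_mat[OF shiftY_carrier] carrier_matD[OF clockX_carrier] carrier_matD[OF shiftY_carrier])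
  show ?thesis
    unfolding D_dim_def
  proof (rule tensor_centralizer[where C = "\<lambda>i. clockX (ll i) (eps i)" and S = "\<lambda>i. shiftY (ll i)"])
    show "Z \<in> carrier_mat (\<Prod>i<r. ll i) (\<Prod>i<r. ll i)" using Z by (simp add: D_dim_def)
    show "\<exists>c. Y = c \<cdot>\<^sub>m 1\<^sub>m (ll i)" if "i < r" "Y \<in> carrier_mat (ll i) (ll i)"
      "Y * clockX (ll i) (eps i) = clockX (ll i) (eps i) * Y" "Y * shiftY (ll i) = shiftY (ll i) * Y" for i Y
      using clock_shift_centralizer that gens by blast
  qed (auto simp: gens 1 2 comm elem_closed)
qed

end

section \<open>Elementary 2-groups: transposes, squares and eigenmatrices of the
  \<open>X t\<close>\<close>

locale elementary_division_data = division_data G T \<beta> ab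
  for G :: "('g, 'b) monoid_scheme" (structure) and T and \<beta> :: "'g \<Rightarrow> 'g \<Rightarrow> 'a::field" and ab +
  assumes char_2: "(2::'a) \<noteq> 0" and elementary: "t \<in> T \<Longrightarrow> t \<otimes> t = \<one>"
begin

lemma T_inv: "t \<in> T \<Longrightarrow> inv t = t"
  using elementary by (intro inv_equality) auto

lemma ll_cases: "i < r \<Longrightarrow> ll i = 1 \<or> ll i = 2"
proof -
  assume i: "i < r"
  have "fst (ab ! i) [^] (2::nat) = \<one>" using gens[OF i] elementary by (simp add: numeral_2_eq_2)
  then have "ord (fst (ab ! i)) dvd 2" using gens[OF i] pow_eq_id by auto
  then have "ll i \<le> 2" using gen_ords[OF i] by (simp add: dvd_imp_le)
  then show ?thesis using gens(4)[OF i] by linarith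
qed

lemma X_transpose: "t \<in> T \<Longrightarrow> \<exists>c. c \<noteq> 0 \<and> transpose_mat (X t) = c \<cdot>\<^sub>m X t"
proof -
  assume "t \<in> T"
  then obtain x where x: "t = elt x" using ex_elem by blast
  let ?c = "\<lambda>i. if odd (snd (x i)) then eps i ^ fst (x i) else 1"
  have "transpose_mat (X t) = tensor r (\<lambda>i. ?c i \<cdot>\<^sub>m clock_shift (ll i) (eps i) (x i))"
    unfolding x X_elem word_def
    by (subst tensor_transpose[where l = ll])
      (auto intro!: tensor_cong clock_shift_transpose[OF ll_cases gens(5)])
  also have "\<dots> = (\<Prod>i<r. ?c i) \<cdot>\<^sub>m X t"
    unfolding x X_elem word_def by (rule tensor_smult[where l = ll]) auto
  finally show ?thesis using eps_nonzero by (intro exI[of _ "\<Prod>i<r. ?c i"]) auto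
qed

lemma X_square: "t \<in> T \<Longrightarrow> \<exists>c. c \<noteq> 0 \<and> X t * X t = c \<cdot>\<^sub>m 1\<^sub>m d"
  using X_mult[of t t] elementary by (simp add: X_one)

text \<open>The order of \<open>T\<close> is the product of the squares of the \<open>ll i\<close>,
  all of them 1 or 2. It is the value of the character sum whose nonvanishing is exploited in
  \<open>eigenmatrix\<close>.\<close>

lemma card_T_nonzero: "of_nat (card T) \<noteq> (0::'a)"
proof -
  have "card T = (\<Prod>i<r. ll i * ll i)"
    using bij_betw_same_card[OF elem_bij] by (simp add: exponents_def card_PiE)
  moreover have "of_nat (ll i * ll i) \<noteq> (0::'a)" if "i < r" for i
    using ll_cases[OF that] char_2 by auto
  ultimately show ?thesis by auto
qed

text \<open>The scalars \<open>c t\<close> form a character of \<open>T\<close>; orthogonality of characters produces \<open>s\<close>.\<close>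

lemma eigenmatrix:
  assumes p: "p \<in> carrier_mat d d" "p \<noteq> 0\<^sub>m d d"
    and eig: "\<And>t. t \<in> T \<Longrightarrow> X t * p = c t \<cdot>\<^sub>m (p * X t)"
  shows "\<exists>s\<in>T. (\<forall>t\<in>T. c t = \<beta> t s) \<and> (\<exists>q. q \<noteq> 0 \<and> p = q \<cdot>\<^sub>m X s)"
proof -
  have pX: "p * X t \<noteq> 0\<^sub>m d d" if t: "t \<in> T" for t
  proof
    assume 0: "p * X t = 0\<^sub>m d d"
    obtain Y where "Y \<in> carrier_mat d d" "X t * Y = 1\<^sub>m d" using X_inverse t by blast
    then have "p * X t * Y = p" using p by (simp add: assoc_mult_mat[of _ d d _ d _ d])
    then show False using 0 p \<open>Y \<in> _\<close> by simp
  qed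
  have cancel: "x = y" if eq: "x \<cdot>\<^sub>m M = y \<cdot>\<^sub>m M" and M: "M \<noteq> 0\<^sub>m d d" "M \<in> carrier_mat d d"
    for x y and M :: "'a mat"
  proof -
    obtain i j where "i < d" "j < d" "M $$ (i, j) \<noteq> 0"
      using nonzero_mat_entry[OF M(2,1)] by blast
    then show ?thesis using arg_cong[OF eq, of "\<lambda>A. A $$ (i, j)"] M by simp
  qed
  \<comment> \<open>Moving \<open>p\<close> past \<open>X s * X t\<close> at once or one factor at a
    time gives the same result.\<close>
  have c_mult: "c (s \<otimes> t) = c s * c t" if st: "s \<in> T" "t \<in> T" for s t
  proof -
    obtain e where e: "e \<noteq> 0" "X s * X t = e \<cdot>\<^sub>m X (s \<otimes> t)" using X_mult st by blast
    have "(e * c (s \<otimes> t)) \<cdot>\<^sub>m (p * X (s \<otimes> t)) = (X s * X t) * p"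
      using p eig[of "s \<otimes> t"] st by (simp add: e mult_smult_assoc_mat[of _ d d _ d] smult_smult_mat)
    also have "\<dots> = X s * (X t * p)" using p by (simp add: assoc_mult_mat[of _ d d _ d _ d])
    also have "\<dots> = c t \<cdot>\<^sub>m (X s * (p * X t))"
      using p st by (simp add: eig mult_smult_distrib[of _ d d _ d])
    also have "\<dots> = c t \<cdot>\<^sub>m ((X s * p) * X t)"
      using p by (simp only: assoc_mult_mat[of "X s" d d p d "X t" d] X_carrier)
    also have "\<dots> = (c t * c s) \<cdot>\<^sub>m (p * (X s * X t))"
      using p eig st by (simp add: mult_smult_assoc_mat[of _ d d _ d] assoc_mult_mat[of _ d d _ d _ d] smult_smult_mat)
    also have "\<dots> = (c t * c s * e) \<cdot>\<^sub>m (p * X (s \<otimes> t))"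
      using p by (simp add: e mult_smult_distrib[of _ d d _ d] smult_smult_mat)
    finally have "e * c (s \<otimes> t) = c t * c s * e"
      using pX st p by (intro cancel[where M = "p * X (s \<otimes> t)"]) (auto intro!: mult_carrier_mat)
    then show ?thesis using e by (simp add: mult_ac)
  qed
  have c_one: "c \<one> = 1"
  proof -
    have "1 \<cdot>\<^sub>m p = c \<one> \<cdot>\<^sub>m p" using eig[of \<one>] p by (simp add: X_one)
    then show ?thesis using cancel[of 1 p "c \<one>"] p by auto
  qed
  \<comment> \<open>For \<open>t \<noteq> \<one>\<close>, a translation by \<open>u\<close> with
    \<open>\<beta> t u \<noteq> 1\<close> reindexes the sum and multiplies it by
    \<open>\<beta> t u\<close>.\<close>
  have orth: "(\<Sum>s\<in>T. \<beta> t s) = (if t = \<one> then of_nat (card T) else 0)" if t: "t \<in> T" for t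
  proof (cases "t = \<one>")
    case True
    have "\<beta> \<one> s = 1" if "s \<in> T" for s
      by (rule character_one[of "\<lambda>u. \<beta> u s"]) (auto simp: beta_mult_left beta_nonzero that)
    then show ?thesis using True by simp
  next
    case False
    then obtain u where u: "u \<in> T" "\<beta> u t \<noteq> 1" using nondeg t by (auto simp: nondegenerate_def)
    then have u': "\<beta> t u \<noteq> 1" using beta_swap[of u t] t by auto
    have "(\<Sum>s\<in>T. \<beta> t s) = (\<Sum>s\<in>T. \<beta> t (u \<otimes> s))"
      using u by (intro sum.reindex_bij_witness[of _ "\<lambda>s. u \<otimes> s" "\<lambda>s. u \<otimes> s"])
        (auto simp: m_assoc[symmetric] elementary)
    also have "\<dots> = \<beta> t u * (\<Sum>s\<in>T. \<beta> t s)"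
      using u t by (simp add: beta_mult_right sum_distrib_left)
    finally show ?thesis using u' False by simp
  qed
  \<comment> \<open>Summed over all \<open>s\<close>, the pairings of \<open>c\<close> with the
    characters \<open>\<beta> _ s\<close> give the nonzero order of \<open>T\<close>, so some
    pairing is nonzero.\<close>
  have "(\<Sum>s\<in>T. \<Sum>t\<in>T. c t * \<beta> t s) = (\<Sum>t\<in>T. c t * (\<Sum>s\<in>T. \<beta> t s))"
    unfolding sum_distrib_left by (rule sum.swap)
  also have "\<dots> = (\<Sum>t\<in>T. if t = \<one> then c \<one> * of_nat (card T) else 0)"
    by (intro sum.cong) (auto simp: orth)
  also have "\<dots> \<noteq> 0" using finite_T card_T_nonzero c_one by (simp add: sum.delta)
  finally obtain s where s: "s \<in> T" "(\<Sum>t\<in>T. c t * \<beta> t s) \<noteq> 0"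
    by (meson sum.neutral)
  \<comment> \<open>The same translation argument: a nonzero sum that is reproduced up to the factor
    \<open>c u * \<beta> u s\<close> forces this factor to be 1.\<close>
  have cs: "c u * \<beta> u s = 1" if u: "u \<in> T" for u
  proof -
    have "(\<Sum>t\<in>T. c t * \<beta> t s) = (\<Sum>t\<in>T. c (u \<otimes> t) * \<beta> (u \<otimes> t) s)"
      using u by (intro sum.reindex_bij_witness[of _ "\<lambda>s. u \<otimes> s" "\<lambda>s. u \<otimes> s"])
        (auto simp: m_assoc[symmetric] elementary)
    also have "\<dots> = (c u * \<beta> u s) * (\<Sum>t\<in>T. c t * \<beta> t s)"
      using u s by (simp add: beta_mult_left c_mult sum_distrib_left mult_ac)
    finally show ?thesis using s by simp
  qed
  have bb: "\<beta> u s * \<beta> u s = 1" if "u \<in> T" for u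
    using that s beta_mult_right[of s s u] by (simp add: elementary beta_one_right)
  have c_eq: "c u = \<beta> u s" if "u \<in> T" for u
    using cs[OF that] bb[OF that] by (metis mult_right_cancel mult_zero_right zero_neq_one)
  \<comment> \<open>The eigenvalues of \<open>p\<close> and of \<open>X s\<close> cancel, so
    \<open>p * X s\<close> commutes with all \<open>X t\<close>; then \<open>p\<close> is recovered
    because \<open>X s\<close> squares to a scalar.\<close>
  have "\<exists>q. p * X s = q \<cdot>\<^sub>m 1\<^sub>m d"
  proof (rule X_centralizer)
    fix t assume t: "t \<in> T"
    have "X t * (p * X s) = (X t * p) * X s" using p by (simp add: assoc_mult_mat[of _ d d _ d _ d])
    also have "\<dots> = c t \<cdot>\<^sub>m (p * (X t * X s))"
      using p t by (simp add: eig mult_smult_assoc_mat[of _ d d _ d] assoc_mult_mat[of _ d d _ d _ d])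
    also have "p * (X t * X s) = \<beta> t s \<cdot>\<^sub>m (p * (X s * X t))"
      unfolding X_comm[OF t s(1)]
      by (rule mult_smult_distrib[OF p(1) mult_carrier_mat[OF X_carrier X_carrier]])
    also have "c t \<cdot>\<^sub>m (\<beta> t s \<cdot>\<^sub>m (p * (X s * X t))) = (c t * \<beta> t s) \<cdot>\<^sub>m (p * (X s * X t))"
      by (rule smult_smult_mat)
    finally show "p * X s * X t = X t * (p * X s)"
      using p cs[OF t] by (simp add: assoc_mult_mat[of _ d d _ d _ d])
  qed (use p in auto)
  then obtain q where q: "p * X s = q \<cdot>\<^sub>m 1\<^sub>m d" by blast
  obtain e where e: "e \<noteq> 0" "X s * X s = e \<cdot>\<^sub>m 1\<^sub>m d" using X_square s by blast
  have "e \<cdot>\<^sub>m p = p * (X s * X s)" using p by (simp add: e mult_smult_distrib[of _ d d _ d])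
  also have "\<dots> = q \<cdot>\<^sub>m X s"
    using p q by (simp add: assoc_mult_mat[of _ d d _ d _ d, symmetric] mult_smult_assoc_mat[of _ d d _ d] del: assoc_mult_mat)
  finally have "inverse e \<cdot>\<^sub>m (e \<cdot>\<^sub>m p) = inverse e \<cdot>\<^sub>m (q \<cdot>\<^sub>m X s)" by simp
  then have pq: "p = (inverse e * q) \<cdot>\<^sub>m X s" using e by (simp add: smult_smult_mat)
  moreover have "inverse e * q \<noteq> 0"
  proof
    assume "inverse e * q = 0"
    then have "p = 0\<^sub>m d d" using pq X_carrier[of s] by (intro eq_matI) auto
    then show False using p by simp
  qed
  ultimately show ?thesis using s c_eq by blast
qed

end

section \<open>Congruence of bilinear forms\<close>

lemma mult_if:
  fixes c :: "'a::mult_zero"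
  shows "(if P then a else 0) * c = (if P then a * c else 0)" "c * (if P then a else 0) = (if P then c * a else 0)"
  by auto

lemma sum_if_const: "(\<Sum>x\<in>I. if P then f x else 0) = (if P then \<Sum>x\<in>I. f x else 0)"
  by simp

text \<open>Forms are functions on an index set and not matrices, so that passing to a subset of the
  indices needs no renumbering.\<close>

definition nondeg_on :: "'i set \<Rightarrow> ('i \<Rightarrow> 'i \<Rightarrow> 'a::field) \<Rightarrow> bool" where
  "nondeg_on I Q \<longleftrightarrow> (\<forall>x. (\<forall>b\<in>I. (\<Sum>a\<in>I. x a * Q a b) = 0) \<longrightarrow> (\<forall>a\<in>I. x a = 0))"

text \<open>The congruent form \<open>A^T Q A\<close>, with all sums over \<open>I\<close>.\<close>

definition transform_form :: "'i set \<Rightarrow> ('i \<Rightarrow> 'i \<Rightarrow> 'a::field) \<Rightarrow> ('i \<Rightarrow> 'i \<Rightarrow> 'a) \<Rightarrow> 'i \<Rightarrow> 'i \<Rightarrow> 'a" where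
  "transform_form I A Q a b = (\<Sum>x\<in>I. \<Sum>y\<in>I. A x a * Q x y * A y b)"

lemma transform_form_comp:
  "transform_form I A' (transform_form I A Q) a b =
   transform_form I (\<lambda>x b. \<Sum>c\<in>I. A x c * A' c b) Q a b"
proof -
  have "transform_form I (\<lambda>x b. \<Sum>c\<in>I. A x c * A' c b) Q a b =
    (\<Sum>x\<in>I. \<Sum>y\<in>I. \<Sum>c\<in>I. \<Sum>e\<in>I. A x c * A' c a * Q x y * (A y e * A' e b))"
  proof -
    have "(\<Sum>c\<in>I. A x c * A' c a) * Q x y * (\<Sum>e\<in>I. A y e * A' e b) =
      (\<Sum>c\<in>I. \<Sum>e\<in>I. A x c * A' c a * Q x y * (A y e * A' e b))" for x y
      by (simp only: sum_distrib_right) (simp only: sum_distrib_left)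
    then show ?thesis by (simp only: transform_form_def)
  qed
  also have "\<dots> = (\<Sum>x\<in>I. \<Sum>c\<in>I. \<Sum>y\<in>I. \<Sum>e\<in>I. A x c * A' c a * Q x y * (A y e * A' e b))"
    by (intro sum.cong refl sum.swap)
  also have "\<dots> = (\<Sum>c\<in>I. \<Sum>x\<in>I. \<Sum>y\<in>I. \<Sum>e\<in>I. A x c * A' c a * Q x y * (A y e * A' e b))"
    by (rule sum.swap)
  also have "\<dots> = (\<Sum>c\<in>I. \<Sum>x\<in>I. \<Sum>e\<in>I. \<Sum>y\<in>I. A x c * A' c a * Q x y * (A y e * A' e b))"
    by (intro sum.cong refl sum.swap)
  also have "\<dots> = (\<Sum>c\<in>I. \<Sum>e\<in>I. \<Sum>x\<in>I. \<Sum>y\<in>I. A x c * A' c a * Q x y * (A y e * A' e b))"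
    by (intro sum.cong refl sum.swap)
  also have "\<dots> = transform_form I A' (transform_form I A Q) a b"
    by (simp add: transform_form_def sum_distrib_left sum_distrib_right mult_ac)
  finally show ?thesis by simp
qed

text \<open>One statement for symmetric forms (\<open>\<epsilon> = 1\<close>) and skew ones
  (\<open>\<epsilon> = - 1\<close>).\<close>

lemma transform_form_commute:
  assumes "\<And>a b. a \<in> I \<Longrightarrow> b \<in> I \<Longrightarrow> Q a b = \<epsilon> * Q b a"
  shows "transform_form I A Q a b = \<epsilon> * transform_form I A Q b a"
proof -
  have "A x a * Q x y * A y b = \<epsilon> * (A y b * Q y x * A x a)" if "x \<in> I" "y \<in> I" for x y
    unfolding assms[OF that] by (simp only: mult_ac)
  then have "transform_form I A Q a b = (\<Sum>x\<in>I. \<Sum>y\<in>I. \<epsilon> * (A y b * Q y x * A x a))"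
    unfolding transform_form_def by (intro sum.cong refl) auto
  also have "\<dots> = (\<Sum>y\<in>I. \<Sum>x\<in>I. \<epsilon> * (A y b * Q y x * A x a))" by (rule sum.swap)
  finally show ?thesis by (simp add: transform_form_def sum_distrib_left)
qed

text \<open>The base change that exchanges the basis vector \<open>y\<close> for \<open>v\<close>
  and keeps the others; invertible when \<open>v y \<noteq> 0\<close>.\<close>

definition replace_basis :: "'i \<Rightarrow> ('i \<Rightarrow> 'a::field) \<Rightarrow> 'i \<Rightarrow> 'i \<Rightarrow> 'a" where
  "replace_basis y v x a = (if a = y then v x else if x = a then 1 else 0)"

lemma transform_replace_basis:
  assumes "finite I" "y \<in> I"
  shows "a \<in> I \<Longrightarrow> b \<in> I \<Longrightarrow> a \<noteq> y \<Longrightarrow> b \<noteq> y \<Longrightarrow> transform_form I (replace_basis y v) Q a b = Q a b"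
    and "a \<in> I \<Longrightarrow> a \<noteq> y \<Longrightarrow> transform_form I (replace_basis y v) Q a y = (\<Sum>z\<in>I. Q a z * v z)"
    and "transform_form I (replace_basis y v) Q y y = (\<Sum>x\<in>I. \<Sum>z\<in>I. v x * Q x z * v z)"
  using assms by (simp_all add: transform_form_def replace_basis_def mult_if sum_if_const)

text \<open>Let \<open>w\<close> be the image of \<open>x\<close> under the base change. It is
  orthogonal to the kept basis vectors and to \<open>v\<close>, hence to the vector \<open>y\<close>
  as \<open>v y \<noteq> 0\<close>; so \<open>w\<close> vanishes, and then \<open>x\<close>
  does.\<close>

lemma nondeg_replace_basis:
  assumes I: "finite I" "y \<in> I" and v: "v y \<noteq> 0" and Q: "nondeg_on I Q"
  shows "nondeg_on I (transform_form I (replace_basis y v) Q)"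
  unfolding nondeg_on_def
proof (intro allI impI)
  fix x assume x: "\<forall>b\<in>I. (\<Sum>a\<in>I. x a * transform_form I (replace_basis y v) Q a b) = 0"
  define w where "w z = (\<Sum>a\<in>I. replace_basis y v z a * x a)" for z
  have *: "(\<Sum>a\<in>I. x a * transform_form I (replace_basis y v) Q a b) =
     (\<Sum>z\<in>I. (\<Sum>u\<in>I. w u * Q u z) * replace_basis y v z b)" for b
  proof -
    have "(\<Sum>a\<in>I. x a * transform_form I (replace_basis y v) Q a b) =
      (\<Sum>a\<in>I. \<Sum>u\<in>I. \<Sum>z\<in>I. replace_basis y v u a * x a * Q u z * replace_basis y v z b)"
      by (simp add: transform_form_def sum_distrib_left mult_ac)
    also have "\<dots> = (\<Sum>u\<in>I. \<Sum>a\<in>I. \<Sum>z\<in>I. replace_basis y v u a * x a * Q u z * replace_basis y v z b)"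
      by (rule sum.swap)
    also have "\<dots> = (\<Sum>u\<in>I. \<Sum>z\<in>I. \<Sum>a\<in>I. replace_basis y v u a * x a * Q u z * replace_basis y v z b)"
      by (intro sum.cong refl sum.swap)
    also have "\<dots> = (\<Sum>z\<in>I. \<Sum>u\<in>I. \<Sum>a\<in>I. replace_basis y v u a * x a * Q u z * replace_basis y v z b)"
      by (rule sum.swap)
    also have "\<dots> = (\<Sum>z\<in>I. (\<Sum>u\<in>I. w u * Q u z) * replace_basis y v z b)"
      by (simp add: w_def sum_distrib_right)
    finally show ?thesis .
  qed
  have other: "(\<Sum>u\<in>I. w u * Q u b) = 0" if "b \<in> I" "b \<noteq> y" for b
    using x[rule_format, OF that(1)] that I unfolding *
    by (simp add: replace_basis_def mult_if)
  have "(\<Sum>z\<in>I. (\<Sum>u\<in>I. w u * Q u z) * v z) = 0"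
    using x[rule_format, OF I(2)] unfolding * by (simp add: replace_basis_def)
  moreover have "(\<Sum>z\<in>I. (\<Sum>u\<in>I. w u * Q u z) * v z) = (\<Sum>z\<in>I. if z = y then (\<Sum>u\<in>I. w u * Q u y) * v y else 0)"
    by (intro sum.cong refl) (auto simp: other)
  ultimately have "(\<Sum>u\<in>I. w u * Q u y) = 0" using I v by simp
  then have w0: "w z = 0" if "z \<in> I" for z using Q other that unfolding nondeg_on_def by metis
  have wz: "w z = v z * x y + (if z = y then 0 else x z)" if "z \<in> I" for z
  proof -
    have "w z = (\<Sum>a\<in>I. (if a = y then v z * x y else 0) + (if a = z then (if z = y then 0 else x z) else 0))"
      unfolding w_def by (intro sum.cong refl) (auto simp: replace_basis_def)
    then show ?thesis using I that by (simp add: sum.distrib)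
  qed
  have "x y = 0" using wz[OF I(2)] w0[OF I(2)] v by simp
  moreover have "x a = 0" if "a \<in> I" "a \<noteq> y" for a
    using wz[OF that(1)] w0[OF that(1)] that(2) \<open>x y = 0\<close> by simp
  ultimately show "\<forall>a\<in>I. x a = 0" by blast
qed

text \<open>The Schur complement of the block on \<open>K\<close>, with \<open>R\<close> in the role
  of the inverse of that block.\<close>

definition schur_form :: "'i set \<Rightarrow> ('i \<Rightarrow> 'i \<Rightarrow> 'a::field) \<Rightarrow> ('i \<Rightarrow> 'i \<Rightarrow> 'a) \<Rightarrow> 'i \<Rightarrow> 'i \<Rightarrow> 'a" where
  "schur_form K R Q a b = Q a b - (\<Sum>k\<in>K. \<Sum>k'\<in>K. Q a k * R k k' * Q k' b)"

context
  fixes I K :: "'i set" and Q R :: "'i \<Rightarrow> 'i \<Rightarrow> 'a::field" and \<epsilon> :: 'a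
  assumes I: "finite I" "K \<subseteq> I"
    and sym: "\<And>a b. a \<in> I \<Longrightarrow> b \<in> I \<Longrightarrow> Q a b = \<epsilon> * Q b a"
    and RQ: "\<And>a b. a \<in> K \<Longrightarrow> b \<in> K \<Longrightarrow> (\<Sum>k\<in>K. R a k * Q k b) = (if a = b then 1 else 0)"
    and QR: "\<And>a b. a \<in> K \<Longrightarrow> b \<in> K \<Longrightarrow> (\<Sum>k\<in>K. Q a k * R k b) = (if a = b then 1 else 0)"
begin

lemma sum_split_K: "(\<Sum>a\<in>I. f a) = (\<Sum>a\<in>K. f a) + (\<Sum>a\<in>I - K. f a)" for f :: "'i \<Rightarrow> 'a"
  using sum.subset_diff[OF I(2,1), of f] by (simp add: add.commute)

lemma finite_K: "finite K"
  using I finite_subset by blast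

text \<open>A radical vector of the Schur complement extends to a radical vector of
  \<open>Q\<close>; the values of \<open>w\<close> on \<open>K\<close> are those that make it
  orthogonal to \<open>K\<close>.\<close>

lemma nondeg_schur:
  assumes Q: "nondeg_on I Q"
  shows "nondeg_on (I - K) (schur_form K R Q)"
  unfolding nondeg_on_def
proof (intro allI impI)
  fix x assume x: "\<forall>b\<in>I - K. (\<Sum>a\<in>I - K. x a * schur_form K R Q a b) = 0"
  define w where "w a = (if a \<in> K then - (\<Sum>e\<in>I - K. \<Sum>k\<in>K. x e * Q e k * R k a) else x a)" for a
  have K: "(\<Sum>a\<in>K. w a * Q a b) = - (\<Sum>e\<in>I - K. x e * (\<Sum>k\<in>K. \<Sum>a\<in>K. Q e k * R k a * Q a b))" for b
  proof -
    have "(\<Sum>a\<in>K. w a * Q a b) = - (\<Sum>a\<in>K. \<Sum>e\<in>I - K. \<Sum>k\<in>K. x e * Q e k * R k a * Q a b)"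
      by (simp add: w_def sum_distrib_right sum_negf)
    also have "(\<Sum>a\<in>K. \<Sum>e\<in>I - K. \<Sum>k\<in>K. x e * Q e k * R k a * Q a b) =
       (\<Sum>e\<in>I - K. \<Sum>a\<in>K. \<Sum>k\<in>K. x e * Q e k * R k a * Q a b)" by (rule sum.swap)
    also have "\<dots> = (\<Sum>e\<in>I - K. \<Sum>k\<in>K. \<Sum>a\<in>K. x e * Q e k * R k a * Q a b)"
      by (intro sum.cong refl sum.swap)
    finally show ?thesis by (simp add: sum_distrib_left mult_ac)
  qed
  have "(\<Sum>a\<in>I. w a * Q a b) = 0" if b: "b \<in> I" for b
  proof -
    have L: "(\<Sum>a\<in>I - K. w a * Q a b) = (\<Sum>a\<in>I - K. x a * Q a b)" by (simp add: w_def)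
    have *: "(\<Sum>a\<in>I. w a * Q a b) = (\<Sum>a\<in>I - K. x a * schur_form K R Q a b)"
      unfolding sum_split_K K L schur_form_def by (simp add: right_diff_distrib sum_subtractf)
    show ?thesis
    proof (cases "b \<in> K")
      case True
      have "schur_form K R Q a b = 0" for a
      proof -
        have "(\<Sum>k\<in>K. \<Sum>k'\<in>K. Q a k * R k k' * Q k' b) = (\<Sum>k\<in>K. Q a k * (\<Sum>k'\<in>K. R k k' * Q k' b))"
          by (simp add: sum_distrib_left mult_ac)
        also have "\<dots> = Q a b"
          using True finite_K by (simp add: RQ mult_if)
        finally show ?thesis by (simp add: schur_form_def)
      qed
      then show ?thesis by (simp add: *)
    qed (use x b * in auto)
  qed
  then have w0: "w a = 0" if "a \<in> I" for a using Q that unfolding nondeg_on_def by blast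
  show "\<forall>a\<in>I - K. x a = 0"
  proof
    fix a assume "a \<in> I - K"
    then show "x a = 0" using w0[of a] by (simp add: w_def)
  qed
qed

lemma schur_commute:
  assumes "a \<in> I - K" "b \<in> I - K" and \<epsilon>: "\<epsilon> * \<epsilon> = 1"
    and R: "\<And>k k'. k \<in> K \<Longrightarrow> k' \<in> K \<Longrightarrow> R k k' = \<epsilon> * R k' k"
  shows "schur_form K R Q a b = \<epsilon> * schur_form K R Q b a"
proof -
  have "(\<Sum>k\<in>K. \<Sum>k'\<in>K. Q a k * R k k' * Q k' b) = (\<Sum>k\<in>K. \<Sum>k'\<in>K. \<epsilon> * (Q b k' * R k' k * Q k a))"
  proof (intro sum.cong refl)
    fix k k' assume k: "k \<in> K" "k' \<in> K"
    have "Q a k = \<epsilon> * Q k a" "Q k' b = \<epsilon> * Q b k'" using sym k assms I(2) by (meson DiffD1 subsetD)+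
    then have "Q a k * R k k' * Q k' b = (\<epsilon> * \<epsilon>) * (\<epsilon> * (Q b k' * R k' k * Q k a))"
      using R[OF k] by (simp add: mult_ac)
    then show "Q a k * R k k' * Q k' b = \<epsilon> * (Q b k' * R k' k * Q k a)" by (simp add: \<epsilon>)
  qed
  also have "\<dots> = (\<Sum>k'\<in>K. \<Sum>k\<in>K. \<epsilon> * (Q b k' * R k' k * Q k a))" by (rule sum.swap)
  finally have *: "(\<Sum>k\<in>K. \<Sum>k'\<in>K. Q a k * R k k' * Q k' b) =
      (\<Sum>k'\<in>K. \<Sum>k\<in>K. \<epsilon> * (Q b k' * R k' k * Q k a))" .
  have **: "Q a b = \<epsilon> * Q b a" using sym assms(1,2) by blast
  show ?thesis
    unfolding schur_form_def * right_diff_distrib sum_distrib_left by (subst **) (rule refl)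
qed

text \<open>Block elimination: the basis vectors outside \<open>K\<close> are corrected by vectors
  of \<open>K\<close> until they are orthogonal to \<open>K\<close>. The form on the corrected ones
  is the Schur complement, on which \<open>A'\<close> acts.\<close>

lemma transform_schur:
  assumes A': "\<And>a b. a \<in> I - K \<Longrightarrow> b \<in> I - K \<Longrightarrow> transform_form (I - K) A' (schur_form K R Q) a b = J a b"
    and JK: "\<And>a b. a \<in> K \<Longrightarrow> b \<in> K \<Longrightarrow> J a b = Q a b"
    and J0: "\<And>a b. a \<in> K \<Longrightarrow> b \<in> I - K \<Longrightarrow> J a b = 0 \<and> J b a = 0"
  shows "\<exists>A. \<forall>a\<in>I. \<forall>b\<in>I. transform_form I A Q a b = J a b"
proof -
  define g where "g k b = (\<Sum>e\<in>I - K. Q k e * A' e b)" for k b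
  define A where "A x b = (if b \<in> K then (if x = b then 1 else 0)
     else if x \<in> K then - (\<Sum>k\<in>K. R x k * g k b) else A' x b)" for x b
  define h where "h x b = (\<Sum>y\<in>I. Q x y * A y b)" for x b
  have h_K: "h x b = Q x b" if "b \<in> K" for x b
  proof -
    have "h x b = (\<Sum>y\<in>I. if y = b then Q x b else 0)"
      unfolding h_def A_def using that by (intro sum.cong) auto
    then show ?thesis using that I by auto
  qed
  have h_L: "h x b = g x b - (\<Sum>k'\<in>K. (\<Sum>k\<in>K. Q x k * R k k') * g k' b)" if "b \<in> I - K" for x b
  proof -
    have "(\<Sum>y\<in>K. Q x y * A y b) = - (\<Sum>y\<in>K. \<Sum>k'\<in>K. Q x y * R y k' * g k' b)"
      using that by (simp add: A_def sum_distrib_left sum_negf mult_ac)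
    also have "(\<Sum>y\<in>K. \<Sum>k'\<in>K. Q x y * R y k' * g k' b) = (\<Sum>k'\<in>K. \<Sum>y\<in>K. Q x y * R y k' * g k' b)"
      by (rule sum.swap)
    finally have "(\<Sum>y\<in>K. Q x y * A y b) = - (\<Sum>k'\<in>K. (\<Sum>k\<in>K. Q x k * R k k') * g k' b)"
      by (simp add: sum_distrib_right)
    moreover have "(\<Sum>y\<in>I - K. Q x y * A y b) = g x b" using that by (simp add: g_def A_def)
    ultimately show ?thesis by (simp add: h_def sum_split_K)
  qed
  have h_KL: "h x b = 0" if "x \<in> K" "b \<in> I - K" for x b
    unfolding h_L[OF that(2)] using that finite_K by (simp add: QR mult_if)
  have h_LL: "h x b = (\<Sum>y\<in>I - K. schur_form K R Q x y * A' y b)" if "b \<in> I - K" for x b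
  proof -
    have "(\<Sum>k'\<in>K. (\<Sum>k\<in>K. Q x k * R k k') * g k' b) =
        (\<Sum>k'\<in>K. \<Sum>y\<in>I - K. \<Sum>k\<in>K. Q x k * R k k' * Q k' y * A' y b)"
      by (simp add: g_def sum_distrib_left sum_distrib_right mult_ac)
    also have "\<dots> = (\<Sum>y\<in>I - K. \<Sum>k'\<in>K. \<Sum>k\<in>K. Q x k * R k k' * Q k' y * A' y b)" by (rule sum.swap)
    also have "\<dots> = (\<Sum>y\<in>I - K. \<Sum>k\<in>K. \<Sum>k'\<in>K. Q x k * R k k' * Q k' y * A' y b)"
      by (intro sum.cong refl sum.swap)
    finally show ?thesis unfolding h_L[OF that]
      by (simp add: schur_form_def g_def left_diff_distrib sum_subtractf sum_distrib_right)
  qed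
  have T: "transform_form I A Q a b = (\<Sum>x\<in>I. A x a * h x b)" for a b
    by (simp add: transform_form_def h_def sum_distrib_left mult_ac)
  have T_K: "transform_form I A Q a b = h a b" if "a \<in> K" for a b
  proof -
    have "transform_form I A Q a b = (\<Sum>x\<in>I. if x = a then h a b else 0)"
      unfolding T A_def using that by (intro sum.cong) auto
    then show ?thesis using that I by auto
  qed
  have "transform_form I A Q a b = J a b" if ab: "a \<in> I" "b \<in> I" for a b
  proof (cases "a \<in> K"; cases "b \<in> K")
    assume "a \<in> K" "b \<in> K" then show ?thesis by (simp add: T_K h_K JK)
  next
    assume "a \<in> K" "b \<notin> K" then show ?thesis using ab by (simp add: T_K h_KL J0)
  next
    assume "a \<notin> K" "b \<in> K"
    then show ?thesis using ab transform_form_commute[OF sym, where a = a and b = b and A = A]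
      by (simp add: T_K h_KL J0)
  next
    assume K: "a \<notin> K" "b \<notin> K"
    then have "transform_form I A Q a b = (\<Sum>x\<in>I - K. A' x a * h x b)"
      unfolding T sum_split_K using ab by (simp add: h_KL) (simp add: A_def)
    also have "\<dots> = transform_form (I - K) A' (schur_form K R Q) a b"
      using K ab by (simp add: h_LL transform_form_def sum_distrib_left mult_ac)
    finally show ?thesis using A' K ab by simp
  qed
  then show ?thesis by blast
qed

end

section \<open>Normal forms of nondegenerate symmetric and skew forms\<close>

lemma nondeg_on_nonzero_entry:
  fixes Q :: "'i \<Rightarrow> 'i \<Rightarrow> 'a::field"
  assumes "nondeg_on I Q" "finite I" "y \<in> I"
  shows "\<exists>w\<in>I. Q y w \<noteq> 0"
proof (rule ccontr)
  assume "\<not> ?thesis"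
  then have "\<forall>b\<in>I. (\<Sum>a\<in>I. (if a = y then 1 else 0) * Q a b) = 0"
    using assms by (simp add: mult_if sum_if_const)
  with assms(1) have "\<forall>a\<in>I. (if a = y then 1 else 0) = (0::'a)"
    unfolding nondeg_on_def by (elim allE) (erule (1) impE)
  then show False using assms(3) by auto
qed

lemma transform_via_replacement:
  assumes "\<And>a b. a \<in> I \<Longrightarrow> b \<in> I \<Longrightarrow> transform_form I A (transform_form I M Q) a b = J a b"
  shows "\<exists>A. \<forall>a\<in>I. \<forall>b\<in>I. transform_form I A Q a b = J a b"
  using assms by (auto simp: transform_form_comp)

text \<open>Orthogonalization: a vector of nonzero length is scaled to length 1 by a square root,
  made a basis vector, and split off by its Schur complement.\<close>

lemma symmetric_form_diagonalizable:
  fixes Q :: "'i \<Rightarrow> 'i \<Rightarrow> 'a::alg_closed_field"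
  assumes two: "(2::'a) \<noteq> 0"
  shows "finite I \<Longrightarrow> nondeg_on I Q \<Longrightarrow> (\<And>a b. a \<in> I \<Longrightarrow> b \<in> I \<Longrightarrow> Q a b = Q b a) \<Longrightarrow>
    \<exists>A. \<forall>a\<in>I. \<forall>b\<in>I. transform_form I A Q a b = (if a = b then 1 else 0)"
proof (induction "card I" arbitrary: I Q)
  case 0 then show ?case by simp
next
  case (Suc n)
  then obtain x where x: "x \<in> I" by fastforce
  have fin: "finite I" by fact
  have "\<exists>y\<in>I. \<exists>v. v y \<noteq> 0 \<and> (\<Sum>x\<in>I. \<Sum>z\<in>I. v x * Q x z * v z) \<noteq> 0"
  proof (cases "\<exists>y\<in>I. Q y y \<noteq> 0")
    case True
    then obtain y where y: "y \<in> I" "Q y y \<noteq> 0" by blast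
    then show ?thesis using fin
      by (intro bexI[of _ y] exI[of _ "\<lambda>x. if x = y then 1 else 0"])
        (auto simp: mult_if sum_if_const)
  next
    case False
    obtain y where y: "y \<in> I" "Q x y \<noteq> 0" using nondeg_on_nonzero_entry[OF Suc.prems(2,1) x] by blast
    then have "x \<noteq> y" using False by blast
    \<comment> \<open>With all diagonal entries zero, the sum of two basis vectors has length
      \<open>2 * Q x y\<close>, nonzero outside characteristic 2.\<close>
    let ?v = "\<lambda>z. (if z = x then 1 else 0) + (if z = y then 1 else 0) :: 'a"
    have "(\<Sum>a\<in>I. \<Sum>z\<in>I. ?v a * Q a z * ?v z) = 2 * Q x y"
      using x y fin False Suc.prems(3)[OF x y(1)]
      by (simp add: distrib_left distrib_right sum.distrib mult_if sum_if_const)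
    then show ?thesis using y \<open>x \<noteq> y\<close> two by (intro bexI[of _ y] exI[of _ ?v]) auto
  qed
  then obtain y v where y: "y \<in> I" "v y \<noteq> 0" "(\<Sum>x\<in>I. \<Sum>z\<in>I. v x * Q x z * v z) \<noteq> 0" by blast
  obtain c where c: "c ^ 2 = (\<Sum>x\<in>I. \<Sum>z\<in>I. v x * Q x z * v z)" using nth_root_exists[of 2] by auto
  then have c0: "c \<noteq> 0" using y by auto
  define v' where "v' z = v z / c" for z
  have "(\<Sum>x\<in>I. \<Sum>z\<in>I. v' x * Q x z * v' z) = (\<Sum>x\<in>I. \<Sum>z\<in>I. v x * Q x z * v z) / c ^ 2"
    by (simp add: v'_def sum_divide_distrib power2_eq_square)
  then have v': "v' y \<noteq> 0" "(\<Sum>x\<in>I. \<Sum>z\<in>I. v' x * Q x z * v' z) = 1" using y c c0 by (auto simp: v'_def)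
  let ?Q = "transform_form I (replace_basis y v') Q"
  have yy: "?Q y y = 1" unfolding transform_replace_basis(3)[OF fin y(1)] by (rule v'(2))
  have sym: "?Q a b = 1 * ?Q b a" for a b
    using Suc.prems by (intro transform_form_commute) auto
  have "\<exists>A. \<forall>a\<in>I - {y}. \<forall>b\<in>I - {y}.
     transform_form (I - {y}) A (schur_form {y} (\<lambda>_ _. 1) ?Q) a b = (if a = b then 1 else 0)"
  proof (rule Suc.hyps(1))
    show "n = card (I - {y})" using Suc.hyps(2) y by simp
    show "nondeg_on (I - {y}) (schur_form {y} (\<lambda>_ _. 1) ?Q)"
      by (rule nondeg_schur[OF fin _ sym])
        (use fin y v' yy Suc.prems nondeg_replace_basis in auto)
    show "schur_form {y} (\<lambda>_ _. 1) ?Q a b = schur_form {y} (\<lambda>_ _. 1) ?Q b a" for a b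
      unfolding schur_form_def using sym[of a b] sym[of a y] sym[of y b] by simp
  qed (use fin in auto)
  then obtain A where A: "\<And>a b. a \<in> I - {y} \<Longrightarrow> b \<in> I - {y} \<Longrightarrow>
     transform_form (I - {y}) A (schur_form {y} (\<lambda>_ _. 1) ?Q) a b = (if a = b then 1 else 0)" by blast
  have "\<exists>A. \<forall>a\<in>I. \<forall>b\<in>I. transform_form I A ?Q a b = (if a = b then 1 else 0)"
  proof (rule transform_schur[OF fin _ sym, where K = "{y}" and R = "\<lambda>_ _. 1" and A' = A])
    show "(if a = b then 1 else 0) = (0::'a) \<and> (if b = a then 1 else 0) = (0::'a)"
      if "a \<in> {y}" "b \<in> I - {y}" for a b
      using that by auto
  qed (use y yy A in auto)
  then show ?case by (elim exE) (rule transform_via_replacement, blast)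
qed

text \<open>\<open>H\<close> holds one index of each hyperbolic pair and \<open>\<sigma>\<close>
  gives the other. Leaving both abstract lets the normal form be laid out by any pairing of the
  indices.\<close>

definition symplectic_form :: "'i set \<Rightarrow> ('i \<Rightarrow> 'i) \<Rightarrow> 'i \<Rightarrow> 'i \<Rightarrow> 'a::field" where
  "symplectic_form H \<sigma> a b = (if a \<in> H \<and> b = \<sigma> a then 1 else if b \<in> H \<and> a = \<sigma> b then - 1 else 0)"

lemma skew_form_zero:
  fixes Q :: "'i \<Rightarrow> 'i \<Rightarrow> 'a::field"
  assumes "(2::'a) \<noteq> 0" "Q a a = - 1 * Q a a"
  shows "Q a a = 0"
proof -
  have "Q a a + Q a a = 0"
    using assms(2) unfolding mult_minus1 eq_neg_iff_add_eq_0 .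
  then show ?thesis using assms(1) by (simp flip: mult_2)
qed

text \<open>Keep \<open>y\<close>, replace its prescribed partner \<open>z\<close> by a vector
  pairing to 1 with \<open>y\<close>, and split off the hyperbolic plane; the pairing of the
  remaining indices is untouched.\<close>

lemma skew_form_symplectic:
  fixes Q :: "'i \<Rightarrow> 'i \<Rightarrow> 'a::field"
  assumes two: "(2::'a) \<noteq> 0"
  shows "finite H \<Longrightarrow> inj_on \<sigma> H \<Longrightarrow> H \<inter> \<sigma> ` H = {} \<Longrightarrow> I = H \<union> \<sigma> ` H \<Longrightarrow> nondeg_on I Q \<Longrightarrow>
    (\<And>a b. a \<in> I \<Longrightarrow> b \<in> I \<Longrightarrow> Q a b = - 1 * Q b a) \<Longrightarrow>
    \<exists>A. \<forall>a\<in>I. \<forall>b\<in>I. transform_form I A Q a b = symplectic_form H \<sigma> a b"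
proof (induction H arbitrary: I Q rule: finite_induct)
  case empty then show ?case by simp
next
  case (insert y H)
  define z where "z = \<sigma> y"
  have fin: "finite I" and yI: "y \<in> I" and zI: "z \<in> I" and yz: "y \<noteq> z"
    using insert.prems(1-3) insert.hyps by (auto simp: z_def)
  have IK: "I - {y, z} = H \<union> \<sigma> ` H"
    using insert.prems(1-3) insert.hyps by (auto simp: z_def)
  have "\<exists>v. v z \<noteq> 0 \<and> (\<Sum>x\<in>I. Q y x * v x) = 1"
  proof (cases "Q y z = 0")
    case False
    then have "(\<Sum>x\<in>I. Q y x * (if x = z then 1 / Q y z else 0)) = (\<Sum>x\<in>I. if x = z then 1 else 0)"
      by (intro sum.cong) auto
    then show ?thesis using fin zI False
      by (intro exI[of _ "\<lambda>x. if x = z then 1 / Q y z else 0"] conjI) auto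
  next
    case True
    obtain w where w: "w \<in> I" "Q y w \<noteq> 0" using nondeg_on_nonzero_entry[OF insert.prems(4) fin yI] by blast
    then have "w \<noteq> z" using True by blast
    \<comment> \<open>Coefficient 1 at \<open>z\<close> keeps the replacement invertible, and the
      multiple of \<open>w\<close> supplies the value 1 against \<open>y\<close>.\<close>
    let ?v = "\<lambda>x. (if x = z then 1 else 0) + (if x = w then 1 / Q y w else 0)"
    have "(\<Sum>x\<in>I. Q y x * ?v x) = (\<Sum>x\<in>I. (if x = z then Q y z else 0) + (if x = w then 1 else 0))"
      using w by (intro sum.cong) (auto simp: distrib_left)
    also have "\<dots> = 1" using fin zI w(1) True by (simp add: sum.distrib)
    finally show ?thesis using \<open>w \<noteq> z\<close> by (intro exI[of _ ?v] conjI) auto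
  qed
  then obtain v where v: "v z \<noteq> 0" "(\<Sum>x\<in>I. Q y x * v x) = 1" by blast
  let ?Q = "transform_form I (replace_basis z v) Q"
  have sym: "?Q a b = - 1 * ?Q b a" for a b
    by (rule transform_form_commute) (rule insert.prems(5))
  have Qyz: "?Q y z = 1" unfolding transform_replace_basis(2)[OF fin zI yI yz] by (rule v(2))
  have Qzy: "?Q z y = - 1" using sym[of z y] Qyz by simp
  have Q0: "?Q a a = 0" for a by (rule skew_form_zero[where Q = ?Q, OF two sym])
  \<comment> \<open>The inverse of the Gram matrix of the plane belonging to \<open>y\<close> and
    \<open>z\<close>.\<close>
  let ?R = "\<lambda>a b. if a = y \<and> b = z then - 1 else if a = z \<and> b = y then 1 else (0::'a)"
  note K = fin Qyz Qzy Q0 yz yI zI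
  have "\<exists>A. \<forall>a\<in>I - {y, z}. \<forall>b\<in>I - {y, z}.
     transform_form (I - {y, z}) A (schur_form {y, z} ?R ?Q) a b = symplectic_form H \<sigma> a b"
  proof (rule insert.IH)
    show "nondeg_on (I - {y, z}) (schur_form {y, z} ?R ?Q)"
    proof (rule nondeg_schur[OF fin _ sym])
      show "nondeg_on I ?Q" using fin zI v(1) insert.prems(4) by (rule nondeg_replace_basis)
    qed (use K in auto)
    show "schur_form {y, z} ?R ?Q a b = - 1 * schur_form {y, z} ?R ?Q b a" if "a \<in> I - {y, z}" "b \<in> I - {y, z}" for a b
      by (rule schur_commute[OF fin _ sym]) (use K that in auto)
  qed (use insert.prems(1,2) IK in auto)
  then obtain A where A: "\<And>a b. a \<in> I - {y, z} \<Longrightarrow> b \<in> I - {y, z} \<Longrightarrow>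
     transform_form (I - {y, z}) A (schur_form {y, z} ?R ?Q) a b = symplectic_form H \<sigma> a b" by blast
  have J: "symplectic_form H \<sigma> a b = symplectic_form (insert y H) \<sigma> a b" if "a \<in> I - {y, z}" "b \<in> I - {y, z}" for a b
    using that by (auto simp: symplectic_form_def z_def)
  have "\<exists>A. \<forall>a\<in>I. \<forall>b\<in>I. transform_form I A ?Q a b = symplectic_form (insert y H) \<sigma> a b"
  proof (rule transform_schur[OF fin _ sym, where K = "{y, z}" and R = ?R and A' = A])
    show "symplectic_form (insert y H) \<sigma> a b = ?Q a b" if "a \<in> {y, z}" "b \<in> {y, z}" for a b
      using that K insert.prems(1-3) insert.hyps(2) by (auto simp: symplectic_form_def z_def)
    show "symplectic_form (insert y H) \<sigma> a b = 0 \<and> symplectic_form (insert y H) \<sigma> b a = 0"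
      if "a \<in> {y, z}" "b \<in> I - {y, z}" for a b
      using that insert.prems(1-3) insert.hyps unfolding IK by (auto simp: symplectic_form_def z_def inj_on_def)
    show "transform_form (I - {y, z}) A (schur_form {y, z} ?R ?Q) a b = symplectic_form (insert y H) \<sigma> a b"
      if "a \<in> I - {y, z}" "b \<in> I - {y, z}" for a b
      using A[OF that] J[OF that] by (rule trans)
  qed (use K in auto)
  then show ?case by (elim exE) (rule transform_via_replacement, blast)
qed

text \<open>Splitting off planes without a pairing given in advance: any \<open>z\<close> with
  \<open>Q y z \<noteq> 0\<close> will do, and each plane removes two indices. This will exclude
  skew forms on blocks of odd size.\<close>

lemma skew_form_even:
  fixes Q :: "'i \<Rightarrow> 'i \<Rightarrow> 'a::field"
  assumes two: "(2::'a) \<noteq> 0"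
  shows "finite I \<Longrightarrow> nondeg_on I Q \<Longrightarrow> (\<And>a b. a \<in> I \<Longrightarrow> b \<in> I \<Longrightarrow> Q a b = - 1 * Q b a) \<Longrightarrow> even (card I)"
proof (induction "card I" arbitrary: I Q rule: less_induct)
  case less
  show ?case
  proof (cases "I = {}")
    case False
    then obtain y where y: "y \<in> I" by blast
    obtain z where z: "z \<in> I" "Q y z \<noteq> 0" using nondeg_on_nonzero_entry[OF less.prems(2,1) y] by blast
    have Q0: "Q a a = 0" if "a \<in> I" for a
      by (rule skew_form_zero[OF two]) (rule less.prems(3)[OF that that])
    have yz: "y \<noteq> z" using Q0 z y by auto
    have Qzy: "Q z y = - Q y z" using less.prems(3)[OF z(1) y] by simp
    let ?R = "\<lambda>a b. if a = y \<and> b = z then 1 / Q z y else if a = z \<and> b = y then 1 / Q y z else (0::'a)"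
    have lt: "card (I - {y, z}) < card I" and eq: "card I = card (I - {y, z}) + 2"
      using y z yz less.prems(1) card_Diff_subset[of "{y, z}" I] card_mono[of I "{y, z}"] by auto
    have "even (card (I - {y, z}))"
    proof (rule less.hyps[OF lt])
      show "nondeg_on (I - {y, z}) (schur_form {y, z} ?R Q)"
        by (rule nondeg_schur[OF less.prems(1) _ less.prems(3)]) (use y z yz Q0 Qzy less.prems(2) in auto)
      show "schur_form {y, z} ?R Q a b = - 1 * schur_form {y, z} ?R Q b a" if "a \<in> I - {y, z}" "b \<in> I - {y, z}" for a b
        by (rule schur_commute[OF less.prems(1) _ less.prems(3)]) (use y z yz Q0 Qzy that in auto)
    qed (use less.prems(1) in auto)
    then show ?thesis using eq by simp
  qed simp
qed

section \<open>Block decompositions of an index range\<close>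

text \<open>\<open>block_of\<close> and \<open>offset\<close> are the coordinates of an index in a
  concatenation of blocks of sizes \<open>ks\<close>; they are meaningful only below
  \<open>sum_list ks\<close>.\<close>

fun block_of :: "nat list \<Rightarrow> nat \<Rightarrow> nat" where
  "block_of [] a = 0"
| "block_of (k # ks) a = (if a < k then 0 else Suc (block_of ks (a - k)))"

fun offset :: "nat list \<Rightarrow> nat \<Rightarrow> nat" where
  "offset [] a = a"
| "offset (k # ks) a = (if a < k then a else offset ks (a - k))"

lemma block_of_less: "a < sum_list ks \<Longrightarrow> block_of ks a < length ks"
  by (induction ks arbitrary: a) auto

lemma offset_less: "a < sum_list ks \<Longrightarrow> offset ks a < ks ! block_of ks a"
  by (induction ks arbitrary: a) auto

lemma block_offset_inj:
  "a < sum_list ks \<Longrightarrow> b < sum_list ks \<Longrightarrow> block_of ks a = block_of ks b \<Longrightarrow> offset ks a = offset ks b \<Longrightarrow> a = b"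
proof (induction ks arbitrary: a b)
  case (Cons k ks)
  show ?case
  proof (cases "a < k")
    case True
    then show ?thesis using Cons.prems by (auto split: if_splits)
  next
    case False
    then have b: "\<not> b < k" using Cons.prems(3) by auto
    have "a - k = b - k"
    proof (rule Cons.IH)
      show "a - k < sum_list ks" using Cons.prems(1) False by simp
      show "b - k < sum_list ks" using Cons.prems(2) b by simp
      show "block_of ks (a - k) = block_of ks (b - k)" using Cons.prems(3) False b by simp
      show "offset ks (a - k) = offset ks (b - k)" using Cons.prems(4) False b by simp
    qed
    then show ?thesis using False b by simp
  qed
qed simp

lemma block_offset_surj:
  "i < length ks \<Longrightarrow> x < ks ! i \<Longrightarrow> \<exists>a<sum_list ks. block_of ks a = i \<and> offset ks a = x"
proof (induction ks arbitrary: i)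
  case (Cons k ks)
  show ?case
  proof (cases i)
    case 0
    then show ?thesis using Cons.prems by (intro exI[of _ x]) auto
  next
    case (Suc j)
    then obtain a where "a < sum_list ks" "block_of ks a = j" "offset ks a = x"
      using Cons.IH[of j] Cons.prems by auto
    then show ?thesis using Suc by (intro exI[of _ "a + k"]) auto
  qed
qed simp

lemma block_bij_betw:
  assumes "i < length ks"
  shows "bij_betw (offset ks) {a. a < sum_list ks \<and> block_of ks a = i} {..<ks ! i}"
  unfolding bij_betw_def
proof
  show "inj_on (offset ks) {a. a < sum_list ks \<and> block_of ks a = i}"
    by (auto intro!: inj_onI dest: block_offset_inj)
  show "offset ks ` {a. a < sum_list ks \<and> block_of ks a = i} = {..<ks ! i}"
    using offset_less block_offset_surj[OF assms] by fastforce
qed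

lemma card_block:
  "i < length ks \<Longrightarrow> card {a. a < sum_list ks \<and> block_of ks a = i} = ks ! i"
  using bij_betw_same_card[OF block_bij_betw] by simp

lemma block_of_append:
  "block_of (ks @ ks') a = (if a < sum_list ks then block_of ks a else length ks + block_of ks' (a - sum_list ks))"
  "offset (ks @ ks') a = (if a < sum_list ks then offset ks a else offset ks' (a - sum_list ks))"
  by (induction ks arbitrary: a) (auto simp: not_less)

text \<open>Relates two layouts of a swapped pair: two blocks of size \<open>q i\<close> as in
  \<open>kappa_form\<close>, or one block of size \<open>2 * q i\<close> as in
  \<open>Phi_mat\<close>.\<close>

lemma block_of_doubled:
  assumes "a < sum_list (map (\<lambda>i. 2 * q i) xs)"
  defines "j \<equiv> block_of (map (\<lambda>i. 2 * q i) xs) a" and "x \<equiv> offset (map (\<lambda>i. 2 * q i) xs) a"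
  shows "block_of (concat (map (\<lambda>i. [q i, q i]) xs)) a = 2 * j + (if x < q (xs ! j) then 0 else 1)"
    "offset (concat (map (\<lambda>i. [q i, q i]) xs)) a = (if x < q (xs ! j) then x else x - q (xs ! j))"
  using assms(1) unfolding j_def x_def
  by (induction xs arbitrary: a) (auto simp: not_less mult_2 le_diff_conv2 diff_diff_add)

lemma sum_list_doubled:
  "sum_list (concat (map (\<lambda>i. [q i, q i]) xs)) = sum_list (map (\<lambda>i. 2 * q i) xs)" for q :: "'b \<Rightarrow> nat"
  by (induction xs) auto

lemma diag_block_mat_index:
  "(\<And>A. A \<in> set As \<Longrightarrow> dim_col A = dim_row A) \<Longrightarrow>
   a < sum_list (map dim_row As) \<Longrightarrow> b < sum_list (map dim_row As) \<Longrightarrow>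
   diag_block_mat As $$ (a, b) =
    (if block_of (map dim_row As) a = block_of (map dim_row As) b
     then As ! block_of (map dim_row As) a $$ (offset (map dim_row As) a, offset (map dim_row As) b) else 0)"
proof (induction As arbitrary: a b)
  case (Cons A As)
  have dims: "dim_row (diag_block_mat As) = sum_list (map dim_row As)"
    "dim_col (diag_block_mat As) = sum_list (map dim_row As)"
  proof -
    have "map dim_col As = map dim_row As" using Cons.prems(1) by simp
    then show "dim_row (diag_block_mat As) = sum_list (map dim_row As)"
      "dim_col (diag_block_mat As) = sum_list (map dim_row As)"
      by (simp_all only: dim_diag_block_mat)
  qed
  show ?case
  proof (cases "a < dim_row A \<or> b < dim_row A")
    case True
    then show ?thesis using Cons.prems dims by (auto simp: Let_def)
  next
    case False
    then show ?thesis using Cons.prems dims Cons.IH[of "a - dim_row A" "b - dim_row A"]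
      by (auto simp: Let_def)
  qed
qed simp

text \<open>A direct sum of Kronecker products need not be a Kronecker product, but its right factor
  depends only on the block of the row.\<close>

lemma diag_block_mat_kron:
  fixes ps :: "('a::comm_semiring_1 mat \<times> 'a mat) list"
  assumes "\<And>A B. (A, B) \<in> set ps \<Longrightarrow> dim_col A = dim_row A \<and> B \<in> carrier_mat d d"
  defines "ks \<equiv> map (\<lambda>(A, B). dim_row A) ps"
  shows "diag_block_mat (map (\<lambda>(A, B). kron A B) ps) =
    row_kron (sum_list ks) d (diag_block_mat (map fst ps)) (\<lambda>a. snd (ps ! block_of ks a))"
  using assms(1) unfolding ks_def
proof (induction ps)
  case Nil
  show ?case by (rule eq_matI) auto
next
  case (Cons p ps)
  obtain A B where p: "p = (A, B)" by (cases p)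
  define k where "k = dim_row A"
  define N where "N = sum_list (map (\<lambda>(A, B). dim_row A) ps)"
  define E where "E = diag_block_mat (map (\<lambda>(A, B). kron A B) ps)"
  define F where "F = diag_block_mat (map fst ps)"
  have A: "A \<in> carrier_mat k k" and B: "B \<in> carrier_mat d d" using Cons.prems[of A B] by (auto simp: p k_def)
  have IH: "E = row_kron N d F (\<lambda>a. snd (ps ! block_of (map (\<lambda>(A, B). dim_row A) ps) a))"
    unfolding E_def N_def F_def by (rule Cons.IH) (use Cons.prems in auto)
  have F: "F \<in> carrier_mat N N"
  proof -
    have *: "map dim_col (map fst ps) = map dim_row (map fst ps)"
      using Cons.prems by fastforce
    have m: "map dim_row (map fst ps) = map (\<lambda>(A, B). dim_row A) ps" by auto
    have "dim_row F = N" unfolding F_def dim_diag_block_mat N_def m ..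
    moreover have "dim_col F = N" unfolding F_def dim_diag_block_mat N_def * m ..
    ultimately show ?thesis by auto
  qed
  have E: "E \<in> carrier_mat (N * d) (N * d)" unfolding IH by simp
  have kAB: "kron A B \<in> carrier_mat (k * d) (k * d)" using A B by simp
  have L: "diag_block_mat (map (\<lambda>(A, B). kron A B) (p # ps)) =
      four_block_mat (kron A B) (0\<^sub>m (k * d) (N * d)) (0\<^sub>m (N * d) (k * d)) E"
    using kAB E by (auto simp: p Let_def E_def[symmetric])
  have R: "diag_block_mat (map fst (p # ps)) = four_block_mat A (0\<^sub>m k N) (0\<^sub>m N k) F"
    using A F by (auto simp: p Let_def F_def[symmetric])
  have ks: "map (\<lambda>(A, B). dim_row A) (p # ps) = k # map (\<lambda>(A, B). dim_row A) ps"
    "sum_list (map (\<lambda>(A, B). dim_row A) (p # ps)) = k + N"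
    by (simp_all add: p k_def N_def)
  show ?case
    unfolding L R ks(2)
  proof (rule eq_mat_blockwise)
    show "four_block_mat (kron A B) (0\<^sub>m (k * d) (N * d)) (0\<^sub>m (N * d) (k * d)) E
        \<in> carrier_mat ((k + N) * d) ((k + N) * d)"
      using four_block_carrier_mat[OF kAB E] by (simp add: add_mult_distrib)
    fix a b u v assume ab: "a < k + N" "b < k + N" and uv: "u < d" "v < d"
    \<comment> \<open>With \<open>w < d\<close>, comparing \<open>c * d + w\<close> with
      \<open>k * d\<close> is comparing \<open>c\<close> with \<open>k\<close>; so the four cases of
      the large matrix are those of the small one.\<close>
    have lt: "c * d + w < k * d \<longleftrightarrow> c < k" if "w < d" for c w
    proof
      assume "c < k" then show "c * d + w < k * d" using that by (rule mult_add_less_mult)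
    next
      assume "c * d + w < k * d"
      then show "c < k" using that by (metis add_lessD1 mult_less_cancel2)
    qed
    have ge: "c * d + w - k * d = (c - k) * d + w" "c * d + w < k * d + N * d" if "\<not> c < k" "c < k + N" "w < d" for c w
      using that mult_add_less_mult[of "c - k" N w d] by (auto simp: diff_mult_distrib not_less add_mult_distrib
          intro: mult_add_less_mult[of c "k + N" w d, simplified add_mult_distrib])
    have lt2: "c * d + w < k * d + N * d" if "c < k + N" "w < d" for c w
      using mult_add_less_mult[OF that] by (simp add: add_mult_distrib)
    have entry: "four_block_mat (kron A B) (0\<^sub>m (k * d) (N * d)) (0\<^sub>m (N * d) (k * d)) E $$ (a * d + u, b * d + v) =
      (if a < k then if b < k then A $$ (a, b) * B $$ (u, v) else 0
       else if b < k then 0 else E $$ ((a - k) * d + u, (b - k) * d + v))"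
    proof -
      have "four_block_mat (kron A B) (0\<^sub>m (k * d) (N * d)) (0\<^sub>m (N * d) (k * d)) E $$ (a * d + u, b * d + v) =
        (if a * d + u < k * d then if b * d + v < k * d then kron A B $$ (a * d + u, b * d + v)
           else 0\<^sub>m (k * d) (N * d) $$ (a * d + u, b * d + v - k * d)
         else if b * d + v < k * d then 0\<^sub>m (N * d) (k * d) $$ (a * d + u - k * d, b * d + v)
           else E $$ (a * d + u - k * d, b * d + v - k * d))"
        using lt2[OF ab(1) uv(1)] lt2[OF ab(2) uv(2)]
        by (subst index_mat_four_block(1)) (simp_all add: carrier_matD[OF kAB] carrier_matD[OF E])
      then show ?thesis
        unfolding lt[OF uv(1)] lt[OF uv(2)]
        using ge(1)[OF _ ab(1) uv(1)] ge(1)[OF _ ab(2) uv(2)] ab uv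
          mult_add_less_mult[of a k u d] mult_add_less_mult[of b k v d]
          mult_add_less_mult[of "a - k" N u d] mult_add_less_mult[of "b - k" N v d]
        by (auto simp: kron_index[OF A B])
    qed
    have entry': "four_block_mat A (0\<^sub>m k N) (0\<^sub>m N k) F $$ (a, b) =
      (if a < k then if b < k then A $$ (a, b) else 0 else if b < k then 0 else F $$ (a - k, b - k))"
      using ab A F by auto
    show "four_block_mat (kron A B) (0\<^sub>m (k * d) (N * d)) (0\<^sub>m (N * d) (k * d)) E $$ (a * d + u, b * d + v) =
      row_kron (k + N) d (four_block_mat A (0\<^sub>m k N) (0\<^sub>m N k) F)
        (\<lambda>a. snd ((p # ps) ! block_of (map (\<lambda>(A, B). dim_row A) (p # ps)) a)) $$ (a * d + u, b * d + v)"
      unfolding row_kron_index[OF ab uv] entry entry' ks(1) using ab uv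
      by (auto simp: p IH row_kron_index)
  qed simp
qed

lemma block_idem_carrier [simp]: "block_idem \<kappa> i \<in> carrier_mat (sum_list \<kappa>) (sum_list \<kappa>)"
proof -
  let ?As = "map (\<lambda>j. if j = i then 1\<^sub>m (\<kappa> ! j) else 0\<^sub>m (\<kappa> ! j) (\<kappa> ! j) :: 'a mat) [0..<length \<kappa>]"
  have "map dim_row ?As = \<kappa>" "map dim_col ?As = \<kappa>"
    by (rule nth_equalityI, auto simp del: upt_Suc)+
  then show ?thesis unfolding block_idem_def carrier_mat_def dim_diag_block_mat mem_Collect_eq
    by (simp only:)
qed

lemma block_idem_index:
  assumes "a < sum_list \<kappa>" "b < sum_list \<kappa>"
  shows "block_idem \<kappa> i $$ (a, b) = (if a = b \<and> block_of \<kappa> a = i then 1 else 0 :: 'a::comm_semiring_1)"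
proof -
  define As where "As = map (\<lambda>j. if j = i then 1\<^sub>m (\<kappa> ! j) else 0\<^sub>m (\<kappa> ! j) (\<kappa> ! j) :: 'a mat) [0..<length \<kappa>]"
  have dims: "map dim_row As = \<kappa>"
    unfolding As_def by (rule nth_equalityI) (auto simp del: upt_Suc)
  have "block_idem \<kappa> i = diag_block_mat As" by (simp add: block_idem_def As_def)
  also have "\<dots> $$ (a, b) = (if block_of \<kappa> a = block_of \<kappa> b
     then As ! block_of \<kappa> a $$ (offset \<kappa> a, offset \<kappa> b) else 0)"
    by (rule diag_block_mat_index[of As a b, unfolded dims]) (use assms in \<open>auto simp: As_def\<close>)
  also have "\<dots> = (if a = b \<and> block_of \<kappa> a = i then 1 else 0)"
    using block_of_less[OF assms(1)] offset_less[OF assms(1)] offset_less[OF assms(2)] block_offset_inj[OF assms]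
    by (auto simp: As_def)
  finally show ?thesis .
qed

text \<open>Every nonvanishing term of the Leibniz expansion of the determinant provides a permutation.\<close>

lemma card_block_le:
  fixes Q :: "'a::field mat"
  assumes Q: "Q \<in> carrier_mat N N" "det Q \<noteq> 0"
    and supp: "\<And>a b. a < N \<Longrightarrow> b < N \<Longrightarrow> Q $$ (a, b) \<noteq> 0 \<Longrightarrow> f b = \<tau> (f a)"
  shows "card {a. a < N \<and> f a = i} \<le> card {a. a < N \<and> f a = \<tau> i}"
proof -
  have "\<exists>p. p permutes {0..<N} \<and> (\<Prod>a = 0..<N. Q $$ (a, p a)) \<noteq> 0"
  proof (rule ccontr)
    assume "\<not> ?thesis"
    then have "det Q = 0" using Q(1) by (auto simp: det_def intro!: sum.neutral)
    then show False using Q by simp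
  qed
  then obtain p where p: "p permutes {0..<N}" "(\<Prod>a = 0..<N. Q $$ (a, p a)) \<noteq> 0" by blast
  have pN: "p a < N" if "a < N" for a using permutes_in_image[OF p(1), of a] that by simp
  have "Q $$ (a, p a) \<noteq> 0" if "a < N" for a using p(2) that by auto
  then have "p ` {a. a < N \<and> f a = i} \<subseteq> {a. a < N \<and> f a = \<tau> i}" using supp pN by auto
  moreover have "inj_on p {a. a < N \<and> f a = i}" using permutes_inj[OF p(1)] by (auto intro: inj_on_subset)
  ultimately show ?thesis by (intro card_inj_on_le[of p]) auto
qed

section \<open>Anti-automorphisms of matrix algebras\<close>

lemma ex_inverse_mat:
  fixes A :: "'a::field mat"
  assumes "A \<in> carrier_mat n n" "det A \<noteq> 0"
  shows "\<exists>B\<in>carrier_mat n n. A * B = 1\<^sub>m n \<and> B * A = 1\<^sub>m n"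
  using det_non_zero_imp_unit[OF assms, of "()"] by (auto simp: Units_def ring_mat_def)

lemma det_nonzero_of_right_inverse:
  fixes A :: "'a::field mat"
  assumes "A \<in> carrier_mat n n" "B \<in> carrier_mat n n" "A * B = 1\<^sub>m n"
  shows "det A \<noteq> 0"
  using det_mult[OF assms(1,2)] assms(3) by auto

definition unit_mat :: "nat \<Rightarrow> nat \<Rightarrow> nat \<Rightarrow> 'a::comm_semiring_1 mat" where
  "unit_mat n i j = mat n n (\<lambda>(a, b). if a = i \<and> b = j then 1 else 0)"

lemma unit_mat_carrier [simp]: "unit_mat n i j \<in> carrier_mat n n"
  by (simp add: unit_mat_def)

text \<open>The columns of the conjugating matrix are \<open>\<alpha> (unit_mat n i 0) v\<close> for a unit vector \<open>v\<close> not
  killed by \<open>\<alpha> (unit_mat n 0 0)\<close>, where \<open>\<alpha>\<close> is the composition of \<open>\<phi>\<close> with the transpose.\<close>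

lemma antiaut_conj_transpose:
  fixes \<phi> :: "'a::field mat \<Rightarrow> 'a mat"
  assumes \<phi>: "mat_alg_antiaut n \<phi>" and n: "0 < n"
  shows "\<exists>P\<in>carrier_mat n n. \<exists>P'\<in>carrier_mat n n. P * P' = 1\<^sub>m n \<and> P' * P = 1\<^sub>m n \<and>
    (\<forall>Y\<in>carrier_mat n n. \<phi> Y = P' * transpose_mat Y * P)"
proof -
  define \<alpha> where "\<alpha> Y = \<phi> (transpose_mat Y)" for Y
  have closed: "\<phi> Y \<in> carrier_mat n n" if "Y \<in> carrier_mat n n" for Y
    using \<phi> that by (auto simp: mat_alg_antiaut_def bij_betw_def)
  then have \<alpha>_closed: "\<alpha> Y \<in> carrier_mat n n" if "Y \<in> carrier_mat n n" for Y
    using that by (simp add: \<alpha>_def)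
  have \<alpha>_mult: "\<alpha> (Y * Z) = \<alpha> Y * \<alpha> Z" if "Y \<in> carrier_mat n n" "Z \<in> carrier_mat n n" for Y Z
    using \<phi> that by (auto simp: \<alpha>_def mat_alg_antiaut_def transpose_mult[of Y n n Z n])
  have \<alpha>_add: "\<alpha> (Y + Z) = \<alpha> Y + \<alpha> Z" if "Y \<in> carrier_mat n n" "Z \<in> carrier_mat n n" for Y Z
    using \<phi> that by (auto simp: \<alpha>_def mat_alg_antiaut_def mat_linear_def transpose_add[of Y n n Z])
  have \<alpha>_smult: "\<alpha> (c \<cdot>\<^sub>m Y) = c \<cdot>\<^sub>m \<alpha> Y" if "Y \<in> carrier_mat n n" for Y c
  proof -
    have "transpose_mat (c \<cdot>\<^sub>m Y) = c \<cdot>\<^sub>m transpose_mat Y" by (rule eq_matI) auto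
    then show ?thesis using \<phi> that by (auto simp: \<alpha>_def mat_alg_antiaut_def mat_linear_def)
  qed
  have \<alpha>_zero: "\<alpha> (0\<^sub>m n n) = 0\<^sub>m n n"
  proof -
    have "0 \<cdot>\<^sub>m (0\<^sub>m n n) = (0\<^sub>m n n :: 'a mat)" by (rule eq_matI) auto
    then have *: "\<alpha> (0\<^sub>m n n) = 0 \<cdot>\<^sub>m \<alpha> (0\<^sub>m n n)" using \<alpha>_smult[of "0\<^sub>m n n" 0] by simp
    show ?thesis by (subst *) (use \<alpha>_closed[of "0\<^sub>m n n"] in \<open>auto intro!: eq_matI\<close>)
  qed
  have "\<alpha> (unit_mat n 0 0) \<noteq> 0\<^sub>m n n"
  proof
    assume "\<alpha> (unit_mat n 0 0) = 0\<^sub>m n n"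
    then have "\<alpha> (unit_mat n 0 0) = \<alpha> (0\<^sub>m n n)" by (simp add: \<alpha>_zero)
    then have "transpose_mat (unit_mat n 0 0) = (transpose_mat (0\<^sub>m n n) :: 'a mat)"
      using \<phi> unfolding \<alpha>_def mat_alg_antiaut_def bij_betw_def
      by (auto dest!: inj_onD[of \<phi>])
    then have "transpose_mat (unit_mat n 0 0) $$ (0, 0) = (transpose_mat (0\<^sub>m n n) :: 'a mat) $$ (0, 0)" by simp
    then show False using n by (simp add: unit_mat_def)
  qed
  then obtain r c where rc: "r < n" "c < n" "\<alpha> (unit_mat n 0 0) $$ (r, c) \<noteq> 0"
    using nonzero_mat_entry[OF \<alpha>_closed[OF unit_mat_carrier]] by blast
  \<comment> \<open>Linearity of \<open>\<alpha>\<close> on matrices supported in column 0, adding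
    one entry at a time.\<close>
  have expand: "\<alpha> (mat n n (\<lambda>(a, b). if b = 0 \<and> a < k then w a else 0)) $$ (r', c) =
      (\<Sum>a<k. w a * \<alpha> (unit_mat n a 0) $$ (r', c))" if "k \<le> n" "r' < n" for k w r'
    using that(1)
  proof (induction k)
    case 0
    have "mat n n (\<lambda>(a, b). if b = 0 \<and> a < 0 then w a else 0) = 0\<^sub>m n n" by (rule eq_matI) auto
    then show ?case using that(2) rc by (simp only: \<alpha>_zero lessThan_0 sum.empty index_zero_mat(1))
  next
    case (Suc k)
    let ?M = "mat n n (\<lambda>(a, b). if b = 0 \<and> a < k then w a else 0)"
    have "mat n n (\<lambda>(a, b). if b = 0 \<and> a < Suc k then w a else 0) = ?M + w k \<cdot>\<^sub>m unit_mat n k 0"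
      by (rule eq_matI) (auto simp: unit_mat_def less_Suc_eq)
    then have "\<alpha> (mat n n (\<lambda>(a, b). if b = 0 \<and> a < Suc k then w a else 0)) =
        \<alpha> ?M + w k \<cdot>\<^sub>m \<alpha> (unit_mat n k 0)"
      by (simp add: \<alpha>_add \<alpha>_smult)
    then show ?case using Suc that rc \<alpha>_closed[of "unit_mat n k 0"] \<alpha>_closed[of ?M] by simp
  qed
  define P where "P = mat n n (\<lambda>(a, i). \<alpha> (unit_mat n i 0) $$ (a, c))"
  have P: "P \<in> carrier_mat n n" by (simp add: P_def)
  \<comment> \<open>\<open>Y * unit_mat n i 0\<close> is column \<open>i\<close> of \<open>Y\<close>
    placed in column 0; its image under \<open>\<alpha>\<close> is computed once by multiplicativity
    and once by \<open>expand\<close>.\<close>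
  have intertwine: "\<alpha> Y * P = P * Y" if Y: "Y \<in> carrier_mat n n" for Y
  proof (rule eq_matI)
    fix a i assume "a < dim_row (P * Y)" "i < dim_col (P * Y)"
    then have ai: "a < n" "i < n" using P Y by auto
    have col: "Y * unit_mat n i 0 = mat n n (\<lambda>(a, b). if b = 0 \<and> a < n then Y $$ (a, i) else 0)"
    proof (rule eq_matI)
      fix x y assume "x < dim_row (mat n n (\<lambda>(a, b). if b = 0 \<and> a < n then Y $$ (a, i) else 0))"
        "y < dim_col (mat n n (\<lambda>(a, b). if b = 0 \<and> a < n then Y $$ (a, i) else 0))"
      then have xy: "x < n" "y < n" by auto
      have "(Y * unit_mat n i 0) $$ (x, y) = (\<Sum>k<n. if k = i then (if y = 0 then Y $$ (x, i) else 0) else 0)"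
        unfolding index_mult_mat_sum[OF Y unit_mat_carrier xy]
        using xy by (intro sum.cong) (auto simp: unit_mat_def)
      then show "(Y * unit_mat n i 0) $$ (x, y) = mat n n (\<lambda>(a, b). if b = 0 \<and> a < n then Y $$ (a, i) else 0) $$ (x, y)"
        using xy ai by simp
    qed (use Y in \<open>auto simp: unit_mat_def\<close>)
    have "(\<alpha> Y * P) $$ (a, i) = (\<Sum>k<n. \<alpha> Y $$ (a, k) * \<alpha> (unit_mat n i 0) $$ (k, c))"
      unfolding index_mult_mat_sum[OF \<alpha>_closed[OF Y] P ai] using ai by (intro sum.cong) (auto simp: P_def)
    also have "\<dots> = \<alpha> (Y * unit_mat n i 0) $$ (a, c)"
      unfolding \<alpha>_mult[OF Y unit_mat_carrier]
      by (rule index_mult_mat_sum[OF \<alpha>_closed[OF Y] \<alpha>_closed[OF unit_mat_carrier] ai(1) rc(2), symmetric])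
    also have "\<dots> = (\<Sum>k<n. Y $$ (k, i) * \<alpha> (unit_mat n k 0) $$ (a, c))"
      unfolding col using ai by (intro expand) auto
    also have "\<dots> = (P * Y) $$ (a, i)"
      unfolding index_mult_mat_sum[OF P Y ai] using ai by (intro sum.cong) (auto simp: P_def mult.commute)
    finally show "(\<alpha> Y * P) $$ (a, i) = (P * Y) $$ (a, i)" .
  qed (use P Y \<alpha>_closed[OF Y] in auto)
  have "det P \<noteq> 0"
  proof
    assume "det P = 0"
    then obtain v where v: "v \<in> carrier_vec n" "v \<noteq> 0\<^sub>v n" "P *\<^sub>v v = 0\<^sub>v n"
      using det_0_iff_vec_prod_zero_field[OF P] by blast
    then obtain i where i: "i < n" "v $ i \<noteq> 0" by (metis carrier_vecD eq_vecI index_zero_vec)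
    \<comment> \<open>\<open>Y\<close> sends the kernel vector \<open>v\<close> to the 0th unit
      vector, so \<open>P\<close> would kill that vector; but column 0 of \<open>P\<close> is
      nonzero in row \<open>r\<close> by the choice of \<open>r\<close> and
      \<open>c\<close>.\<close>
    define Y where "Y = mat n n (\<lambda>(a, b). if a = 0 \<and> b = i then 1 / v $ i else 0)"
    have Y: "Y \<in> carrier_mat n n" by (simp add: Y_def)
    have Yv: "Y *\<^sub>v v = unit_vec n 0"
    proof (rule eq_vecI)
      fix a assume "a < dim_vec (unit_vec n 0)"
      then have a: "a < n" by simp
      have "(Y *\<^sub>v v) $ a = (\<Sum>k<n. Y $$ (a, k) * v $ k)"
        using a v Y by (auto simp: scalar_prod_def lessThan_atLeast0 intro!: sum.cong)
      also have "\<dots> = (\<Sum>k<n. if k = i then (if a = 0 then 1 else 0) else 0)"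
        using a i by (intro sum.cong) (auto simp: Y_def)
      finally show "(Y *\<^sub>v v) $ a = unit_vec n 0 $ a" using a i n by (simp add: unit_vec_def)
    qed (simp add: Y_def)
    have "P *\<^sub>v unit_vec n 0 = (P * Y) *\<^sub>v v" using P Y v by (simp add: Yv[symmetric])
    also have "\<dots> = \<alpha> Y *\<^sub>v (P *\<^sub>v v)"
      using P Y v \<alpha>_closed[OF Y] by (simp add: intertwine[symmetric])
    also have "\<dots> = 0\<^sub>v n" unfolding v(3) using \<alpha>_closed[OF Y] by (intro eq_vecI) auto
    finally have "(P *\<^sub>v unit_vec n 0) $ r = 0" using rc by simp
    then have "P $$ (r, 0) = 0" using P rc n by (simp add: scalar_prod_right_unit)
    then show False using rc n by (simp add: P_def)
  qed
  then obtain P' where P': "P' \<in> carrier_mat n n" "P * P' = 1\<^sub>m n" "P' * P = 1\<^sub>m n"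
    using ex_inverse_mat[OF P] by blast
  have "\<phi> Y = P * transpose_mat Y * P'" if Y: "Y \<in> carrier_mat n n" for Y
  proof -
    have Yt: "transpose_mat Y \<in> carrier_mat n n" using Y by simp
    have "\<phi> Y = \<alpha> (transpose_mat Y) * (P * P')"
      using closed[OF Y] by (simp add: \<alpha>_def P')
    also have "\<dots> = (\<alpha> (transpose_mat Y) * P) * P'"
      using \<alpha>_closed[OF Yt] P P' by (simp add: assoc_mult_mat[of _ n n _ n _ n])
    finally show ?thesis by (simp add: intertwine[OF Yt])
  qed
  \<comment> \<open>The matrix built here is the \<open>P'\<close> of the statement, and its inverse
    is the \<open>P\<close>.\<close>
  then show ?thesis using P P' by blast
qed

lemma conj_transpose_antiaut:
  fixes P :: "'a::field mat"
  assumes P: "P \<in> carrier_mat n n" "P' \<in> carrier_mat n n" "P * P' = 1\<^sub>m n" "P' * P = 1\<^sub>m n"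
  shows "mat_alg_antiaut n (\<lambda>Y. P' * transpose_mat Y * P)"
proof -
  let ?\<phi> = "\<lambda>Y. P' * transpose_mat Y * P"
  let ?\<psi> = "\<lambda>Y. transpose_mat (P * Y * P')"
  have a: "A * (B * C) = A * B * C" if "A \<in> carrier_mat n n" "B \<in> carrier_mat n n" "C \<in> carrier_mat n n"
    for A B C :: "'a mat"
    using that by (simp add: assoc_mult_mat[of _ n n _ n _ n])
  have cl: "A * B \<in> carrier_mat n n" if "A \<in> carrier_mat n n" "B \<in> carrier_mat n n" for A B :: "'a mat"
    using that by (rule mult_carrier_mat)
  have r1: "A * P * P' = A" "A * P' * P = A" if "A \<in> carrier_mat n n" for A
    using that P by (simp_all add: assoc_mult_mat[of _ n n _ n _ n])
  have l1: "P * P' * A = A" "P' * P * A = A" if "A \<in> carrier_mat n n" for A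
    using that P by simp_all
  have "bij_betw ?\<phi> (carrier_mat n n) (carrier_mat n n)"
  proof (rule bij_betw_byWitness[where f' = ?\<psi>])
    show "\<forall>Y\<in>carrier_mat n n. ?\<psi> (?\<phi> Y) = Y"
      using P by (simp add: a cl l1 r1 del: assoc_mult_mat)
    show "\<forall>Y\<in>carrier_mat n n. ?\<phi> (?\<psi> Y) = Y"
      using P by (simp add: a cl l1 r1 del: assoc_mult_mat)
  qed (use P in \<open>auto intro!: cl\<close>)
  moreover have "mat_linear n ?\<phi>"
    unfolding mat_linear_def
  proof (intro conjI ballI allI)
    fix Y Z :: "'a mat" assume YZ: "Y \<in> carrier_mat n n" "Z \<in> carrier_mat n n"
    then show "?\<phi> (Y + Z) = ?\<phi> Y + ?\<phi> Z"
      using P by (simp add: transpose_add[OF YZ] mult_add_distrib_mat[of _ n n _ n] add_mult_distrib_mat[of _ n n _ _ n] cl)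
  next
    fix c and Y :: "'a mat" assume Y: "Y \<in> carrier_mat n n"
    have "transpose_mat (c \<cdot>\<^sub>m Y) = c \<cdot>\<^sub>m transpose_mat Y" by (rule eq_matI) auto
    then show "?\<phi> (c \<cdot>\<^sub>m Y) = c \<cdot>\<^sub>m ?\<phi> Y"
      using P Y by (simp add: mult_smult_distrib[of _ n n _ n] mult_smult_assoc_mat[of _ n n _ n] cl)
  qed
  moreover have "?\<phi> (Y * Z) = ?\<phi> Z * ?\<phi> Y" if "Y \<in> carrier_mat n n" "Z \<in> carrier_mat n n" for Y Z
    using P that by (simp add: transpose_mult[of Y n n Z n] a cl r1 del: assoc_mult_mat)
  ultimately show ?thesis by (simp add: mat_alg_antiaut_def)
qed

section \<open>Graded matrix algebras\<close>

lemma mult_kron_index: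
  fixes M :: "'a::comm_semiring_1 mat"
  assumes "M \<in> carrier_mat (N * d) (N * d)" "A \<in> carrier_mat N N" "Y \<in> carrier_mat d d"
    and "a < N" "b < N" "u < d" "v < d"
  shows "(M * kron A Y) $$ (a * d + u, b * d + v) =
      (\<Sum>c<N. \<Sum>w<d. M $$ (a * d + u, c * d + w) * (A $$ (c, b) * Y $$ (w, v)))"
    and "(kron A Y * M) $$ (a * d + u, b * d + v) =
      (\<Sum>c<N. \<Sum>w<d. (A $$ (a, c) * Y $$ (u, w)) * M $$ (c * d + w, b * d + v))"
  using assms
  by (subst index_mult_mat_sum[OF assms(1) kron_carrier[OF assms(2,3)]],
      simp_all add: mult_add_less_mult sum_lessThan_mult kron_index)
    (subst index_mult_mat_sum[OF kron_carrier[OF assms(2,3)] assms(1)],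
      simp_all add: mult_add_less_mult sum_lessThan_mult kron_index)

definition slice :: "nat \<Rightarrow> 'a mat \<Rightarrow> nat \<Rightarrow> nat \<Rightarrow> 'a mat" where
  "slice d M a b = mat d d (\<lambda>(u, v). M $$ (a * d + u, b * d + v))"

lemma slice_carrier [simp]: "slice d M a b \<in> carrier_mat d d"
  by (simp add: slice_def)

text \<open>A diagonal left factor does not mix blocks, so relations involving block scalar matrices
  can be read slice by slice.\<close>

lemma slice_mult_diag:
  fixes M :: "'a::comm_semiring_1 mat"
  assumes M: "M \<in> carrier_mat (N * d) (N * d)" and Y: "Y \<in> carrier_mat d d" and ab: "a < N" "b < N"
  shows "slice d (M * kron (mat_diag N f) Y) a b = f b \<cdot>\<^sub>m (slice d M a b * Y)"
    and "slice d (kron (mat_diag N f) Y * M) a b = f a \<cdot>\<^sub>m (Y * slice d M a b)"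
proof -
  have D: "mat_diag N f \<in> carrier_mat N N" by simp
  show "slice d (M * kron (mat_diag N f) Y) a b = f b \<cdot>\<^sub>m (slice d M a b * Y)"
  proof (rule eq_matI)
    fix u v assume "u < dim_row (f b \<cdot>\<^sub>m (slice d M a b * Y))" "v < dim_col (f b \<cdot>\<^sub>m (slice d M a b * Y))"
    then have uv: "u < d" "v < d" using Y by (auto simp: slice_def)
    have "(M * kron (mat_diag N f) Y) $$ (a * d + u, b * d + v) =
        (\<Sum>c<N. if c = b then f b * (\<Sum>w<d. slice d M a b $$ (u, w) * Y $$ (w, v)) else 0)"
      unfolding mult_kron_index(1)[OF M D Y ab uv] using uv ab
      by (intro sum.cong) (auto simp: mat_diag_def slice_def sum_distrib_left mult_ac)
    also have "\<dots> = f b * (slice d M a b * Y) $$ (u, v)"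
      using ab by (simp add: index_mult_mat_sum[OF slice_carrier Y uv])
    finally show "slice d (M * kron (mat_diag N f) Y) a b $$ (u, v) = (f b \<cdot>\<^sub>m (slice d M a b * Y)) $$ (u, v)"
      using uv Y by (simp add: slice_def)
  qed (use Y in \<open>auto simp: slice_def\<close>)
  show "slice d (kron (mat_diag N f) Y * M) a b = f a \<cdot>\<^sub>m (Y * slice d M a b)"
  proof (rule eq_matI)
    fix u v assume "u < dim_row (f a \<cdot>\<^sub>m (Y * slice d M a b))" "v < dim_col (f a \<cdot>\<^sub>m (Y * slice d M a b))"
    then have uv: "u < d" "v < d" using Y by (auto simp: slice_def)
    have "(kron (mat_diag N f) Y * M) $$ (a * d + u, b * d + v) =
        (\<Sum>c<N. if c = a then f a * (\<Sum>w<d. Y $$ (u, w) * slice d M a b $$ (w, v)) else 0)"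
      unfolding mult_kron_index(2)[OF M D Y ab uv] using uv ab
      by (intro sum.cong) (auto simp: mat_diag_def slice_def sum_distrib_left mult_ac)
    also have "\<dots> = f a * (Y * slice d M a b) $$ (u, v)"
      using ab by (simp add: index_mult_mat_sum[OF Y slice_carrier uv])
    finally show "slice d (kron (mat_diag N f) Y * M) a b $$ (u, v) = (f a \<cdot>\<^sub>m (Y * slice d M a b)) $$ (u, v)"
      using uv Y by (simp add: slice_def)
  qed (use Y in \<open>auto simp: slice_def\<close>)
qed

text \<open>The upper left entries of the blocks of \<open>M\<close> form a right inverse of
  \<open>Q\<close>.\<close>

lemma kron_one_right_inverse:
  fixes Q :: "'a::field mat"
  assumes Q: "Q \<in> carrier_mat N N" and M: "M \<in> carrier_mat (N * d) (N * d)" and d: "0 < d"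
    and eq: "kron Q (1\<^sub>m d) * M = 1\<^sub>m (N * d)"
  shows "det Q \<noteq> 0"
proof (rule det_nonzero_of_right_inverse[OF Q])
  let ?Q' = "mat N N (\<lambda>(c, b). M $$ (c * d, b * d))"
  show "?Q' \<in> carrier_mat N N" by simp
  show "Q * ?Q' = 1\<^sub>m N"
  proof (rule eq_matI)
    fix a b assume "a < dim_row (1\<^sub>m N :: 'a mat)" "b < dim_col (1\<^sub>m N :: 'a mat)"
    then have ab: "a < N" "b < N" by auto
    have "(Q * ?Q') $$ (a, b) = (\<Sum>c<N. Q $$ (a, c) * M $$ (c * d, b * d))"
      by (subst index_mult_mat_sum[OF Q]) (use ab in auto)
    also have "\<dots> = (\<Sum>c<N. \<Sum>w<d. if w = 0 then Q $$ (a, c) * M $$ (c * d, b * d) else 0)"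
      using d by simp
    also have "\<dots> = (kron Q (1\<^sub>m d) * M) $$ (a * d + 0, b * d + 0)"
      unfolding mult_kron_index(2)[OF M Q one_carrier_mat ab d d]
      using d by (intro sum.cong) auto
    also have "\<dots> = 1\<^sub>m N $$ (a, b)"
      using ab d by (simp add: eq)
    finally show "(Q * ?Q') $$ (a, b) = 1\<^sub>m N $$ (a, b)" .
  qed (use Q in auto)
qed

lemma mult_unit_mat_index:
  fixes A :: "'a::comm_semiring_1 mat"
  assumes "A \<in> carrier_mat N N" "x < N" "y < N" "a < N" "b < N"
  shows "(A * unit_mat N a b) $$ (x, y) = (if y = b then A $$ (x, a) else 0)"
    and "(unit_mat N a b * A) $$ (x, y) = (if x = a then A $$ (b, y) else 0)"
proof -
  have "(A * unit_mat N a b) $$ (x, y) = (\<Sum>c<N. if c = a then (if y = b then A $$ (x, a) else 0) else 0)"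
    unfolding index_mult_mat_sum[OF assms(1) unit_mat_carrier assms(2,3)]
    using assms by (intro sum.cong) (auto simp: unit_mat_def)
  then show "(A * unit_mat N a b) $$ (x, y) = (if y = b then A $$ (x, a) else 0)" using assms by simp
  have "(unit_mat N a b * A) $$ (x, y) = (\<Sum>c<N. if c = b then (if x = a then A $$ (b, y) else 0) else 0)"
    unfolding index_mult_mat_sum[OF unit_mat_carrier assms(1-3)]
    using assms by (intro sum.cong) (auto simp: unit_mat_def)
  then show "(unit_mat N a b * A) $$ (x, y) = (if x = a then A $$ (b, y) else 0)" using assms by simp
qed

locale graded_data = division_data G T \<beta> ab
  for G :: "('g, 'b) monoid_scheme" (structure) and T and \<beta> :: "'g \<Rightarrow> 'g \<Rightarrow> 'a::field" and ab +
  fixes \<kappa> :: "nat list" and \<gamma> :: "'g list"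
  assumes kappa: "\<kappa> \<noteq> []" "\<And>k. k \<in> set \<kappa> \<Longrightarrow> 0 < k"
    and gamma: "length \<gamma> = length \<kappa>" "set \<gamma> \<subseteq> carrier G"
      "\<And>i j. i < length \<gamma> \<Longrightarrow> j < length \<gamma> \<Longrightarrow> i \<noteq> j \<Longrightarrow> inv (\<gamma> ! i) \<otimes> (\<gamma> ! j) \<notin> T"

lemma (in division_data) graded_data_iff:
  "graded_data G T \<beta> ab \<kappa> \<gamma> \<longleftrightarrow> graded_matrix_data G T \<beta> ab \<kappa> \<gamma>"
  using division_data_axioms subgroup_T finite_T bicharacter nondeg decomposition
  unfolding graded_data_def graded_data_axioms_def graded_matrix_data_def by auto

lemma graded_dataI:
  "comm_group G \<Longrightarrow> graded_matrix_data G T \<beta> ab \<kappa> \<gamma> \<Longrightarrow> graded_data G T \<beta> ab \<kappa> \<gamma>"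
  unfolding graded_data_def graded_data_axioms_def graded_matrix_data_def division_data_def division_data_axioms_def
  by auto

context graded_data
begin

abbreviation "N \<equiv> sum_list \<kappa>"
abbreviation "s \<equiv> length \<kappa>"
abbreviation "blk \<equiv> block_of \<kappa>"
abbreviation "e i \<equiv> block_idem \<kappa> i :: 'a mat"
abbreviation "E i \<equiv> R_idem G ab \<kappa> i :: 'a mat"
abbreviation "R \<equiv> R_comp G T \<beta> ab \<kappa> \<gamma>"
abbreviation "n \<equiv> R_dim G ab \<kappa>"
abbreviation "Dg c \<equiv> mat_diag N (\<lambda>a. c (blk a)) :: 'a mat"

lemma n_def: "n = N * d"
  by (simp add: R_dim_def)

lemma gamma_closed [simp]: "i < s \<Longrightarrow> \<gamma> ! i \<in> carrier G"
  using gamma by (metis nth_mem subsetD)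

lemma block_nonempty: "i < s \<Longrightarrow> \<exists>a<N. blk a = i"
  using block_offset_surj[of i \<kappa> 0] kappa(2)[of "\<kappa> ! i"] by auto

lemma blk_less: "a < N \<Longrightarrow> blk a < s"
  by (rule block_of_less)

lemma N_pos: "0 < N"
  using block_nonempty[of 0] kappa(1) by fastforce

lemma n_pos: "0 < n"
  using N_pos d_pos by (simp add: n_def)

text \<open>The matrices \<open>Dg c\<close> are scalar on each block; seeing the idempotents among
  them reduces multiplication by an idempotent to a scaling of rows or columns.\<close>

lemma e_conv_Dg: "e i = Dg (\<lambda>j. if j = i then 1 else 0)"
proof (rule eq_matI)
  fix a b assume "a < dim_row (Dg (\<lambda>j. if j = i then 1 else 0))" "b < dim_col (Dg (\<lambda>j. if j = i then 1 else 0))"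
  then have "a < N" "b < N" by (auto simp: mat_diag_def)
  then show "e i $$ (a, b) = Dg (\<lambda>j. if j = i then 1 else 0) $$ (a, b)"
    by (auto simp: block_idem_index mat_diag_def)
qed (auto simp: mat_diag_def carrier_matD[OF block_idem_carrier])

lemma Dg_carrier [simp]: "Dg c \<in> carrier_mat N N"
  by (simp add: mat_diag_def)

lemma Dg_mult_left: "A \<in> carrier_mat N N \<Longrightarrow> Dg c * A = mat N N (\<lambda>(a, b). c (blk a) * A $$ (a, b))"
  by (rule mat_diag_mult_left)

lemma Dg_mult_right: "A \<in> carrier_mat N N \<Longrightarrow> A * Dg c = mat N N (\<lambda>(a, b). A $$ (a, b) * c (blk b))"
  by (rule mat_diag_mult_right)

lemma Dg_eqD: "Dg c = Dg c' \<Longrightarrow> i < s \<Longrightarrow> c i = c' i"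
proof -
  assume eq: "Dg c = Dg c'" and "i < s"
  then obtain a where "a < N" "blk a = i" using block_nonempty by blast
  then show ?thesis using arg_cong[OF eq, of "\<lambda>A. A $$ (a, a)"] by (simp add: mat_diag_def)
qed

lemma Dg_cong: "(\<And>i. i < s \<Longrightarrow> c i = c' i) \<Longrightarrow> Dg c = Dg c'"
  by (rule eq_matI) (auto simp: mat_diag_def blk_less)

lemma corner_index:
  assumes "A \<in> carrier_mat N N" "a < N" "b < N"
  shows "(e i * A * e j) $$ (a, b) = (if blk a = i \<and> blk b = j then A $$ (a, b) else 0)"
proof -
  have "e i * A = mat N N (\<lambda>(a, b). (if blk a = i then 1 else 0) * A $$ (a, b))"
    unfolding e_conv_Dg using assms(1) by (rule Dg_mult_left)
  then have "e i * A * e j = mat N N (\<lambda>(a, b). (if blk a = i then 1 else 0) * A $$ (a, b)) * e j"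
    by simp
  also have "\<dots> = mat N N (\<lambda>(a, b). mat N N (\<lambda>(a, b). (if blk a = i then 1 else 0) * A $$ (a, b)) $$ (a, b) * (if blk b = j then 1 else 0))"
    unfolding e_conv_Dg[of j] by (rule Dg_mult_right) simp
  finally show ?thesis using assms by auto
qed

lemma corner_carrier [simp]: "A \<in> carrier_mat N N \<Longrightarrow> e i * A * e j \<in> carrier_mat N N"
  by (intro mult_carrier_mat[of _ N N] block_idem_carrier)

lemma corner_e: "e i * e i * e i = e i"
  by (rule eq_matI)
    (auto simp del: index_mult_mat(1) simp: corner_index carrier_matD[OF block_idem_carrier] block_idem_index)

lemma corner_unit_mat: "a < N \<Longrightarrow> b < N \<Longrightarrow> e (blk a) * unit_mat N a b * e (blk b) = unit_mat N a b"
  by (rule eq_matI)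
    (auto simp del: index_mult_mat(1) simp: corner_index unit_mat_def carrier_matD[OF block_idem_carrier])

lemma E_carrier [simp]: "E i \<in> carrier_mat (N * d) (N * d)"
  by (simp add: R_idem_def)

lemma E_M_E_index:
  assumes M: "M \<in> carrier_mat (N * d) (N * d)" and ab: "a < N" "b < N" "u < d" "v < d"
  shows "(E i * M * E j) $$ (a * d + u, b * d + v) =
    (if blk a = i \<and> blk b = j then M $$ (a * d + u, b * d + v) else 0)"
proof -
  have cl: "A * B \<in> carrier_mat (N * d) (N * d)" if "A \<in> carrier_mat (N * d) (N * d)" "B \<in> carrier_mat (N * d) (N * d)" for A B :: "'a mat"
    using that by (rule mult_carrier_mat)
  have EM: "E i * M \<in> carrier_mat (N * d) (N * d)" using M by (intro cl) auto
  have "slice d (E i * M * E j) a b = (if blk b = j then 1 else 0) \<cdot>\<^sub>m (slice d (E i * M) a b * 1\<^sub>m d)"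
    unfolding R_idem_def[of _ _ _ j] e_conv_Dg[of j]
    using slice_mult_diag(1)[OF EM one_carrier_mat ab(1,2)] .
  also have "slice d (E i * M) a b = (if blk a = i then 1 else 0) \<cdot>\<^sub>m (1\<^sub>m d * slice d M a b)"
    unfolding R_idem_def e_conv_Dg[of i]
    using slice_mult_diag(2)[OF M one_carrier_mat ab(1,2)] .
  finally have *: "slice d (E i * M * E j) a b = (if blk b = j then 1 else 0) \<cdot>\<^sub>m ((if blk a = i then 1 else 0) \<cdot>\<^sub>m slice d M a b)"
    by (simp only: left_mult_one_mat[OF slice_carrier] right_mult_one_mat[OF smult_carrier_mat[OF slice_carrier]])
  show ?thesis using arg_cong[OF *, of "\<lambda>A. A $$ (u, v)"] ab by (auto simp: slice_def)
qed

lemma E_kron_E: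
  assumes "A \<in> carrier_mat N N" "Y \<in> carrier_mat d d"
  shows "E i * kron A Y * E j = kron (e i * A * e j) Y"
  using assms by (simp add: R_idem_def kron_mult[of _ N _ _ d] mult_carrier_mat[of _ N N])

lemma R_comp_generator:
  assumes "A \<in> carrier_mat N N" "i < s" "j < s" "t \<in> T" "h = inv (\<gamma> ! i) \<otimes> t \<otimes> (\<gamma> ! j)"
  shows "kron (e i * A * e j) (X t) \<in> R h"
proof -
  let ?S = "{kron (block_idem \<kappa> i * A * block_idem \<kappa> j) d |A d i j t.
        i < length \<kappa> \<and> j < length \<kappa> \<and> t \<in> T \<and>
        A \<in> carrier_mat (sum_list \<kappa>) (sum_list \<kappa>) \<and> d \<in> D_comp G \<beta> ab t \<and>
        h = inv\<^bsub>G\<^esub> (\<gamma> ! i) \<otimes>\<^bsub>G\<^esub> t \<otimes>\<^bsub>G\<^esub> (\<gamma> ! j)}"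
  have "X t \<in> D_comp G \<beta> ab t" unfolding D_comp_def by (intro CollectI exI[of _ 1]) simp
  then have "kron (e i * A * e j) (X t) \<in> ?S" using assms by blast
  then have "1 \<cdot>\<^sub>m kron (e i * A * e j) (X t) + 0\<^sub>m n n \<in> mat_span n ?S"
    by (intro mat_span.intros)
  moreover have "kron (e i * A * e j) (X t) \<in> carrier_mat n n"
    unfolding n_def using assms by (intro kron_carrier corner_carrier X_carrier)
  ultimately show ?thesis unfolding R_comp_def by simp
qed

lemma R_comp_carrier: "M \<in> R h \<Longrightarrow> M \<in> carrier_mat n n"
  unfolding R_comp_def
proof (induction rule: mat_span.induct)
  case (add A B c)
  then obtain A' D i j t where "A = kron (e i * A' * e j) D" "A' \<in> carrier_mat N N" "D \<in> D_comp G \<beta> ab t" by blast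
  then have "A \<in> carrier_mat n n" unfolding n_def D_comp_def by (auto intro!: kron_carrier)
  then show ?case using add by simp
qed simp

text \<open>The degree \<open>h\<close> and the corner \<open>(i, j)\<close> determine
  \<open>t\<close>, so all terms of the corner share one right factor. The second alternative covers
  a vanishing corner, where possibly no \<open>t\<close> fits the degree.\<close>

lemma R_comp_corner:
  assumes "M \<in> R h" "i < s" "j < s" "h \<in> carrier G"
  shows "\<exists>A\<in>carrier_mat N N. \<exists>t\<in>T. E i * M * E j = kron A (X t) \<and>
    (h = inv (\<gamma> ! i) \<otimes> t \<otimes> (\<gamma> ! j) \<or> A = 0\<^sub>m N N)"
  using assms(1) unfolding R_comp_def
proof (induction rule: mat_span.induct)
  case zero
  have "E i * 0\<^sub>m n n * E j = kron (0\<^sub>m N N) (X \<one>)"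
    using right_mult_zero_mat[OF E_carrier[of i]] left_mult_zero_mat[OF E_carrier[of j]]
    by (simp add: n_def kron_zero_left[of _ d])
  then show ?case by (intro bexI[of _ "0\<^sub>m N N"] bexI[of _ \<one>] conjI) auto
next
  case (add K M c)
  obtain A D i' j' t' where K: "K = kron (e i' * A * e j') D" and A: "A \<in> carrier_mat N N"
    and D: "D \<in> D_comp G \<beta> ab t'" and ij': "i' < s" "j' < s" "t' \<in> T" "h = inv (\<gamma> ! i') \<otimes> t' \<otimes> (\<gamma> ! j')"
    using add.hyps(1) by blast
  obtain q where q: "D = q \<cdot>\<^sub>m X t'" using D by (auto simp: D_comp_def)
  obtain B t where B: "B \<in> carrier_mat N N" "t \<in> T" "E i * M * E j = kron B (X t)"
    "h = inv (\<gamma> ! i) \<otimes> t \<otimes> (\<gamma> ! j) \<or> B = 0\<^sub>m N N" using add.IH by blast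
  have M: "M \<in> carrier_mat (N * d) (N * d)"
    using add.hyps(2) R_comp_carrier[of M h] unfolding R_comp_def n_def by blast
  have Kc: "K = kron (q \<cdot>\<^sub>m (e i' * A * e j')) (X t')"
    unfolding K q using A by (simp add: kron_smult[of _ N _ d])
  define A' where "A' = (c * q) \<cdot>\<^sub>m (e i * (e i' * A * e j') * e j)"
  have A': "A' \<in> carrier_mat N N" using A by (simp add: A'_def)
  have Kcar: "K \<in> carrier_mat (N * d) (N * d)" unfolding Kc using A by (intro kron_carrier) auto
  have "E i * (c \<cdot>\<^sub>m K) * E j = c \<cdot>\<^sub>m (E i * K * E j)"
    using Kcar by (simp add: mult_smult_distrib[of _ "N * d" "N * d" _ "N * d"] mult_smult_assoc_mat[of _ "N * d" "N * d" _ "N * d"] mult_carrier_mat[of _ "N * d" "N * d"])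
  also have "E i * K * E j = q \<cdot>\<^sub>m (E i * kron (e i' * A * e j') (X t') * E j)"
    unfolding K q kron_smult(2)[OF corner_carrier[OF A] X_carrier]
    using kron_carrier[OF corner_carrier[OF A] X_carrier]
    by (simp add: mult_smult_distrib[of _ "N * d" "N * d" _ "N * d"] mult_smult_assoc_mat[of _ "N * d" "N * d" _ "N * d"] mult_carrier_mat[of _ "N * d" "N * d"])
  also have "E i * kron (e i' * A * e j') (X t') * E j = kron (e i * (e i' * A * e j') * e j) (X t')"
    by (rule E_kron_E[OF corner_carrier[OF A] X_carrier])
  finally have 1: "E i * (c \<cdot>\<^sub>m K) * E j = kron A' (X t')"
    unfolding A'_def kron_smult(1)[OF corner_carrier[OF corner_carrier[OF A]] X_carrier]
    by (simp add: smult_smult_mat)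
  have "E i * (c \<cdot>\<^sub>m K + M) * E j = E i * (c \<cdot>\<^sub>m K) * E j + E i * M * E j"
    using Kcar M by (simp add: mult_add_distrib_mat[of _ "N * d" "N * d" _ "N * d"] add_mult_distrib_mat[of _ "N * d" "N * d" _ _ "N * d"] mult_carrier_mat[of _ "N * d" "N * d"])
  then have sum: "E i * (c \<cdot>\<^sub>m K + M) * E j = kron A' (X t') + kron B (X t)" using 1 B by simp
  show ?case
  proof (cases "i = i' \<and> j = j'")
    case False
    have "A' = 0\<^sub>m N N"
      by (rule eq_matI)
        (use False A in \<open>auto simp del: index_mult_mat(1) simp: A'_def corner_index carrier_matD[OF block_idem_carrier]\<close>)
    then have "E i * (c \<cdot>\<^sub>m K + M) * E j = kron B (X t)"
      using sum B by (simp add: kron_zero_left[of _ d])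
    then show ?thesis using B by blast
  next
    case True
    show ?thesis
    proof (cases "B = 0\<^sub>m N N")
      case True
      then have "E i * (c \<cdot>\<^sub>m K + M) * E j = kron A' (X t')"
        using sum A' by (simp add: kron_zero_left[of _ d])
      then show ?thesis using A' ij' \<open>i = i' \<and> j = j'\<close> by blast
    next
      case False
      then have "inv (\<gamma> ! i) \<otimes> t \<otimes> (\<gamma> ! j) = inv (\<gamma> ! i) \<otimes> t' \<otimes> (\<gamma> ! j)" using B ij' True by simp
      then have "t = t'" using assms B ij' by (simp add: m_assoc)
      then have "E i * (c \<cdot>\<^sub>m K + M) * E j = kron (A' + B) (X t)"
        using sum A' B by (simp add: kron_add_left[of _ N _ _ d])
      moreover have "h = inv (\<gamma> ! i) \<otimes> t \<otimes> (\<gamma> ! j)" using B(4) False by simp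
      moreover have "A' + B \<in> carrier_mat N N" using A' B(1) by simp
      ultimately show ?thesis using B(2) by (intro bexI[of _ "A' + B"] bexI[of _ t] conjI disjI1)
    qed
  qed
qed

text \<open>A nonzero corner with \<open>i \<noteq> j\<close> would put
  \<open>inv (\<gamma> ! i) \<otimes> (\<gamma> ! j)\<close> into \<open>T\<close>, which the choice
  of degrees excludes; on the diagonal the degree forces the factor \<open>X t\<close>.\<close>

lemma R_comp_T:
  assumes M: "M \<in> R t" and t: "t \<in> T"
  shows "\<exists>A\<in>carrier_mat N N. M = kron A (X t) \<and> (\<forall>a<N. \<forall>b<N. blk a \<noteq> blk b \<longrightarrow> A $$ (a, b) = 0)"
proof -
  have Mc: "M \<in> carrier_mat (N * d) (N * d)" using R_comp_carrier[OF M] by (simp add: n_def)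
  have off: "E i * M * E j = 0\<^sub>m (N * d) (N * d)" if ij: "i < s" "j < s" "i \<noteq> j" for i j
  proof -
    obtain A u where A: "A \<in> carrier_mat N N" "u \<in> T" "E i * M * E j = kron A (X u)"
      "t = inv (\<gamma> ! i) \<otimes> u \<otimes> (\<gamma> ! j) \<or> A = 0\<^sub>m N N"
      using R_comp_corner[OF M ij(1,2)] t by auto
    have "t \<noteq> inv (\<gamma> ! i) \<otimes> u \<otimes> (\<gamma> ! j)"
    proof
      assume "t = inv (\<gamma> ! i) \<otimes> u \<otimes> (\<gamma> ! j)"
      then have "t \<otimes> inv u = inv (\<gamma> ! i) \<otimes> (\<gamma> ! j)"
        using A ij by (simp add: m_ac) (simp add: m_assoc[symmetric])
      then show False using gamma ij A t by (metis T_closed(1,3))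
    qed
    then show ?thesis using A by (simp add: kron_zero_left[of _ d])
  qed
  have "\<exists>A\<in>carrier_mat N N. E i * M * E i = kron A (X t)" if i: "i < s" for i
  proof -
    obtain A u where A: "A \<in> carrier_mat N N" "u \<in> T" "E i * M * E i = kron A (X u)"
      "t = inv (\<gamma> ! i) \<otimes> u \<otimes> (\<gamma> ! i) \<or> A = 0\<^sub>m N N"
      using R_comp_corner[OF M i i] t by auto
    show ?thesis
    proof (cases "A = 0\<^sub>m N N")
      case True
      then show ?thesis using A by (intro bexI[of _ A]) (auto simp: kron_zero_left[of _ d])
    next
      case False
      then have "t = inv (\<gamma> ! i) \<otimes> u \<otimes> (\<gamma> ! i)" using A by blast
      also have "\<dots> = u" using A i by (simp add: m_ac)
      finally show ?thesis using A by blast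
    qed
  qed
  then obtain A where A: "A i \<in> carrier_mat N N" "E i * M * E i = kron (A i) (X t)" if "i < s" for i by metis
  define A' where "A' = mat N N (\<lambda>(a, b). if blk a = blk b then A (blk a) $$ (a, b) else 0)"
  have "M = kron A' (X t)"
  proof (rule eq_mat_blockwise[OF Mc])
    fix a b u v assume ab: "a < N" "b < N" "u < d" "v < d"
    have *: "M $$ (a * d + u, b * d + v) = (E (blk a) * M * E (blk b)) $$ (a * d + u, b * d + v)"
      using E_M_E_index[OF Mc ab] by simp
    show "M $$ (a * d + u, b * d + v) = kron A' (X t) $$ (a * d + u, b * d + v)"
    proof (cases "blk a = blk b")
      case True
      then show ?thesis unfolding * using A[OF blk_less] ab
        by (simp add: kron_index[of _ N _ d] A'_def)
    next
      case False
      then show ?thesis unfolding * using off[OF blk_less blk_less False] ab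
        by (simp add: kron_index[of _ N _ d] A'_def mult_add_less_mult)
    qed
  qed (auto simp: A'_def)
  then show ?thesis by (intro bexI[of _ A']) (auto simp: A'_def)
qed

text \<open>Commuting with the diagonal matrix units makes \<open>A\<close> diagonal; commuting with
  the other matrix units of a block equates its diagonal entries there.\<close>

lemma block_scalar:
  assumes A: "A \<in> carrier_mat N N"
    and comm: "\<And>a b. a < N \<Longrightarrow> b < N \<Longrightarrow> blk a = blk b \<Longrightarrow> A * unit_mat N a b = unit_mat N a b * A"
  shows "\<exists>c. A = Dg c"
proof -
  define c where "c i = (let a = SOME a. a < N \<and> blk a = i in A $$ (a, a))" for i
  have off: "A $$ (x, a) = 0" if "x < N" "a < N" "x \<noteq> a" for x a
  proof -
    have "(A * unit_mat N a a) $$ (x, a) = (unit_mat N a a * A) $$ (x, a)"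
      using comm[of a a] that by simp
    then show ?thesis using mult_unit_mat_index[OF A that(1,2,2,2)] that by simp
  qed
  have diag: "A $$ (a, a) = A $$ (b, b)" if "a < N" "b < N" "blk a = blk b" for a b
  proof -
    have "(A * unit_mat N a b) $$ (a, b) = (unit_mat N a b * A) $$ (a, b)"
      using comm[of a b] that by simp
    then show ?thesis using mult_unit_mat_index[OF A that(1,2,1,2)] by simp
  qed
  have "A $$ (a, a) = c (blk a)" if a: "a < N" for a
  proof -
    have "\<exists>b. b < N \<and> blk b = blk a" using a by blast
    then have "(SOME b. b < N \<and> blk b = blk a) < N \<and> blk (SOME b. b < N \<and> blk b = blk a) = blk a"
      by (rule someI_ex)
    then show ?thesis unfolding c_def Let_def using diag a by metis
  qed
  then have "A = Dg c"
    using A off by (intro eq_matI) (auto simp: mat_diag_def)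
  then show ?thesis by blast
qed

end

section \<open>Anti-automorphisms compatible with the grading\<close>

locale antiaut_data = graded_data G T \<beta> ab \<kappa> \<gamma>
  for G :: "('g, 'b) monoid_scheme" (structure) and T and \<beta> :: "'g \<Rightarrow> 'g \<Rightarrow> 'a::field" and ab \<kappa> \<gamma> +
  fixes \<phi> :: "'a mat \<Rightarrow> 'a mat"
  assumes char_not_2: "(2::'a) \<noteq> 0"
    and antiaut: "graded_antiaut G T \<beta> ab \<kappa> \<gamma> \<phi>"
    and involutive: "\<And>Y. Y \<in> R \<one> \<Longrightarrow> \<phi> (\<phi> Y) = Y"
begin

abbreviation "nn \<equiv> N * d"

lemma phi_antiaut: "mat_alg_antiaut nn \<phi>"
  using antiaut by (simp add: graded_antiaut_def n_def)

lemma phi_carrier: "Y \<in> carrier_mat nn nn \<Longrightarrow> \<phi> Y \<in> carrier_mat nn nn"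
  and phi_mult: "Y \<in> carrier_mat nn nn \<Longrightarrow> Z \<in> carrier_mat nn nn \<Longrightarrow> \<phi> (Y * Z) = \<phi> Z * \<phi> Y"
  and phi_smult: "Y \<in> carrier_mat nn nn \<Longrightarrow> \<phi> (c \<cdot>\<^sub>m Y) = c \<cdot>\<^sub>m \<phi> Y"
  and phi_inj: "inj_on \<phi> (carrier_mat nn nn)"
  using phi_antiaut by (auto simp: mat_alg_antiaut_def mat_linear_def bij_betw_def)

lemma phi_zero: "\<phi> (0\<^sub>m nn nn) = 0\<^sub>m nn nn"
proof -
  have "0 \<cdot>\<^sub>m (0\<^sub>m nn nn) = (0\<^sub>m nn nn :: 'a mat)" by (rule eq_matI) auto
  then have *: "\<phi> (0\<^sub>m nn nn) = 0 \<cdot>\<^sub>m \<phi> (0\<^sub>m nn nn)" using phi_smult[of "0\<^sub>m nn nn" 0] by simp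
  show ?thesis by (subst *) (use phi_carrier[of "0\<^sub>m nn nn"] in \<open>auto intro!: eq_matI\<close>)
qed

lemma phi_nonzero: "Y \<in> carrier_mat nn nn \<Longrightarrow> Y \<noteq> 0\<^sub>m nn nn \<Longrightarrow> \<phi> Y \<noteq> 0\<^sub>m nn nn"
  using phi_inj phi_zero by (metis inj_onD zero_carrier_mat)

lemma phi_R: "h \<in> carrier G \<Longrightarrow> \<phi> ` R h = R h"
  using antiaut by (simp add: graded_antiaut_def compatible_with_grading_def)

lemma phi_in_R: "h \<in> carrier G \<Longrightarrow> Y \<in> R h \<Longrightarrow> \<phi> Y \<in> R h"
  using phi_R by blast

lemma kron_corner_R_T: "i < s \<Longrightarrow> A \<in> carrier_mat N N \<Longrightarrow> t \<in> T \<Longrightarrow> kron (e i * A * e i) (X t) \<in> R t"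
  by (rule R_comp_generator) (auto simp: m_ac)

lemma kron_e_R: "i < s \<Longrightarrow> t \<in> T \<Longrightarrow> kron (e i) (X t) \<in> R t"
  using kron_corner_R_T[of i "e i" t] by (simp add: corner_e)

lemma E_conv: "E i = kron (e i) (X \<one>)"
  by (simp add: R_idem_def X_one)

lemma e_comm_block_diagonal:
  assumes A: "A \<in> carrier_mat N N" and off: "\<And>a b. a < N \<Longrightarrow> b < N \<Longrightarrow> blk a \<noteq> blk b \<Longrightarrow> A $$ (a, b) = 0"
  shows "A * e i = e i * A"
proof -
  have "A * e i = mat N N (\<lambda>(a, b). A $$ (a, b) * (if blk b = i then 1 else 0))"
    unfolding e_conv_Dg using A by (rule Dg_mult_right)
  also have "\<dots> = mat N N (\<lambda>(a, b). (if blk a = i then 1 else 0) * A $$ (a, b))"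
    by (rule eq_matI) (use off in auto)
  also have "\<dots> = e i * A"
    unfolding e_conv_Dg using A by (rule Dg_mult_left[symmetric])
  finally show ?thesis .
qed

text \<open>The image commutes with the identity component, which consists of block diagonal matrices.\<close>

lemma phi_kron_e:
  assumes i: "i < s" and t: "t \<in> T"
  shows "\<exists>c. \<phi> (kron (e i) (X t)) = kron (Dg c) (X t)"
proof -
  have "\<phi> (kron (e i) (X t)) \<in> R t" using kron_e_R[OF i t] t by (intro phi_in_R) auto
  then obtain A where A: "A \<in> carrier_mat N N" "\<phi> (kron (e i) (X t)) = kron A (X t)"
    using R_comp_T t by blast
  have "\<exists>c. A = Dg c"
  proof (rule block_scalar[OF A(1)])
    fix a b assume ab: "a < N" "b < N" "blk a = blk b"
    \<comment> \<open>Compatibility makes \<open>\<phi>\<close> surjective on the identity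
      component, so each matrix unit there is the image of some \<open>K\<close>, and
      \<open>K\<close> is block diagonal, hence commutes with
      \<open>kron (e i) (X t)\<close>.\<close>
    have U: "kron (unit_mat N a b) (1\<^sub>m d) \<in> R \<one>"
      using kron_corner_R_T[of "blk a" "unit_mat N a b" \<one>] corner_unit_mat[OF ab(1,2)] ab blk_less by (simp add: X_one)
    then obtain K where K: "K \<in> R \<one>" "kron (unit_mat N a b) (1\<^sub>m d) = \<phi> K"
      using phi_R[of \<one>] by blast
    obtain B where B: "B \<in> carrier_mat N N" "K = kron B (X \<one>)" "\<forall>a<N. \<forall>b<N. blk a \<noteq> blk b \<longrightarrow> B $$ (a, b) = 0"
      using R_comp_T[OF K(1)] by auto
    have "kron (e i) (X t) * K = K * kron (e i) (X t)"
      using B e_comm_block_diagonal[of B i] by (simp add: kron_mult[of _ N _ _ d] X_one)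
    then have "\<phi> (kron (e i) (X t) * K) = \<phi> (K * kron (e i) (X t))" by simp
    then have "kron (unit_mat N a b) (1\<^sub>m d) * kron A (X t) = kron A (X t) * kron (unit_mat N a b) (1\<^sub>m d)"
      using B by (subst (asm) (1 2) phi_mult) (auto simp: K(2) A(2))
    then have "kron (unit_mat N a b * A) (X t) = kron (A * unit_mat N a b) (X t)"
      using A by (simp add: kron_mult[of _ N _ _ d])
    then show "A * unit_mat N a b = unit_mat N a b * A"
      using A X_nonzero[OF t] by (metis kron_left_cancel X_carrier mult_carrier_mat unit_mat_carrier)
  qed
  then show ?thesis using A by auto
qed

lemma kron_Dg_mult:
  "s' \<in> carrier_mat d d \<Longrightarrow> t' \<in> carrier_mat d d \<Longrightarrow>
    kron (Dg c) s' * kron (Dg c') t' = kron (Dg (\<lambda>i. c i * c' i)) (s' * t')"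
  by (simp add: kron_mult[of _ N _ _ d] mat_diag_diag)

lemma kron_nonzero:
  assumes "A \<in> carrier_mat N N" "A \<noteq> 0\<^sub>m N N" "t \<in> T"
  shows "kron A (X t) \<noteq> 0\<^sub>m nn nn"
  using kron_left_cancel[OF assms(1) zero_carrier_mat[of N N] X_carrier X_nonzero[OF assms(3)]] assms(2)
  by (auto simp: kron_zero_left[of _ d])

lemma Dg_zero: "(\<And>i. i < s \<Longrightarrow> c i = 0) \<Longrightarrow> Dg c = 0\<^sub>m N N"
  by (rule eq_matI) (auto simp: mat_diag_def blk_less)

lemma e_nonzero: "i < s \<Longrightarrow> e i \<noteq> 0\<^sub>m N N"
proof
  assume "i < s" "e i = 0\<^sub>m N N"
  moreover obtain a where "a < N" "blk a = i" using \<open>i < s\<close> block_nonempty by blast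
  ultimately show False using block_idem_index[of a \<kappa> a i, where 'a = 'a] by simp
qed

lemma E_inj: "E i = E j \<Longrightarrow> i < s \<Longrightarrow> i = j"
proof -
  assume "E i = E j" and i: "i < s"
  then have "e i = e j"
    unfolding E_conv by (intro kron_left_cancel[of "e i" N "e j" "X \<one>" d]) (auto simp: X_nonzero)
  then have "Dg (\<lambda>k. if k = i then 1 else 0) = Dg (\<lambda>k. if k = j then 1 else 0)"
    by (simp only: e_conv_Dg)
  from Dg_eqD[OF this i] show ?thesis by (auto split: if_splits)
qed

text \<open>\<open>\<phi>\<close> maps the orthogonal idempotents \<open>E i\<close> to nonzero
  orthogonal idempotents among the block scalars; as there are as many of them as blocks, each is
  again one of the \<open>E j\<close>.\<close>

lemma ex_tau: "\<exists>\<tau>. \<forall>i<s. \<tau> i < s \<and> \<phi> (E i) = E (\<tau> i) \<and> \<tau> (\<tau> i) = i"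
proof -
  have "\<forall>i. \<exists>c. i < s \<longrightarrow> \<phi> (E i) = kron (Dg c) (X \<one>)"
    unfolding E_conv using phi_kron_e by (metis T_closed(2))
  then obtain c where c: "\<phi> (E i) = kron (Dg (c i)) (X \<one>)" if "i < s" for i by metis
  have prod: "c i j * c i' j = (if i = i' then c i j else 0)" if "i < s" "i' < s" "j < s" for i i' j
  proof -
    have "E i' * E i = (if i = i' then E i else 0\<^sub>m nn nn)"
    proof (cases "i = i'")
      case True
      have "e i * e i = e i" unfolding e_conv_Dg by (simp add: mat_diag_diag if_distrib cong: if_cong)
      then show ?thesis using True by (simp add: E_conv X_one kron_mult[of _ N _ _ d])
    next
      case False
      have "e i' * e i = Dg (\<lambda>j. (if j = i' then 1 else 0) * (if j = i then 1 else 0))"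
        unfolding e_conv_Dg by (simp add: mat_diag_diag)
      also have "\<dots> = 0\<^sub>m N N" using False by (intro Dg_zero) auto
      finally show ?thesis using False by (simp add: E_conv X_one kron_mult[of _ N _ _ d] kron_zero_left[of _ d])
    qed
    moreover have "\<phi> (E i' * E i) = \<phi> (E i) * \<phi> (E i')" by (rule phi_mult) auto
    ultimately have "\<phi> (E i) * \<phi> (E i') = (if i = i' then \<phi> (E i) else 0\<^sub>m nn nn)"
      using phi_zero by (cases "i = i'") auto
    moreover have "kron (Dg (\<lambda>j. if i = i' then c i j else 0)) (X \<one>) = (if i = i' then \<phi> (E i) else 0\<^sub>m nn nn)"
      using c[OF that(1)] Dg_zero[of "\<lambda>j. 0"] by (cases "i = i'") (simp_all add: kron_zero_left[of _ d])
    ultimately have "kron (Dg (\<lambda>j. c i j * c i' j)) (X \<one>) = kron (Dg (\<lambda>j. if i = i' then c i j else 0)) (X \<one>)"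
      using c that by (simp add: kron_Dg_mult X_one)
    then have "Dg (\<lambda>j. c i j * c i' j) = Dg (\<lambda>j. if i = i' then c i j else 0)"
      by (rule kron_left_cancel[OF Dg_carrier Dg_carrier X_carrier X_nonzero, rotated]) auto
    from Dg_eqD[OF this that(3)] show ?thesis .
  qed
  have "\<exists>j<s. c i j \<noteq> 0" if i: "i < s" for i
  proof (rule ccontr)
    assume "\<not> ?thesis"
    then have "Dg (c i) = 0\<^sub>m N N" by (intro Dg_zero) auto
    then have "\<phi> (E i) = 0\<^sub>m nn nn" using c[OF i] by (simp add: kron_zero_left[of _ d])
    moreover have "E i \<noteq> 0\<^sub>m nn nn" unfolding E_conv using e_nonzero[OF i] by (intro kron_nonzero) auto
    ultimately show False using phi_nonzero E_carrier by blast
  qed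
  then obtain \<tau> where \<tau>: "\<tau> i < s" "c i (\<tau> i) \<noteq> 0" if "i < s" for i by metis
  \<comment> \<open>Orthogonality: the images of two different idempotents cannot both be nonzero on
    the same block.\<close>
  have inj: "inj_on \<tau> {..<s}"
  proof (rule inj_onI)
    fix i i' assume "i \<in> {..<s}" "i' \<in> {..<s}" "\<tau> i = \<tau> i'"
    then show "i = i'" using prod[of i i' "\<tau> i"] \<tau>[of i] \<tau>[of i'] by (auto split: if_splits)
  qed
  then have surj: "\<tau> ` {..<s} = {..<s}" using \<tau> by (intro endo_inj_surj) auto
  have ci: "c i j = (if j = \<tau> i then 1 else 0)" if "i < s" "j < s" for i j
  proof (cases "j = \<tau> i")
    case True
    then show ?thesis using prod[OF that(1,1,2)] \<tau>[OF that(1)] by simp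
  next
    case False
    have "j \<in> \<tau> ` {..<s}" using surj that(2) by simp
    then obtain i' where i': "i' < s" "j = \<tau> i'" by auto
    then have "i \<noteq> i'" using False by auto
    then show ?thesis using prod[OF that(1) i'(1) that(2)] \<tau>[OF i'(1)] i' False by simp
  qed
  have \<phi>E: "\<phi> (E i) = E (\<tau> i)" if "i < s" for i
  proof -
    have "Dg (c i) = e (\<tau> i)" unfolding e_conv_Dg using ci[OF that] by (intro Dg_cong) auto
    then show ?thesis using c[OF that] by (simp only: E_conv[of "\<tau> i"])
  qed
  have "\<tau> (\<tau> i) = i" if i: "i < s" for i
  proof -
    have "E i \<in> R \<one>" using kron_e_R[OF i, of \<one>] by (simp add: E_conv)
    then have "E (\<tau> (\<tau> i)) = E i" using involutive[of "E i"] \<phi>E[OF i] \<phi>E[OF \<tau>(1)[OF i]] by simp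
    then show ?thesis by (rule E_inj) (intro \<tau>(1) i)
  qed
  then show ?thesis using \<tau> \<phi>E by blast
qed

definition tau :: "nat \<Rightarrow> nat" where
  "tau = (SOME \<tau>. \<forall>i<s. \<tau> i < s \<and> \<phi> (E i) = E (\<tau> i) \<and> \<tau> (\<tau> i) = i)"

lemma tau: "i < s \<Longrightarrow> tau i < s" "i < s \<Longrightarrow> \<phi> (E i) = E (tau i)" "i < s \<Longrightarrow> tau (tau i) = i"
  using someI_ex[OF ex_tau] unfolding tau_def by blast+

text \<open>By \<open>phi_kron_e\<close> the image is block scalar on the left, and multiplication
  by \<open>E (tau i)\<close> fixes it, which leaves a single block.\<close>

lemma phi_kron_e_tau:
  assumes i: "i < s" and t: "t \<in> T"
  shows "\<exists>c. c \<noteq> 0 \<and> \<phi> (kron (e i) (X t)) = c \<cdot>\<^sub>m kron (e (tau i)) (X t)"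
proof -
  obtain c where c: "\<phi> (kron (e i) (X t)) = kron (Dg c) (X t)" using phi_kron_e[OF assms] by blast
  have ee: "e i * e i = e i" unfolding e_conv_Dg by (simp add: mat_diag_diag if_distrib cong: if_cong)
  have "E i * kron (e i) (X t) = kron (e i) (X t)"
    by (simp add: R_idem_def kron_mult[of _ N _ _ d] ee)
  then have "\<phi> (kron (e i) (X t)) * E (tau i) = \<phi> (kron (e i) (X t))"
    using phi_mult[of "E i" "kron (e i) (X t)"] tau(2)[OF i] by simp
  then have "kron (Dg c) (X t) * E (tau i) = kron (Dg c) (X t)" unfolding c .
  moreover have "kron (Dg c) (X t) * E (tau i) = kron (Dg (\<lambda>j. c j * (if j = tau i then 1 else 0))) (X t)"
    unfolding R_idem_def e_conv_Dg[of "tau i"]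
    using kron_Dg_mult[OF X_carrier one_carrier_mat, of c t "\<lambda>j. if j = tau i then 1 else 0"]
    by (simp add: right_mult_one_mat[OF X_carrier])
  ultimately have "kron (Dg (\<lambda>j. c j * (if j = tau i then 1 else 0))) (X t) = kron (Dg c) (X t)" by simp
  moreover have "Dg (\<lambda>j. c j * (if j = tau i then 1 else 0)) = c (tau i) \<cdot>\<^sub>m e (tau i)"
    unfolding e_conv_Dg by (rule eq_matI) (auto simp: mat_diag_def)
  ultimately have *: "\<phi> (kron (e i) (X t)) = c (tau i) \<cdot>\<^sub>m kron (e (tau i)) (X t)"
    unfolding c by (simp add: kron_smult[of _ N _ d])
  moreover have "c (tau i) \<noteq> 0"
  proof
    assume 0: "c (tau i) = 0"
    have "\<phi> (kron (e i) (X t)) = 0\<^sub>m nn nn"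
      unfolding * 0 by (rule eq_matI) (auto simp: carrier_matD[OF kron_carrier[OF block_idem_carrier X_carrier]])
    moreover have "kron (e i) (X t) \<noteq> 0\<^sub>m nn nn" using e_nonzero[OF i] t by (intro kron_nonzero) auto
    ultimately show False using phi_nonzero kron_carrier[OF block_idem_carrier X_carrier] by blast
  qed
  ultimately show ?thesis by blast
qed

lemma beta_square:
  assumes st: "t \<in> T" "u \<in> T"
  shows "\<beta> t u * \<beta> t u = 1"
proof -
  have i: "0 < s" using kappa by simp
  let ?K = "\<lambda>t. kron (e 0) (X t)" and ?L = "\<lambda>t. kron (e (tau 0)) (X t)"
  have K: "?K t \<in> carrier_mat nn nn" "?L t \<in> carrier_mat nn nn" for t by auto
  obtain c where c: "c \<noteq> 0" "\<phi> (?K t) = c \<cdot>\<^sub>m ?L t" using phi_kron_e_tau[OF i st(1)] by blast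
  obtain c' where c': "c' \<noteq> 0" "\<phi> (?K u) = c' \<cdot>\<^sub>m ?L u" using phi_kron_e_tau[OF i st(2)] by blast
  have XX: "X t * X u \<in> carrier_mat d d" for t u by (rule mult_carrier_mat[OF X_carrier X_carrier])
  have ee: "e j * e j = e j" for j unfolding e_conv_Dg by (simp add: mat_diag_diag if_distrib cong: if_cong)
  have KK: "?K t * ?K u = kron (e 0) (X t * X u)" "?L t * ?L u = kron (e (tau 0)) (X t * X u)" for t u
    by (simp_all add: kron_mult[of _ N _ _ d] ee)
  \<comment> \<open>\<open>\<phi>\<close> reverses both sides of the commutation relation. The
    scalars \<open>c\<close> and \<open>c'\<close> appear on both sides, and undoing the reversal
    yields a second factor \<open>\<beta> t u\<close>.\<close>
  have "\<phi> (?K t * ?K u) = \<phi> (\<beta> t u \<cdot>\<^sub>m (?K u * ?K t))"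
    unfolding KK X_comm[OF st] by (simp add: kron_smult(2)[OF block_idem_carrier XX])
  then have "\<phi> (?K u) * \<phi> (?K t) = \<beta> t u \<cdot>\<^sub>m (\<phi> (?K t) * \<phi> (?K u))"
    using K by (simp add: phi_mult phi_smult mult_carrier_mat[of _ nn nn])
  then have "(c' * c) \<cdot>\<^sub>m (?L u * ?L t) = (\<beta> t u * (c * c')) \<cdot>\<^sub>m (?L t * ?L u)"
    unfolding c c' using K
    by (simp add: mult_smult_distrib[of _ nn nn _ nn] mult_smult_assoc_mat[of _ nn nn _ nn] smult_smult_mat mult_ac)
  also have "?L t * ?L u = \<beta> t u \<cdot>\<^sub>m (?L u * ?L t)"
    unfolding KK X_comm[OF st] by (simp add: kron_smult(2)[OF block_idem_carrier XX])
  finally have eq: "(c' * c) \<cdot>\<^sub>m (?L u * ?L t) = (\<beta> t u * (c * c') * \<beta> t u) \<cdot>\<^sub>m (?L u * ?L t)"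
    by (simp add: smult_smult_mat)
  obtain q where q: "q \<noteq> 0" "X u * X t = q \<cdot>\<^sub>m X (u \<otimes> t)" using X_mult st by blast
  have "?L u * ?L t = q \<cdot>\<^sub>m kron (e (tau 0)) (X (u \<otimes> t))"
    unfolding KK q by (simp add: kron_smult[of _ N _ d])
  moreover have "kron (e (tau 0)) (X (u \<otimes> t)) \<noteq> 0\<^sub>m nn nn"
    using st e_nonzero[OF tau(1)[OF i]] by (intro kron_nonzero) auto
  then obtain x y where "x < nn" "y < nn" "kron (e (tau 0)) (X (u \<otimes> t)) $$ (x, y) \<noteq> 0"
    using nonzero_mat_entry[OF kron_carrier[OF block_idem_carrier X_carrier]] by blast
  ultimately have "c' * c = \<beta> t u * (c * c') * \<beta> t u"
    using arg_cong[OF eq, of "\<lambda>A. A $$ (x, y)"] q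
    by (simp add: carrier_matD[OF kron_carrier[OF block_idem_carrier X_carrier]])
  then show ?thesis using c c' by (simp add: mult_ac)
qed

lemma T_elementary: "t \<in> T \<Longrightarrow> t \<otimes> t = \<one>"
proof -
  assume t: "t \<in> T"
  have "\<beta> u (t \<otimes> t) = 1" if "u \<in> T" for u
    using that t beta_square by (simp add: beta_mult_right)
  then show ?thesis using nondeg t by (simp add: nondegenerate_def)
qed

sublocale elementary_division_data G T \<beta> ab
  using char_not_2 T_elementary by unfold_locales

end

section \<open>The block form of the conjugating matrix\<close>

context antiaut_data
begin

lemma beta_inj:
  assumes "t \<in> T" "t' \<in> T" "\<And>u. u \<in> T \<Longrightarrow> \<beta> u t = \<beta> u t'"
  shows "t = t'"
proof -
  have "\<beta> u (t \<otimes> t') = 1" if "u \<in> T" for u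
    using that assms beta_square[of u t'] by (simp add: beta_mult_right)
  then have "t \<otimes> t' = \<one>" using nondeg assms by (simp add: nondegenerate_def)
  then show ?thesis using assms T_inv by (metis T_closed(4) inv_equality)
qed

text \<open>Every \<open>d\<close>-by-\<open>d\<close> slice of a matrix \<open>P\<close> with \<open>P * \<phi> Y = Y\<^sup>T * P\<close> is an eigenmatrix for the
  conjugations by the \<open>X u\<close>, with eigenvalues depending on the block of the row only.\<close>

lemma ex_row_kron_form:
  assumes P: "P \<in> carrier_mat nn nn"
    and comm: "\<And>Y. Y \<in> carrier_mat nn nn \<Longrightarrow> P * \<phi> Y = transpose_mat Y * P"
  shows "\<exists>Q t. Q \<in> carrier_mat N N \<and> (\<forall>i. t i \<in> T) \<and> P = row_kron N d Q (\<lambda>a. X (t (blk a))) \<and>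
    (\<forall>a<N. \<forall>b<N. Q $$ (a, b) \<noteq> 0 \<longrightarrow> blk b = tau (blk a))"
proof -
  have "\<forall>i u. \<exists>c. i < s \<longrightarrow> u \<in> T \<longrightarrow> \<phi> (kron (e i) (X u)) = c \<cdot>\<^sub>m kron (e (tau i)) (X u)"
    using phi_kron_e_tau by blast
  then obtain c where c: "\<phi> (kron (e i) (X u)) = c i u \<cdot>\<^sub>m kron (e (tau i)) (X u)"
    if "i < s" "u \<in> T" for i u by metis
  have "\<forall>u. \<exists>r. u \<in> T \<longrightarrow> r \<noteq> 0 \<and> transpose_mat (X u) = r \<cdot>\<^sub>m X u" using X_transpose by blast
  then obtain r where r: "r u \<noteq> 0" "transpose_mat (X u) = r u \<cdot>\<^sub>m X u" if "u \<in> T" for u by metis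
  let ?p = "slice d P"
  \<comment> \<open>Slice \<open>(a, b)\<close> of \<open>P * \<phi> Y = Y^T * P\<close> for
    \<open>Y = kron (e i) (X u)\<close> and \<open>i = blk a\<close>; only columns in block
    \<open>tau i\<close> survive on the left.\<close>
  have sl: "(c (blk a) u * (if blk b = tau (blk a) then 1 else 0)) \<cdot>\<^sub>m (?p a b * X u) = r u \<cdot>\<^sub>m (X u * ?p a b)"
    if ab: "a < N" "b < N" and u: "u \<in> T" for a b u
  proof -
    let ?i = "blk a"
    have i: "?i < s" using blk_less ab by simp
    have kc: "kron (e j) (X u) \<in> carrier_mat nn nn" for j by simp
    have et: "transpose_mat (e ?i) = e ?i" unfolding e_conv_Dg by (rule eq_matI) (auto simp: mat_diag_def)
    have "P * (c ?i u \<cdot>\<^sub>m kron (e (tau ?i)) (X u)) = kron (e ?i) (r u \<cdot>\<^sub>m X u) * P"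
      using comm[OF kc[of ?i]] by (simp add: c[OF i u] kron_transpose[of _ N _ d] et r[OF u])
    moreover have "P * (c ?i u \<cdot>\<^sub>m kron (e (tau ?i)) (X u)) = P * kron (mat_diag N (\<lambda>a. c ?i u * (if blk a = tau ?i then 1 else 0))) (X u)"
    proof -
      have "mat_diag N (\<lambda>a. c ?i u * (if blk a = tau ?i then 1 else 0)) = c ?i u \<cdot>\<^sub>m e (tau ?i)"
        unfolding e_conv_Dg by (rule eq_matI) (auto simp: mat_diag_def)
      then show ?thesis by (simp add: kron_smult[of _ N _ d])
    qed
    ultimately have "slice d (P * kron (mat_diag N (\<lambda>a. c ?i u * (if blk a = tau ?i then 1 else 0))) (X u)) a b =
       slice d (kron (mat_diag N (\<lambda>a. if blk a = ?i then 1 else 0)) (r u \<cdot>\<^sub>m X u) * P) a b"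
      unfolding e_conv_Dg[of ?i] by simp
    then show ?thesis
      using slice_mult_diag(1)[OF P X_carrier ab, of "\<lambda>a. c ?i u * (if blk a = tau ?i then 1 else 0)" u]
        slice_mult_diag(2)[OF P smult_carrier_mat[OF X_carrier] ab, of "\<lambda>a. if blk a = ?i then 1 else 0" "r u" u]
      by (simp add: mult_smult_assoc_mat[OF X_carrier slice_carrier])
  qed
  \<comment> \<open>\<open>t i\<close> is the element whose commutation factors are the eigenvalues
    of the row of blocks \<open>i\<close>; it is unique by \<open>beta_inj\<close>. The default
    \<open>\<one>\<close> is taken where none exists.\<close>
  define good where "good i t \<longleftrightarrow> t \<in> T \<and> (\<forall>u\<in>T. c i u / r u = \<beta> u t)" for i t
  define t where "t i = (if \<exists>t. good i t then SOME t. good i t else \<one>)" for i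
  have t_T: "t i \<in> T" for i
  proof (cases "\<exists>t. good i t")
    case True
    then have "good i (t i)" by (simp add: t_def someI_ex)
    then show ?thesis by (simp add: good_def)
  qed (simp add: t_def)
  have t_eq: "t i = t'" if "good i t'" for i t'
  proof -
    have "good i (t i)" using that by (auto simp: t_def intro: someI2)
    then show ?thesis using that by (intro beta_inj) (auto simp: good_def)
  qed
  have entry: "\<exists>q. ?p a b = q \<cdot>\<^sub>m X (t (blk a)) \<and> (q \<noteq> 0 \<longrightarrow> blk b = tau (blk a))" if ab: "a < N" "b < N" for a b
  proof (cases "?p a b = 0\<^sub>m d d")
    case True
    then have "?p a b = 0 \<cdot>\<^sub>m X (t (blk a))" by (auto intro!: eq_matI)
    then show ?thesis by blast
  next
    case False
    \<comment> \<open>At \<open>u = \<one>\<close> the left side of \<open>sl\<close> vanishes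
      outside block \<open>tau (blk a)\<close>, while the right side is a nonzero multiple of the
      slice.\<close>
    have blk: "blk b = tau (blk a)"
    proof (rule ccontr)
      assume "blk b \<noteq> tau (blk a)"
      then have *: "0 \<cdot>\<^sub>m ?p a b = r \<one> \<cdot>\<^sub>m ?p a b" using sl[OF ab, of \<one>] by (simp add: X_one left_mult_one_mat[OF slice_carrier] right_mult_one_mat[OF slice_carrier])
      have "?p a b = 0\<^sub>m d d"
      proof (rule eq_matI)
        fix x y assume "x < dim_row (0\<^sub>m d d :: 'a mat)" "y < dim_col (0\<^sub>m d d :: 'a mat)"
        then show "?p a b $$ (x, y) = 0\<^sub>m d d $$ (x, y)"
          using arg_cong[OF *, of "\<lambda>A. A $$ (x, y)"] r(1)[of \<one>] carrier_matD[OF slice_carrier[of d P a b]] by simp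
      qed (auto simp: slice_def)
      then show False using False by simp
    qed
    have eig: "X u * ?p a b = (c (blk a) u / r u) \<cdot>\<^sub>m (?p a b * X u)" if u: "u \<in> T" for u
    proof -
      have "X u * ?p a b = inverse (r u) \<cdot>\<^sub>m (r u \<cdot>\<^sub>m (X u * ?p a b))"
        using r(1)[OF u] by (simp add: smult_smult_mat)
      also have "\<dots> = inverse (r u) \<cdot>\<^sub>m (c (blk a) u \<cdot>\<^sub>m (?p a b * X u))"
        using sl[OF ab u] blk by simp
      finally show ?thesis by (simp add: smult_smult_mat divide_inverse mult.commute)
    qed
    obtain t' q where t': "t' \<in> T" "\<forall>u\<in>T. c (blk a) u / r u = \<beta> u t'" "?p a b = q \<cdot>\<^sub>m X t'"
      using eigenmatrix[OF slice_carrier False, of "\<lambda>u. c (blk a) u / r u"] eig by blast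
    then have "t (blk a) = t'" by (intro t_eq) (auto simp: good_def)
    then show ?thesis using t' blk by blast
  qed
  then obtain q where q: "?p a b = q a b \<cdot>\<^sub>m X (t (blk a))" "q a b \<noteq> 0 \<Longrightarrow> blk b = tau (blk a)"
    if "a < N" "b < N" for a b by metis
  define Q where "Q = mat N N (\<lambda>(a, b). q a b)"
  have "P = row_kron N d Q (\<lambda>a. X (t (blk a)))"
  proof (rule eq_mat_blockwise[OF P])
    fix a b u v assume ab: "a < N" "b < N" "u < d" "v < d"
    have "P $$ (a * d + u, b * d + v) = ?p a b $$ (u, v)" using ab by (simp add: slice_def)
    also have "\<dots> = q a b * X (t (blk a)) $$ (u, v)" using ab by (simp add: q(1))
    finally show "P $$ (a * d + u, b * d + v) = row_kron N d Q (\<lambda>a. X (t (blk a))) $$ (a * d + u, b * d + v)"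
      using ab by (simp add: row_kron_index Q_def)
  qed simp
  moreover have "\<forall>a<N. \<forall>b<N. Q $$ (a, b) \<noteq> 0 \<longrightarrow> blk b = tau (blk a)" using q by (simp add: Q_def)
  ultimately show ?thesis using t_T by (intro exI[of _ Q] exI[of _ t]) (simp add: Q_def)
qed

lemma ex_form:
  "\<exists>Q t P'. Q \<in> carrier_mat N N \<and> det Q \<noteq> 0 \<and> (\<forall>i. t i \<in> T) \<and>
    (\<forall>a<N. \<forall>b<N. Q $$ (a, b) \<noteq> 0 \<longrightarrow> blk b = tau (blk a)) \<and>
    P' \<in> carrier_mat nn nn \<and> row_kron N d Q (\<lambda>a. X (t (blk a))) * P' = 1\<^sub>m nn \<and>
    P' * row_kron N d Q (\<lambda>a. X (t (blk a))) = 1\<^sub>m nn \<and>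
    (\<forall>Y\<in>carrier_mat nn nn. \<phi> Y = P' * transpose_mat Y * row_kron N d Q (\<lambda>a. X (t (blk a))))"
proof -
  have pos: "0 < nn" using n_pos by (simp add: n_def)
  obtain P P' where P: "P \<in> carrier_mat nn nn" "P' \<in> carrier_mat nn nn" "P * P' = 1\<^sub>m nn" "P' * P = 1\<^sub>m nn"
    "\<forall>Y\<in>carrier_mat nn nn. \<phi> Y = P' * transpose_mat Y * P"
    using antiaut_conj_transpose[OF phi_antiaut pos] by blast
  have comm: "P * \<phi> Y = transpose_mat Y * P" if Y: "Y \<in> carrier_mat nn nn" for Y
  proof -
    have Yt: "transpose_mat Y \<in> carrier_mat nn nn" using Y by simp
    have "P * \<phi> Y = P * (P' * (transpose_mat Y * P))"
      using P Y Yt by (simp add: assoc_mult_mat[OF P(2) Yt P(1)])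
    also have "\<dots> = (P * P') * (transpose_mat Y * P)"
      by (rule assoc_mult_mat[OF P(1,2) mult_carrier_mat[OF Yt P(1)], symmetric])
    also have "\<dots> = transpose_mat Y * P"
      using left_mult_one_mat[OF mult_carrier_mat[OF Yt P(1)]] by (simp add: P(3))
    finally show ?thesis .
  qed
  obtain Q t where Q: "Q \<in> carrier_mat N N" "\<forall>i. t i \<in> T" "P = row_kron N d Q (\<lambda>a. X (t (blk a)))"
    "\<forall>a<N. \<forall>b<N. Q $$ (a, b) \<noteq> 0 \<longrightarrow> blk b = tau (blk a)"
    using ex_row_kron_form[OF P(1) comm] by blast
  \<comment> \<open>\<open>P\<close> is the block diagonal \<open>?D\<close> times
    \<open>kron Q 1\<close>, so the inverse of \<open>P\<close> yields a right inverse of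
    \<open>kron Q 1\<close>, and \<open>Q\<close> is invertible.\<close>
  let ?D = "row_kron N d (1\<^sub>m N) (\<lambda>a. X (t (blk a)))"
  have PD: "?D * kron Q (1\<^sub>m d) = P"
  proof -
    have "?D * kron Q (1\<^sub>m d) = row_kron N d (1\<^sub>m N * Q) (\<lambda>a. X (t (blk a)) * 1\<^sub>m d)"
      unfolding kron_conv_row_kron[OF Q(1) one_carrier_mat]
      by (rule row_kron_mult) (use Q in auto)
    then show ?thesis unfolding Q(3) left_mult_one_mat[OF Q(1)] right_mult_one_mat[OF X_carrier] .
  qed
  have cars: "?D \<in> carrier_mat nn nn" "kron Q (1\<^sub>m d) \<in> carrier_mat nn nn" using Q by auto
  have "?D * (kron Q (1\<^sub>m d) * P') = 1\<^sub>m nn"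
    using P(3) unfolding PD[symmetric] assoc_mult_mat[OF cars P(2)] .
  then have "kron Q (1\<^sub>m d) * P' * ?D = 1\<^sub>m nn"
    by (rule mat_mult_left_right_inverse[OF cars(1) mult_carrier_mat[OF cars(2) P(2)]])
  then have "kron Q (1\<^sub>m d) * (P' * ?D) = 1\<^sub>m nn"
    unfolding assoc_mult_mat[OF cars(2) P(2) cars(1)] .
  then have "det Q \<noteq> 0"
    by (rule kron_one_right_inverse[OF Q(1) mult_carrier_mat[OF P(2) cars(1)] d_pos])
  then show ?thesis using P Q by blast
qed

end

locale antiaut_form = antiaut_data G T \<beta> ab \<kappa> \<gamma> \<phi>
  for G :: "('g, 'b) monoid_scheme" (structure) and T and \<beta> :: "'g \<Rightarrow> 'g \<Rightarrow> 'a::field" and ab \<kappa> \<gamma> \<phi> +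
  fixes Q :: "'a mat" and t :: "nat \<Rightarrow> 'g" and P' :: "'a mat"
  assumes Q: "Q \<in> carrier_mat N N" "det Q \<noteq> 0"
    and t_T [simp]: "t i \<in> T"
    and supp: "a < N \<Longrightarrow> b < N \<Longrightarrow> Q $$ (a, b) \<noteq> 0 \<Longrightarrow> blk b = tau (blk a)"
    and P': "P' \<in> carrier_mat nn nn" "row_kron N d Q (\<lambda>a. X (t (blk a))) * P' = 1\<^sub>m nn"
      "P' * row_kron N d Q (\<lambda>a. X (t (blk a))) = 1\<^sub>m nn"
    and phi_form: "Y \<in> carrier_mat nn nn \<Longrightarrow>
      \<phi> Y = P' * transpose_mat Y * row_kron N d Q (\<lambda>a. X (t (blk a)))"
begin

abbreviation "P \<equiv> row_kron N d Q (\<lambda>a. X (t (blk a)))"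

lemma P_phi: "Y \<in> carrier_mat nn nn \<Longrightarrow> P * \<phi> Y = transpose_mat Y * P"
proof -
  assume Y: "Y \<in> carrier_mat nn nn"
  have Yt: "transpose_mat Y \<in> carrier_mat nn nn" using Y by simp
  have "P * \<phi> Y = P * (P' * (transpose_mat Y * P))"
    unfolding phi_form[OF Y] assoc_mult_mat[OF P'(1) Yt row_kron_carrier] ..
  also have "\<dots> = (P * P') * (transpose_mat Y * P)"
    by (rule assoc_mult_mat[OF row_kron_carrier P'(1) mult_carrier_mat[OF Yt row_kron_carrier], symmetric])
  also have "\<dots> = transpose_mat Y * P"
    unfolding P'(2) by (rule left_mult_one_mat[OF mult_carrier_mat[OF Yt row_kron_carrier]])
  finally show ?thesis .
qed

lemma Q_row_nonzero: "a < N \<Longrightarrow> \<exists>b<N. Q $$ (a, b) \<noteq> 0"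
proof (rule ccontr)
  assume a: "a < N" and "\<not> ?thesis"
  then have 0: "\<forall>b<N. Q $$ (a, b) = 0" by blast
  obtain B where B: "B \<in> carrier_mat N N" "Q * B = 1\<^sub>m N" using ex_inverse_mat Q by blast
  have "(Q * B) $$ (a, a) = 0"
    unfolding index_mult_mat_sum[OF Q(1) B(1) a a] using 0 by simp
  then show False using B a by simp
qed

text \<open>A permutation supported on the nonzero entries of \<open>Q\<close> carries block
  \<open>i\<close> into block \<open>tau i\<close>; the reverse inequality is the same statement for
  \<open>tau i\<close>.\<close>

lemma block_size_tau: "i < s \<Longrightarrow> \<kappa> ! tau i = \<kappa> ! i"
proof -
  have le: "\<kappa> ! i \<le> \<kappa> ! tau i" if "i < s" for i
    using card_block_le[where f = blk and \<tau> = tau and i = i, OF Q supp] card_block[OF that] card_block[OF tau(1)[OF that]] by simp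
  assume i: "i < s"
  then show ?thesis using le[OF i] le[OF tau(1)[OF i]] tau(3)[OF i] by simp
qed

text \<open>Comparing the degrees of \<open>e\<^sub>i C e\<^sub>j \<otimes> 1\<close> and of its image.\<close>

lemma degree_relation:
  assumes i: "i < s" and j: "j < s"
  shows "\<gamma> ! i \<otimes> \<gamma> ! tau i \<otimes> t i = \<gamma> ! j \<otimes> \<gamma> ! tau j \<otimes> t j"
proof -
  obtain a b where ab: "a < N" "blk a = i" "b < N" "blk b = j" using block_nonempty i j by metis
  let ?U = "unit_mat N a b :: 'a mat" and ?h = "inv (\<gamma> ! i) \<otimes> \<one> \<otimes> (\<gamma> ! j)"
  let ?K = "kron ?U (1\<^sub>m d)"
  have U: "e i * ?U * e j = ?U" using corner_unit_mat[OF ab(1,3)] ab by simp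
  have h: "?h \<in> carrier G" using i j by simp
  have Kc: "?K \<in> carrier_mat nn nn" by simp
  have "?K \<in> R ?h" using R_comp_generator[OF unit_mat_carrier i j, of \<one> ?h a b] U by (simp add: X_one)
  then have \<phi>K: "\<phi> ?K \<in> R ?h" by (intro phi_in_R h)
  have K: "?K = E i * ?K * E j" using E_kron_E[OF unit_mat_carrier one_carrier_mat, of i a b j] U by simp
  have "\<phi> ?K = \<phi> (E j) * (\<phi> ?K * \<phi> (E i))"
  proof -
    have "\<phi> ?K = \<phi> (E i * ?K * E j)" using K by simp
    also have "\<dots> = \<phi> (E j) * \<phi> (E i * ?K)"
      by (rule phi_mult[OF mult_carrier_mat[OF E_carrier Kc] E_carrier])
    also have "\<phi> (E i * ?K) = \<phi> ?K * \<phi> (E i)" by (rule phi_mult[OF E_carrier Kc])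
    finally show ?thesis .
  qed
  then have "\<phi> ?K = E (tau j) * \<phi> ?K * E (tau i)"
    unfolding tau(2)[OF i] tau(2)[OF j] assoc_mult_mat[OF E_carrier phi_carrier[OF Kc] E_carrier] .
  then obtain A v where A: "A \<in> carrier_mat N N" "v \<in> T" "\<phi> ?K = kron A (X v)"
    "?h = inv (\<gamma> ! tau j) \<otimes> v \<otimes> (\<gamma> ! tau i) \<or> A = 0\<^sub>m N N"
    using R_comp_corner[OF \<phi>K tau(1)[OF j] tau(1)[OF i] h] by auto
  \<comment> \<open>Block \<open>(b, y)\<close> of \<open>P * \<phi> K = K^T * P\<close> compares a
    multiple of \<open>X (t j) * X v\<close> with the nonzero multiple \<open>Q $$ (a, y)\<close> of
    \<open>X (t i)\<close>, whence \<open>t i = t j \<otimes> v\<close>.\<close>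
  obtain y where y: "y < N" "Q $$ (a, y) \<noteq> 0" using Q_row_nonzero ab by blast
  have "P * kron A (X v) = row_kron N d (Q * A) (\<lambda>x. X (t (blk x)) * X v)"
    unfolding kron_conv_row_kron[OF A(1) X_carrier] by (rule row_kron_mult) (use Q A in auto)
  moreover have "transpose_mat ?K * P = row_kron N d (unit_mat N b a * Q) (\<lambda>x. 1\<^sub>m d * X (t i))"
  proof -
    have "transpose_mat ?U = unit_mat N b a" by (rule eq_matI) (auto simp: unit_mat_def)
    then have "transpose_mat ?K = row_kron N d (unit_mat N b a) (\<lambda>_. 1\<^sub>m d)"
      unfolding kron_transpose[OF unit_mat_carrier one_carrier_mat] kron_conv_row_kron[OF unit_mat_carrier one_carrier_mat, symmetric]
      by simp
    moreover have "row_kron N d (unit_mat N b a) (\<lambda>_. 1\<^sub>m d) * P = row_kron N d (unit_mat N b a * Q) (\<lambda>x. 1\<^sub>m d * X (t i))"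
      by (rule row_kron_mult) (use Q ab in \<open>auto simp: unit_mat_def split: if_splits\<close>)
    ultimately show ?thesis by simp
  qed
  ultimately have eq: "row_kron N d (Q * A) (\<lambda>x. X (t (blk x)) * X v) = row_kron N d (unit_mat N b a * Q) (\<lambda>x. 1\<^sub>m d * X (t i))"
    using P_phi[OF Kc] A by simp
  have uQ: "(unit_mat N b a * Q) $$ (b, y) = Q $$ (a, y)"
    using mult_unit_mat_index(2)[OF Q(1) ab(3) y(1) ab(3,1)] by simp
  have XX: "(Q * A) $$ (b, y) \<cdot>\<^sub>m (X (t j) * X v) = Q $$ (a, y) \<cdot>\<^sub>m X (t i)"
  proof (rule eq_matI)
    fix x z assume "x < dim_row (Q $$ (a, y) \<cdot>\<^sub>m X (t i))" "z < dim_col (Q $$ (a, y) \<cdot>\<^sub>m X (t i))"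
    then have xz: "x < d" "z < d" by auto
    have "(Q * A) $$ (b, y) * (X (t (blk b)) * X v) $$ (x, z) = (unit_mat N b a * Q) $$ (b, y) * (1\<^sub>m d * X (t i)) $$ (x, z)"
      using arg_cong[OF eq, of "\<lambda>M. M $$ (b * d + x, y * d + z)"]
      unfolding row_kron_index[OF ab(3) y(1) xz] .
    then show "((Q * A) $$ (b, y) \<cdot>\<^sub>m (X (t j) * X v)) $$ (x, z) = (Q $$ (a, y) \<cdot>\<^sub>m X (t i)) $$ (x, z)"
      unfolding uQ left_mult_one_mat[OF X_carrier] using xz ab by (simp del: index_mult_mat(1))
  qed auto
  obtain q where q: "q \<noteq> 0" "X (t j) * X v = q \<cdot>\<^sub>m X (t j \<otimes> v)" using X_mult[OF t_T A(2)] by blast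
  have "X (t i) = inverse (Q $$ (a, y)) \<cdot>\<^sub>m (Q $$ (a, y) \<cdot>\<^sub>m X (t i))"
    using y by (simp add: smult_smult_mat)
  also have "\<dots> = (inverse (Q $$ (a, y)) * (Q * A) $$ (b, y) * q) \<cdot>\<^sub>m X (t j \<otimes> v)"
    unfolding XX[symmetric] q by (simp add: smult_smult_mat mult_ac del: index_mult_mat(1))
  finally have ti: "t i = t j \<otimes> v" using A by (intro X_independent[of "t i" "t j \<otimes> v"]) auto
  \<comment> \<open>Excludes the alternative in which \<open>R_comp_corner\<close> says nothing
    about the degree.\<close>
  have "A \<noteq> 0\<^sub>m N N"
  proof
    assume "A = 0\<^sub>m N N"
    then have "\<phi> ?K = 0\<^sub>m nn nn" using A by (simp add: kron_zero_left[of _ d])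
    moreover have "?U \<noteq> 0\<^sub>m N N"
    proof
      assume "?U = 0\<^sub>m N N"
      from arg_cong[OF this, of "\<lambda>A. A $$ (a, b)"] show False using ab by (simp add: unit_mat_def)
    qed
    then have "?K \<noteq> 0\<^sub>m nn nn" using kron_nonzero[of ?U \<one>] by (simp add: X_one)
    ultimately show False using phi_nonzero Kc by blast
  qed
  then have "?h = inv (\<gamma> ! tau j) \<otimes> v \<otimes> (\<gamma> ! tau i)" using A by blast
  then have hh: "inv (\<gamma> ! i) \<otimes> (\<gamma> ! j) = inv (\<gamma> ! tau j) \<otimes> v \<otimes> (\<gamma> ! tau i)" using i j by simp
  define gi gj gi' gj' where g: "gi = \<gamma> ! i" "gj = \<gamma> ! j" "gi' = \<gamma> ! tau i" "gj' = \<gamma> ! tau j"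
  have gc: "gi \<in> carrier G" "gj \<in> carrier G" "gi' \<in> carrier G" "gj' \<in> carrier G" "v \<in> carrier G" "t j \<in> carrier G"
    using i j tau A by (auto simp: g)
  have "gj = gi \<otimes> (inv gi \<otimes> gj)" using gc by (simp add: m_assoc[symmetric])
  also have "\<dots> = gi \<otimes> (inv gj' \<otimes> v \<otimes> gi')" using hh by (simp add: g)
  finally have "gj \<otimes> gj' \<otimes> t j = gi \<otimes> (inv gj' \<otimes> v \<otimes> gi') \<otimes> gj' \<otimes> t j" by simp
  also have "\<dots> = gi \<otimes> gi' \<otimes> (t j \<otimes> v) \<otimes> (gj' \<otimes> inv gj')"
  proof -
    define w where "w = inv gj'"
    have "w \<in> carrier G" using gc by (simp add: w_def)
    then show ?thesis using gc unfolding w_def[symmetric] by (simp add: m_ac)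
  qed
  also have "\<dots> = gi \<otimes> gi' \<otimes> t i" using gc by (simp add: ti)
  finally show ?thesis by (simp add: g)
qed

text \<open>In a commutative group \<open>\<gamma> ! i \<otimes> \<gamma> ! tau i\<close> is the
  same for \<open>i\<close> and \<open>tau i\<close>, so it cancels in
  \<open>degree_relation\<close>.\<close>

lemma t_tau: "i < s \<Longrightarrow> t (tau i) = t i"
proof -
  assume i: "i < s"
  have "\<gamma> ! i \<otimes> \<gamma> ! tau i \<otimes> t i = \<gamma> ! i \<otimes> \<gamma> ! tau i \<otimes> t (tau i)"
    using degree_relation[OF i tau(1)[OF i]] i tau[OF i] by (simp add: m_comm)
  then show ?thesis using i tau[OF i] by simp
qed

text \<open>\<open>P' * P\<^sup>T\<close> commutes with the identity component, because \<open>\<phi> \<circ> \<phi>\<close> is the identity there.\<close>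

lemma ex_nu: "\<exists>\<nu>. \<forall>a<N. \<forall>b<N. Q $$ (b, a) = \<nu> (blk b) * Q $$ (a, b)"
proof -
  \<comment> \<open>\<open>\<phi> (\<phi> K)\<close> is the conjugate of \<open>K\<close> by
    \<open>Z\<close>, so \<open>Z\<close> commutes with every \<open>K\<close> in the identity
    component.\<close>
  define Z where "Z = P' * transpose_mat P"
  have PT: "transpose_mat P \<in> carrier_mat nn nn" by simp
  have Z: "Z \<in> carrier_mat nn nn" unfolding Z_def by (rule mult_carrier_mat[OF P'(1) PT])
  have PZ: "P * Z = transpose_mat P"
    unfolding Z_def assoc_mult_mat[OF row_kron_carrier P'(1) PT, symmetric] P'(2) by simp
  have comm: "Z * K = K * Z" if K: "K \<in> R \<one>" for K
  proof -
    have Kc: "K \<in> carrier_mat nn nn" using R_comp_carrier[OF K] by (simp add: n_def)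
    have \<phi>Kc: "transpose_mat (\<phi> K) \<in> carrier_mat nn nn" using phi_carrier[OF Kc] by simp
    have 1: "P * K = transpose_mat (\<phi> K) * P"
      using P_phi[OF phi_carrier[OF Kc]] involutive[OF K] by simp
    have "transpose_mat (P * \<phi> K) = transpose_mat (transpose_mat K * P)" using P_phi[OF Kc] by simp
    then have 2: "transpose_mat (\<phi> K) * transpose_mat P = transpose_mat P * K"
      unfolding transpose_mult[OF row_kron_carrier phi_carrier[OF Kc]]
        transpose_mult[OF transpose_carrier_mat[THEN iffD2, OF Kc] row_kron_carrier] by simp
    have "K * Z = (P' * P) * (K * Z)" unfolding P'(3) using left_mult_one_mat[OF mult_carrier_mat[OF Kc Z]] by simp
    also have "\<dots> = P' * ((P * K) * Z)"
      unfolding assoc_mult_mat[OF P'(1) row_kron_carrier mult_carrier_mat[OF Kc Z]]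
        assoc_mult_mat[OF row_kron_carrier Kc Z] ..
    also have "\<dots> = P' * (transpose_mat (\<phi> K) * (P * Z))"
      unfolding 1 assoc_mult_mat[OF \<phi>Kc row_kron_carrier Z] ..
    also have "\<dots> = P' * (transpose_mat P * K)" unfolding PZ 2 ..
    also have "\<dots> = Z * K" unfolding Z_def assoc_mult_mat[OF P'(1) PT Kc] ..
    finally show ?thesis by simp
  qed
  \<comment> \<open>Commuting with the matrix unit \<open>(a, b)\<close> of a diagonal block,
    written entrywise.\<close>
  have unit: "(if y = b then Z $$ (x * d + u, a * d + v) else 0) = (if x = a then Z $$ (b * d + u, y * d + v) else 0)"
    if ab: "a < N" "b < N" "blk a = blk b" and xy: "x < N" "y < N" "u < d" "v < d" for a b x y u v
  proof -
    let ?K = "kron (unit_mat N a b) (1\<^sub>m d) :: 'a mat"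
    have "?K \<in> R \<one>"
      using kron_corner_R_T[of "blk a" "unit_mat N a b" \<one>] corner_unit_mat[OF ab(1,2)] ab blk_less by (simp add: X_one)
    then have *: "(Z * ?K) $$ (x * d + u, y * d + v) = (?K * Z) $$ (x * d + u, y * d + v)" using comm by simp
    have "(Z * ?K) $$ (x * d + u, y * d + v) =
        (\<Sum>c<N. \<Sum>w<d. if c = a \<and> w = v then (if y = b then Z $$ (x * d + u, a * d + v) else 0) else 0)"
      unfolding mult_kron_index(1)[OF Z unit_mat_carrier one_carrier_mat xy]
      using xy ab by (intro sum.cong refl) (auto simp: unit_mat_def)
    also have "\<dots> = (\<Sum>c<N. if c = a then (\<Sum>w<d. if w = v then (if y = b then Z $$ (x * d + u, a * d + v) else 0) else 0) else 0)"
      by (intro sum.cong) auto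
    finally have l: "(Z * ?K) $$ (x * d + u, y * d + v) = (if y = b then Z $$ (x * d + u, a * d + v) else 0)"
      using xy ab by simp
    have "(?K * Z) $$ (x * d + u, y * d + v) =
        (\<Sum>c<N. \<Sum>w<d. if c = b \<and> w = u then (if x = a then Z $$ (b * d + u, y * d + v) else 0) else 0)"
      unfolding mult_kron_index(2)[OF Z unit_mat_carrier one_carrier_mat xy]
      using xy ab by (intro sum.cong refl) (auto simp: unit_mat_def)
    also have "\<dots> = (\<Sum>c<N. if c = b then (\<Sum>w<d. if w = u then (if x = a then Z $$ (b * d + u, y * d + v) else 0) else 0) else 0)"
      by (intro sum.cong) auto
    finally have "(?K * Z) $$ (x * d + u, y * d + v) = (if x = a then Z $$ (b * d + u, y * d + v) else 0)"
      using xy ab by simp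
    then show ?thesis using l * by simp
  qed
  \<comment> \<open>By \<open>unit\<close>, the diagonal slices of \<open>Z\<close> agree within a
    block and the other slices vanish; a chosen row of the block represents them.\<close>
  define z where "z i = slice d Z (SOME a. a < N \<and> blk a = i) (SOME a. a < N \<and> blk a = i)" for i
  have zc: "z i \<in> carrier_mat d d" for i by (simp add: z_def)
  have Z_form: "Z = row_kron N d (1\<^sub>m N) (\<lambda>a. z (blk a))"
  proof (rule eq_mat_blockwise[OF Z])
    fix a b u v assume ab: "a < N" "b < N" "u < d" "v < d"
    define r where "r = (SOME b. b < N \<and> blk b = blk a)"
    have "\<exists>b. b < N \<and> blk b = blk a" using ab by blast
    then have r: "r < N \<and> blk r = blk a" unfolding r_def by (rule someI_ex)
    show "Z $$ (a * d + u, b * d + v) = row_kron N d (1\<^sub>m N) (\<lambda>a. z (blk a)) $$ (a * d + u, b * d + v)"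
    proof (cases "a = b")
      case True
      have "Z $$ (a * d + u, a * d + v) = Z $$ (r * d + u, r * d + v)"
        using unit[of a r a r u v] r ab by simp
      then show ?thesis using True ab by (simp add: row_kron_index z_def r_def slice_def)
    next
      case False
      then have "Z $$ (a * d + u, b * d + v) = 0" using unit[of b b a b u v] ab by simp
      then show ?thesis using False ab by (simp add: row_kron_index)
    qed
  qed simp
  have "\<forall>u. \<exists>r. u \<in> T \<longrightarrow> r \<noteq> 0 \<and> transpose_mat (X u) = r \<cdot>\<^sub>m X u" using X_transpose by blast
  then obtain r where r: "r u \<noteq> 0" "transpose_mat (X u) = r u \<cdot>\<^sub>m X u" if "u \<in> T" for u by metis
  have L: "P * Z = row_kron N d (Q * 1\<^sub>m N) (\<lambda>a. X (t (blk a)) * z (tau (blk a)))"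
    unfolding Z_form by (rule row_kron_mult) (use Q zc supp in auto)
  have Rt: "transpose_mat P = row_kron N d (transpose_mat Q) (\<lambda>a. r (t (blk a)) \<cdot>\<^sub>m X (t (blk a)))"
  proof (rule row_kron_transpose[OF Q(1) X_carrier])
    fix a b assume ab: "a < N" "b < N" "Q $$ (b, a) \<noteq> 0"
    then have "t (blk a) = t (blk b)" using supp[OF ab(2,1,3)] t_tau[OF blk_less] by simp
    then show "transpose_mat (X (t (blk b))) = r (t (blk a)) \<cdot>\<^sub>m X (t (blk a))" using r by simp
  qed
  \<comment> \<open>Entries of \<open>P * Z = P^T\<close>. Division by a nonzero entry of
    \<open>X (t i)\<close> will turn them into a relation between \<open>Q $$ (a, b)\<close> and
    \<open>Q $$ (b, a)\<close> whose factor depends only on the block of \<open>a\<close>.\<close>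
  have rel: "Q $$ (a, b) * (X (t (blk a)) * z (tau (blk a))) $$ (u, v) = Q $$ (b, a) * (r (t (blk a)) * X (t (blk a)) $$ (u, v))"
    if ab: "a < N" "b < N" "u < d" "v < d" for a b u v
  proof -
    have "(Q * 1\<^sub>m N) $$ (a, b) * (X (t (blk a)) * z (tau (blk a))) $$ (u, v) =
       transpose_mat Q $$ (a, b) * (r (t (blk a)) \<cdot>\<^sub>m X (t (blk a))) $$ (u, v)"
      using arg_cong[OF PZ, of "\<lambda>A. A $$ (a * d + u, b * d + v)"]
      unfolding L Rt row_kron_index[OF ab] .
    then show ?thesis using ab Q(1) unfolding right_mult_one_mat[OF Q(1)] by (simp del: index_mult_mat(1))
  qed
  have "\<exists>\<nu>. \<forall>a<N. \<forall>b<N. blk a = i \<longrightarrow> Q $$ (b, a) = \<nu> * Q $$ (a, b)" for i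
  proof -
    obtain u v where uv: "u < d" "v < d" "X (t i) $$ (u, v) \<noteq> 0"
      using nonzero_mat_entry[OF X_carrier X_nonzero[OF t_T]] by blast
    let ?\<nu> = "(X (t i) * z (tau i)) $$ (u, v) / (r (t i) * X (t i) $$ (u, v))"
    have "Q $$ (b, a) = ?\<nu> * Q $$ (a, b)" if "a < N" "b < N" "blk a = i" for a b
      using rel[OF that(1,2) uv(1,2)] that r(1)[OF t_T] uv(3) by (simp add: field_simps del: index_mult_mat(1))
    then show ?thesis by blast
  qed
  then obtain \<nu> where \<nu>: "\<forall>a<N. \<forall>b<N. blk a = i \<longrightarrow> Q $$ (b, a) = \<nu> i * Q $$ (a, b)" for i by metis
  \<comment> \<open>Where \<open>Q $$ (a, b)\<close> is nonzero, the block of \<open>a\<close> is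
    \<open>tau\<close> of that of \<open>b\<close>; so the factor may be indexed by the block of
    \<open>b\<close>.\<close>
  have "Q $$ (b, a) = \<nu> (tau (blk b)) * Q $$ (a, b)" if ab: "a < N" "b < N" for a b
  proof -
    have *: "Q $$ (b, a) = \<nu> (blk a) * Q $$ (a, b)" using \<nu> ab by blast
    show ?thesis
    proof (cases "Q $$ (a, b) = 0")
      case True
      then show ?thesis using * by simp
    next
      case False
      then have "tau (blk b) = blk a" using supp[OF ab] tau(3)[OF blk_less[OF ab(1)]] by simp
      then show ?thesis by (simp only: *)
    qed
  qed
  then show ?thesis by (intro exI[of _ "\<lambda>i. \<nu> (tau i)"]) blast
qed

end

section \<open>Isomorphisms of graded matrix algebras\<close>

text \<open>The inverse of the coordinates \<open>block_of\<close> and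
  \<open>offset\<close>.\<close>

definition position :: "nat list \<Rightarrow> nat \<Rightarrow> nat \<Rightarrow> nat" where
  "position ks p x = sum_list (take p ks) + x"

lemma position:
  assumes "p < length ks" "x < ks ! p"
  shows "position ks p x < sum_list ks" "block_of ks (position ks p x) = p" "offset ks (position ks p x) = x"
proof -
  have "position ks p x < sum_list ks \<and> block_of ks (position ks p x) = p \<and> offset ks (position ks p x) = x"
    using assms
  proof (induction ks arbitrary: p)
    case (Cons k ks)
    show ?case
    proof (cases p)
      case (Suc p')
      then have "position ks p' x < sum_list ks \<and> block_of ks (position ks p' x) = p' \<and> offset ks (position ks p' x) = x"
        using Cons by auto
      then show ?thesis by (simp add: Suc position_def)
    qed (use Cons in \<open>simp add: position_def\<close>)
  qed simp
  then show "position ks p x < sum_list ks" "block_of ks (position ks p x) = p" "offset ks (position ks p x) = x"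
    by auto
qed

lemma position_block_offset:
  assumes "a < sum_list ks"
  shows "position ks (block_of ks a) (offset ks a) = a"
  by (rule block_offset_inj[OF position(1) assms position(2,3)])
    (rule block_of_less[OF assms] offset_less[OF assms])+

lemma mat_span_linear:
  assumes S: "S \<subseteq> carrier_mat n n" and M: "M \<in> mat_span n S" and M': "M' \<in> mat_span n S"
  shows "c \<cdot>\<^sub>m M + M' \<in> mat_span n S" "M \<in> carrier_mat n n"
proof -
  have car: "M \<in> carrier_mat n n" if "M \<in> mat_span n S" for M
    using that by (induction rule: mat_span.induct) (use S in auto)
  show "M \<in> carrier_mat n n" by (rule car[OF M])
  show "c \<cdot>\<^sub>m M + M' \<in> mat_span n S"
    using M
  proof (induction rule: mat_span.induct)
    case zero
    have "c \<cdot>\<^sub>m 0\<^sub>m n n = (0\<^sub>m n n :: 'a mat)" by (rule eq_matI) auto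
    then have "c \<cdot>\<^sub>m 0\<^sub>m n n + M' = M'" using car[OF M'] by simp
    then show ?case using M' by simp
  next
    case (add A B c1)
    have A: "A \<in> carrier_mat n n" using S add by blast
    have "c \<cdot>\<^sub>m (c1 \<cdot>\<^sub>m A + B) + M' = (c * c1) \<cdot>\<^sub>m A + (c \<cdot>\<^sub>m B + M')"
      using A car[OF add.hyps(2)] car[OF M'] by (intro eq_matI) (auto simp: distrib_left mult.assoc add.assoc)
    then show ?case using add by (auto intro: mat_span.add)
  qed
qed


lemma conj_mat_alg_iso:
  fixes V :: "'a::field mat"
  assumes V: "V \<in> carrier_mat n n" "W \<in> carrier_mat n n" "W * V = 1\<^sub>m n" "V * W = 1\<^sub>m n"
  shows "mat_alg_iso n n (\<lambda>Y. V * Y * W)"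
proof -
  have a: "A * (B * C) = A * B * C" if "A \<in> carrier_mat n n" "B \<in> carrier_mat n n" "C \<in> carrier_mat n n"
    for A B C :: "'a mat"
    using that by (simp add: assoc_mult_mat[of _ n n _ n _ n])
  have cl: "A * B \<in> carrier_mat n n" if "A \<in> carrier_mat n n" "B \<in> carrier_mat n n" for A B :: "'a mat"
    using that by (rule mult_carrier_mat)
  have r1: "A * V * W = A" "A * W * V = A" if "A \<in> carrier_mat n n" for A
    using that V by (simp_all add: assoc_mult_mat[of _ n n _ n _ n])
  have l1: "V * W * A = A" "W * V * A = A" if "A \<in> carrier_mat n n" for A
    using that V by simp_all
  have "bij_betw (\<lambda>Y. V * Y * W) (carrier_mat n n) (carrier_mat n n)"
  proof (rule bij_betw_byWitness[where f' = "\<lambda>Y. W * Y * V"])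
    show "\<forall>Y\<in>carrier_mat n n. W * (V * Y * W) * V = Y" "\<forall>Y\<in>carrier_mat n n. V * (W * Y * V) * W = Y"
      using V by (simp_all add: a cl l1 r1 del: assoc_mult_mat)
  qed (use V in \<open>auto intro!: cl\<close>)
  moreover have "mat_linear n (\<lambda>Y. V * Y * W)"
    unfolding mat_linear_def
  proof (intro conjI ballI allI)
    fix Y Z :: "'a mat" assume YZ: "Y \<in> carrier_mat n n" "Z \<in> carrier_mat n n"
    then show "V * (Y + Z) * W = V * Y * W + V * Z * W"
      using V by (simp add: mult_add_distrib_mat[of _ n n _ n] add_mult_distrib_mat[of _ n n _ _ n] cl)
  next
    fix c and Y :: "'a mat" assume Y: "Y \<in> carrier_mat n n"
    then show "V * (c \<cdot>\<^sub>m Y) * W = c \<cdot>\<^sub>m (V * Y * W)"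
      using V by (simp add: mult_smult_distrib[of _ n n _ n] mult_smult_assoc_mat[of _ n n _ n] cl)
  qed
  moreover have "V * (Y * Z) * W = V * Y * W * (V * Z * W)" if "Y \<in> carrier_mat n n" "Z \<in> carrier_mat n n" for Y Z
    using V that by (simp add: a cl r1 del: assoc_mult_mat)
  ultimately show ?thesis by (simp add: mat_alg_iso_def)
qed

lemma mult_mat_nonzero_entry:
  fixes A :: "'a::semiring_1 mat"
  assumes "A \<in> carrier_mat n m" "B \<in> carrier_mat m r" "i < n" "j < r" "(A * B) $$ (i, j) \<noteq> 0"
  obtains k where "k < m" "A $$ (i, k) \<noteq> 0" "B $$ (k, j) \<noteq> 0"
proof (rule ccontr)
  assume "\<not> thesis"
  then have "A $$ (i, k) * B $$ (k, j) = 0" if "k < m" for k using that \<open>\<And>k. _ \<Longrightarrow> _ \<Longrightarrow> _ \<Longrightarrow> thesis\<close> by fastforce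
  then show False using assms by (simp add: index_mult_mat_sum[OF assms(1-4)] del: index_mult_mat)
qed

lemma (in graded_data) R_comp_linear:
  assumes "M \<in> R h" "M' \<in> R h"
  shows "c \<cdot>\<^sub>m M + M' \<in> R h"
proof -
  let ?S = "{kron (block_idem \<kappa> i * A * block_idem \<kappa> j) d |A d i j t.
        i < length \<kappa> \<and> j < length \<kappa> \<and> t \<in> T \<and>
        A \<in> carrier_mat (sum_list \<kappa>) (sum_list \<kappa>) \<and> d \<in> D_comp G \<beta> ab t \<and>
        h = inv\<^bsub>G\<^esub> (\<gamma> ! i) \<otimes>\<^bsub>G\<^esub> t \<otimes>\<^bsub>G\<^esub> (\<gamma> ! j)}"
  have "?S \<subseteq> carrier_mat n n"
    unfolding n_def D_comp_def by (auto intro!: kron_carrier)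
  then show ?thesis using mat_span_linear assms unfolding R_comp_def by blast
qed

text \<open>Conjugation by a monomial matrix of blocks \<open>X u\<close> changes the degrees \<open>\<gamma>\<close> by the \<open>u\<close> and permutes them.\<close>

lemma (in elementary_division_data) conj_R_comp:
  assumes A: "graded_data G T \<beta> ab \<kappa> \<gamma>" and B: "graded_data G T \<beta> ab \<kappa>' \<gamma>'"
    and N: "sum_list \<kappa> = N" "sum_list \<kappa>' = N"
    and \<rho>: "\<And>i. i < length \<kappa> \<Longrightarrow> \<rho> i < length \<kappa>'"
    and B1: "B1 \<in> carrier_mat N N" "\<And>a x. a < N \<Longrightarrow> x < N \<Longrightarrow> B1 $$ (a, x) \<noteq> 0 \<Longrightarrow> block_of \<kappa>' a = \<rho> (block_of \<kappa> x)"
    and B2: "B2 \<in> carrier_mat N N" "\<And>a x. a < N \<Longrightarrow> x < N \<Longrightarrow> B2 $$ (x, a) \<noteq> 0 \<Longrightarrow> block_of \<kappa>' a = \<rho> (block_of \<kappa> x)"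
    and u: "\<And>i. i < length \<kappa> \<Longrightarrow> u i \<in> T" "\<And>i. i < length \<kappa> \<Longrightarrow> \<gamma>' ! \<rho> i = \<gamma> ! i \<otimes> u i"
    and F1: "\<And>a. a < N \<Longrightarrow> F1 a \<in> carrier_mat d d"
      "\<And>a i. a < N \<Longrightarrow> i < length \<kappa> \<Longrightarrow> block_of \<kappa>' a = \<rho> i \<Longrightarrow> F1 a = c1 i \<cdot>\<^sub>m X (u i)"
    and F2: "\<And>x. x < N \<Longrightarrow> F2 x = c2 (block_of \<kappa> x) \<cdot>\<^sub>m X (u (block_of \<kappa> x))"
    and M: "M \<in> R_comp G T \<beta> ab \<kappa> \<gamma> h"
  shows "row_kron N d B1 F1 * M * row_kron N d B2 F2 \<in> R_comp G T \<beta> ab \<kappa>' \<gamma>' h"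
proof -
  interpret A: graded_data G T \<beta> ab \<kappa> \<gamma> by (rule A)
  interpret B: graded_data G T \<beta> ab \<kappa>' \<gamma>' by (rule B)
  let ?V = "row_kron N d B1 F1" and ?W = "row_kron N d B2 F2"
  have F2c: "F2 x \<in> carrier_mat d d" if "x < N" for x using F2[OF that] by simp
  have VW: "?V \<in> carrier_mat (N * d) (N * d)" "?W \<in> carrier_mat (N * d) (N * d)" by auto
  have nA: "A.n = N * d" "B.n = N * d" using A.n_def B.n_def N by auto
  \<comment> \<open>A generator in corner \<open>(i, j)\<close> with factor \<open>X t\<close>
    becomes a multiple of one in corner \<open>(\<rho> i, \<rho> j)\<close> with factor
    \<open>X (u i \<otimes> t \<otimes> u j)\<close>.\<close>
  have gen: "?V * kron (A.e i * K * A.e j) (X t) * ?W \<in> B.R h"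
    if K: "K \<in> carrier_mat N N" and ij: "i < length \<kappa>" "j < length \<kappa>" and t: "t \<in> T"
      and h: "h = inv (\<gamma> ! i) \<otimes> t \<otimes> (\<gamma> ! j)" for K i j t
  proof -
    let ?C = "A.e i * K * A.e j"
    have C: "?C \<in> carrier_mat N N" using A.corner_carrier[of K i j] K N by simp
    have Cij: "?C $$ (a, b) = (if block_of \<kappa> a = i \<and> block_of \<kappa> b = j then K $$ (a, b) else 0)" if "a < N" "b < N" for a b
      using A.corner_index[of K a b i j] K N that by simp
    obtain q1 where q1: "X (u i) * X t = q1 \<cdot>\<^sub>m X (u i \<otimes> t)" using X_mult u t ij by blast
    obtain q2 where q2: "X (u i \<otimes> t) * X (u j) = q2 \<cdot>\<^sub>m X (u i \<otimes> t \<otimes> u j)"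
      using X_mult[of "u i \<otimes> t" "u j"] u t ij by auto
    let ?t = "u i \<otimes> t \<otimes> u j"
    have 1: "?V * kron ?C (X t) = row_kron N d (B1 * ?C) (\<lambda>a. F1 a * X t)"
      unfolding kron_conv_row_kron[OF C X_carrier] by (rule row_kron_mult) (use B1 C F1 in auto)
    have B1C: "B1 * ?C \<in> carrier_mat N N" using B1(1) C by (rule mult_carrier_mat)
    have supp1: "block_of \<kappa>' a = \<rho> i \<and> block_of \<kappa> b = j" if ab: "a < N" "b < N" "(B1 * ?C) $$ (a, b) \<noteq> 0" for a b
    proof -
      obtain c where c: "c < N" "B1 $$ (a, c) \<noteq> 0" "?C $$ (c, b) \<noteq> 0"
        by (rule mult_mat_nonzero_entry[OF B1(1) C ab])
      have "block_of \<kappa> c = i" "block_of \<kappa> b = j" using c(3) Cij[OF c(1) ab(2)] by (auto split: if_splits)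
      then show ?thesis using B1(2)[OF ab(1) c(1,2)] by simp
    qed
    have FX: "F1 a * X t \<in> carrier_mat d d" if "a < N" for a by (rule mult_carrier_mat[OF F1(1)[OF that] X_carrier])
    have 2: "?V * kron ?C (X t) * ?W = row_kron N d (B1 * ?C * B2) (\<lambda>a. F1 a * X t * (c2 j \<cdot>\<^sub>m X (u j)))"
      unfolding 1
    proof (rule row_kron_mult[OF B1C B2(1)])
      show "F2 c = c2 j \<cdot>\<^sub>m X (u j)" if "a < N" "c < N" "(B1 * ?C) $$ (a, c) \<noteq> 0" for a c
        using F2[OF that(2)] supp1[OF that] by simp
    qed (auto intro: FX F2c)
    let ?BCB = "B1 * ?C * B2"
    have BCB: "?BCB \<in> carrier_mat N N" using B1C B2(1) by (rule mult_carrier_mat)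
    have supp2: "block_of \<kappa>' a = \<rho> i \<and> block_of \<kappa>' b = \<rho> j" if ab: "a < N" "b < N" "?BCB $$ (a, b) \<noteq> 0" for a b
    proof -
      obtain c where c: "c < N" "(B1 * ?C) $$ (a, c) \<noteq> 0" "B2 $$ (c, b) \<noteq> 0"
        by (rule mult_mat_nonzero_entry[OF B1C B2(1) ab])
      then show ?thesis using supp1[OF ab(1) c(1,2)] B2(2)[OF ab(2) c(1,3)] by simp
    qed
    have scal: "(c1 i \<cdot>\<^sub>m X (u i)) * X t * (c2 j \<cdot>\<^sub>m X (u j)) = (c1 i * q1 * c2 j * q2) \<cdot>\<^sub>m X ?t"
    proof -
      have "(c1 i \<cdot>\<^sub>m X (u i)) * X t = (c1 i * q1) \<cdot>\<^sub>m X (u i \<otimes> t)"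
        by (simp add: mult_smult_assoc_mat[OF X_carrier X_carrier] q1 smult_smult_mat)
      then show ?thesis
        by (simp add: mult_smult_assoc_mat[OF X_carrier smult_carrier_mat[OF X_carrier]]
            mult_smult_distrib[OF X_carrier X_carrier] q2 smult_smult_mat mult_ac)
    qed
    let ?q = "c1 i * q1 * c2 j * q2"
    have corner: "?BCB = B.e (\<rho> i) * ?BCB * B.e (\<rho> j)"
    proof (rule eq_matI)
      have D: "B.e (\<rho> i) * ?BCB * B.e (\<rho> j) \<in> carrier_mat N N" using B.corner_carrier[of ?BCB] BCB N by simp
      show "dim_row ?BCB = dim_row (B.e (\<rho> i) * ?BCB * B.e (\<rho> j))" "dim_col ?BCB = dim_col (B.e (\<rho> i) * ?BCB * B.e (\<rho> j))"
        using carrier_matD[OF D] carrier_matD[OF BCB] by simp_all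
      fix a b assume "a < dim_row (B.e (\<rho> i) * ?BCB * B.e (\<rho> j))" "b < dim_col (B.e (\<rho> i) * ?BCB * B.e (\<rho> j))"
      then have ab: "a < N" "b < N" using carrier_matD[OF D] by simp_all
      show "?BCB $$ (a, b) = (B.e (\<rho> i) * ?BCB * B.e (\<rho> j)) $$ (a, b)"
        using B.corner_index[of ?BCB a b "\<rho> i" "\<rho> j"] BCB N ab supp2[OF ab] by metis
    qed
    have "?V * kron ?C (X t) * ?W = row_kron N d ?BCB (\<lambda>_. ?q \<cdot>\<^sub>m X ?t)"
      unfolding 2
    proof (rule row_kron_cong)
      fix a b x y assume ab: "a < N" "b < N" "x < d" "y < d"
      show "?BCB $$ (a, b) * (F1 a * X t * (c2 j \<cdot>\<^sub>m X (u j))) $$ (x, y) = ?BCB $$ (a, b) * (?q \<cdot>\<^sub>m X ?t) $$ (x, y)"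
      proof (cases "?BCB $$ (a, b) = 0")
        case False
        then show ?thesis using F1(2)[OF ab(1) ij(1)] supp2[OF ab(1,2) False] scal by simp
      qed simp
    qed
    also have "\<dots> = ?q \<cdot>\<^sub>m kron (B.e (\<rho> i) * ?BCB * B.e (\<rho> j)) (X ?t)"
      unfolding corner[symmetric] kron_conv_row_kron[OF BCB smult_carrier_mat[OF X_carrier], symmetric]
      by (rule kron_smult(2)[OF BCB X_carrier])
    finally have eq: "?V * kron ?C (X t) * ?W = ?q \<cdot>\<^sub>m kron (B.e (\<rho> i) * ?BCB * B.e (\<rho> j)) (X ?t)" .
    \<comment> \<open>The shifts of the degrees and those of \<open>t\<close> cancel because
      \<open>u i\<close> and \<open>u j\<close> square to the identity.\<close>
    have "h = inv (\<gamma>' ! \<rho> i) \<otimes> ?t \<otimes> (\<gamma>' ! \<rho> j)"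
    proof -
      have c: "\<gamma> ! i \<in> carrier G" "\<gamma> ! j \<in> carrier G" "u i \<in> carrier G" "u j \<in> carrier G" "t \<in> carrier G"
        using ij u t by auto
      have "inv (\<gamma> ! i \<otimes> u i) = u i \<otimes> inv (\<gamma> ! i)" using c u ij by (simp add: inv_mult_group T_inv)
      then have "inv (\<gamma>' ! \<rho> i) \<otimes> ?t \<otimes> (\<gamma>' ! \<rho> j) = u i \<otimes> inv (\<gamma> ! i) \<otimes> (u i \<otimes> t \<otimes> u j) \<otimes> (\<gamma> ! j \<otimes> u j)"
        using u ij by simp
      also have "\<dots> = inv (\<gamma> ! i) \<otimes> t \<otimes> (\<gamma> ! j) \<otimes> (u i \<otimes> u i) \<otimes> (u j \<otimes> u j)"
      proof -
        define gi where "gi = inv (\<gamma> ! i)"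
        have "gi \<in> carrier G" using c by (simp add: gi_def)
        then show ?thesis using c unfolding gi_def[symmetric] by (simp add: m_ac)
      qed
      also have "\<dots> = inv (\<gamma> ! i) \<otimes> t \<otimes> (\<gamma> ! j)" using c u ij by (simp add: elementary)
      finally show ?thesis using h by simp
    qed
    then have "kron (B.e (\<rho> i) * ?BCB * B.e (\<rho> j)) (X ?t) \<in> B.R h"
      using \<rho> ij t u BCB N by (intro B.R_comp_generator) auto
    moreover have "0\<^sub>m (N * d) (N * d) \<in> B.R h"
      unfolding R_comp_def nA by (rule mat_span.zero)
    ultimately have "?q \<cdot>\<^sub>m kron (B.e (\<rho> i) * ?BCB * B.e (\<rho> j)) (X ?t) + 0\<^sub>m (N * d) (N * d) \<in> B.R h"
      by (rule B.R_comp_linear)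
    then show ?thesis
      unfolding eq using kron_carrier[OF B.corner_carrier X_carrier, of ?BCB] BCB N by simp
  qed
  show ?thesis
    using M unfolding R_comp_def[of _ _ _ _ \<kappa>]
  proof (induction rule: mat_span.induct)
    case zero
    have "?V * 0\<^sub>m A.n A.n * ?W = 0\<^sub>m B.n B.n"
      unfolding nA right_mult_zero_mat[OF VW(1)] left_mult_zero_mat[OF VW(2)] ..
    then show ?case unfolding R_comp_def by (simp add: mat_span.zero)
  next
    case (add K M' c)
    obtain K' D i j t where K: "K = kron (A.e i * K' * A.e j) D" and K': "K' \<in> carrier_mat N N"
      and D: "D \<in> D_comp G \<beta> ab t" and ij: "i < length \<kappa>" "j < length \<kappa>" "t \<in> T" "h = inv (\<gamma> ! i) \<otimes> t \<otimes> (\<gamma> ! j)"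
      using add.hyps(1) N by blast
    obtain q where q: "D = q \<cdot>\<^sub>m X t" using D by (auto simp: D_comp_def)
    let ?K = "kron (A.e i * K' * A.e j) (X t)"
    have cc: "A.e i * K' * A.e j \<in> carrier_mat N N" using A.corner_carrier[of K' i j] K' N by simp
    have Kc: "?K \<in> carrier_mat (N * d) (N * d)" by (rule kron_carrier[OF cc X_carrier])
    have M': "M' \<in> carrier_mat (N * d) (N * d)"
      using add.hyps(2) A.R_comp_carrier[of M' h] unfolding R_comp_def nA by blast
    have cl: "Y * Z \<in> carrier_mat (N * d) (N * d)" if "Y \<in> carrier_mat (N * d) (N * d)" "Z \<in> carrier_mat (N * d) (N * d)" for Y Z :: "'a mat"
      using that by (rule mult_carrier_mat)
    have "K = q \<cdot>\<^sub>m ?K" unfolding K q by (rule kron_smult(2)[OF cc X_carrier])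
    then have "?V * (c \<cdot>\<^sub>m K + M') * ?W = (c * q) \<cdot>\<^sub>m (?V * ?K * ?W) + ?V * M' * ?W"
      using VW Kc M' by (simp add: mult_add_distrib_mat[of _ "N * d" "N * d" _ "N * d"] add_mult_distrib_mat[of _ "N * d" "N * d" _ _ "N * d"]
          mult_smult_distrib[of _ "N * d" "N * d" _ "N * d"] mult_smult_assoc_mat[of _ "N * d" "N * d" _ "N * d"] cl smult_smult_mat)
    then show ?case using B.R_comp_linear[OF gen[OF K' ij] add.IH] by simp
  qed
qed

section \<open>The normal form\<close>

lemma length_concat_pairs: "length (concat (map (\<lambda>i. [f i, g i]) xs)) = 2 * length xs"
  by (induction xs) auto

lemma nth_concat_pairs:
  "j < length xs \<Longrightarrow> concat (map (\<lambda>i. [f i, g i]) xs) ! (2 * j) = f (xs ! j)"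
  "j < length xs \<Longrightarrow> concat (map (\<lambda>i. [f i, g i]) xs) ! Suc (2 * j) = g (xs ! j)"
proof (induction xs arbitrary: j)
  case (Cons x xs)
  { case 1 then show ?case using Cons(1)[of "j - 1"] by (cases j) auto }
  { case 2 then show ?case using Cons(2)[of "j - 1"] by (cases j) auto }
qed auto

lemma length_kappa_form: "l \<le> m \<Longrightarrow> m \<le> k \<Longrightarrow> length (kappa_form l m k q) = m + 2 * (k - m)"
  by (simp add: kappa_form_def length_concat_pairs del: upt_Suc)

lemma length_gamma_form: "m \<le> k \<Longrightarrow> length (gamma_form m k g g' g'') = m + 2 * (k - m)"
  by (simp add: gamma_form_def length_concat_pairs del: upt_Suc)

lemma nth_kappa_form:
  assumes "l \<le> m" "m \<le> k"
  shows "p < l \<Longrightarrow> kappa_form l m k q ! p = q (p + 1)"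
    and "l \<le> p \<Longrightarrow> p < m \<Longrightarrow> kappa_form l m k q ! p = 2 * q (p + 1)"
    and "j < k - m \<Longrightarrow> kappa_form l m k q ! (m + 2 * j) = q (m + 1 + j)"
    and "j < k - m \<Longrightarrow> kappa_form l m k q ! (m + 2 * j + 1) = q (m + 1 + j)"
proof -
  have len: "length (map q [1..<l + 1] @ map (\<lambda>i. 2 * q i) [l + 1..<m + 1]) = m" using assms by (simp del: upt_Suc)
  have nth: "kappa_form l m k q ! (m + r) = concat (map (\<lambda>i. [q i, q i]) [m + 1..<k + 1]) ! r" for r
    unfolding kappa_form_def append_assoc[symmetric] nth_append len by simp
  show "j < k - m \<Longrightarrow> kappa_form l m k q ! (m + 2 * j) = q (m + 1 + j)"
    unfolding nth by (subst nth_concat_pairs) (simp_all del: upt_Suc)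
  show "j < k - m \<Longrightarrow> kappa_form l m k q ! (m + 2 * j + 1) = q (m + 1 + j)"
    using nth[of "2 * j + 1"] nth_concat_pairs(2)[of j "[m + 1..<k + 1]" q q] by (simp del: upt_Suc)
  show "p < l \<Longrightarrow> kappa_form l m k q ! p = q (p + 1)"
    by (simp add: kappa_form_def nth_append del: upt_Suc)
  show "l \<le> p \<Longrightarrow> p < m \<Longrightarrow> kappa_form l m k q ! p = 2 * q (p + 1)"
    using diff_less_mono[of p m l] by (simp add: kappa_form_def nth_append del: upt_Suc)
qed

lemma nth_gamma_form:
  assumes "m \<le> k"
  shows "p < m \<Longrightarrow> gamma_form m k g g' g'' ! p = g (p + 1)"
    and "j < k - m \<Longrightarrow> gamma_form m k g g' g'' ! (m + 2 * j) = g' (m + 1 + j)"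
    and "j < k - m \<Longrightarrow> gamma_form m k g g' g'' ! (m + 2 * j + 1) = g'' (m + 1 + j)"
proof -
  have nth: "gamma_form m k g g' g'' ! (m + r) = concat (map (\<lambda>i. [g' i, g'' i]) [m + 1..<k + 1]) ! r" for r
    unfolding gamma_form_def nth_append by (simp del: upt_Suc)
  show "j < k - m \<Longrightarrow> gamma_form m k g g' g'' ! (m + 2 * j) = g' (m + 1 + j)"
    unfolding nth by (subst nth_concat_pairs) (simp_all del: upt_Suc)
  show "j < k - m \<Longrightarrow> gamma_form m k g g' g'' ! (m + 2 * j + 1) = g'' (m + 1 + j)"
    using nth[of "2 * j + 1"] nth_concat_pairs(2)[of j "[m + 1..<k + 1]" g' g''] by (simp del: upt_Suc)
  show "p < m \<Longrightarrow> gamma_form m k g g' g'' ! p = g (p + 1)"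
    by (simp add: gamma_form_def nth_append del: upt_Suc)
qed

locale ordered_form = antiaut_form G T \<beta> ab \<kappa> \<gamma> \<phi> Q t P'
  for G :: "('g, 'b) monoid_scheme" (structure) and T and \<beta> :: "'g \<Rightarrow> 'g \<Rightarrow> 'a::alg_closed_field" and ab \<kappa> \<gamma> \<phi> Q t P' +
  fixes \<pi> :: "nat \<Rightarrow> nat" and l m k :: nat and q :: "nat \<Rightarrow> nat" and g g' g'' :: "nat \<Rightarrow> 'g"
  assumes ordered: "ordered_by_antiaut G ab \<kappa> \<gamma> \<phi> \<pi> l m k q g g' g''"
begin

abbreviation "\<kappa>' \<equiv> kappa_form l m k q"
abbreviation "blk' \<equiv> block_of \<kappa>'"
abbreviation "off' \<equiv> offset \<kappa>'"

lemma le: "l \<le> m" "m \<le> k"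
  and pi_permutes: "\<pi> permutes {..<s}"
  and permute_kappa: "permute_list \<pi> \<kappa> = \<kappa>'"
  and permute_gamma: "permute_list \<pi> \<gamma> = gamma_form m k g g' g''"
  and odd_q: "i \<in> {1..l} \<Longrightarrow> odd (q i)"
  using ordered by (auto simp: ordered_by_antiaut_def)

lemma length_kappa': "length \<kappa>' = s"
  using arg_cong[OF permute_kappa, of length] by simp

lemma s_eq: "s = m + 2 * (k - m)"
  using length_kappa' length_kappa_form[OF le] by simp

lemma sum_kappa': "sum_list \<kappa>' = N"
  using mset_permute_list[OF pi_permutes] unfolding permute_kappa by (metis sum_mset_sum_list)

lemma pi_less: "p < s \<Longrightarrow> \<pi> p < s"
  using permutes_in_image[OF pi_permutes, of p] by simp

definition ip :: "nat \<Rightarrow> nat" where "ip = inv_into UNIV \<pi>"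

lemma ip: "ip (\<pi> p) = p" "\<pi> (ip i) = i" "i < s \<Longrightarrow> ip i < s"
proof -
  show "ip (\<pi> p) = p" "\<pi> (ip i) = i"
    unfolding ip_def using permutes_inj[OF pi_permutes] permutes_surj[OF pi_permutes]
    by (auto simp: inv_f_f surj_f_inv_f)
  then show "i < s \<Longrightarrow> ip i < s" using permutes_in_image[OF pi_permutes, of "ip i"] by simp
qed

lemma kappa'_nth: "p < s \<Longrightarrow> \<kappa>' ! p = \<kappa> ! \<pi> p"
  using permute_list_nth[OF pi_permutes, of p] unfolding permute_kappa by simp

lemma gamma_form_nth: "p < s \<Longrightarrow> gamma_form m k g g' g'' ! p = \<gamma> ! \<pi> p"
  using permute_list_nth[of \<pi> \<gamma> p] pi_permutes gamma unfolding permute_gamma by simp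

lemma kappa'_pos: "p < s \<Longrightarrow> 0 < \<kappa>' ! p"
  using kappa(2)[of "\<kappa> ! \<pi> p"] pi_less by (simp add: kappa'_nth)

lemma block_cases:
  assumes "p < s"
  obtains (fixed) "p < m" | (fst) j where "j < k - m" "p = m + 2 * j" | (snd) j where "j < k - m" "p = m + 2 * j + 1"
proof (cases "p < m")
  case False
  define j where "j = (p - m) div 2"
  have "p = m + 2 * j \<or> p = m + 2 * j + 1" using False by (auto simp: j_def)
  moreover have "j < k - m" using assms False by (auto simp: j_def s_eq)
  ultimately show ?thesis using fst snd by blast
qed (use fixed in blast)

text \<open>The involution \<open>tau\<close> read in the reordered positions, see
  \<open>tau_pi\<close>.\<close>

definition partner :: "nat \<Rightarrow> nat" where
  "partner p = (if p < m then p else if even (p - m) then p + 1 else p - 1)"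

lemma partner_simps [simp]:
  "p < m \<Longrightarrow> partner p = p" "partner (m + 2 * j) = m + 2 * j + 1" "partner (Suc (m + 2 * j)) = m + 2 * j"
  by (auto simp: partner_def)

lemma partner: "p < s \<Longrightarrow> partner p < s" "p < s \<Longrightarrow> partner (partner p) = p"
  by (erule block_cases; auto simp: s_eq)+

lemma tau_pi: "p < s \<Longrightarrow> tau (\<pi> p) = \<pi> (partner p)"
proof -
  assume p: "p < s"
  have "\<phi> (E (\<pi> p)) = E (\<pi> (partner p))"
    using p
  proof (cases rule: block_cases)
    case fixed
    then have "p + 1 \<in> {1..m}" by simp
    then have "\<phi> (E (\<pi> (p + 1 - 1))) = E (\<pi> (p + 1 - 1))"
      using ordered unfolding ordered_by_antiaut_def Let_def by blast
    then show ?thesis using fixed by simp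
  next
    case (fst j)
    then have "m + 1 + j \<in> {m + 1..k}" by simp
    then have "\<phi> (E (\<pi> (m + 2 * (m + 1 + j - m - 1)))) = E (\<pi> (m + 2 * (m + 1 + j - m - 1) + 1))"
      using ordered unfolding ordered_by_antiaut_def Let_def by blast
    then show ?thesis using fst by simp
  next
    case (snd j)
    then have "m + 1 + j \<in> {m + 1..k}" by simp
    then have "\<phi> (E (\<pi> (m + 2 * (m + 1 + j - m - 1) + 1))) = E (\<pi> (m + 2 * (m + 1 + j - m - 1)))"
      using ordered unfolding ordered_by_antiaut_def Let_def by blast
    then show ?thesis using snd by simp
  qed
  then have "E (tau (\<pi> p)) = E (\<pi> (partner p))" using tau(2)[OF pi_less[OF p]] by simp
  then show ?thesis by (rule E_inj) (intro tau(1) pi_less p)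
qed

text \<open>The degree shift at position \<open>p\<close>. Only the second member of a pair is
  shifted, by its \<open>t\<close>: since both members carry the same \<open>t\<close>, one extra
  factor \<open>X t\<close> turns the right factor of each of the two blocks into a scalar.\<close>

definition u' :: "nat \<Rightarrow> 'g" where
  "u' p = (if p < m \<or> even (p - m) then \<one> else t (\<pi> p))"

lemma u'_T [simp]: "u' p \<in> T"
  by (simp add: u'_def)

lemma u'_simps: "p < m \<Longrightarrow> u' p = \<one>" "u' (m + 2 * j) = \<one>" "u' (Suc (m + 2 * j)) = t (\<pi> (m + 2 * j + 1))"
  by (auto simp: u'_def)

definition h'' :: "nat \<Rightarrow> 'g" where
  "h'' i = g'' i \<otimes> t (\<pi> (m + 2 * (i - m - 1) + 1))"

abbreviation "\<gamma>' \<equiv> gamma_form m k g g' h''"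

lemma gamma'_nth: "p < s \<Longrightarrow> \<gamma>' ! p = \<gamma> ! \<pi> p \<otimes> u' p"
proof -
  assume p: "p < s"
  have c: "\<gamma> ! \<pi> p \<in> carrier G" using p pi_less by simp
  note * = nth_gamma_form[OF le(2), where g = g and g' = g']
  show ?thesis
    using p
  proof (cases rule: block_cases)
    case fixed
    then show ?thesis using *(1)[of p g''] *(1)[of p h''] gamma_form_nth[OF p] c by (simp add: u'_simps)
  next
    case (fst j)
    then show ?thesis using *(2)[of j g''] *(2)[of j h''] gamma_form_nth[OF p] c by (simp add: u'_simps)
  next
    case (snd j)
    then show ?thesis using *(3)[of j g''] *(3)[of j h''] gamma_form_nth[OF p] c by (simp add: u'_simps h''_def)
  qed
qed

text \<open>Multiplying the degrees by elements of \<open>T\<close> and reordering them keeps their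
  cosets distinct.\<close>

lemma graded': "graded_data G T \<beta> ab \<kappa>' \<gamma>'"
proof (unfold_locales)
  show "\<kappa>' \<noteq> []" using length_kappa' kappa by auto
  show "0 < x" if "x \<in> set \<kappa>'" for x
    using that kappa'_pos length_kappa' by (metis in_set_conv_nth)
  show len: "length \<gamma>' = length \<kappa>'" using length_kappa_form[OF le] length_gamma_form[OF le(2)] by simp
  show "set \<gamma>' \<subseteq> carrier G"
  proof
    fix x assume "x \<in> set \<gamma>'"
    then obtain p where "p < s" "x = \<gamma>' ! p" using len length_kappa' by (metis in_set_conv_nth)
    then show "x \<in> carrier G" using gamma'_nth pi_less by simp
  qed
  show "inv (\<gamma>' ! i) \<otimes> (\<gamma>' ! j) \<notin> T" if "i < length \<gamma>'" "j < length \<gamma>'" "i \<noteq> j" for i j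
  proof
    assume T: "inv (\<gamma>' ! i) \<otimes> (\<gamma>' ! j) \<in> T"
    have ij: "i < s" "j < s" using that len length_kappa' by auto
    define x y where "x = inv (\<gamma> ! \<pi> i)" and "y = \<gamma> ! \<pi> j"
    have c: "x \<in> carrier G" "y \<in> carrier G" using ij pi_less by (auto simp: x_def y_def)
    have "inv (\<gamma>' ! i) \<otimes> (\<gamma>' ! j) = (u' i \<otimes> x) \<otimes> (y \<otimes> u' j)"
      using ij pi_less by (simp add: gamma'_nth inv_mult_group T_inv x_def y_def)
    then have "u' i \<otimes> ((u' i \<otimes> x) \<otimes> (y \<otimes> u' j)) \<otimes> u' j \<in> T" using T by simp
    moreover have "u' i \<otimes> ((u' i \<otimes> x) \<otimes> (y \<otimes> u' j)) \<otimes> u' j = (u' i \<otimes> u' i) \<otimes> (u' j \<otimes> u' j) \<otimes> (x \<otimes> y)"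
      using c by (simp add: m_ac)
    ultimately have "x \<otimes> y \<in> T" using c by (simp add: elementary)
    moreover have "\<pi> i \<noteq> \<pi> j" using that ip(1) by metis
    ultimately show False using gamma(3)[of "\<pi> i" "\<pi> j"] ij pi_less gamma(1) by (simp add: x_def y_def)
  qed
qed

text \<open>The permutation of matrix indices induced by \<open>\<pi>\<close> on blocks, with
  offsets unchanged; \<open>fi\<close> is its inverse.\<close>

definition f :: "nat \<Rightarrow> nat" where
  "f a = position \<kappa> (\<pi> (blk' a)) (off' a)"

definition fi :: "nat \<Rightarrow> nat" where
  "fi x = position \<kappa>' (ip (blk x)) (offset \<kappa> x)"

lemma blk'_less: "a < N \<Longrightarrow> blk' a < s"
  using block_of_less[of a \<kappa>'] by (simp add: sum_kappa' length_kappa')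

lemma off'_less: "a < N \<Longrightarrow> off' a < \<kappa>' ! blk' a"
  using offset_less[of a \<kappa>'] by (simp add: sum_kappa')

lemma f:
  assumes "a < N"
  shows "f a < N" "blk (f a) = \<pi> (blk' a)" "offset \<kappa> (f a) = off' a" "fi (f a) = a"
proof -
  have *: "\<pi> (blk' a) < s" "off' a < \<kappa> ! \<pi> (blk' a)"
    using assms blk'_less pi_less off'_less by (auto simp flip: kappa'_nth)
  show "f a < N" and 1: "blk (f a) = \<pi> (blk' a)" and 2: "offset \<kappa> (f a) = off' a"
    unfolding f_def by (rule position[OF *])+
  show "fi (f a) = a" unfolding fi_def 1 2 ip(1)
    by (rule position_block_offset) (simp add: sum_kappa' assms)
qed

lemma fi:
  assumes "x < N"
  shows "fi x < N" "blk' (fi x) = ip (blk x)" "off' (fi x) = offset \<kappa> x" "f (fi x) = x"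
proof -
  have *: "ip (blk x) < length \<kappa>'" "offset \<kappa> x < \<kappa>' ! ip (blk x)"
    using assms ip(2,3) blk_less offset_less[OF assms] by (auto simp: length_kappa' kappa'_nth)
  show "fi x < N" and 1: "blk' (fi x) = ip (blk x)" and 2: "off' (fi x) = offset \<kappa> x"
    unfolding fi_def using position[OF *] by (auto simp: sum_kappa')
  show "f (fi x) = x" unfolding f_def 1 2 ip(2)
    by (rule position_block_offset[OF assms])
qed

lemma f_bij: "bij_betw f {..<N} {..<N}"
  by (rule bij_betw_byWitness[where f' = fi]) (auto simp: f fi)

definition Q' :: "nat \<Rightarrow> nat \<Rightarrow> 'a" where "Q' a b = Q $$ (f a, f b)"

lemma Q'_supp: "a < N \<Longrightarrow> b < N \<Longrightarrow> Q' a b \<noteq> 0 \<Longrightarrow> blk' b = partner (blk' a)"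
proof -
  assume ab: "a < N" "b < N" "Q' a b \<noteq> 0"
  then have "\<pi> (blk' b) = tau (\<pi> (blk' a))" using supp[of "f a" "f b"] f by (simp add: Q'_def)
  then have "\<pi> (blk' b) = \<pi> (partner (blk' a))" using tau_pi blk'_less ab by simp
  then show ?thesis using ip(1) by metis
qed

definition nu :: "nat \<Rightarrow> 'a" where
  "nu = (SOME \<nu>. \<forall>a<N. \<forall>b<N. Q $$ (b, a) = \<nu> (blk b) * Q $$ (a, b))"

lemma nu: "a < N \<Longrightarrow> b < N \<Longrightarrow> Q $$ (b, a) = nu (blk b) * Q $$ (a, b)"
  using someI_ex[OF ex_nu] unfolding nu_def by blast

definition nu' :: "nat \<Rightarrow> 'a" where "nu' p = nu (\<pi> p)"

lemma nu': "a < N \<Longrightarrow> b < N \<Longrightarrow> Q' b a = nu' (blk' b) * Q' a b"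
  unfolding Q'_def nu'_def using nu[of "f a" "f b"] f by simp

lemma Q'_row_nonzero: "a < N \<Longrightarrow> \<exists>b<N. Q' a b \<noteq> 0"
proof -
  assume "a < N"
  then obtain x where "x < N" "Q $$ (f a, x) \<noteq> 0" using Q_row_nonzero f by blast
  then show ?thesis using fi[of x] unfolding Q'_def by (intro exI[of _ "fi x"]) simp
qed

lemma block'_nonempty: "p < s \<Longrightarrow> \<exists>a<N. blk' a = p"
  using position[of p \<kappa>' 0] kappa'_pos[of p] by (auto simp: length_kappa' sum_kappa')

lemma nu'_nonzero: "p < s \<Longrightarrow> nu' p \<noteq> 0"
proof -
  assume "p < s"
  then obtain a where a: "a < N" "blk' a = p" using block'_nonempty by blast
  then obtain b where "b < N" "Q' a b \<noteq> 0" using Q'_row_nonzero by blast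
  then show ?thesis using nu'[of b a] a by auto
qed

text \<open>On a fixed block, transposing \<open>Q'\<close> twice multiplies it by the square of
  \<open>nu' p\<close>.\<close>

lemma nu'_cases: "p < m \<Longrightarrow> nu' p = 1 \<or> nu' p = - 1"
proof -
  assume p: "p < m"
  then obtain a where a: "a < N" "blk' a = p" using block'_nonempty[of p] s_eq by auto
  then obtain b where b: "b < N" "Q' a b \<noteq> 0" using Q'_row_nonzero by blast
  have bp: "blk' b = p" using Q'_supp[OF a(1) b] a p by simp
  have "Q' a b = nu' p * Q' b a" using nu'[OF b(1) a(1)] a by simp
  also have "Q' b a = nu' p * Q' a b" using nu'[OF a(1) b(1)] bp by simp
  finally have "nu' p * nu' p = 1" using b by simp
  then show ?thesis by (metis square_eq_1_iff power2_eq_square mult_1)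
qed

abbreviation "I p \<equiv> {a. a < N \<and> blk' a = p}"

lemma sum_block:
  fixes F :: "nat \<Rightarrow> 'a"
  assumes "\<And>x. x < N \<Longrightarrow> blk' x \<noteq> p \<Longrightarrow> F x = 0"
  shows "(\<Sum>x<N. F x) = (\<Sum>x\<in>I p. F x)"
  by (rule sum.mono_neutral_right) (use assms in auto)

definition Qi :: "'a mat" where
  "Qi = (SOME B. B \<in> carrier_mat N N \<and> Q * B = 1\<^sub>m N \<and> B * Q = 1\<^sub>m N)"

lemma Qi: "Qi \<in> carrier_mat N N" "Q * Qi = 1\<^sub>m N" "Qi * Q = 1\<^sub>m N"
proof -
  have "\<exists>B. B \<in> carrier_mat N N \<and> Q * B = 1\<^sub>m N \<and> B * Q = 1\<^sub>m N" using ex_inverse_mat[OF Q] by blast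
  then have "Qi \<in> carrier_mat N N \<and> Q * Qi = 1\<^sub>m N \<and> Qi * Q = 1\<^sub>m N" unfolding Qi_def by (rule someI_ex)
  then show "Qi \<in> carrier_mat N N" "Q * Qi = 1\<^sub>m N" "Qi * Q = 1\<^sub>m N" by auto
qed

lemma Q'_Qi: "a < N \<Longrightarrow> b < N \<Longrightarrow> (\<Sum>y<N. Q' a y * Qi $$ (f y, f b)) = (if a = b then 1 else 0)"
proof -
  assume ab: "a < N" "b < N"
  have "(\<Sum>y<N. Q' a y * Qi $$ (f y, f b)) = (\<Sum>y<N. Q $$ (f a, y) * Qi $$ (y, f b))"
    unfolding Q'_def using sum.reindex_bij_betw[OF f_bij, of "\<lambda>y. Q $$ (f a, y) * Qi $$ (y, f b)"] .
  also have "\<dots> = (Q * Qi) $$ (f a, f b)"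
    using ab f by (intro index_mult_mat_sum[OF Q(1) Qi(1), symmetric]) auto
  also have "\<dots> = (if f a = f b then 1 else 0)" using ab f by (simp add: Qi)
  also have "f a = f b \<longleftrightarrow> a = b" using ab f(4) by metis
  finally show ?thesis .
qed

text \<open>A fixed block is orthogonal to all other blocks, so a radical vector extended by zero is
  annihilated by the whole of \<open>Q'\<close> and vanishes by invertibility.\<close>

lemma nondeg_block: "p < m \<Longrightarrow> nondeg_on (I p) Q'"
  unfolding nondeg_on_def
proof (intro allI impI ballI)
  fix x a assume p: "p < m" and x: "\<forall>b\<in>I p. (\<Sum>a\<in>I p. x a * Q' a b) = 0" and a: "a \<in> I p"
  define w where "w c = (if blk' c = p then x c else 0)" for c
  have w: "(\<Sum>c<N. w c * Q' c b) = 0" if b: "b < N" for b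
  proof (cases "blk' b = p")
    case True
    have "(\<Sum>c<N. w c * Q' c b) = (\<Sum>c\<in>I p. w c * Q' c b)" by (rule sum_block) (simp add: w_def)
    also have "\<dots> = (\<Sum>c\<in>I p. x c * Q' c b)" by (intro sum.cong) (auto simp: w_def)
    finally show ?thesis using x True b by simp
  next
    case False
    have "w c * Q' c b = 0" if "c < N" for c
      using Q'_supp[OF that b] False p by (cases "Q' c b = 0") (auto simp: w_def)
    then show ?thesis by (intro sum.neutral) blast
  qed
  have "(\<Sum>b<N. (\<Sum>c<N. w c * Q' c b) * Qi $$ (f b, f a)) = (\<Sum>b<N. \<Sum>c<N. w c * (Q' c b * Qi $$ (f b, f a)))"
    by (simp add: sum_distrib_right mult.assoc)
  also have "\<dots> = (\<Sum>c<N. \<Sum>b<N. w c * (Q' c b * Qi $$ (f b, f a)))" by (rule sum.swap)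
  also have "\<dots> = (\<Sum>c<N. w c * (if c = a then 1 else 0))"
    using a by (intro sum.cong refl) (simp add: sum_distrib_left[symmetric] Q'_Qi)
  also have "\<dots> = w a" using a by (simp add: mult_if)
  finally have "w a = 0" using w by simp
  then show "x a = 0" using a by (simp add: w_def)
qed

lemma card_I: "p < s \<Longrightarrow> card (I p) = \<kappa>' ! p"
  using card_block[of p \<kappa>'] by (simp add: length_kappa' sum_kappa')

text \<open>A nondegenerate skew form lives on an even number of indices, so the blocks of odd size
  are symmetric and every skew block has the size of a symplectic matrix.\<close>

lemma skew_size: "p < m \<Longrightarrow> nu' p \<noteq> 1 \<Longrightarrow> nu' p = - 1 \<and> l \<le> p \<and> \<kappa>' ! p = 2 * q (p + 1)"
proof -
  assume p: "p < m" "nu' p \<noteq> 1"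
  have n1: "nu' p = - 1" using nu'_cases p by blast
  have "even (card (I p))"
  proof (rule skew_form_even[OF char_not_2 _ nondeg_block[OF p(1)]])
    show "Q' a b = - 1 * Q' b a" if "a \<in> I p" "b \<in> I p" for a b
      using nu'[of b a] that n1 by simp
  qed simp
  then have ev: "even (\<kappa>' ! p)" using card_I[of p] p s_eq by simp
  have "l \<le> p"
  proof (rule ccontr)
    assume "\<not> l \<le> p"
    then show False using ev nth_kappa_form(1)[OF le, of p q] odd_q[of "p + 1"] by simp
  qed
  then show ?thesis using n1 nth_kappa_form(2)[OF le] p by simp
qed

definition rho :: "'g \<Rightarrow> 'a" where
  "rho u = (SOME c. c \<noteq> 0 \<and> X u * X u = c \<cdot>\<^sub>m 1\<^sub>m d)"

lemma rho: "u \<in> T \<Longrightarrow> rho u \<noteq> 0" "u \<in> T \<Longrightarrow> X u * X u = rho u \<cdot>\<^sub>m 1\<^sub>m d"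
  using someI_ex[OF X_square] unfolding rho_def by blast+

text \<open>The normal form is a monomial matrix: its nonzero entries are \<open>coef a\<close> at \<open>(a, iota a)\<close>.\<close>

definition iota :: "nat \<Rightarrow> nat" where
  "iota a = (let p = blk' a in
     if p < m then if nu' p = 1 then a
       else if off' a < q (p + 1) then position \<kappa>' p (off' a + q (p + 1)) else position \<kappa>' p (off' a - q (p + 1))
     else position \<kappa>' (partner p) (off' a))"

text \<open>The factors \<open>1 / rho\<close> anticipate the scalars that remain when
  \<open>W\<close> turns the paired factors \<open>X t\<close> into multiples of the identity; after
  that multiplication the paired entries are 1 and \<open>mu\<close>.\<close>

definition coef :: "nat \<Rightarrow> 'a" where
  "coef a = (let p = blk' a in
     if p < m then if nu' p = 1 \<or> off' a < q (p + 1) then 1 else - 1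
     else if even (p - m) then 1 / rho (t (\<pi> p)) else nu' p / rho (t (\<pi> p)))"

lemma coef_nonzero: "a < N \<Longrightarrow> coef a \<noteq> 0"
  using blk'_less nu'_nonzero rho by (auto simp: coef_def Let_def)

lemma kappa'_partner: "p < s \<Longrightarrow> \<kappa>' ! partner p = \<kappa>' ! p"
  using block_size_tau[OF pi_less] by (simp add: kappa'_nth partner tau_pi)

lemma iota:
  assumes a: "a < N"
  shows "iota a < N" "blk' (iota a) = partner (blk' a)" "iota (iota a) = a"
    "m \<le> blk' a \<Longrightarrow> off' (iota a) = off' a"
    "blk' a < m \<Longrightarrow> nu' (blk' a) = 1 \<Longrightarrow> iota a = a"
    "blk' a < m \<Longrightarrow> nu' (blk' a) \<noteq> 1 \<Longrightarrow> off' (iota a) =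
      (if off' a < q (blk' a + 1) then off' a + q (blk' a + 1) else off' a - q (blk' a + 1))"
proof -
  let ?p = "blk' a"
  have p: "?p < s" "?p < length \<kappa>'" using blk'_less[OF a] by (auto simp: length_kappa')
  have pos: "position \<kappa>' r x < N" "blk' (position \<kappa>' r x) = r" "off' (position \<kappa>' r x) = x" if "r < s" "x < \<kappa>' ! r" for r x
    using position[of r \<kappa>' x] that by (auto simp: length_kappa' sum_kappa')
  have pos_off: "position \<kappa>' ?p (off' a) = a" by (rule position_block_offset) (simp add: sum_kappa' a)
  have "iota a < N \<and> blk' (iota a) = partner ?p \<and> iota (iota a) = a \<and>
    (m \<le> ?p \<longrightarrow> off' (iota a) = off' a) \<and> (?p < m \<longrightarrow> nu' ?p = 1 \<longrightarrow> iota a = a) \<and>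
    (?p < m \<longrightarrow> nu' ?p \<noteq> 1 \<longrightarrow> off' (iota a) =
      (if off' a < q (?p + 1) then off' a + q (?p + 1) else off' a - q (?p + 1)))"
  proof (cases "?p < m")
    case False
    have o: "off' a < \<kappa>' ! partner ?p" using off'_less[OF a] kappa'_partner[OF p(1)] by simp
    have "m \<le> partner ?p" using p(1) False by (cases rule: block_cases) auto
    then show ?thesis using pos[OF partner(1)[OF p(1)] o] partner[OF p(1)] False pos_off
      by (simp add: iota_def Let_def)
  next
    case True
    show ?thesis
    proof (cases "nu' ?p = 1")
      case True
      then show ?thesis using \<open>?p < m\<close> a by (simp add: iota_def Let_def)
    next
      case False
      let ?q = "q (?p + 1)"
      have size: "\<kappa>' ! ?p = 2 * ?q" using skew_size True False by blast
      show ?thesis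
      proof (cases "off' a < ?q")
        case 1: True
        have o: "off' a + ?q < \<kappa>' ! ?p" using 1 size by simp
        show ?thesis using pos[OF p(1) o] True False 1 pos_off by (simp add: iota_def Let_def)
      next
        case 2: False
        have o: "off' a - ?q < \<kappa>' ! ?p" "off' a - ?q < ?q" using 2 size off'_less[OF a] by auto
        show ?thesis using pos[OF p(1) o(1)] True False 2 o pos_off by (simp add: iota_def Let_def)
      qed
    qed
  qed
  then show "iota a < N" "blk' (iota a) = partner (blk' a)" "iota (iota a) = a"
    "m \<le> blk' a \<Longrightarrow> off' (iota a) = off' a"
    "blk' a < m \<Longrightarrow> nu' (blk' a) = 1 \<Longrightarrow> iota a = a"
    "blk' a < m \<Longrightarrow> nu' (blk' a) \<noteq> 1 \<Longrightarrow> off' (iota a) =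
      (if off' a < q (blk' a + 1) then off' a + q (blk' a + 1) else off' a - q (blk' a + 1))" by auto
qed

definition J :: "nat \<Rightarrow> nat \<Rightarrow> 'a" where
  "J a b = (if b = iota a then coef a else 0)"

lemma ex_block_transform:
  assumes p: "p < m"
  shows "\<exists>A. \<forall>a\<in>I p. \<forall>b\<in>I p. transform_form (I p) A Q' a b = J a b"
proof (cases "nu' p = 1")
  case True
  have "\<exists>A. \<forall>a\<in>I p. \<forall>b\<in>I p. transform_form (I p) A Q' a b = (if a = b then 1 else 0)"
  proof (rule symmetric_form_diagonalizable[OF char_not_2 _ nondeg_block[OF p]])
    show "Q' a b = Q' b a" if "a \<in> I p" "b \<in> I p" for a b
      using nu'[of b a] that True by simp
  qed simp
  moreover have "J a b = (if a = b then 1 else 0)" if "a \<in> I p" for a b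
  proof -
    have "coef a = 1" "iota a = a" using that p True iota(5)[of a] by (auto simp: coef_def)
    then show ?thesis by (cases "a = b") (auto simp: J_def)
  qed
  ultimately show ?thesis by simp
next
  case False
  have skew: "nu' p = - 1" "l \<le> p" "\<kappa>' ! p = 2 * q (p + 1)" using skew_size[OF p False] by auto
  \<comment> \<open>The first half of the offsets; \<open>iota\<close> shifts by half the block, so
    the hyperbolic pairs are laid out as in \<open>symplectic_mat\<close>.\<close>
  define H where "H = {a \<in> I p. off' a < q (p + 1)}"
  have iH: "iota a \<in> I p - H" if "a \<in> H" for a
    using that iota[of a] p False by (auto simp: H_def)
  have iH': "iota a \<in> H" if "a \<in> I p - H" for a
    using that iota[of a] p False skew off'_less[of a] by (auto simp: H_def)
  have inj: "inj_on iota (I p)" by (rule inj_on_inverseI[of _ iota]) (auto simp: iota)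
  have I_eq: "I p = H \<union> iota ` H"
  proof
    show "I p \<subseteq> H \<union> iota ` H"
    proof
      fix a assume a: "a \<in> I p"
      show "a \<in> H \<union> iota ` H"
      proof (cases "a \<in> H")
        case False
        then have "a = iota (iota a)" "iota a \<in> H" using a iH' iota(3)[of a] by auto
        then show ?thesis by blast
      qed simp
    qed
    show "H \<union> iota ` H \<subseteq> I p" using iH by (auto simp: H_def)
  qed
  have "\<exists>A. \<forall>a\<in>I p. \<forall>b\<in>I p. transform_form (I p) A Q' a b = symplectic_form H iota a b"
  proof (rule skew_form_symplectic[OF char_not_2 _ _ _ I_eq nondeg_block[OF p]])
    show "finite H" by (simp add: H_def)
    show "inj_on iota H" by (rule inj_on_subset[OF inj]) (auto simp: H_def)
    show "H \<inter> iota ` H = {}" using iH by auto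
    show "Q' a b = - 1 * Q' b a" if "a \<in> I p" "b \<in> I p" for a b
      using nu'[of b a] that skew(1) by simp
  qed
  moreover have "J a b = symplectic_form H iota a b" if ab: "a \<in> I p" "b \<in> I p" for a b
  proof (cases "a \<in> H")
    case True
    then have "\<not> (b \<in> H \<and> a = iota b)" using iH by auto
    then show ?thesis using True ab p by (auto simp: J_def symplectic_form_def coef_def H_def Let_def)
  next
    case aH: False
    have "b = iota a \<longleftrightarrow> a = iota b" using iota(3) ab by auto
    moreover have "b \<in> H" if "b = iota a" using iH'[of a] ab aH that by blast
    moreover have "coef a = - 1" using aH ab p False by (auto simp: coef_def H_def Let_def)
    ultimately show ?thesis using aH by (auto simp: J_def symplectic_form_def)
  qed
  ultimately show ?thesis by simp
qed

text \<open>Fixed blocks are brought to normal form one by one. In a pair, the first member keeps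
  its basis and the second is transformed by the inverse of the block of \<open>Q'\<close>, up to
  \<open>rho\<close>; through \<open>nu'\<close> this settles the transposed block as well.\<close>

lemma ex_transform:
  "\<exists>A. (\<forall>x b. A x b \<noteq> 0 \<longrightarrow> blk' x = blk' b) \<and>
     (\<forall>a<N. \<forall>b<N. (\<Sum>x<N. \<Sum>y<N. A x a * Q' x y * A y b) = J a b)"
proof -
  define C where "C p = (SOME A. \<forall>a\<in>I p. \<forall>b\<in>I p. transform_form (I p) A Q' a b = J a b)" for p
  have C: "\<forall>a\<in>I p. \<forall>b\<in>I p. transform_form (I p) (C p) Q' a b = J a b" if "p < m" for p
    using someI_ex[OF ex_block_transform[OF that]] unfolding C_def .
  \<comment> \<open>In the last case column \<open>b\<close> of \<open>A\<close> is the column of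
    the inverse of \<open>Q'\<close> at the partner index \<open>iota b\<close>, so multiplying by
    \<open>Q'\<close> leaves a single entry, in row \<open>iota b\<close>.\<close>
  define A where "A x b = (if blk' x = blk' b then
      if blk' b < m then C (blk' b) x b else if even (blk' b - m) then if x = b then 1 else 0
      else Qi $$ (f x, f (iota b)) / rho (t (\<pi> (blk' b))) else 0)" for x b
  have supp_A: "A x b \<noteq> 0 \<Longrightarrow> blk' x = blk' b" for x b by (auto simp: A_def split: if_splits)
  have "(\<Sum>x<N. \<Sum>y<N. A x a * Q' x y * A y b) = J a b" if ab: "a < N" "b < N" for a b
  proof (cases "blk' b = partner (blk' a)")
    case False
    have zero: "A x a * Q' x y * A y b = 0" if "x < N" "y < N" for x y
      using Q'_supp[OF that] supp_A[of x a] supp_A[of y b] False by fastforce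
    have "(\<Sum>x<N. \<Sum>y<N. A x a * Q' x y * A y b) = 0"
      by (intro sum.neutral ballI zero) simp_all
    moreover have "J a b = 0" using False iota(2)[OF ab(1)] by (auto simp: J_def)
    ultimately show ?thesis by simp
  next
    case partner_ab: True
    have p: "blk' a < s" using blk'_less ab by simp
    show ?thesis
      using p
    proof (cases rule: block_cases)
      case fixed
      let ?p = "blk' a"
      have bp: "blk' b = ?p" using partner_ab fixed by simp
      have "(\<Sum>x<N. \<Sum>y<N. A x a * Q' x y * A y b) = (\<Sum>x\<in>I ?p. \<Sum>y<N. A x a * Q' x y * A y b)"
      proof (rule sum_block)
        fix x assume "blk' x \<noteq> ?p"
        then have "A x a = 0" using supp_A by blast
        then show "(\<Sum>y<N. A x a * Q' x y * A y b) = 0" by simp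
      qed
      also have "\<dots> = (\<Sum>x\<in>I ?p. \<Sum>y\<in>I ?p. A x a * Q' x y * A y b)"
      proof (rule sum.cong[OF refl], rule sum_block)
        fix x y assume "blk' y \<noteq> ?p"
        then have "A y b = 0" using supp_A bp by metis
        then show "A x a * Q' x y * A y b = 0" by simp
      qed
      also have "\<dots> = transform_form (I ?p) (C ?p) Q' a b"
        unfolding transform_form_def using fixed bp by (intro sum.cong refl) (auto simp: A_def)
      finally show ?thesis using C[OF fixed] ab bp by simp
    next
      case (fst j)
      have bp: "blk' b = Suc (m + 2 * j)" using partner_ab fst by simp
      have ib: "iota b < N" "blk' (iota b) = blk' a" using iota(1,2)[OF ab(2)] fst bp by auto
      have "(\<Sum>x<N. \<Sum>y<N. A x a * Q' x y * A y b) = (\<Sum>x<N. if x = a then \<Sum>y<N. Q' a y * A y b else 0)"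
        using fst by (intro sum.cong refl) (auto simp: A_def)
      also have "\<dots> = (\<Sum>y<N. Q' a y * A y b)" using ab by simp
      also have "\<dots> = (\<Sum>y<N. Q' a y * Qi $$ (f y, f (iota b))) / rho (t (\<pi> (blk' b)))"
        unfolding sum_divide_distrib
      proof (rule sum.cong[OF refl])
        fix y assume "y \<in> {..<N}"
        then show "Q' a y * A y b = Q' a y * Qi $$ (f y, f (iota b)) / rho (t (\<pi> (blk' b)))"
          using Q'_supp[OF ab(1), of y] bp fst by (cases "Q' a y = 0") (auto simp: A_def)
      qed
      also have "\<dots> = (if a = iota b then 1 else 0) / rho (t (\<pi> (blk' b)))"
        using ab ib by (simp add: Q'_Qi)
      also have "\<dots> = J a b"
      proof -
        \<comment> \<open>Both members of a pair have the same \<open>t\<close>, so the scalar may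
          be indexed by either of them.\<close>
        have "t (\<pi> (blk' b)) = t (\<pi> (blk' a))"
          using t_tau[OF pi_less[OF p]] tau_pi[OF p] partner_ab by simp
        moreover have "b = iota a \<longleftrightarrow> a = iota b" using iota(3) ab by auto
        ultimately show ?thesis using fst by (auto simp: J_def coef_def Let_def)
      qed
      finally show ?thesis .
    next
      case (snd j)
      have bp: "blk' b = m + 2 * j" using partner_ab snd by simp
      have ia: "iota a < N" "blk' (iota a) = blk' b" using iota(1,2)[OF ab(1)] snd bp by auto
      have "(\<Sum>x<N. \<Sum>y<N. A x a * Q' x y * A y b) = (\<Sum>x<N. \<Sum>y<N. if y = b then A x a * Q' x b else 0)"
        using bp by (intro sum.cong refl) (auto simp: A_def)
      also have "\<dots> = (\<Sum>x<N. A x a * Q' x b)" using ab by simp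
      also have "\<dots> = (\<Sum>x<N. Q' b x * Qi $$ (f x, f (iota a))) * (nu' (blk' a) / rho (t (\<pi> (blk' a))))"
        unfolding sum_distrib_right
      proof (rule sum.cong[OF refl])
        fix x assume x: "x \<in> {..<N}"
        show "A x a * Q' x b = Q' b x * Qi $$ (f x, f (iota a)) * (nu' (blk' a) / rho (t (\<pi> (blk' a))))"
        proof (cases "blk' x = blk' a")
          case True
          \<comment> \<open>The block from second to first member is the transpose of the one from
            first to second up to \<open>nu'\<close>, which makes the same inverse
            applicable.\<close>
          have "Q' x b = nu' (blk' a) * Q' b x" using nu'[OF ab(2), of x] x True by simp
          then show ?thesis using True snd by (simp add: A_def)
        next
          case False
          then have "Q' b x = 0" using Q'_supp[OF ab(2), of x] x bp snd by auto
          then show ?thesis using False by (simp add: A_def)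
        qed
      qed
      also have "\<dots> = (if b = iota a then 1 else 0) * (nu' (blk' a) / rho (t (\<pi> (blk' a))))"
        using ab ia by (simp add: Q'_Qi)
      also have "\<dots> = J a b" using snd by (auto simp: J_def coef_def Let_def)
      finally show ?thesis .
    qed
  qed
  then show ?thesis using supp_A by blast
qed

end

section \<open>The conjugating matrix and the transformed matrix of the anti-automorphism\<close>

context ordered_form
begin

definition A :: "nat \<Rightarrow> nat \<Rightarrow> 'a" where
  "A = (SOME A. (\<forall>x b. A x b \<noteq> 0 \<longrightarrow> blk' x = blk' b) \<and>
     (\<forall>a<N. \<forall>b<N. (\<Sum>x<N. \<Sum>y<N. A x a * Q' x y * A y b) = J a b))"

lemma A: "A x b \<noteq> 0 \<Longrightarrow> blk' x = blk' b"
  "a < N \<Longrightarrow> b < N \<Longrightarrow> (\<Sum>x<N. \<Sum>y<N. A x a * Q' x y * A y b) = J a b"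
  using someI_ex[OF ex_transform] unfolding A_def by blast+

text \<open>Rows are in the original order and columns in the new one, so that
  \<open>B^T Q B\<close> is the normal form in the new order.\<close>

definition B :: "'a mat" where
  "B = mat N N (\<lambda>(x, b). A (fi x) b)"

lemma B_carrier [simp]: "B \<in> carrier_mat N N"
  by (simp add: B_def)

lemma B_supp: "x < N \<Longrightarrow> b < N \<Longrightarrow> B $$ (x, b) \<noteq> 0 \<Longrightarrow> blk x = \<pi> (blk' b)"
proof -
  assume "x < N" "b < N" "B $$ (x, b) \<noteq> 0"
  then have "blk' (fi x) = blk' b" using A(1) by (simp add: B_def)
  then show ?thesis using fi(2)[OF \<open>x < N\<close>] ip(2) by metis
qed

definition Jm :: "'a mat" where "Jm = transpose_mat B * Q * B"

lemma BtQ_carrier: "transpose_mat B * Q \<in> carrier_mat N N"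
  using Q(1) by (intro mult_carrier_mat[of _ N N]) auto

lemma Jm_carrier: "Jm \<in> carrier_mat N N"
  unfolding Jm_def by (rule mult_carrier_mat[OF BtQ_carrier B_carrier])

lemma Jm_index: "a < N \<Longrightarrow> b < N \<Longrightarrow> Jm $$ (a, b) = J a b"
proof -
  assume ab: "a < N" "b < N"
  have Bt: "transpose_mat B \<in> carrier_mat N N" by simp
  have "Jm $$ (a, b) = (\<Sum>y<N. (transpose_mat B * Q) $$ (a, y) * B $$ (y, b))"
    unfolding Jm_def by (rule index_mult_mat_sum[OF BtQ_carrier B_carrier ab])
  also have "\<dots> = (\<Sum>y<N. (\<Sum>x<N. A (fi x) a * Q $$ (x, y)) * A (fi y) b)"
  proof (rule sum.cong[OF refl])
    fix y assume y: "y \<in> {..<N}"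
    have "(transpose_mat B * Q) $$ (a, y) = (\<Sum>x<N. transpose_mat B $$ (a, x) * Q $$ (x, y))"
      using y by (intro index_mult_mat_sum[OF Bt Q(1) ab(1)]) simp
    also have "\<dots> = (\<Sum>x<N. A (fi x) a * Q $$ (x, y))"
      using ab by (intro sum.cong) (auto simp: B_def)
    finally show "(transpose_mat B * Q) $$ (a, y) * B $$ (y, b) = (\<Sum>x<N. A (fi x) a * Q $$ (x, y)) * A (fi y) b"
      using y ab by (simp add: B_def)
  qed
  also have "\<dots> = (\<Sum>y<N. \<Sum>x<N. A (fi x) a * Q $$ (x, y) * A (fi y) b)"
    by (simp add: sum_distrib_right)
  also have "\<dots> = (\<Sum>y<N. \<Sum>x<N. A (fi x) a * Q $$ (x, f y) * A (fi (f y)) b)"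
    by (rule sum.reindex_bij_betw[OF f_bij, symmetric])
  also have "\<dots> = (\<Sum>y<N. \<Sum>x<N. A (fi (f x)) a * Q $$ (f x, f y) * A (fi (f y)) b)"
    by (intro sum.cong refl sum.reindex_bij_betw[OF f_bij, symmetric])
  also have "\<dots> = (\<Sum>y<N. \<Sum>x<N. A x a * Q' x y * A y b)"
    by (intro sum.cong refl) (simp add: f Q'_def)
  also have "\<dots> = (\<Sum>x<N. \<Sum>y<N. A x a * Q' x y * A y b)" by (rule sum.swap)
  finally show ?thesis using A(2) ab by simp
qed

text \<open>\<open>Jm = B^T Q B\<close> is monomial with nonzero coefficients, hence invertible, and
  so is its factor \<open>B\<close>. This supplies what \<open>ex_transform\<close> leaves open, the
  invertibility of the base change.\<close>

lemma det_B: "det B \<noteq> 0"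
proof -
  define Ji where "Ji = mat N N (\<lambda>(b, c). if b = iota c then 1 / coef c else 0)"
  have "Jm * Ji = 1\<^sub>m N"
  proof (rule eq_matI)
    fix a c assume "a < dim_row (1\<^sub>m N :: 'a mat)" "c < dim_col (1\<^sub>m N :: 'a mat)"
    then have ac: "a < N" "c < N" by auto
    have "(Jm * Ji) $$ (a, c) = (\<Sum>b<N. Jm $$ (a, b) * Ji $$ (b, c))"
      using ac by (intro index_mult_mat_sum[OF Jm_carrier]) (auto simp: Ji_def)
    also have "\<dots> = (\<Sum>b<N. if b = iota a then (if iota a = iota c then coef a / coef c else 0) else 0)"
      using ac by (intro sum.cong) (auto simp: Jm_index J_def Ji_def)
    also have "\<dots> = (if iota a = iota c then coef a / coef c else 0)" using iota(1)[OF ac(1)] by simp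
    also have "iota a = iota c \<longleftrightarrow> a = c" using iota(3) ac by metis
    finally show "(Jm * Ji) $$ (a, c) = 1\<^sub>m N $$ (a, c)" using ac coef_nonzero by simp
  qed (use Jm_carrier in \<open>auto simp: Ji_def\<close>)
  then have "det Jm \<noteq> 0"
    by (rule det_nonzero_of_right_inverse[OF Jm_carrier, rotated]) (simp add: Ji_def)
  then show ?thesis unfolding Jm_def det_mult[OF BtQ_carrier B_carrier] by simp
qed

definition Bi :: "'a mat" where
  "Bi = (SOME C. C \<in> carrier_mat N N \<and> B * C = 1\<^sub>m N \<and> C * B = 1\<^sub>m N)"

lemma Bi: "Bi \<in> carrier_mat N N" "B * Bi = 1\<^sub>m N" "Bi * B = 1\<^sub>m N"
proof -
  have "\<exists>C. C \<in> carrier_mat N N \<and> B * C = 1\<^sub>m N \<and> C * B = 1\<^sub>m N" using ex_inverse_mat[OF B_carrier det_B] by blast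
  then have "Bi \<in> carrier_mat N N \<and> B * Bi = 1\<^sub>m N \<and> Bi * B = 1\<^sub>m N" unfolding Bi_def by (rule someI_ex)
  then show "Bi \<in> carrier_mat N N" "B * Bi = 1\<^sub>m N" "Bi * B = 1\<^sub>m N" by auto
qed

definition e' :: "nat \<Rightarrow> 'a mat" where
  "e' p = mat_diag N (\<lambda>a. if blk' a = p then 1 else 0)"

lemma e'_carrier [simp]: "e' p \<in> carrier_mat N N"
  by (simp add: e'_def)

lemma e'_conv: "block_idem \<kappa>' p = e' p"
  using graded_data.e_conv_Dg[OF graded', of p] by (simp add: sum_kappa' e'_def)

lemma e_B: "e (\<pi> p) * B = B * e' p"
proof -
  have "e (\<pi> p) * B = mat N N (\<lambda>(x, b). (if blk x = \<pi> p then 1 else 0) * B $$ (x, b))"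
    unfolding e_conv_Dg by (rule Dg_mult_left[OF B_carrier])
  also have "\<dots> = mat N N (\<lambda>(x, b). B $$ (x, b) * (if blk' b = p then 1 else 0))"
    using B_supp ip(1) by (intro cong_mat refl) (auto, metis+)
  also have "\<dots> = B * e' p"
    unfolding e'_def by (rule mat_diag_mult_right[OF B_carrier, symmetric])
  finally show ?thesis .
qed

lemma Bi_e: "Bi * e (\<pi> p) = e' p * Bi"
proof -
  have eN: "e (\<pi> p) \<in> carrier_mat N N" by simp
  have "Bi * e (\<pi> p) = Bi * (e (\<pi> p) * (B * Bi))"
    unfolding Bi(2) right_mult_one_mat[OF eN] ..
  also have "\<dots> = Bi * (B * e' p * Bi)"
    unfolding assoc_mult_mat[OF eN B_carrier Bi(1), symmetric] e_B ..
  also have "\<dots> = (Bi * B) * (e' p * Bi)"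
    unfolding assoc_mult_mat[OF B_carrier e'_carrier Bi(1)]
    by (rule assoc_mult_mat[OF Bi(1) B_carrier mult_carrier_mat[OF e'_carrier Bi(1)], symmetric])
  also have "\<dots> = e' p * Bi"
    unfolding Bi(3) by (rule left_mult_one_mat[OF mult_carrier_mat[OF e'_carrier Bi(1)]])
  finally show ?thesis .
qed

text \<open>The block support of the inverse is read off from the exchange relation
  \<open>Bi_e\<close> with the idempotents.\<close>

lemma Bi_supp: "a < N \<Longrightarrow> x < N \<Longrightarrow> Bi $$ (a, x) \<noteq> 0 \<Longrightarrow> blk x = \<pi> (blk' a)"
proof -
  assume ax: "a < N" "x < N" "Bi $$ (a, x) \<noteq> 0"
  let ?p = "blk' a"
  have l: "Bi * e (\<pi> ?p) = mat N N (\<lambda>(a, x). Bi $$ (a, x) * (if blk x = \<pi> ?p then 1 else 0))"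
    unfolding e_conv_Dg by (rule Dg_mult_right[OF Bi(1)])
  have r: "e' ?p * Bi = mat N N (\<lambda>(a, x). (if blk' a = ?p then 1 else 0) * Bi $$ (a, x))"
    unfolding e'_def by (rule mat_diag_mult_left[OF Bi(1)])
  have "Bi $$ (a, x) * (if blk x = \<pi> ?p then 1 else 0) = Bi $$ (a, x)"
    using arg_cong[OF Bi_e[of ?p], of "\<lambda>M. M $$ (a, x)"] ax unfolding l r by simp
  then show ?thesis using ax(3) by (auto split: if_splits)
qed

text \<open>The coordinate change: \<open>B\<close> on the matrix coordinates, and
  \<open>X (u' p)\<close> on the division algebra, block by block. \<open>V\<close> is its inverse,
  as \<open>X u\<close> squares to the scalar \<open>rho u\<close>.\<close>

definition W :: "'a mat" where "W = row_kron N d B (\<lambda>x. X (u' (ip (blk x))))"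

definition V :: "'a mat" where
  "V = row_kron N d Bi (\<lambda>a. (1 / rho (u' (blk' a))) \<cdot>\<^sub>m X (u' (blk' a)))"

lemma WV_carrier [simp]: "W \<in> carrier_mat nn nn" "V \<in> carrier_mat nn nn"
  by (simp_all add: W_def V_def)

lemma W_V: "W * V = 1\<^sub>m nn"
proof -
  have "W * V = row_kron N d (B * Bi)
      (\<lambda>x. X (u' (ip (blk x))) * ((1 / rho (u' (ip (blk x)))) \<cdot>\<^sub>m X (u' (ip (blk x)))))"
    unfolding W_def V_def
  proof (rule row_kron_mult[OF B_carrier Bi(1)])
    fix x c assume "x < N" "c < N" "B $$ (x, c) \<noteq> 0"
    then have "ip (blk x) = blk' c" using B_supp ip(1) by metis
    then show "(1 / rho (u' (blk' c))) \<cdot>\<^sub>m X (u' (blk' c)) = (1 / rho (u' (ip (blk x)))) \<cdot>\<^sub>m X (u' (ip (blk x)))" by simp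
  qed simp_all
  also have "X u * ((1 / rho u) \<cdot>\<^sub>m X u) = 1\<^sub>m d" if "u \<in> T" for u
    using rho[OF that] by (simp add: mult_smult_distrib[OF X_carrier X_carrier] smult_smult_mat)
  then have "row_kron N d (B * Bi) (\<lambda>x. X (u' (ip (blk x))) * ((1 / rho (u' (ip (blk x)))) \<cdot>\<^sub>m X (u' (ip (blk x))))) =
      kron (1\<^sub>m N) (1\<^sub>m d)"
    unfolding Bi(2) kron_conv_row_kron[OF one_carrier_mat one_carrier_mat] by simp
  finally show ?thesis by (simp add: kron_one)
qed

lemma V_W: "V * W = 1\<^sub>m nn"
  by (rule mat_mult_left_right_inverse[OF WV_carrier W_V])

definition tr :: "'g \<Rightarrow> 'a" where
  "tr u = (SOME c. c \<noteq> 0 \<and> transpose_mat (X u) = c \<cdot>\<^sub>m X u)"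

lemma tr: "u \<in> T \<Longrightarrow> tr u \<noteq> 0" "u \<in> T \<Longrightarrow> transpose_mat (X u) = tr u \<cdot>\<^sub>m X u"
  using someI_ex[OF X_transpose] unfolding tr_def by blast+

definition Phi :: "'a mat" where "Phi = transpose_mat W * P * W"

text \<open>The right factor of \<open>Phi\<close> in block \<open>p\<close>: the shifts of
  \<open>p\<close> and of its partner surround the factor \<open>X t\<close> of
  \<open>P\<close>.\<close>

definition Z :: "nat \<Rightarrow> 'a mat" where
  "Z p = transpose_mat (X (u' p)) * X (t (\<pi> p)) * X (u' (partner p))"

lemma Phi_row_kron: "Phi = row_kron N d Jm (\<lambda>a. Z (blk' a))"
proof -
  have Wt: "transpose_mat W = row_kron N d (transpose_mat B) (\<lambda>a. transpose_mat (X (u' (blk' a))))"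
    unfolding W_def
  proof (rule row_kron_transpose[OF B_carrier X_carrier])
    fix a b assume "a < N" "b < N" "B $$ (b, a) \<noteq> 0"
    then have "ip (blk b) = blk' a" using B_supp ip(1) by metis
    then show "transpose_mat (X (u' (ip (blk b)))) = transpose_mat (X (u' (blk' a)))" by simp
  qed
  have Bt: "transpose_mat B \<in> carrier_mat N N" by simp
  have Xt: "transpose_mat (X u) \<in> carrier_mat d d" for u by simp
  have WP: "transpose_mat W * P = row_kron N d (transpose_mat B * Q)
      (\<lambda>a. transpose_mat (X (u' (blk' a))) * X (t (\<pi> (blk' a))))"
    unfolding Wt
  proof (rule row_kron_mult[OF Bt Q(1)])
    fix a c assume "a < N" "c < N" "transpose_mat B $$ (a, c) \<noteq> 0"
    then have "blk c = \<pi> (blk' a)" using B_supp[of c a] B_carrier by (simp add: carrier_matD[OF B_carrier])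
    then show "X (t (blk c)) = X (t (\<pi> (blk' a)))" by simp
  qed simp_all
  show ?thesis
    unfolding Phi_def WP Jm_def Z_def unfolding W_def
  proof (rule row_kron_mult[OF BtQ_carrier B_carrier])
    show "transpose_mat (X (u' (blk' a))) * X (t (\<pi> (blk' a))) \<in> carrier_mat d d" for a
      by (rule mult_carrier_mat[OF Xt X_carrier])
    fix a c assume ac: "a < N" "c < N" "(transpose_mat B * Q) $$ (a, c) \<noteq> 0"
    obtain b where b: "b < N" "transpose_mat B $$ (a, b) \<noteq> 0" "Q $$ (b, c) \<noteq> 0"
      by (rule mult_mat_nonzero_entry[OF Bt Q(1) ac])
    have "blk b = \<pi> (blk' a)" using B_supp[of b a] b ac by (simp add: carrier_matD[OF B_carrier])
    then have "blk c = \<pi> (partner (blk' a))"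
      using supp[OF b(1) ac(2) b(3)] tau_pi[OF blk'_less[OF ac(1)]] by simp
    then show "X (u' (ip (blk c))) = X (u' (partner (blk' a)))" by (simp add: ip(1))
  qed simp_all
qed

lemma Z_fixed: "p < m \<Longrightarrow> Z p = X (t (\<pi> p))"
  by (simp add: Z_def u'_simps X_one left_mult_one_mat[OF X_carrier] right_mult_one_mat[OF X_carrier])

lemma Z_fst: "j < k - m \<Longrightarrow> Z (m + 2 * j) = rho (t (\<pi> (m + 2 * j))) \<cdot>\<^sub>m 1\<^sub>m d"
proof -
  assume "j < k - m"
  then have p: "m + 2 * j < s" by (simp add: s_eq)
  have "t (\<pi> (Suc (m + 2 * j))) = t (\<pi> (m + 2 * j))"
    using t_tau[OF pi_less[OF p]] tau_pi[OF p] by simp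
  then show ?thesis by (simp add: Z_def u'_simps X_one left_mult_one_mat[OF X_carrier] rho)
qed

lemma Z_snd: "j < k - m \<Longrightarrow> Z (Suc (m + 2 * j)) =
    (tr (t (\<pi> (Suc (m + 2 * j)))) * rho (t (\<pi> (Suc (m + 2 * j))))) \<cdot>\<^sub>m 1\<^sub>m d"
  by (simp add: Z_def u'_simps X_one tr mult_smult_assoc_mat[OF X_carrier X_carrier] rho smult_smult_mat)

definition tt :: "nat \<Rightarrow> 'g" where "tt i = t (\<pi> (i - 1))"

definition S :: "nat \<Rightarrow> 'a mat" where
  "S i = (if nu' (i - 1) = 1 then 1\<^sub>m (2 * q i) else symplectic_mat (q i))"

text \<open>\<open>nu'\<close> compares the two blocks of \<open>Q'\<close> in a pair, and
  \<open>tr\<close> is the scalar picked up by transposing the factor \<open>X t\<close> of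
  \<open>W\<close>.\<close>

definition mu :: "nat \<Rightarrow> 'a" where
  "mu i = (let p = Suc (m + 2 * (i - m - 1)) in nu' p * tr (t (\<pi> p)))"

lemma mu_nonzero: "i \<in> {m + 1..k} \<Longrightarrow> mu i \<noteq> 0"
proof -
  assume "i \<in> {m + 1..k}"
  then have "i - m - 1 < k - m" by auto
  then have "Suc (m + 2 * (i - m - 1)) < s" unfolding s_eq by linarith
  then show ?thesis using nu'_nonzero tr(1)[OF t_T] by (simp add: mu_def Let_def)
qed

definition Sblock :: "nat \<Rightarrow> 'a mat" where
  "Sblock i = (if i \<le> l then 1\<^sub>m (q i) else if i \<le> m then S i
     else four_block_mat (0\<^sub>m (q i) (q i)) (1\<^sub>m (q i)) (mu i \<cdot>\<^sub>m 1\<^sub>m (q i)) (0\<^sub>m (q i) (q i)))"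

definition Xblock :: "nat \<Rightarrow> 'a mat" where
  "Xblock i = (if i \<le> m then X (tt i) else 1\<^sub>m d)"

text \<open>The block sizes of \<open>Phi_mat\<close>, in which a swapped pair is one block of size
  \<open>2 * q i\<close>, unlike in \<open>kappa_form\<close>.\<close>

definition merged :: "nat list" where
  "merged = map (\<lambda>i. if i \<le> l then q i else 2 * q i) [1..<k + 1]"

lemma merged_nth: "j < k \<Longrightarrow> merged ! j = (if Suc j \<le> l then q (Suc j) else 2 * q (Suc j))"
  by (simp add: merged_def del: upt_Suc)

lemma upt_split: "[1..<k + 1] = [1..<l + 1] @ [l + 1..<m + 1] @ [m + 1..<k + 1]"
proof -
  have "[1..<k + 1] = [1..<m + 1] @ [m + 1..<k + 1]"
    using le upt_add_eq_append[of 1 "m + 1" "k - m"] by simp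
  moreover have "[1..<m + 1] = [1..<l + 1] @ [l + 1..<m + 1]"
    using le upt_add_eq_append[of 1 "l + 1" "m - l"] by simp
  ultimately show ?thesis by simp
qed

lemma Phi_mat_conv:
  "Phi_mat G \<beta> ab l m k q tt S mu = diag_block_mat (map (\<lambda>(A, B). kron A B) (map (\<lambda>i. (Sblock i, Xblock i)) [1..<k + 1]))"
  unfolding Phi_mat_def upt_split map_append
  by (intro arg_cong[where f = diag_block_mat] arg_cong2[where f = "(@)"])
    (use le in \<open>auto simp: Sblock_def Xblock_def simp del: upt_Suc\<close>)

lemma symplectic_mat_dim: "dim_row (symplectic_mat w) = 2 * w" "dim_col (symplectic_mat w) = 2 * w"
  by (simp_all add: symplectic_mat_def)

lemma Sblock_dim: "dim_row (Sblock i) = (if i \<le> l then q i else 2 * q i)"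
  "dim_col (Sblock i) = (if i \<le> l then q i else 2 * q i)"
  by (simp_all add: Sblock_def S_def symplectic_mat_dim)

lemma merged_block:
  assumes a: "a < N"
  defines "j \<equiv> block_of merged a" and "x \<equiv> offset merged a"
  shows "a < sum_list merged" "j < k"
    "j < m \<Longrightarrow> blk' a = j" "j < m \<Longrightarrow> off' a = x"
    "m \<le> j \<Longrightarrow> blk' a = (if x < q (Suc j) then m + 2 * (j - m) else Suc (m + 2 * (j - m)))"
    "m \<le> j \<Longrightarrow> off' a = (if x < q (Suc j) then x else x - q (Suc j))"
proof -
  define k1 where "k1 = map q [1..<l + 1] @ map (\<lambda>i. 2 * q i) [l + 1..<m + 1]"
  define xs where "xs = [m + 1..<k + 1]"
  have len1: "length k1 = m" using le by (simp add: k1_def del: upt_Suc)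
  have merged_eq: "merged = k1 @ map (\<lambda>i. 2 * q i) xs"
    unfolding merged_def upt_split map_append k1_def xs_def append_assoc
    by (intro arg_cong2[where f = "(@)"]) (use le in \<open>auto simp del: upt_Suc\<close>)
  have kappa_eq: "\<kappa>' = k1 @ concat (map (\<lambda>i. [q i, q i]) xs)"
    by (simp add: kappa_form_def k1_def xs_def del: upt_Suc)
  have sums: "sum_list merged = N"
    unfolding sum_kappa'[symmetric] merged_eq kappa_eq sum_list_append sum_list_doubled ..
  then show am: "a < sum_list merged" using a by simp
  have len: "length merged = k" by (simp add: merged_def del: upt_Suc)
  show "j < k" using block_of_less[OF am] len by (simp add: j_def)
  have "(j < m \<longrightarrow> blk' a = j \<and> off' a = x) \<and>
    (m \<le> j \<longrightarrow> blk' a = (if x < q (Suc j) then m + 2 * (j - m) else Suc (m + 2 * (j - m))) \<and>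
       off' a = (if x < q (Suc j) then x else x - q (Suc j)))"
  proof (cases "a < sum_list k1")
    case True
    then have "j < m" using block_of_less[OF True] len1 by (simp add: j_def merged_eq block_of_append)
    then show ?thesis using True by (simp add: j_def x_def merged_eq kappa_eq block_of_append)
  next
    case False
    define a' where "a' = a - sum_list k1"
    have a': "a' < sum_list (map (\<lambda>i. 2 * q i) xs)" using False am by (simp add: a'_def merged_eq)
    define j' where "j' = block_of (map (\<lambda>i. 2 * q i) xs) a'"
    have j': "j = m + j'" "x = offset (map (\<lambda>i. 2 * q i) xs) a'"
      using False by (simp_all add: j_def x_def j'_def merged_eq block_of_append len1 a'_def)
    have "j' < length xs" using block_of_less[OF a'] by (simp add: j'_def)
    then have xs: "xs ! j' = Suc j" by (simp add: xs_def j' del: upt_Suc)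
    have "blk' a = m + block_of (concat (map (\<lambda>i. [q i, q i]) xs)) a'"
      "off' a = offset (concat (map (\<lambda>i. [q i, q i]) xs)) a'"
      using False by (simp_all add: kappa_eq block_of_append len1 a'_def)
    then show ?thesis
      unfolding block_of_doubled[OF a'] j'_def[symmetric] j'(2)[symmetric] xs using j' by simp
  qed
  then show "j < m \<Longrightarrow> blk' a = j" "j < m \<Longrightarrow> off' a = x"
    "m \<le> j \<Longrightarrow> blk' a = (if x < q (Suc j) then m + 2 * (j - m) else Suc (m + 2 * (j - m)))"
    "m \<le> j \<Longrightarrow> off' a = (if x < q (Suc j) then x else x - q (Suc j))" by auto
qed

lemma eq_iota_iff:
  assumes "a < N" "b < N"
  shows "b = iota a \<longleftrightarrow> blk' b = partner (blk' a) \<and> off' b = off' (iota a)"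
  using iota(1,2)[OF assms(1)] block_offset_inj[of b \<kappa>' "iota a"] assms by (auto simp: sum_kappa')

text \<open>Compares the monomial matrix \<open>J\<close>, laid out by \<open>kappa_form\<close>,
  with the explicit blocks, laid out by \<open>merged\<close>; \<open>Z\<close> supplies the right
  factors and the scalars that cancel the \<open>1 / rho\<close> of \<open>coef\<close>.\<close>

lemma Phi_entry:
  assumes ab: "a < N" "b < N" and uv: "u < d" "v < d"
  defines "j \<equiv> block_of merged a"
  shows "J a b * Z (blk' a) $$ (u, v) =
    (if j = block_of merged b then Sblock (Suc j) $$ (offset merged a, offset merged b) else 0) * Xblock (Suc j) $$ (u, v)"
proof -
  define x y i where "x = offset merged a" and "y = offset merged b" and "i = block_of merged b"
  note A = merged_block[OF ab(1), folded x_def j_def] and B = merged_block[OF ab(2), folded y_def i_def]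
  have x: "x < (if Suc j \<le> l then q (Suc j) else 2 * q (Suc j))"
    using offset_less[OF A(1)] unfolding x_def[symmetric] j_def[symmetric] merged_nth[OF A(2)] .
  have y: "y < (if Suc i \<le> l then q (Suc i) else 2 * q (Suc i))"
    using offset_less[OF B(1)] unfolding y_def[symmetric] i_def[symmetric] merged_nth[OF B(2)] .
  show ?thesis
    unfolding i_def[symmetric] x_def[symmetric] y_def[symmetric]
  proof (cases "j < m")
    case j: True
    have Zx: "Z (blk' a) = Xblock (Suc j)" using j A(3) by (simp add: Z_fixed Xblock_def tt_def)
    have "J a b = (if j = i then Sblock (Suc j) $$ (x, y) else 0)"
    proof (cases "j = i")
      case False
      have "blk' b \<noteq> j" using B(3,5) False j by (cases "i < m") auto
      then show ?thesis using False eq_iota_iff[OF ab] A(3) j by (simp add: J_def)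
    next
      case ij: True
      have off: "off' a = x" "off' b = y" "blk' a = j" "blk' b = j" using A B j ij by auto
      show ?thesis
      proof (cases "nu' j = 1")
        case True
        have "Sblock (Suc j) $$ (x, y) = (if x = y then 1 else 0)"
          using x y ij True j by (auto simp: Sblock_def S_def)
        moreover have "J a b = (if x = y then 1 else 0)"
          using eq_iota_iff[OF ab] off j True iota(5)[OF ab(1)] by (auto simp: J_def coef_def)
        ultimately show ?thesis using ij by simp
      next
        case False
        have lj: "l \<le> j" using skew_size[OF j False] by simp
        let ?q = "q (Suc j)"
        have "Sblock (Suc j) $$ (x, y) = (if x < ?q then (if y = x + ?q then 1 else 0) else (if x = y + ?q then - 1 else 0))"
          using x y ij False j lj by (auto simp: Sblock_def S_def symplectic_mat_def)
        moreover have "J a b = (if x < ?q then (if y = x + ?q then 1 else 0) else (if x = y + ?q then - 1 else 0))"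
          using eq_iota_iff[OF ab] off j False iota(6)[OF ab(1)] by (auto simp: J_def coef_def)
        ultimately show ?thesis using ij by simp
      qed
    qed
    then show "J a b * Z (blk' a) $$ (u, v) = (if j = i then Sblock (Suc j) $$ (x, y) else 0) * Xblock (Suc j) $$ (u, v)"
      by (simp add: Zx)
  next
    case j: False
    let ?q = "q (Suc j)" and ?r = "j - m"
    have r: "?r < k - m" using A(2) j by simp
    have Sb: "Sblock (Suc j) = four_block_mat (0\<^sub>m ?q ?q) (1\<^sub>m ?q) (mu (Suc j) \<cdot>\<^sub>m 1\<^sub>m ?q) (0\<^sub>m ?q ?q)"
      using j le by (simp add: Sblock_def)
    have Xb: "Xblock (Suc j) = 1\<^sub>m d" using j by (simp add: Xblock_def)
    have x2: "x < 2 * ?q" using x j le by simp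
    have i_of: "blk' b = m + 2 * ?r \<longleftrightarrow> i = j \<and> y < ?q" "blk' b = Suc (m + 2 * ?r) \<longleftrightarrow> i = j \<and> \<not> y < ?q"
    proof -
      \<comment> \<open>Parity separates the first from the second members of pairs.\<close>
      have odd: "Suc (m + 2 * c) \<noteq> m + 2 * c'" for c c' by presburger
      have "(blk' b = m + 2 * ?r \<longleftrightarrow> i = j \<and> y < ?q) \<and> (blk' b = Suc (m + 2 * ?r) \<longleftrightarrow> i = j \<and> \<not> y < ?q)"
      proof (cases "i < m")
        case True
        then have "blk' b < m" using B(3) by simp
        then show ?thesis using True j by auto
      next
        case False
        then have bb: "blk' b = (if y < q (Suc i) then m + 2 * (i - m) else Suc (m + 2 * (i - m)))" using B(5) by simp
        show ?thesis
        proof (cases "i = j")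
          case True
          then show ?thesis using bb odd by simp
        next
          case ij: False
          then have "i - m \<noteq> ?r" using False j by linarith
          then show ?thesis using bb ij odd odd[symmetric] by simp
        qed
      qed
      then show "blk' b = m + 2 * ?r \<longleftrightarrow> i = j \<and> y < ?q" "blk' b = Suc (m + 2 * ?r) \<longleftrightarrow> i = j \<and> \<not> y < ?q"
        by blast+
    qed
    show "J a b * Z (blk' a) $$ (u, v) = (if j = i then Sblock (Suc j) $$ (x, y) else 0) * Xblock (Suc j) $$ (u, v)"
    proof (cases "x < ?q")
      case True
      have a: "blk' a = m + 2 * ?r" "off' a = x" using A(5,6) j True by auto
      have "off' (iota a) = x" using iota(4)[OF ab(1)] a by simp
      then have io: "b = iota a \<longleftrightarrow> i = j \<and> \<not> y < ?q \<and> y - ?q = x"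
        using eq_iota_iff[OF ab] a i_of(2) B(6) j by auto
      have S: "i = j \<Longrightarrow> Sblock (Suc j) $$ (x, y) = (if \<not> y < ?q \<and> y - ?q = x then 1 else 0)"
        unfolding Sb using True y j le by auto
      have "coef a = 1 / rho (t (\<pi> (m + 2 * ?r)))" using a by (simp add: coef_def)
      then show ?thesis
        using io S rho(1)[OF t_T] uv by (auto simp: J_def a(1) Z_fst[OF r] Xb)
    next
      case False
      have a: "blk' a = Suc (m + 2 * ?r)" "off' a = x - ?q" using A(5,6) j False by auto
      have "off' (iota a) = x - ?q" using iota(4)[OF ab(1)] a by simp
      then have io: "b = iota a \<longleftrightarrow> i = j \<and> y < ?q \<and> y = x - ?q"
        using eq_iota_iff[OF ab] a i_of(1) B(6) j by auto
      have S: "i = j \<Longrightarrow> Sblock (Suc j) $$ (x, y) = (if y < ?q \<and> y = x - ?q then mu (Suc j) else 0)"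
        unfolding Sb using False x2 y j le by auto
      have "coef a = nu' (Suc (m + 2 * ?r)) / rho (t (\<pi> (Suc (m + 2 * ?r))))" using a by (simp add: coef_def)
      moreover have "mu (Suc j) = nu' (Suc (m + 2 * ?r)) * tr (t (\<pi> (Suc (m + 2 * ?r))))" by (simp add: mu_def)
      ultimately show ?thesis
        using io S rho(1)[OF t_T] uv by (auto simp: J_def a(1) Z_snd[OF r] Xb)
    qed
  qed
qed

lemma Phi_eq: "Phi = Phi_mat G \<beta> ab l m k q tt S mu"
proof -
  define ps where "ps = map (\<lambda>i. (Sblock i, Xblock i)) [1..<k + 1]"
  have dims: "map (\<lambda>(A, B). dim_row A) ps = merged" "map dim_row (map fst ps) = merged"
    by (simp_all add: ps_def merged_def Sblock_dim del: upt_Suc)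
  have sums: "sum_list merged = N" using merged_block(1) N_pos
  proof -
    have "sum_list merged = sum_list \<kappa>'"
      unfolding merged_def upt_split map_append kappa_form_def sum_list_append sum_list_doubled
      by (intro arg_cong2[where f = "(+)"] arg_cong[where f = sum_list]) (use le in \<open>auto simp del: upt_Suc\<close>)
    then show ?thesis by (simp add: sum_kappa')
  qed
  have "Phi_mat G \<beta> ab l m k q tt S mu =
      row_kron N d (diag_block_mat (map fst ps)) (\<lambda>a. snd (ps ! block_of merged a))"
    unfolding Phi_mat_conv ps_def[symmetric]
    by (subst diag_block_mat_kron[where d = d]) (auto simp: dims sums, auto simp: ps_def Sblock_dim Xblock_def)
  also have "\<dots> = row_kron N d Jm (\<lambda>a. Z (blk' a))"
  proof (rule row_kron_cong)
    fix a b u v assume ab: "a < N" "b < N" and uv: "u < d" "v < d"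
    have "diag_block_mat (map fst ps) $$ (a, b) = (if block_of merged a = block_of merged b
       then (map fst ps) ! block_of merged a $$ (offset merged a, offset merged b) else 0)"
      by (rule diag_block_mat_index[of "map fst ps", unfolded dims])
        (use ab sums in \<open>auto simp: ps_def Sblock_dim\<close>)
    moreover have "(map fst ps) ! block_of merged a = Sblock (Suc (block_of merged a))"
      "snd (ps ! block_of merged a) = Xblock (Suc (block_of merged a))"
      using merged_block(2)[OF ab(1)] by (simp_all add: ps_def del: upt_Suc)
    ultimately show "diag_block_mat (map fst ps) $$ (a, b) * snd (ps ! block_of merged a) $$ (u, v) =
      Jm $$ (a, b) * Z (blk' a) $$ (u, v)"
      using Phi_entry[OF ab uv] Jm_index[OF ab] by (simp only:)
  qed
  finally show ?thesis by (simp add: Phi_row_kron)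
qed

end

section \<open>The isomorphic pair and its degrees\<close>

context ordered_form
begin

text \<open>The inverse of \<open>Phi = W^T P W\<close>, assembled from the inverses
  \<open>V\<close> of \<open>W\<close> and \<open>P'\<close> of \<open>P\<close>.\<close>

definition Psi :: "'a mat" where "Psi = V * P' * transpose_mat V"

abbreviation phi' :: "'a mat \<Rightarrow> 'a mat" where
  "phi' \<equiv> \<lambda>Y. Psi * transpose_mat Y * Phi"

lemma mult_closed: "C \<in> carrier_mat nn nn \<Longrightarrow> D \<in> carrier_mat nn nn \<Longrightarrow> C * D \<in> carrier_mat nn nn" for C D :: "'a mat"
  by (rule mult_carrier_mat)

lemma mult_assoc_left:
  "C \<in> carrier_mat nn nn \<Longrightarrow> D \<in> carrier_mat nn nn \<Longrightarrow> F \<in> carrier_mat nn nn \<Longrightarrow> C * (D * F) = C * D * F"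
  for C D F :: "'a mat"
  by (rule assoc_mult_mat[symmetric])

lemma mult_cancel:
  assumes "C \<in> carrier_mat nn nn"
  shows "C * V * W = C" "C * W * V = C" "C * P * P' = C" "C * P' * P = C"
    "C * transpose_mat V * transpose_mat W = C" "C * transpose_mat W * transpose_mat V = C"
proof -
  have tVW: "transpose_mat V * transpose_mat W = 1\<^sub>m nn" "transpose_mat W * transpose_mat V = 1\<^sub>m nn"
    by (simp_all add: transpose_mult[OF WV_carrier, symmetric] transpose_mult[OF WV_carrier(2,1), symmetric] W_V V_W)
  have tc: "transpose_mat V \<in> carrier_mat nn nn" "transpose_mat W \<in> carrier_mat nn nn" by simp_all
  show "C * V * W = C" "C * W * V = C"
    unfolding assoc_mult_mat[OF assms WV_carrier(2,1)] assoc_mult_mat[OF assms WV_carrier(1,2)] W_V V_W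
    using right_mult_one_mat[OF assms] by simp_all
  show "C * P * P' = C" "C * P' * P = C"
    unfolding assoc_mult_mat[OF assms row_kron_carrier P'(1)] assoc_mult_mat[OF assms P'(1) row_kron_carrier] P'(2,3)
    using right_mult_one_mat[OF assms] by simp_all
  show "C * transpose_mat V * transpose_mat W = C" "C * transpose_mat W * transpose_mat V = C"
    unfolding assoc_mult_mat[OF assms tc] assoc_mult_mat[OF assms tc(2,1)] tVW
    using right_mult_one_mat[OF assms] by simp_all
qed

lemma transposes_carrier: "transpose_mat V \<in> carrier_mat nn nn" "transpose_mat W \<in> carrier_mat nn nn"
  by simp_all

lemma Phi_carrier: "Phi \<in> carrier_mat nn nn"
  unfolding Phi_def by (intro mult_closed transposes_carrier row_kron_carrier WV_carrier)

lemma Psi_carrier: "Psi \<in> carrier_mat nn nn"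
  unfolding Psi_def by (intro mult_closed transposes_carrier P'(1) WV_carrier)

lemma Psi_Phi: "Psi * Phi = 1\<^sub>m nn"
proof -
  have "Psi * Phi = V * P' * transpose_mat V * transpose_mat W * P * W"
    unfolding Psi_def Phi_def
    by (simp add: mult_assoc_left mult_closed transposes_carrier P'(1) del: assoc_mult_mat)
  also have "\<dots> = V * W"
    by (simp add: mult_cancel mult_closed P'(1) del: assoc_mult_mat)
  finally show ?thesis by (simp add: V_W)
qed

lemma Phi_Psi: "Phi * Psi = 1\<^sub>m nn"
  by (rule mat_mult_left_right_inverse[OF Psi_carrier Phi_carrier Psi_Phi])

text \<open>Conjugating \<open>Y \<mapsto> P' Y^T P\<close> by \<open>V\<close> surrounds
  \<open>P\<close> with \<open>W^T\<close> and \<open>W\<close>: a congruence and not a conjugation,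
  because of the transpose.\<close>

lemma conj_phi:
  assumes Y: "Y \<in> carrier_mat nn nn"
  shows "V * \<phi> Y * W = phi' (V * Y * W)"
proof -
  have Yt: "transpose_mat Y \<in> carrier_mat nn nn" using Y by simp
  have "transpose_mat (V * Y * W) = transpose_mat W * (transpose_mat Y * transpose_mat V)"
    unfolding transpose_mult[OF mult_closed[OF WV_carrier(2) Y] WV_carrier(1)] transpose_mult[OF WV_carrier(2) Y] ..
  then have "phi' (V * Y * W) = V * P' * transpose_mat V * transpose_mat W * transpose_mat Y * transpose_mat V * transpose_mat W * P * W"
    unfolding Psi_def Phi_def using Yt
    by (simp add: mult_assoc_left mult_closed transposes_carrier P'(1) del: assoc_mult_mat)
  also have "\<dots> = V * P' * transpose_mat Y * P * W"
    using Yt by (simp add: mult_cancel mult_closed P'(1) del: assoc_mult_mat)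
  also have "\<dots> = V * \<phi> Y * W"
    unfolding phi_form[OF Y] using Yt
    by (simp add: mult_assoc_left mult_closed P'(1) del: assoc_mult_mat)
  finally show ?thesis by simp
qed

text \<open>An instance of \<open>conj_R_comp\<close> with the shifts \<open>u'\<close>. The shifts
  are involutions, so \<open>W_R'_V\<close> uses the same ones for the opposite inclusion.\<close>

lemma V_R_W: "M \<in> R h \<Longrightarrow> V * M * W \<in> R_comp G T \<beta> ab \<kappa>' \<gamma>' h"
  unfolding V_def W_def
proof (rule conj_R_comp[OF graded_data_axioms graded' refl sum_kappa',
      where \<rho> = ip and u = "\<lambda>i. u' (ip i)" and ?c1.0 = "\<lambda>i. 1 / rho (u' (ip i))" and ?c2.0 = "\<lambda>_. 1"])
  show "ip i < length \<kappa>'" if "i < s" for i using ip(3) that by (simp add: length_kappa')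
  show "blk' a = ip (blk x)" if "a < N" "x < N" "Bi $$ (a, x) \<noteq> 0" for a x
    using Bi_supp[OF that] ip(1) by simp
  show "blk' a = ip (blk x)" if "a < N" "x < N" "B $$ (x, a) \<noteq> 0" for a x
    using B_supp[OF that(2,1,3)] ip(1) by simp
  show "\<gamma>' ! ip i = \<gamma> ! i \<otimes> u' (ip i)" if "i < s" for i
    using gamma'_nth[OF ip(3)[OF that]] ip(2) by simp
qed (auto simp: Bi(1))

lemma W_R'_V: "M \<in> R_comp G T \<beta> ab \<kappa>' \<gamma>' h \<Longrightarrow> W * M * V \<in> R h"
  unfolding V_def W_def
proof (rule conj_R_comp[OF graded' graded_data_axioms sum_kappa' refl,
      where \<rho> = \<pi> and u = u' and ?c1.0 = "\<lambda>_. 1" and ?c2.0 = "\<lambda>i. 1 / rho (u' i)"])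
  show "\<pi> i < s" if "i < length \<kappa>'" for i using pi_less that by (simp add: length_kappa')
  show "blk a = \<pi> (blk' x)" if "a < N" "x < N" "B $$ (a, x) \<noteq> 0" for a x using B_supp that by blast
  show "blk a = \<pi> (blk' x)" if "a < N" "x < N" "Bi $$ (x, a) \<noteq> 0" for a x using Bi_supp that by blast
  show "\<gamma> ! \<pi> i = \<gamma>' ! i \<otimes> u' i" if "i < length \<kappa>'" for i
    using that pi_less by (simp add: gamma'_nth length_kappa' m_assoc elementary)
qed (auto simp: Bi(1) ip(1))

lemma conj_R: "(\<lambda>Y. V * Y * W) ` R h = R_comp G T \<beta> ab \<kappa>' \<gamma>' h"
proof
  show "(\<lambda>Y. V * Y * W) ` R h \<subseteq> R_comp G T \<beta> ab \<kappa>' \<gamma>' h" using V_R_W by blast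
  show "R_comp G T \<beta> ab \<kappa>' \<gamma>' h \<subseteq> (\<lambda>Y. V * Y * W) ` R h"
  proof
    fix M assume M: "M \<in> R_comp G T \<beta> ab \<kappa>' \<gamma>' h"
    have Mc: "M \<in> carrier_mat nn nn"
      using graded_data.R_comp_carrier[OF graded' M] by (simp add: R_dim_def sum_kappa')
    then have "V * (W * M * V) * W = (V * W) * M"
      by (simp add: mult_assoc_left mult_closed mult_cancel del: assoc_mult_mat)
    then have "M = V * (W * M * V) * W" using left_mult_one_mat[OF Mc] by (simp add: V_W)
    then show "M \<in> (\<lambda>Y. V * Y * W) ` R h" using W_R'_V[OF M] by blast
  qed
qed

text \<open>By \<open>e_B\<close> the coordinate change intertwines the two families of idempotents,
  so the reordering \<open>\<pi>\<close> is absorbed and the new pair is ordered by the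
  identity.\<close>

lemma conj_E: "V * E (\<pi> p) * W = R_idem G ab \<kappa>' p"
proof -
  let ?F = "\<lambda>x. X (u' (ip (blk x)))"
  have E': "R_idem G ab \<kappa>' p = kron (e' p) (1\<^sub>m d)" by (simp add: R_idem_def e'_conv)
  have E'c: "kron (e' p) (1\<^sub>m d) \<in> carrier_mat nn nn" by simp
  have "E (\<pi> p) * W = row_kron N d (e (\<pi> p) * B) (\<lambda>x. 1\<^sub>m d * ?F x)"
    unfolding W_def R_idem_def kron_conv_row_kron[OF block_idem_carrier one_carrier_mat]
  proof (rule row_kron_mult[OF block_idem_carrier B_carrier])
    fix x c assume "x < N" "c < N" "e (\<pi> p) $$ (x, c) \<noteq> 0"
    then have "x = c" by (simp add: block_idem_index split: if_splits)
    then show "?F c = ?F x" by simp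
  qed simp_all
  moreover have "W * kron (e' p) (1\<^sub>m d) = row_kron N d (B * e' p) (\<lambda>x. ?F x * 1\<^sub>m d)"
    unfolding W_def kron_conv_row_kron[OF e'_carrier one_carrier_mat]
    by (rule row_kron_mult) simp_all
  ultimately have "E (\<pi> p) * W = W * kron (e' p) (1\<^sub>m d)"
    by (simp add: e_B left_mult_one_mat[OF X_carrier] right_mult_one_mat[OF X_carrier])
  then have "V * E (\<pi> p) * W = V * (W * kron (e' p) (1\<^sub>m d))"
    unfolding assoc_mult_mat[OF WV_carrier(2) E_carrier WV_carrier(1)] by simp
  also have "\<dots> = kron (e' p) (1\<^sub>m d)"
    unfolding assoc_mult_mat[OF WV_carrier(2,1) E'c, symmetric] V_W by (rule left_mult_one_mat[OF E'c])
  finally show ?thesis by (simp add: E')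
qed

lemma phi'_E: "p < s \<Longrightarrow> phi' (R_idem G ab \<kappa>' p) = R_idem G ab \<kappa>' (partner p)"
  using conj_phi[OF E_carrier, of "\<pi> p"] tau(2)[OF pi_less, of p] tau_pi[of p] by (simp add: conj_E)

lemma R_dim': "R_dim G ab \<kappa>' = nn"
  by (simp add: R_dim_def sum_kappa')

lemma graded_antiaut': "graded_antiaut G T \<beta> ab \<kappa>' \<gamma>' phi'"
  unfolding graded_antiaut_def R_dim' compatible_with_grading_def
proof (intro conjI ballI)
  show "mat_alg_antiaut nn phi'"
    by (rule conj_transpose_antiaut[OF Phi_carrier Psi_carrier Phi_Psi Psi_Phi])
  fix h assume h: "h \<in> carrier G"
  have "phi' ` (\<lambda>Y. V * Y * W) ` R h = (\<lambda>Y. V * Y * W) ` \<phi> ` R h"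
    unfolding image_image
  proof (rule image_cong[OF refl])
    fix Y assume "Y \<in> R h"
    then have "Y \<in> carrier_mat nn nn" using R_comp_carrier by (simp add: n_def)
    then show "phi' (V * Y * W) = V * \<phi> Y * W" by (simp add: conj_phi)
  qed
  then show "phi' ` R_comp G T \<beta> ab \<kappa>' \<gamma>' h = R_comp G T \<beta> ab \<kappa>' \<gamma>' h"
    by (simp only: conj_R phi_R[OF h])
qed

lemma isomorphic': "isomorphic_pairs G (R_dim G ab \<kappa>) R \<phi> (R_dim G ab \<kappa>') (R_comp G T \<beta> ab \<kappa>' \<gamma>') phi'"
  unfolding isomorphic_pairs_def R_dim' n_def
proof (intro exI[of _ "\<lambda>Y. V * Y * W"] conjI ballI)
  show iso: "mat_alg_iso nn nn (\<lambda>Y. V * Y * W)"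
    by (rule conj_mat_alg_iso[OF WV_carrier(2,1) W_V V_W])
  show "(\<lambda>Y. V * Y * W) ` R h = R_comp G T \<beta> ab \<kappa>' \<gamma>' h" for h by (rule conj_R)
  fix Y :: "'a mat" assume Y: "Y \<in> carrier_mat nn nn"
  have inj: "inj_on (\<lambda>Y. V * Y * W) (carrier_mat nn nn)"
    using iso by (auto simp: mat_alg_iso_def bij_betw_def)
  show "\<phi> Y = the_inv_into (carrier_mat nn nn) (\<lambda>Y. V * Y * W) (phi' (V * Y * W))"
    using the_inv_into_f_f[OF inj phi_carrier[OF Y]] conj_phi[OF Y] by simp
qed

lemma ordered': "ordered_by_antiaut G ab \<kappa>' \<gamma>' phi' id l m k q g g' h''"
proof -
  have i: "phi' (R_idem G ab \<kappa>' (i - 1)) = R_idem G ab \<kappa>' (i - 1)" if "i \<in> {1..m}" for i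
  proof -
    have "i - 1 < s" "i - 1 < m" using that by (auto simp: s_eq)
    then show ?thesis using phi'_E[of "i - 1"] by simp
  qed
  have ii: "phi' (R_idem G ab \<kappa>' (m + 2 * (i - m - 1))) = R_idem G ab \<kappa>' (m + 2 * (i - m - 1) + 1) \<and>
    phi' (R_idem G ab \<kappa>' (m + 2 * (i - m - 1) + 1)) = R_idem G ab \<kappa>' (m + 2 * (i - m - 1))" if "i \<in> {m + 1..k}" for i
  proof -
    have "i - m - 1 < k - m" using that by auto
    then have "m + 2 * (i - m - 1) < s" "Suc (m + 2 * (i - m - 1)) < s" unfolding s_eq by linarith+
    then show ?thesis using phi'_E[of "m + 2 * (i - m - 1)"] phi'_E[of "Suc (m + 2 * (i - m - 1))"] by simp
  qed
  show ?thesis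
    unfolding ordered_by_antiaut_def Let_def
    by (intro conjI le ballI permutes_id permute_list_id) (use odd_q i ii in simp_all)
qed

text \<open>The position of the fixed block, or of the first member of the pair, with number
  \<open>i\<close>.\<close>

definition pos_of :: "nat \<Rightarrow> nat" where
  "pos_of i = (if i \<le> m then i - 1 else m + 2 * (i - m - 1))"

lemma pos_of: "i \<in> {1..k} \<Longrightarrow> pos_of i < s"
proof -
  assume i: "i \<in> {1..k}"
  show ?thesis
  proof (cases "i \<le> m")
    case False
    then have "i - m - 1 < k - m" using i by auto
    then show ?thesis unfolding pos_of_def s_eq using False by auto
  qed (use i in \<open>auto simp: pos_of_def s_eq\<close>)
qed

text \<open>With \<open>x\<close> the original index at that position, squares and products are both
  \<open>\<gamma> ! x \<otimes> \<gamma> ! tau x\<close>, and the adjusted ones carry the factor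
  \<open>t x\<close>; thus both claims about degrees come from
  \<open>degree_relation\<close>.\<close>

lemma square_or_product:
  assumes i: "i \<in> {1..k}"
  shows "(if i \<le> m then g i [^] (2::nat) else g' i \<otimes> g'' i) = \<gamma> ! \<pi> (pos_of i) \<otimes> \<gamma> ! tau (\<pi> (pos_of i))"
    and "(if i \<le> m then g i [^] (2::nat) \<otimes> tt i else g' i \<otimes> h'' i) =
      \<gamma> ! \<pi> (pos_of i) \<otimes> \<gamma> ! tau (\<pi> (pos_of i)) \<otimes> t (\<pi> (pos_of i))"
proof -
  have p: "pos_of i < s" by (rule pos_of[OF i])
  have c: "\<gamma> ! \<pi> (pos_of i) \<in> carrier G" using p pi_less by simp
  have "(if i \<le> m then g i [^] (2::nat) else g' i \<otimes> g'' i) = \<gamma> ! \<pi> (pos_of i) \<otimes> \<gamma> ! tau (\<pi> (pos_of i)) \<and>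
    (if i \<le> m then g i [^] (2::nat) \<otimes> tt i else g' i \<otimes> h'' i) =
      \<gamma> ! \<pi> (pos_of i) \<otimes> \<gamma> ! tau (\<pi> (pos_of i)) \<otimes> t (\<pi> (pos_of i))"
  proof (cases "i \<le> m")
    case True
    then have pm: "pos_of i = i - 1" "i - 1 < m" using i by (auto simp: pos_of_def)
    have "g i = \<gamma> ! \<pi> (i - 1)"
      using gamma_form_nth[of "i - 1"] nth_gamma_form(1)[OF le(2) pm(2), of g g' g''] p pm i by simp
    moreover have "tau (\<pi> (i - 1)) = \<pi> (i - 1)" using tau_pi[OF p] pm by simp
    ultimately show ?thesis using True c pm by (simp add: numeral_2_eq_2 tt_def)
  next
    case False
    let ?j = "i - m - 1"
    have j: "?j < k - m" "m + 1 + ?j = i" using False i by auto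
    have pm: "pos_of i = m + 2 * ?j" using False by (simp add: pos_of_def)
    have p': "m + 2 * ?j < s" "m + 2 * ?j + 1 < s" using j unfolding s_eq by linarith+
    have "g' i = \<gamma> ! \<pi> (m + 2 * ?j)" "g'' i = \<gamma> ! \<pi> (m + 2 * ?j + 1)"
      using gamma_form_nth[OF p'(1)] gamma_form_nth[OF p'(2)] nth_gamma_form(2)[OF le(2) j(1), of g g' g''] nth_gamma_form(3)[OF le(2) j(1), of g g' g''] j(2) by simp_all
    moreover have tp: "tau (\<pi> (m + 2 * ?j)) = \<pi> (m + 2 * ?j + 1)" using tau_pi[OF p'(1)] by simp
    moreover have "t (\<pi> (m + 2 * ?j + 1)) = t (\<pi> (m + 2 * ?j))" using t_tau[OF pi_less[OF p'(1)]] tp by simp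
    moreover have "\<gamma> ! \<pi> (m + 2 * ?j) \<in> carrier G" "\<gamma> ! \<pi> (m + 2 * ?j + 1) \<in> carrier G" using p' pi_less by auto
    ultimately show ?thesis using False pm by (simp add: h''_def m_assoc)
  qed
  then show "(if i \<le> m then g i [^] (2::nat) else g' i \<otimes> g'' i) = \<gamma> ! \<pi> (pos_of i) \<otimes> \<gamma> ! tau (\<pi> (pos_of i))"
    and "(if i \<le> m then g i [^] (2::nat) \<otimes> tt i else g' i \<otimes> h'' i) =
      \<gamma> ! \<pi> (pos_of i) \<otimes> \<gamma> ! tau (\<pi> (pos_of i)) \<otimes> t (\<pi> (pos_of i))" by auto
qed

lemma cosets_equal:
  assumes ij: "i \<in> {1..k}" "j \<in> {1..k}"
  shows "T #> (if i \<le> m then g i [^] (2::nat) else g' i \<otimes> g'' i) =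
    T #> (if j \<le> m then g j [^] (2::nat) else g' j \<otimes> g'' j)"
proof -
  define x y where "x = \<pi> (pos_of i)" and "y = \<pi> (pos_of j)"
  have xy: "x < s" "y < s" using ij pos_of pi_less by (auto simp: x_def y_def)
  define a b where "a = \<gamma> ! x \<otimes> \<gamma> ! tau x" and "b = \<gamma> ! y \<otimes> \<gamma> ! tau y"
  have c: "a \<in> carrier G" "b \<in> carrier G" using xy tau by (auto simp: a_def b_def)
  \<comment> \<open>\<open>t y\<close> is its own inverse, so it can be inserted twice to make
    \<open>degree_relation\<close> applicable.\<close>
  have "b = b \<otimes> t y \<otimes> t y" using c by (simp add: m_assoc elementary)
  also have "\<dots> = a \<otimes> t x \<otimes> t y" using degree_relation[OF xy] by (simp add: a_def b_def)
  also have "\<dots> = (t x \<otimes> t y) \<otimes> a" using c by (simp add: m_ac)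
  finally have "b \<in> T #> a" unfolding r_coset_def using T_closed(1)[OF t_T t_T] by blast
  then have "T #> a = T #> b" using c subgroup_T by (intro repr_independence)
  then show ?thesis unfolding square_or_product(1)[OF ij(1)] square_or_product(1)[OF ij(2)]
    by (simp add: a_def b_def x_def y_def)
qed

lemma normal_form:
  "graded_matrix_data G T \<beta> ab \<kappa>' \<gamma>' \<and>
   graded_antiaut G T \<beta> ab \<kappa>' \<gamma>' phi' \<and>
   isomorphic_pairs G (R_dim G ab \<kappa>) R \<phi> (R_dim G ab \<kappa>') (R_comp G T \<beta> ab \<kappa>' \<gamma>') phi' \<and>
   ordered_by_antiaut G ab \<kappa>' \<gamma>' phi' id l m k q g g' h'' \<and>
   (\<forall>i\<in>{1..m}. tt i \<in> T) \<and>
   (\<forall>i\<in>{1..k}. \<forall>j\<in>{1..k}. (if i \<le> m then g i [^] (2::nat) \<otimes> tt i else g' i \<otimes> h'' i) =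
      (if j \<le> m then g j [^] (2::nat) \<otimes> tt j else g' j \<otimes> h'' j)) \<and>
   (\<forall>i\<in>{l + 1..m}. S i = 1\<^sub>m (2 * q i) \<or> S i = symplectic_mat (q i)) \<and>
   (\<forall>i\<in>{m + 1..k}. mu i \<noteq> 0) \<and>
   Phi_mat G \<beta> ab l m k q tt S mu \<in> carrier_mat (R_dim G ab \<kappa>') (R_dim G ab \<kappa>') \<and>
   Psi \<in> carrier_mat (R_dim G ab \<kappa>') (R_dim G ab \<kappa>') \<and>
   inverts_mat (Phi_mat G \<beta> ab l m k q tt S mu) Psi \<and> inverts_mat Psi (Phi_mat G \<beta> ab l m k q tt S mu) \<and>
   (\<forall>Y\<in>carrier_mat (R_dim G ab \<kappa>') (R_dim G ab \<kappa>'). phi' Y = Psi * transpose_mat Y * Phi_mat G \<beta> ab l m k q tt S mu)"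
proof (intro conjI ballI)
  show "graded_matrix_data G T \<beta> ab \<kappa>' \<gamma>'" using graded' graded_data_iff by blast
  show "graded_antiaut G T \<beta> ab \<kappa>' \<gamma>' phi'" by (rule graded_antiaut')
  show "isomorphic_pairs G (R_dim G ab \<kappa>) R \<phi> (R_dim G ab \<kappa>') (R_comp G T \<beta> ab \<kappa>' \<gamma>') phi'" by (rule isomorphic')
  show "ordered_by_antiaut G ab \<kappa>' \<gamma>' phi' id l m k q g g' h''" by (rule ordered')
  show "tt i \<in> T" for i by (simp add: tt_def)
  show "(if i \<le> m then g i [^] (2::nat) \<otimes> tt i else g' i \<otimes> h'' i) =
      (if j \<le> m then g j [^] (2::nat) \<otimes> tt j else g' j \<otimes> h'' j)" if "i \<in> {1..k}" "j \<in> {1..k}" for i j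
    unfolding square_or_product(2)[OF that(1)] square_or_product(2)[OF that(2)]
    by (rule degree_relation) (intro pi_less pos_of that)+
  show "S i = 1\<^sub>m (2 * q i) \<or> S i = symplectic_mat (q i)" for i by (simp add: S_def)
  show "mu i \<noteq> 0" if "i \<in> {m + 1..k}" for i using mu_nonzero that .
  show "Phi_mat G \<beta> ab l m k q tt S mu \<in> carrier_mat (R_dim G ab \<kappa>') (R_dim G ab \<kappa>')"
    using Phi_carrier by (simp add: R_dim' Phi_eq)
  show "Psi \<in> carrier_mat (R_dim G ab \<kappa>') (R_dim G ab \<kappa>')" using Psi_carrier by (simp add: R_dim')
  show "inverts_mat (Phi_mat G \<beta> ab l m k q tt S mu) Psi" "inverts_mat Psi (Phi_mat G \<beta> ab l m k q tt S mu)"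
    unfolding Phi_eq[symmetric] inverts_mat_def Phi_Psi Psi_Phi carrier_matD[OF Phi_carrier] carrier_matD[OF Psi_carrier]
    by (rule refl)+
  show "phi' Y = Psi * transpose_mat Y * Phi_mat G \<beta> ab l m k q tt S mu" for Y by (simp add: Phi_eq)
qed

end

section \<open>Existence of the ordering\<close>

lemma distinct_concat_pairs:
  assumes "distinct xs" "inj_on f (set xs)" "f ` set xs \<inter> set xs = {}"
  shows "distinct (concat (map (\<lambda>i. [i, f i]) xs))"
  using assms by (induction xs) auto

lemma set_concat_pairs: "set (concat (map (\<lambda>i. [i, f i]) xs)) = set xs \<union> f ` set xs"
  by (induction xs) auto

text \<open>List the fixed blocks of odd size, then those of even size, then every orbit of length 2
  starting from its smaller element; the two sizes in an orbit agree by
  \<open>block_size_tau\<close>.\<close>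

lemma (in antiaut_form) ex_ordering: "\<exists>\<pi> l m k q g g' g''. ordered_by_antiaut G ab \<kappa> \<gamma> \<phi> \<pi> l m k q g g' g''"
proof -
  define Od where "Od = filter (\<lambda>i. tau i = i \<and> odd (\<kappa> ! i)) [0..<s]"
  define Ev where "Ev = filter (\<lambda>i. tau i = i \<and> even (\<kappa> ! i)) [0..<s]"
  define Pr where "Pr = filter (\<lambda>i. i < tau i) [0..<s]"
  define L where "L = Od @ Ev @ concat (map (\<lambda>i. [i, tau i]) Pr)"
  define l m k where "l = length Od" and "m = l + length Ev" and "k = m + length Pr"
  \<comment> \<open>The identity outside \<open>{..<s}\<close>, as \<open>permutes\<close>
    demands.\<close>
  define \<pi> where "\<pi> p = (if p < s then L ! p else p)" for p
  define q where "q i = (if i \<le> l then \<kappa> ! (L ! (i - 1)) else if i \<le> m then \<kappa> ! (L ! (i - 1)) div 2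
      else \<kappa> ! (Pr ! (i - m - 1)))" for i
  define g where "g i = \<gamma> ! (L ! (i - 1))" for i
  define g' where "g' i = \<gamma> ! (Pr ! (i - m - 1))" for i
  define g'' where "g'' i = \<gamma> ! tau (Pr ! (i - m - 1))" for i
  have tau_inj: "inj_on tau {..<s}" by (rule inj_on_inverseI[of _ tau]) (simp add: tau)
  have setPr: "set Pr = {i. i < s \<and> i < tau i}" by (auto simp: Pr_def)
  have Pr_lt: "i \<in> set Pr \<Longrightarrow> i < s" for i by (simp add: setPr)
  have dPr: "distinct (concat (map (\<lambda>i. [i, tau i]) Pr))"
  proof (rule distinct_concat_pairs)
    show "inj_on tau (set Pr)" by (rule inj_on_subset[OF tau_inj]) (auto simp: setPr)
    show "tau ` set Pr \<inter> set Pr = {}" using tau(3) by (fastforce simp: setPr)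
  qed (simp add: Pr_def)
  have tau_ne: "tau i \<noteq> i" "tau (tau i) \<noteq> tau i" if "i \<in> set Pr" for i
    using that tau(3)[OF Pr_lt[OF that]] by (auto simp: setPr)
  have dist: "distinct L"
    unfolding L_def distinct_append set_append set_concat_pairs
    using dPr tau_ne by (auto simp: Od_def Ev_def)
  have setL: "set L = {..<s}"
  proof
    show "set L \<subseteq> {..<s}"
      unfolding L_def set_append set_concat_pairs using tau(1) by (auto simp: Od_def Ev_def setPr)
    show "{..<s} \<subseteq> set L"
    proof
      fix i assume "i \<in> {..<s}"
      then have i: "i < s" by simp
      consider "tau i = i" | "i < tau i" | "tau i < i" by linarith
      then show "i \<in> set L"
      proof cases
        case 1
        then show ?thesis using i by (auto simp: L_def Od_def Ev_def)
      next
        case 2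
        then show ?thesis using i unfolding L_def set_append set_concat_pairs by (auto simp: setPr)
      next
        case 3
        then have "tau i \<in> set Pr" using tau(1,3)[OF i] by (simp add: setPr)
        moreover have "i = tau (tau i)" using tau(3)[OF i] by simp
        ultimately show ?thesis unfolding L_def set_append set_concat_pairs by blast
      qed
    qed
  qed
  have lenL: "length L = s" using distinct_card[OF dist] setL by simp
  have s_eq: "s = m + 2 * (k - m)"
    using lenL by (simp add: L_def l_def m_def k_def length_concat_pairs)
  have le: "l \<le> m" "m \<le> k" by (simp_all add: m_def k_def)
  have perm: "\<pi> permutes {..<s}"
  proof (rule bij_imp_permutes)
    have "bij_betw (nth L) {..<s} {..<s}" using bij_betw_nth[OF dist refl] setL lenL by simp
    then show "bij_betw \<pi> {..<s} {..<s}" by (rule bij_betw_cong[THEN iffD1, rotated]) (simp add: \<pi>_def)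
  qed (simp add: \<pi>_def)
  have L_O: "L ! p = Od ! p" if "p < l" for p using that by (simp add: L_def l_def nth_append)
  have L_Ev: "L ! p = Ev ! (p - l)" if "l \<le> p" "p < m" for p
    using that diff_less_mono[of p m l] by (simp add: L_def l_def m_def nth_append)
  have L_pairs: "L ! (m + r) = concat (map (\<lambda>i. [i, tau i]) Pr) ! r" for r
    by (simp add: L_def l_def m_def nth_append)
  have L_fst: "L ! (m + 2 * j) = Pr ! j" "L ! (m + 2 * j + 1) = tau (Pr ! j)" if "j < k - m" for j
    using L_pairs[of "2 * j"] L_pairs[of "2 * j + 1"] nth_concat_pairs[of j Pr "\<lambda>i. i" tau] that
    by (simp_all add: k_def)
  have Pr_j: "Pr ! j \<in> set Pr" if "j < k - m" for j using that by (simp add: k_def)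
  have O_p: "tau (L ! p) = L ! p" "odd (\<kappa> ! (L ! p))" if "p < l" for p
    using nth_mem[of p Od] that L_O[OF that] by (auto simp: l_def Od_def)
  have Ev_p: "tau (L ! p) = L ! p" "even (\<kappa> ! (L ! p))" if "l \<le> p" "p < m" for p
  proof -
    have "p - l < length Ev" using that by (simp add: m_def)
    then have "L ! p \<in> set Ev" unfolding L_Ev[OF that] by (rule nth_mem)
    then show "tau (L ! p) = L ! p" "even (\<kappa> ! (L ! p))" by (auto simp: Ev_def)
  qed
  have split_cases: "p < l \<or> (l \<le> p \<and> p < m) \<or> (\<exists>j<k - m. p = m + 2 * j \<or> p = m + 2 * j + 1)" if "p < s" for p
  proof (cases "p < m")
    case False
    have "p = m + 2 * ((p - m) div 2) \<or> p = m + 2 * ((p - m) div 2) + 1" using False by auto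
    moreover have "(p - m) div 2 < k - m" using that False by (auto simp: s_eq)
    ultimately show ?thesis by blast
  qed auto
  have "permute_list \<pi> \<kappa> = kappa_form l m k q"
  proof (rule nth_equalityI)
    show "length (permute_list \<pi> \<kappa>) = length (kappa_form l m k q)"
      using length_kappa_form[OF le] s_eq by simp
    fix p assume "p < length (permute_list \<pi> \<kappa>)"
    then have p: "p < s" by simp
    have "permute_list \<pi> \<kappa> ! p = \<kappa> ! (L ! p)" using permute_list_nth[OF perm, of p] p by (simp add: \<pi>_def)
    also have "\<dots> = kappa_form l m k q ! p"
      using split_cases[OF p]
    proof (elim disjE conjE exE)
      assume "p < l"
      then show ?thesis using nth_kappa_form(1)[OF le] by (simp add: q_def)
    next
      assume pm: "l \<le> p" "p < m"
      then show ?thesis using nth_kappa_form(2)[OF le pm, of q] Ev_p[OF pm] by (simp add: q_def)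
    next
      fix j assume j: "j < k - m" "p = m + 2 * j"
      then show ?thesis using nth_kappa_form(3)[OF le j(1), of q] L_fst(1)[OF j(1)] le by (simp add: q_def)
    next
      fix j assume j: "j < k - m" "p = m + 2 * j + 1"
      have "\<kappa> ! tau (Pr ! j) = \<kappa> ! (Pr ! j)" by (rule block_size_tau[OF Pr_lt[OF Pr_j[OF j(1)]]])
      then show ?thesis using nth_kappa_form(4)[OF le j(1), of q] L_fst(2)[OF j(1)] j le by (simp add: q_def)
    qed
    finally show "permute_list \<pi> \<kappa> ! p = kappa_form l m k q ! p" .
  qed
  moreover have "permute_list \<pi> \<gamma> = gamma_form m k g g' g''"
  proof (rule nth_equalityI)
    show "length (permute_list \<pi> \<gamma>) = length (gamma_form m k g g' g'')"
      using length_gamma_form[OF le(2), of g g' g''] s_eq gamma(1) by simp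
    fix p assume "p < length (permute_list \<pi> \<gamma>)"
    then have p: "p < s" using gamma(1) by simp
    have "permute_list \<pi> \<gamma> ! p = \<gamma> ! (L ! p)"
      using permute_list_nth[of \<pi> \<gamma> p] perm p gamma(1) by (simp add: \<pi>_def)
    also have "\<dots> = gamma_form m k g g' g'' ! p"
      using split_cases[OF p]
    proof (elim disjE conjE exE)
      assume "p < l"
      then show ?thesis using nth_gamma_form(1)[OF le(2), of p g] le by (simp add: g_def)
    next
      assume "l \<le> p" "p < m"
      then show ?thesis using nth_gamma_form(1)[OF le(2), of p g] by (simp add: g_def)
    next
      fix j assume j: "j < k - m" "p = m + 2 * j"
      then show ?thesis using nth_gamma_form(2)[OF le(2) j(1), of g g'] L_fst(1)[OF j(1)] by (simp add: g'_def)
    next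
      fix j assume j: "j < k - m" "p = m + 2 * j + 1"
      then show ?thesis using nth_gamma_form(3)[OF le(2) j(1), of g g' g''] L_fst(2)[OF j(1)] by (simp add: g''_def)
    qed
    finally show "permute_list \<pi> \<gamma> ! p = gamma_form m k g g' g'' ! p" .
  qed
  moreover have "odd (q i)" if "i \<in> {1..l}" for i
  proof -
    have "i - 1 < l" using that by auto
    then show ?thesis using that O_p(2)[of "i - 1"] by (simp add: q_def)
  qed
  moreover have "\<phi> (E (\<pi> (i - 1))) = E (\<pi> (i - 1))" if i: "i \<in> {1..m}" for i
  proof -
    have p: "i - 1 < m" "i - 1 < s" using i s_eq by auto
    then have "L ! (i - 1) < s" using nth_mem[of "i - 1" L] setL lenL by auto
    moreover have "tau (L ! (i - 1)) = L ! (i - 1)" using O_p(1)[of "i - 1"] Ev_p(1)[of "i - 1"] p by linarith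
    ultimately show ?thesis using tau(2)[of "L ! (i - 1)"] p by (simp add: \<pi>_def)
  qed
  moreover have "\<phi> (E (\<pi> (m + 2 * (i - m - 1)))) = E (\<pi> (m + 2 * (i - m - 1) + 1)) \<and>
      \<phi> (E (\<pi> (m + 2 * (i - m - 1) + 1))) = E (\<pi> (m + 2 * (i - m - 1)))" if i: "i \<in> {m + 1..k}" for i
  proof -
    let ?j = "i - m - 1"
    have j: "?j < k - m" using i by auto
    have p: "m + 2 * ?j < s" "m + 2 * ?j + 1 < s" using j unfolding s_eq by linarith+
    have x: "Pr ! ?j < s" by (rule Pr_lt[OF Pr_j[OF j]])
    show ?thesis using p L_fst[OF j] tau(2)[OF x] tau(2)[OF tau(1)[OF x]] tau(3)[OF x] by (simp add: \<pi>_def)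
  qed
  ultimately have "ordered_by_antiaut G ab \<kappa> \<gamma> \<phi> \<pi> l m k q g g' g''"
    unfolding ordered_by_antiaut_def Let_def using le perm by blast
  then show ?thesis by blast
qed

theorem theorem2p10:
  fixes G :: "('g, 'b) monoid_scheme"
    and T :: "'g set"
    and \<beta> :: "'g \<Rightarrow> 'g \<Rightarrow> 'a::alg_closed_field"
    and ab :: "('g \<times> 'g) list"
    and \<kappa> :: "nat list"
    and \<gamma> :: "'g list"
    and \<phi> :: "'a mat \<Rightarrow> 'a mat"
  assumes char: "CHAR('a) \<noteq> 2"
    and G: "comm_group G"
    and data: "graded_matrix_data G T \<beta> ab \<kappa> \<gamma>"
    and antiaut: "graded_antiaut G T \<beta> ab \<kappa> \<gamma> \<phi>"
    and square: "\<forall>X\<in>R_comp G T \<beta> ab \<kappa> \<gamma> \<one>\<^bsub>G\<^esub>. \<phi> (\<phi> X) = X"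
  shows
    "(\<forall>t\<in>T. t [^]\<^bsub>G\<^esub> (2::nat) = \<one>\<^bsub>G\<^esub>) \<and>
     (\<exists>\<pi> l m k q g g' g''. ordered_by_antiaut G ab \<kappa> \<gamma> \<phi> \<pi> l m k q g g' g'') \<and>
     (\<forall>\<pi> l m k q g g' g''. ordered_by_antiaut G ab \<kappa> \<gamma> \<phi> \<pi> l m k q g g' g'' \<longrightarrow>
        (let s = (\<lambda>i. if i \<le> m then g i [^]\<^bsub>G\<^esub> (2::nat) else g' i \<otimes>\<^bsub>G\<^esub> g'' i) in
           \<forall>i\<in>{1..k}. \<forall>j\<in>{1..k}. T #>\<^bsub>G\<^esub> s i = T #>\<^bsub>G\<^esub> s j) \<and>
        (\<exists>h h' h'' \<phi>' t S \<mu> \<Psi>.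
           let \<kappa>' = kappa_form l m k q;
               \<gamma>' = gamma_form m k h h' h'';
               n = R_dim G ab \<kappa>';
               \<Phi> = Phi_mat G \<beta> ab l m k q t S \<mu>;
               s = (\<lambda>i. if i \<le> m then h i [^]\<^bsub>G\<^esub> (2::nat) \<otimes>\<^bsub>G\<^esub> t i else h' i \<otimes>\<^bsub>G\<^esub> h'' i)
           in graded_matrix_data G T \<beta> ab \<kappa>' \<gamma>' \<and>
              graded_antiaut G T \<beta> ab \<kappa>' \<gamma>' \<phi>' \<and>
              isomorphic_pairs G (R_dim G ab \<kappa>) (R_comp G T \<beta> ab \<kappa> \<gamma>) \<phi>
                n (R_comp G T \<beta> ab \<kappa>' \<gamma>') \<phi>' \<and>
              ordered_by_antiaut G ab \<kappa>' \<gamma>' \<phi>' id l m k q h h' h'' \<and>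
              (\<forall>i\<in>{1..m}. t i \<in> T) \<and>
              (\<forall>i\<in>{1..k}. \<forall>j\<in>{1..k}. s i = s j) \<and>
              (\<forall>i\<in>{l+1..m}. S i = 1\<^sub>m (2 * q i) \<or> S i = symplectic_mat (q i)) \<and>
              (\<forall>i\<in>{m+1..k}. \<mu> i \<noteq> 0) \<and>
              \<Phi> \<in> carrier_mat n n \<and> \<Psi> \<in> carrier_mat n n \<and>
              inverts_mat \<Phi> \<Psi> \<and> inverts_mat \<Psi> \<Phi> \<and>
              (\<forall>X\<in>carrier_mat n n. \<phi>' X = \<Psi> * transpose_mat X * \<Phi>)))"
proof -
  interpret graded_data G T \<beta> ab \<kappa> \<gamma> by (rule graded_dataI[OF G data])
  have two: "(2::'a) \<noteq> 0"
  proof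
    assume "(2::'a) = 0"
    then have "of_nat 2 = (0::'a)" by simp
    then have "CHAR('a) dvd 2" by (simp only: of_nat_eq_0_iff_char_dvd)
    \<comment> \<open>A characteristic dividing 2 is 1 or 2, and characteristic 1 would give
      \<open>1 = 0\<close>.\<close>
    then have "CHAR('a) = 1" using char by (metis dvd_imp_le le_neq_implies_less less_2_cases pos2 dvd_0_left_iff zero_neq_numeral One_nat_def)
    then show False using of_nat_CHAR[where 'a = 'a] by simp
  qed
  interpret antiaut_data G T \<beta> ab \<kappa> \<gamma> \<phi>
    using two antiaut square by unfold_locales auto
  obtain Q t P' where Q: "Q \<in> carrier_mat N N" "det Q \<noteq> 0" "\<forall>i. t i \<in> T"
    "\<forall>a<N. \<forall>b<N. Q $$ (a, b) \<noteq> 0 \<longrightarrow> blk b = tau (blk a)"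
    "P' \<in> carrier_mat nn nn" "row_kron N d Q (\<lambda>a. X (t (blk a))) * P' = 1\<^sub>m nn"
    "P' * row_kron N d Q (\<lambda>a. X (t (blk a))) = 1\<^sub>m nn"
    "\<forall>Y\<in>carrier_mat nn nn. \<phi> Y = P' * transpose_mat Y * row_kron N d Q (\<lambda>a. X (t (blk a)))"
    using ex_form by blast
  interpret antiaut_form G T \<beta> ab \<kappa> \<gamma> \<phi> Q t P'
    by unfold_locales (use Q in blast)+
  show ?thesis
  proof (intro conjI allI impI ballI)
    show "u [^]\<^bsub>G\<^esub> (2::nat) = \<one>\<^bsub>G\<^esub>" if "u \<in> T" for u
      using that elementary by (simp add: numeral_2_eq_2)
    show "\<exists>\<pi> l m k q g g' g''. ordered_by_antiaut G ab \<kappa> \<gamma> \<phi> \<pi> l m k q g g' g''" by (rule ex_ordering)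
    fix \<pi> l m k q g g' g'' assume ord: "ordered_by_antiaut G ab \<kappa> \<gamma> \<phi> \<pi> l m k q g g' g''"
    interpret F: ordered_form G T \<beta> ab \<kappa> \<gamma> \<phi> Q t P' \<pi> l m k q g g' g''
      by unfold_locales (rule ord)
    show "let s = (\<lambda>i. if i \<le> m then g i [^]\<^bsub>G\<^esub> (2::nat) else g' i \<otimes>\<^bsub>G\<^esub> g'' i) in
           \<forall>i\<in>{1..k}. \<forall>j\<in>{1..k}. T #>\<^bsub>G\<^esub> s i = T #>\<^bsub>G\<^esub> s j"
      unfolding Let_def using F.cosets_equal by blast
    show "\<exists>h h' h'' \<phi>' t S \<mu> \<Psi>.
           let \<kappa>' = kappa_form l m k q;
               \<gamma>' = gamma_form m k h h' h'';
               n = R_dim G ab \<kappa>';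
               \<Phi> = Phi_mat G \<beta> ab l m k q t S \<mu>;
               s = (\<lambda>i. if i \<le> m then h i [^]\<^bsub>G\<^esub> (2::nat) \<otimes>\<^bsub>G\<^esub> t i else h' i \<otimes>\<^bsub>G\<^esub> h'' i)
           in graded_matrix_data G T \<beta> ab \<kappa>' \<gamma>' \<and>
              graded_antiaut G T \<beta> ab \<kappa>' \<gamma>' \<phi>' \<and>
              isomorphic_pairs G (R_dim G ab \<kappa>) (R_comp G T \<beta> ab \<kappa> \<gamma>) \<phi>
                n (R_comp G T \<beta> ab \<kappa>' \<gamma>') \<phi>' \<and>
              ordered_by_antiaut G ab \<kappa>' \<gamma>' \<phi>' id l m k q h h' h'' \<and>
              (\<forall>i\<in>{1..m}. t i \<in> T) \<and>
              (\<forall>i\<in>{1..k}. \<forall>j\<in>{1..k}. s i = s j) \<and>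
              (\<forall>i\<in>{l+1..m}. S i = 1\<^sub>m (2 * q i) \<or> S i = symplectic_mat (q i)) \<and>
              (\<forall>i\<in>{m+1..k}. \<mu> i \<noteq> 0) \<and>
              \<Phi> \<in> carrier_mat n n \<and> \<Psi> \<in> carrier_mat n n \<and>
              inverts_mat \<Phi> \<Psi> \<and> inverts_mat \<Psi> \<Phi> \<and>
              (\<forall>X\<in>carrier_mat n n. \<phi>' X = \<Psi> * transpose_mat X * \<Phi>)"
      \<comment> \<open>All degrees are kept except the second ones of the pairs, which become
        \<open>F.h''\<close>.\<close>
      unfolding Let_def
      by (rule exI[of _ g], rule exI[of _ g'], rule exI[of _ F.h''], rule exI[of _ "\<lambda>Y. F.Psi * transpose_mat Y * F.Phi"],
          rule exI[of _ F.tt], rule exI[of _ F.S], rule exI[of _ F.mu], rule exI[of _ F.Psi], rule F.normal_form)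
  qed
qed

end
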